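(* Let $(\overline{M}^{2m+1}(c),\varphi,\xi,\eta,\overline{g})$ be a Sasakian space form of constant $\varphi$-sectional curvature $c$, whose Ricci tensor $\mathsf{Ric}$ is regarded as a second metric. There exists no Ricci-biharmonic pseudo-Hopf hypersurface $M^{2m}$ in $\overline{M}^{2m+1}(c)$ (with $\xi$ tangent to $M^{2m}$) such that $\mathrm{grad}|H|$ is a principal direction, i.e. an eigenvector of the Weingarten operator $A$, where $H$ denotes the mean curvature vector field of $M^{2m}$.
   Context: All objects are smooth. A Sasakian manifold $(\overline M^{2m+1},\varphi,\xi,\eta,\overline g)$ with Levi-Civita connection $\overline\nabla$ satisfies $\varphi^2X=-X+\eta(X)\xi$, $\eta(\xi)=1$, $\varphi\xi=0$, $\eta(X)=\overline g(\xi,X)$, $\overline g(\varphi X,\varphi Y)=\overline g(X,Y)-\eta(X)\eta(Y)$, $d\eta(X,Y)=\overline g(X,\varphi Y)$, $(\overline\nabla_X\varphi)Y=\overline g(X,Y)\xi-\eta(Y)X$ and $\overline\nabla_X\xi=-\varphi X$. It is a Sasakian space form $\overline M^{2m+1}(c)$ if its curvature, with sign convention $\overline R(X,Y)=[\overline\nabla_X,\overline\nabla_Y]-\overline\nabla_{[X,Y]}$, is $$\overline R(X,Y)Z=-\tfrac{c-1}{4}\{\eta(Z)[\eta(Y)X-\eta(X)Y]+[\overline g(Y,Z)\eta(X)-\overline g(X,Z)\eta(Y)]\xi+\overline g(\varphi X,Z)\varphi Y+2\overline g(\varphi X,Y)\varphi Z-\overline g(\varphi Y,Z)\varphi X\}+\tfrac{c+3}{4}\{\overline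 g(Y,Z)X-\overline g(X,Z)Y\}.$$ Its Ricci tensor is $\mathsf{Ric}(X,Y)=k_2\,\overline g(X,Y)+k_1\,\eta(X)\eta(Y)$ with $k_1=\frac{(m+1)(1-c)}{2}$, $k_2=\frac{(m+1)c+3m-1}{2}$ (so $k_1+k_2=2m$). $\mathsf{Ric}$ is regarded as a metric (so $k_2\neq0$); $\nabla^{*}$ is its Levi-Civita connection, explicitly $\nabla^{*}_XY=\overline\nabla_XY-\frac{k_1}{k_2}(\eta(X)\varphi Y+\eta(Y)\varphi X)$, and $R^{*}(X,Y)=[\nabla^*_X,\nabla^*_Y]-\nabla^*_{[X,Y]}$. Hypersurface: for an isometric immersion $\psi:M^{2m}\to\overline M^{2m+1}(c)$ put $g=\psi^*\overline g$, $\nabla$ its Levi-Civita connection, $N$ a local unit normal (with respect to $\overline g$), $V=-\varphi N$ (tangent to $M$), $A$ the shape (Weingarten) operator ($AX=-\overline\nabla_XN$), $B$ the second fundamental form, $H=\frac1{2m}\mathrm{trace}_gB=|H|N$ the mean curvature vector field; norms and gradients are with respect to $\overline g$, $g$. The field $\xi$ is assumed tangent to $M$. Ricci-biharmonic: $M^{2m}$ is called Ricci-biharmonic if $\tau_2^*(\psi)=-\Delta^*H-\mathrm{trace}\,R^*(d\psi(\cdot),H)d\psi(\cdot)=0$. Here $\Delta^*X=-\sum_{\alpha=1}^{2m}(\nabla^*_{e_\alpha}\nabla^*_{e_\alpha}X-\nabla^*_{\nabla_{e_\alpha}e_\alpha}X)$ for a $g$-orthonormal frame $\{e_\alpha\}$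 of $M$ and sections $X$ of $\psi^{-1}(T\overline M)$, and the trace of $R^*$ is taken along $TM$ with respect to $\mathsf{Ric}$, i.e. it equals $\frac1{k_2}\sum_{i=1}^{2m-1}R^*(e_i,H)e_i+\frac1{k_1+k_2}R^*(\xi,H)\xi$ for a $g$-orthonormal frame $\{\xi,e_1,\dots,e_{2m-1}\}$ of $TM$. Pseudo-Hopf: write $TM=D\oplus D^\perp$ with $D^\perp=\mathrm{Span}\{\xi,V\}$ and $D$ the maximal $\varphi$-invariant distribution. $M$ is pseudo-Hopf if $A$ leaves $\mathrm{Span}\{\xi,V\}$ invariant: $AD^\perp\subseteq D^\perp$ (and hence $AD\subseteq D$). *)

theory Defs
  imports "HOL-Analysis.Analysis"
begin

section \<open>Smooth maps and smooth manifolds\<close>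

abbreviation FD :: "('a::real_normed_vector \<Rightarrow> 'b::real_normed_vector) \<Rightarrow> 'a \<Rightarrow> 'a \<Rightarrow> 'b"
  where "FD f x \<equiv> frechet_derivative f (at x)"

primrec Ck_on :: "nat \<Rightarrow> 'a::real_normed_vector set \<Rightarrow> ('a \<Rightarrow> 'b::real_normed_vector) \<Rightarrow> bool"
  where
    "Ck_on 0 S f \<longleftrightarrow> continuous_on S f"
  | "Ck_on (Suc k) S f \<longleftrightarrow>
       (\<forall>x\<in>S. f differentiable (at x)) \<and> (\<forall>v. Ck_on k S (\<lambda>x. FD f x v))"

text \<open>Used for open \<open>S\<close> in finite-dimensional spaces only.\<close>

definition smooth_on :: "'a::real_normed_vector set \<Rightarrow> ('a \<Rightarrow> 'b::real_normed_vector) \<Rightarrow> bool"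
  where "smooth_on S f \<longleftrightarrow> (\<forall>k. Ck_on k S f)"

text \<open>
  A chart is a pair of a domain \<open>U\<close> and a coordinate map on \<open>U\<close> with values in a Euclidean
  space \<open>'e\<close>; the values of the map outside \<open>U\<close> are irrelevant. The manifold described by an
  atlas is the union of the chart domains, an open subset of the Hausdorff and
  second countable space \<open>'a\<close>; its dimension is \<open>DIM('e)\<close>. The atlas need not be maximal.
\<close>

type_synonym ('a, 'e) chart = "'a set \<times> ('a \<Rightarrow> 'e)"

abbreviation chart_dom :: "('a, 'e) chart \<Rightarrow> 'a set"
  where "chart_dom \<equiv> fst"

abbreviation chart_map :: "('a, 'e) chart \<Rightarrow> 'a \<Rightarrow> 'e"
  where "chart_map \<equiv> snd"

abbreviation chart_range :: "('a, 'e) chart \<Rightarrow> 'e set"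
  where "chart_range c \<equiv> chart_map c ` chart_dom c"

definition chart_inv :: "('a, 'e) chart \<Rightarrow> 'e \<Rightarrow> 'a"
  where "chart_inv c = inv_into (chart_dom c) (chart_map c)"

definition is_chart :: "('a::topological_space, 'e::euclidean_space) chart \<Rightarrow> bool"
  where "is_chart c \<longleftrightarrow> open (chart_dom c) \<and> open (chart_range c)
    \<and> homeomorphism (chart_dom c) (chart_range c) (chart_map c) (chart_inv c)"

definition transition :: "('a, 'e) chart \<Rightarrow> ('a, 'e) chart \<Rightarrow> 'e \<Rightarrow> 'e"
  where "transition c d = chart_map d \<circ> chart_inv c"

definition smooth_atlas ::
    "('a::{t2_space,second_countable_topology}, 'e::euclidean_space) chart set \<Rightarrow> bool"
  where "smooth_atlas A \<longleftrightarrow> (\<forall>c\<in>A. is_chart c)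
    \<and> (\<forall>c\<in>A. \<forall>d\<in>A. smooth_on (chart_map c ` (chart_dom c \<inter> chart_dom d)) (transition c d))"

definition carrier_of :: "('a, 'e) chart set \<Rightarrow> 'a set"
  where "carrier_of A = (\<Union>c\<in>A. chart_dom c)"

text \<open>Coordinate expression of a map between manifolds, and the open set on which it lives.\<close>

definition local_dom :: "('b \<Rightarrow> 'a) \<Rightarrow> ('b, 'f) chart \<Rightarrow> ('a, 'e) chart \<Rightarrow> 'f set"
  where "local_dom \<psi> c d = chart_map c ` (chart_dom c \<inter> \<psi> -` chart_dom d)"

definition local_rep :: "('b \<Rightarrow> 'a) \<Rightarrow> ('b, 'f) chart \<Rightarrow> ('a, 'e) chart \<Rightarrow> 'f \<Rightarrow> 'e"
  where "local_rep \<psi> c d = chart_map d \<circ> \<psi> \<circ> chart_inv c"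

definition immersion ::
    "('b::{t2_space,second_countable_topology}, 'f::euclidean_space) chart set \<Rightarrow>
     ('a::{t2_space,second_countable_topology}, 'e::euclidean_space) chart set \<Rightarrow>
     ('b \<Rightarrow> 'a) \<Rightarrow> bool"
  where "immersion A Abar \<psi> \<longleftrightarrow>
      continuous_on (carrier_of A) \<psi> \<and> \<psi> ` carrier_of A \<subseteq> carrier_of Abar
    \<and> (\<forall>c\<in>A. \<forall>d\<in>Abar. smooth_on (local_dom \<psi> c d) (local_rep \<psi> c d)
        \<and> (\<forall>x\<in>local_dom \<psi> c d. inj (FD (local_rep \<psi> c d) x)))"


section \<open>Metrics, connections and curvature in coordinates\<close>

text \<open>
  A vector field on an open subset of \<open>'e\<close> is a function \<open>'e \<Rightarrow> 'e\<close>. A metric is a field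
  \<open>g x u v\<close> of bilinear forms, a connection is given by its Christoffel symbols, a field
  \<open>G x u v\<close> of bilinear maps.
\<close>

definition riemannian_metric_on ::
    "'e::euclidean_space set \<Rightarrow> ('e \<Rightarrow> 'e \<Rightarrow> 'e \<Rightarrow> real) \<Rightarrow> bool"
  where "riemannian_metric_on U g \<longleftrightarrow>
      (\<forall>u v. smooth_on U (\<lambda>x. g x u v))
    \<and> (\<forall>x\<in>U. bilinear (g x) \<and> (\<forall>u v. g x u v = g x v u) \<and> (\<forall>u. u \<noteq> 0 \<longrightarrow> g x u u > 0))"

text \<open>
  The Levi-Civita connection of a possibly indefinite metric: the unique connection that is
  torsion-free and compatible with the metric.
\<close>

definition levi_civita ::
    "('e::euclidean_space \<Rightarrow> 'e \<Rightarrow> 'e \<Rightarrow> real) \<Rightarrow> 'e \<Rightarrow> 'e \<Rightarrow> 'e \<Rightarrow> 'e"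
  where "levi_civita g x = (THE G. bilinear G \<and> (\<forall>u v. G u v = G v u)
    \<and> (\<forall>u v w. FD (\<lambda>y. g y v w) x u = g x (G u v) w + g x v (G u w)))"

definition nabla ::
    "('e::euclidean_space \<Rightarrow> 'e \<Rightarrow> 'e \<Rightarrow> 'e) \<Rightarrow> ('e \<Rightarrow> 'e) \<Rightarrow> ('e \<Rightarrow> 'e) \<Rightarrow> 'e \<Rightarrow> 'e"
  where "nabla G X Y x = FD Y x (X x) + G x (X x) (Y x)"

definition bracket :: "('e::euclidean_space \<Rightarrow> 'e) \<Rightarrow> ('e \<Rightarrow> 'e) \<Rightarrow> 'e \<Rightarrow> 'e"
  where "bracket X Y x = FD Y x (X x) - FD X x (Y x)"

definition curvature ::
    "('e::euclidean_space \<Rightarrow> 'e \<Rightarrow> 'e \<Rightarrow> 'e) \<Rightarrow> ('e \<Rightarrow> 'e) \<Rightarrow> ('e \<Rightarrow> 'e) \<Rightarrow> ('e \<Rightarrow> 'e) \<Rightarrow> 'e \<Rightarrow> 'e"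
  where "curvature G X Y Z x =
    nabla G X (nabla G Y Z) x - nabla G Y (nabla G X Z) x - nabla G (bracket X Y) Z x"

text \<open>
  Curvature is tensorial, so on tangent vectors it may be evaluated with the extensions that are
  constant in the coordinates.
\<close>

definition curv_at ::
    "('e::euclidean_space \<Rightarrow> 'e \<Rightarrow> 'e \<Rightarrow> 'e) \<Rightarrow> 'e \<Rightarrow> 'e \<Rightarrow> 'e \<Rightarrow> 'e \<Rightarrow> 'e"
  where "curv_at G x u v w = curvature G (\<lambda>_. u) (\<lambda>_. v) (\<lambda>_. w) x"

text \<open>\<open>Ric(v, w)\<close> is the trace of \<open>u \<mapsto> R(u, v)w\<close>.\<close>

definition ricci :: "('e::euclidean_space \<Rightarrow> 'e \<Rightarrow> 'e \<Rightarrow> real) \<Rightarrow> 'e \<Rightarrow> 'e \<Rightarrow> 'e \<Rightarrow> real"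
  where "ricci g x v w = (\<Sum>b\<in>Basis. curv_at (levi_civita g) x b v w \<bullet> b)"

text \<open>The vector metrically dual to a linear form, for a nondegenerate symmetric form \<open>h\<close>.\<close>

definition sharp :: "('f::euclidean_space \<Rightarrow> 'f \<Rightarrow> real) \<Rightarrow> ('f \<Rightarrow> real) \<Rightarrow> 'f"
  where "sharp h \<alpha> = (THE w. \<forall>z. h w z = \<alpha> z)"

text \<open>
  The trace \<open>h\<^sup>i\<^sup>j T(b\<^sub>i, b\<^sub>j)\<close> of a bilinear map \<open>T\<close> with respect to a nondegenerate symmetric
  form \<open>h\<close>. The inner product of \<open>'f\<close> only serves to write down the coordinate forms of the
  basis. The lemma below gives the value in \<open>h\<close>-orthogonal frames. For \<open>h\<close> positive definite
  and an \<open>h\<close>-orthonormal frame this is \<open>\<Sum> T(e\<^sub>i, e\<^sub>i)\<close>.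
\<close>

definition metric_trace ::
    "('f::euclidean_space \<Rightarrow> 'f \<Rightarrow> real) \<Rightarrow> ('f \<Rightarrow> 'f \<Rightarrow> 'g::real_vector) \<Rightarrow> 'g"
  where "metric_trace h T = (\<Sum>b\<in>Basis. T b (sharp h (\<lambda>z. b \<bullet> z)))"

lemma metric_trace_orthogonal_frame:
  fixes h :: "'f::euclidean_space \<Rightarrow> 'f \<Rightarrow> real" and T :: "'f \<Rightarrow> 'f \<Rightarrow> 'g::real_vector"
    and e :: "'i \<Rightarrow> 'f"
  assumes h: "bilinear h" and T: "bilinear T"
    and I: "finite I" "card I = DIM('f)"
    and eps: "\<And>i. i \<in> I \<Longrightarrow> \<epsilon> i \<noteq> 0"
    and e: "\<And>i j. i \<in> I \<Longrightarrow> j \<in> I \<Longrightarrow> h (e i) (e j) = (if i = j then \<epsilon> i else 0)"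
  shows "metric_trace h T = (\<Sum>i\<in>I. (1 / \<epsilon> i) *\<^sub>R T (e i) (e i))"
proof -
  define w where "w b = (\<Sum>i\<in>I. ((b \<bullet> e i) / \<epsilon> i) *\<^sub>R e i)" for b
  have hl: "linear (\<lambda>x. h x y)" "linear (h x)" for x y
    using h by (auto simp: bilinear_def)
  have coef: "h (\<Sum>i\<in>I. a i *\<^sub>R e i) (e j) = a j * \<epsilon> j" if "j \<in> I" for a j
  proof -
    have "h (\<Sum>i\<in>I. a i *\<^sub>R e i) (e j) = (\<Sum>i\<in>I. a i * h (e i) (e j))"
      using linear_sum[OF hl(1)[of "e j"], of "\<lambda>i. a i *\<^sub>R e i" I]
      by (simp add: linear_cmul[OF hl(1)])
    also have "\<dots> = (\<Sum>i\<in>I. if i = j then a j * \<epsilon> j else 0)"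
      by (rule sum.cong) (use e that in auto)
    finally show ?thesis using that I by simp
  qed
  have inj: "inj_on e I"
    by (rule inj_onI) (metis e eps)
  have indep: "independent (e ` I)"
  proof -
    have "u (e j) = 0" if "(\<Sum>v\<in>e ` I. u v *\<^sub>R v) = 0" "j \<in> I" for u j
    proof -
      have "(\<Sum>i\<in>I. u (e i) *\<^sub>R e i) = 0"
        using that(1) by (simp add: sum.reindex[OF inj])
      then have "u (e j) * \<epsilon> j = 0"
        using coef[OF that(2), of "\<lambda>i. u (e i)"] linear_0[OF hl(1)[of "e j"]] by simp
      then show ?thesis using eps that(2) by simp
    qed
    then show ?thesis
      using I(1) by (auto simp: independent_explicit)
  qed
  have span: "span (e ` I) = UNIV"
    using card_eq_dim[of "e ` I" UNIV] indep I card_image[OF inj] by auto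
  have wz: "h (w b) z = b \<bullet> z" for b z
  proof -
    have "z \<in> span (e ` I)" by (simp add: span)
    then show ?thesis
    proof (rule linear_eq_on[OF hl(2)[of "w b"], rotated])
      show "linear (\<lambda>z. b \<bullet> z)" by (simp add: bounded_linear.linear bounded_linear_inner_right)
      fix v assume "v \<in> e ` I"
      then obtain j where j: "j \<in> I" "v = e j" by auto
      then show "h (w b) v = b \<bullet> v"
        using coef[OF j(1)] eps[OF j(1)] by (simp add: w_def)
    qed
  qed
  have "sharp h (\<lambda>z. b \<bullet> z) = w b" for b
    unfolding sharp_def
  proof (rule the_equality)
    show "\<forall>z. h (w b) z = b \<bullet> z" by (simp add: wz)
    fix v assume v: "\<forall>z. h v z = b \<bullet> z"
    have "v - w b \<in> span (e ` I)" by (simp add: span)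
    then obtain u where "v - w b = (\<Sum>x\<in>e ` I. u x *\<^sub>R x)"
      using I(1) by (auto simp: span_finite)
    then have u: "v - w b = (\<Sum>i\<in>I. u (e i) *\<^sub>R e i)"
      by (simp add: sum.reindex[OF inj])
    have "u (e j) = 0" if "j \<in> I" for j
    proof -
      have "h (v - w b) (e j) = 0"
        using v wz by (simp add: linear_diff[OF hl(1)])
      then show ?thesis using coef[OF that] u eps[OF that] by simp
    qed
    then show "v = w b" using u by simp
  qed
  then have "metric_trace h T = (\<Sum>b\<in>Basis. T b (w b))"
    by (simp add: metric_trace_def)
  also have "\<dots> = (\<Sum>b\<in>Basis. \<Sum>i\<in>I. (1 / \<epsilon> i) *\<^sub>R T ((e i \<bullet> b) *\<^sub>R b) (e i))"
  proof (intro sum.cong refl)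
    fix b
    have T': "linear (T b)" "linear (\<lambda>x. T x y)" for y
      using T by (auto simp: bilinear_def)
    show "T b (w b) = (\<Sum>i\<in>I. (1 / \<epsilon> i) *\<^sub>R T ((e i \<bullet> b) *\<^sub>R b) (e i))"
      unfolding w_def
      by (simp add: linear_sum[OF T'(1)] linear_cmul[OF T'(1)] linear_cmul[OF T'(2)] inner_commute)
  qed
  also have "\<dots> = (\<Sum>i\<in>I. (1 / \<epsilon> i) *\<^sub>R T (\<Sum>b\<in>Basis. (e i \<bullet> b) *\<^sub>R b) (e i))"
  proof -
    have "T (\<Sum>b\<in>Basis. (e i \<bullet> b) *\<^sub>R b) (e i) = (\<Sum>b\<in>Basis. T ((e i \<bullet> b) *\<^sub>R b) (e i))" for i
      using T linear_sum[of "\<lambda>x. T x (e i)"] by (simp add: bilinear_def)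
    then show ?thesis
      by (subst sum.swap) (simp add: scaleR_sum_right)
  qed
  finally show ?thesis by (simp add: euclidean_representation)
qed


section \<open>Sasakian space forms\<close>

record 'e contact_metric =
  cphi :: "'e \<Rightarrow> 'e \<Rightarrow> 'e"
  cxi :: "'e \<Rightarrow> 'e"
  ceta :: "'e \<Rightarrow> 'e \<Rightarrow> real"
  cmet :: "'e \<Rightarrow> 'e \<Rightarrow> 'e \<Rightarrow> real"

text \<open>
  The exterior derivative of a one-form is normalised by
  \<open>2 d\<eta>(X,Y) = X \<eta>(Y) - Y \<eta>(X) - \<eta>([X,Y])\<close>; this is the normalisation for which
  \<open>d\<eta>(X,Y) = g(X, \<phi> Y)\<close> agrees with \<open>\<nabla>\<^sub>X \<xi> = - \<phi> X\<close>.
\<close>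

definition ext_deriv :: "('e::euclidean_space \<Rightarrow> 'e \<Rightarrow> real) \<Rightarrow> 'e \<Rightarrow> 'e \<Rightarrow> 'e \<Rightarrow> real"
  where "ext_deriv \<omega> x u v = (FD (\<lambda>y. \<omega> y v) x u - FD (\<lambda>y. \<omega> y u) x v) / 2"

text \<open>
  \<open>(\<nabla>\<^sub>u \<phi>) v = \<nabla>\<^sub>u (\<phi> v) - \<phi> (\<nabla>\<^sub>u v)\<close>, with \<open>v\<close> extended as a constant field.
\<close>

definition nabla_endo ::
    "('e::euclidean_space \<Rightarrow> 'e \<Rightarrow> 'e \<Rightarrow> 'e) \<Rightarrow> ('e \<Rightarrow> 'e \<Rightarrow> 'e) \<Rightarrow> 'e \<Rightarrow> 'e \<Rightarrow> 'e \<Rightarrow> 'e"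
  where "nabla_endo G \<phi> x u v =
    nabla G (\<lambda>_. u) (\<lambda>y. \<phi> y v) x - \<phi> x (nabla G (\<lambda>_. u) (\<lambda>_. v) x)"

definition sasakian_on :: "'e::euclidean_space set \<Rightarrow> 'e contact_metric \<Rightarrow> bool"
  where "sasakian_on U S \<longleftrightarrow>
    (let \<phi> = cphi S; \<xi> = cxi S; \<eta> = ceta S; g = cmet S; G = levi_civita g in
      riemannian_metric_on U g
    \<and> smooth_on U \<xi> \<and> (\<forall>v. smooth_on U (\<lambda>x. \<phi> x v)) \<and> (\<forall>v. smooth_on U (\<lambda>x. \<eta> x v))
    \<and> (\<forall>x\<in>U. linear (\<phi> x) \<and> linear (\<eta> x) \<and> \<eta> x (\<xi> x) = 1 \<and> \<phi> x (\<xi> x) = 0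
        \<and> (\<forall>u v.
            \<phi> x (\<phi> x u) = - u + \<eta> x u *\<^sub>R \<xi> x
          \<and> \<eta> x u = g x (\<xi> x) u
          \<and> g x (\<phi> x u) (\<phi> x v) = g x u v - \<eta> x u * \<eta> x v
          \<and> ext_deriv \<eta> x u v = g x u (\<phi> x v)
          \<and> nabla_endo G \<phi> x u v = g x u v *\<^sub>R \<xi> x - \<eta> x v *\<^sub>R u
          \<and> nabla G (\<lambda>_. u) \<xi> x = - \<phi> x u)))"

definition sasakian_space_form_on :: "real \<Rightarrow> 'e::euclidean_space set \<Rightarrow> 'e contact_metric \<Rightarrow> bool"
  where "sasakian_space_form_on c U S \<longleftrightarrow> sasakian_on U S \<and>
    (\<forall>x\<in>U. \<forall>X Y Z. let \<phi> = cphi S x; \<xi> = cxi S x; \<eta> = ceta S x; g = cmet S x in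
      curv_at (levi_civita (cmet S)) x X Y Z =
        - ((c - 1) / 4) *\<^sub>R
            (\<eta> Z *\<^sub>R (\<eta> Y *\<^sub>R X - \<eta> X *\<^sub>R Y)
             + (g Y Z * \<eta> X - g X Z * \<eta> Y) *\<^sub>R \<xi>
             + g (\<phi> X) Z *\<^sub>R \<phi> Y + (2 * g (\<phi> X) Y) *\<^sub>R \<phi> Z - g (\<phi> Y) Z *\<^sub>R \<phi> X)
        + ((c + 3) / 4) *\<^sub>R (g Y Z *\<^sub>R X - g X Z *\<^sub>R Y))"

text \<open>
  Tensor fields on a manifold are given by their components in each chart, subject to the
  transformation rule on overlaps.
\<close>

definition sasakian_space_form ::
    "real \<Rightarrow> ('a::{t2_space,second_countable_topology}, 'e::euclidean_space) chart set \<Rightarrow>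
     (('a, 'e) chart \<Rightarrow> 'e contact_metric) \<Rightarrow> bool"
  where "sasakian_space_form c A \<S> \<longleftrightarrow> smooth_atlas A
    \<and> (\<forall>d\<in>A. sasakian_space_form_on c (chart_range d) (\<S> d))
    \<and> (\<forall>d\<in>A. \<forall>d'\<in>A. \<forall>p\<in>chart_dom d \<inter> chart_dom d'.
        let x = chart_map d p; x' = chart_map d' p; L = FD (transition d d') x in
          cxi (\<S> d') x' = L (cxi (\<S> d) x)
        \<and> (\<forall>u v. cphi (\<S> d') x' (L u) = L (cphi (\<S> d) x u)
            \<and> ceta (\<S> d') x' (L u) = ceta (\<S> d) x u
            \<and> cmet (\<S> d') x' (L u) (L v) = cmet (\<S> d) x u v))"

text \<open>
  On a Sasakian space form of dimension \<open>2m + 1\<close> the Ricci tensor is \<open>k\<^sub>2 g + k\<^sub>1 \<eta> \<otimes> \<eta>\<close> with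
  \<open>k\<^sub>1 + k\<^sub>2 = 2m\<close>, so it is a (possibly indefinite) metric exactly if \<open>k\<^sub>2 \<noteq> 0\<close>.
\<close>

definition ricci_k2 :: "nat \<Rightarrow> real \<Rightarrow> real"
  where "ricci_k2 m c = ((real m + 1) * c + 3 * real m - 1) / 2"


section \<open>Hypersurfaces in coordinates\<close>

text \<open>
  Here \<open>P\<close> is the coordinate expression of the immersion, \<open>W\<close> its domain and \<open>S\<close> the structure
  of the ambient space in the chart used. A section of the pulled back tangent bundle is a
  function \<open>'f \<Rightarrow> 'e\<close>, and \<open>along G P X Y\<close> is its derivative in direction \<open>X\<close> for the connection
  pulled back by \<open>P\<close>.
\<close>

definition along ::
    "('e::euclidean_space \<Rightarrow> 'e \<Rightarrow> 'e \<Rightarrow> 'e) \<Rightarrow> ('f::euclidean_space \<Rightarrow> 'e) \<Rightarrow>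
     ('f \<Rightarrow> 'f) \<Rightarrow> ('f \<Rightarrow> 'e) \<Rightarrow> 'f \<Rightarrow> 'e"
  where "along G P X Y x = FD Y x (X x) + G (P x) (FD P x (X x)) (Y x)"

definition pullback_form ::
    "('e::euclidean_space \<Rightarrow> 'e \<Rightarrow> 'e \<Rightarrow> real) \<Rightarrow> ('f::euclidean_space \<Rightarrow> 'e) \<Rightarrow>
     'f \<Rightarrow> 'f \<Rightarrow> 'f \<Rightarrow> real"
  where "pullback_form g P x u v = g (P x) (FD P x u) (FD P x v)"

text \<open>\<open>B(u, v)\<close> is the derivative of \<open>dP v\<close> along \<open>u\<close> minus \<open>dP (\<nabla>\<^sub>u v)\<close>.\<close>

definition second_ff ::
    "'e::euclidean_space contact_metric \<Rightarrow> ('f::euclidean_space \<Rightarrow> 'e) \<Rightarrow> 'f \<Rightarrow> 'f \<Rightarrow> 'f \<Rightarrow> 'e"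
  where "second_ff S P x u v =
      along (levi_civita (cmet S)) P (\<lambda>_. u) (\<lambda>y. FD P y v) x
    - FD P x (nabla (levi_civita (pullback_form (cmet S) P)) (\<lambda>_. u) (\<lambda>_. v) x)"

definition mean_curv ::
    "'e::euclidean_space contact_metric \<Rightarrow> ('f::euclidean_space \<Rightarrow> 'e) \<Rightarrow> 'f \<Rightarrow> 'e"
  where "mean_curv S P x =
    (1 / real DIM('f)) *\<^sub>R metric_trace (pullback_form (cmet S) P x) (second_ff S P x)"

definition mean_curv_norm ::
    "'e::euclidean_space contact_metric \<Rightarrow> ('f::euclidean_space \<Rightarrow> 'e) \<Rightarrow> 'f \<Rightarrow> real"
  where "mean_curv_norm S P x = sqrt (cmet S (P x) (mean_curv S P x) (mean_curv S P x))"

definition grad_mean_curv ::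
    "'e::euclidean_space contact_metric \<Rightarrow> ('f::euclidean_space \<Rightarrow> 'e) \<Rightarrow> 'f \<Rightarrow> 'f"
  where "grad_mean_curv S P x =
    sharp (pullback_form (cmet S) P x) (FD (mean_curv_norm S P) x)"

definition unit_normal_on ::
    "'e::euclidean_space contact_metric \<Rightarrow> ('f::euclidean_space \<Rightarrow> 'e) \<Rightarrow> 'f set \<Rightarrow>
     ('f \<Rightarrow> 'e) \<Rightarrow> bool"
  where "unit_normal_on S P W N \<longleftrightarrow> smooth_on W N
    \<and> (\<forall>x\<in>W. cmet S (P x) (N x) (N x) = 1 \<and> (\<forall>u. cmet S (P x) (N x) (FD P x u) = 0))"

definition shape_op ::
    "'e::euclidean_space contact_metric \<Rightarrow> ('f::euclidean_space \<Rightarrow> 'e) \<Rightarrow> ('f \<Rightarrow> 'e) \<Rightarrow>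
     'f \<Rightarrow> 'f \<Rightarrow> 'f"
  where "shape_op S P N x u =
    (THE w. FD P x w = - along (levi_civita (cmet S)) P (\<lambda>_. u) N x)"

definition xi_tangent ::
    "'e::euclidean_space contact_metric \<Rightarrow> 'f::euclidean_space set \<Rightarrow> ('f \<Rightarrow> 'e) \<Rightarrow> bool"
  where "xi_tangent S W P \<longleftrightarrow> (\<forall>x\<in>W. cxi S (P x) \<in> range (FD P x))"

definition pseudo_hopf ::
    "'e::euclidean_space contact_metric \<Rightarrow> 'f::euclidean_space set \<Rightarrow> ('f \<Rightarrow> 'e) \<Rightarrow> bool"
  where "pseudo_hopf S W P \<longleftrightarrow>
    (\<forall>W' N. open W' \<and> W' \<subseteq> W \<and> unit_normal_on S P W' N \<longrightarrow>
      (\<forall>x\<in>W'. let Dperp = span {cxi S (P x), - cphi S (P x) (N x)} in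
        \<forall>u. FD P x u \<in> Dperp \<longrightarrow> FD P x (shape_op S P N x u) \<in> Dperp))"

text \<open>
  The norm of \<open>H\<close> need not be differentiable where \<open>H\<close> vanishes, so differentiability is
  part of the condition. An eigenvector is nonzero.
\<close>

definition grad_principal ::
    "'e::euclidean_space contact_metric \<Rightarrow> 'f::euclidean_space set \<Rightarrow> ('f \<Rightarrow> 'e) \<Rightarrow> bool"
  where "grad_principal S W P \<longleftrightarrow>
      (\<forall>x\<in>W. mean_curv_norm S P differentiable (at x) \<and> grad_mean_curv S P x \<noteq> 0)
    \<and> (\<forall>W' N. open W' \<and> W' \<subseteq> W \<and> unit_normal_on S P W' N \<longrightarrow>
        (\<forall>x\<in>W'. \<exists>r. shape_op S P N x (grad_mean_curv S P x) = r *\<^sub>R grad_mean_curv S P x))"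

definition star_conn ::
    "'e::euclidean_space contact_metric \<Rightarrow> 'e \<Rightarrow> 'e \<Rightarrow> 'e \<Rightarrow> 'e"
  where "star_conn S = levi_civita (ricci (cmet S))"

text \<open>
  The second covariant derivative under the trace is tensorial in the two directions, so it is
  evaluated on constant fields.
\<close>

definition star_laplacian ::
    "'e::euclidean_space contact_metric \<Rightarrow> ('f::euclidean_space \<Rightarrow> 'e) \<Rightarrow> ('f \<Rightarrow> 'e) \<Rightarrow> 'f \<Rightarrow> 'e"
  where "star_laplacian S P Y x =
    - metric_trace (pullback_form (cmet S) P x)
        (\<lambda>u v. along (star_conn S) P (\<lambda>_. u) (along (star_conn S) P (\<lambda>_. v) Y) x
             - along (star_conn S) P
                 (nabla (levi_civita (pullback_form (cmet S) P)) (\<lambda>_. u) (\<lambda>_. v)) Y x)"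

definition star_bitension ::
    "'e::euclidean_space contact_metric \<Rightarrow> ('f::euclidean_space \<Rightarrow> 'e) \<Rightarrow> 'f \<Rightarrow> 'e"
  where "star_bitension S P x =
    - star_laplacian S P (mean_curv S P) x
    - metric_trace (pullback_form (ricci (cmet S)) P x)
        (\<lambda>u v. curv_at (star_conn S) (P x) (FD P x u) (mean_curv S P x) (FD P x v))"

definition ricci_biharmonic ::
    "'e::euclidean_space contact_metric \<Rightarrow> 'f::euclidean_space set \<Rightarrow> ('f \<Rightarrow> 'e) \<Rightarrow> bool"
  where "ricci_biharmonic S W P \<longleftrightarrow> (\<forall>x\<in>W. star_bitension S P x = 0)"

text \<open>
  A local condition on an immersed submanifold holds if it holds in all pairs of charts. All
  conditions above are invariant under changes of coordinates.
\<close>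

definition in_all_charts ::
    "('b, 'f) chart set \<Rightarrow> ('a, 'e) chart set \<Rightarrow> (('a, 'e) chart \<Rightarrow> 'e contact_metric) \<Rightarrow>
     ('b \<Rightarrow> 'a) \<Rightarrow> ('e contact_metric \<Rightarrow> 'f set \<Rightarrow> ('f \<Rightarrow> 'e) \<Rightarrow> bool) \<Rightarrow> bool"
  where "in_all_charts A Abar \<S> \<psi> Q \<longleftrightarrow>
    (\<forall>c\<in>A. \<forall>d\<in>Abar. Q (\<S> d) (local_dom \<psi> c d) (local_rep \<psi> c d))"

end

(* The statement is local, so one works in a pair of charts, with W open in 'f and a unit normal N
  such that H = f N, f > 0. Write B for minus the shape operator, \<Lambda> = m f, and let E be the unit
  field along grad f. The tangential part of the bitension field forces B E = \<Lambda> E and xi f = 0. The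
  Codazzi equation, used on a generic open set, makes \<phi> E a principal direction, shows that \<Lambda> is a
  simple eigenvalue, and determines all derivatives of E along E, \<phi> E, xi, V. The Gauss equation for
  E, \<phi> E then gives c = -3. On the orthogonal complement of E, \<phi> E, xi, V, N the operators Ah = B and
  Wh = (X \<mapsto> D_X E) commute and satisfy, along E,
    Ah' = (\<Lambda> - Ah) Wh,  Wh' = - Wh^2 - \<Lambda> Ah,  tr Ah = - 3 \<Lambda>,
  while the normal part becomes \<Lambda>'' + tr Wh \<Lambda>' = \<Lambda> (\<Lambda>^2 + tr Ah^2 + m^2). The mixed moments of Ah
  and Wh therefore have the Taylor series along E of those of the solution of an ordinary differential
  equation for pairs (nu_i, omega_i). Writing (omega_i, nu_i) = (p_i, q_i) / d_i, the pairs
  (p_i, q_i) rotate with speed \<Lambda> on the unit circle and d_i' = p_i, and the sign \<Lambda> \<Lambda>' > 0 makes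
  the angle reach a point where some d_i would have to be negative. *)

theory Submission
  imports Defs
begin

section \<open>Smooth maps\<close>

text \<open>Two obstacles shape the argument. Principal curvatures need not be differentiable where
  multiplicities jump; so only traces of words in two commuting operators are differentiated, and
  eigenvalues occur at single points, at last as initial values. Further, the contradiction in the
  plane may need a long time, whereas an integral curve of grad f may leave the hypersurface at
  once. Hence nothing is followed along the hypersurface: smoothness yields formal Taylor series at
  one point, the quadratic system is analytic and has its own solution independent of the
  hypersurface, and an identity of power series at one point is carried along that solution by
  analytic continuation. The system alone already determines \<Lambda>, as minus a third of the sum
  of the \<nu>; the normal equation is an additional constraint, and this overdetermination is what
  fails. The value c = -3 enters twice: the multiple (c + 3) / 4 of constant curvature drops out, so
  the complement evolves as in flat space, and the constant of the normal equation becomes the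
  nonnegative number m^2, which gives the monotonicity of the planar system.\<close>

lemma FD_eqI: "(f has_derivative D) (at x) \<Longrightarrow> FD f x = D"
  by (rule frechet_derivative_at[symmetric])

lemma FD_works: "f differentiable (at x) \<Longrightarrow> (f has_derivative FD f x) (at x)"
  by (simp add: frechet_derivative_works)

lemma FD_linear: "f differentiable (at x) \<Longrightarrow> linear (FD f x)"
  using FD_works has_derivative_linear by blast

text \<open>\<open>frechet_derivative\<close> is a choice made from the predicate
  \<open>has_derivative\<close>, and that predicate is local; so the equality also covers points
  where neither function is differentiable.\<close>

lemma FD_cong_open:
  assumes "open S" "x \<in> S" "\<And>y. y \<in> S \<Longrightarrow> f y = g y"
  shows "FD f x = FD g x"
proof -
  have "(f has_derivative D) (at x) \<longleftrightarrow> (g has_derivative D) (at x)" for D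
    using assms has_derivative_transform_within_open[of f D x UNIV S g]
      has_derivative_transform_within_open[of g D x UNIV S f] by auto
  then show ?thesis unfolding frechet_derivative_def by simp
qed

lemma differentiable_cong_open:
  assumes "open S" "x \<in> S" "\<And>y. y \<in> S \<Longrightarrow> f y = g y" "f differentiable (at x)"
  shows "g differentiable (at x)"
  using assms has_derivative_transform_within_open[of f _ x UNIV S g]
  unfolding differentiable_def by blast

lemma Ck_on_cong:
  assumes "open S" "\<And>y. y \<in> S \<Longrightarrow> f y = g y" "Ck_on k S f"
  shows "Ck_on k S g"
  using assms(2,3)
proof (induction k arbitrary: f g)
  case 0
  then show ?case by (metis Ck_on.simps(1) continuous_on_cong)
next
  case (Suc k)
  have "FD f x = FD g x" if "x \<in> S" for x
    using FD_cong_open[OF assms(1) that Suc.prems(1)] .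
  then have "Ck_on k S (\<lambda>x. FD g x v)" for v
    using Suc.IH[of "\<lambda>x. FD f x v" "\<lambda>x. FD g x v"] Suc.prems(2) by simp
  moreover have "g differentiable (at x)" if "x \<in> S" for x
    using differentiable_cong_open[OF assms(1) that Suc.prems(1)] Suc.prems(2) that by auto
  ultimately show ?case by simp
qed

lemma Ck_on_Suc_imp: "Ck_on (Suc k) S f \<Longrightarrow> Ck_on k S f"
proof (induction k arbitrary: f)
  case 0
  then show ?case
    by (auto intro!: continuous_at_imp_continuous_on differentiable_imp_continuous_within)
next
  case (Suc k)
  then show ?case by simp
qed

lemma Ck_on_subset: "Ck_on k S f \<Longrightarrow> T \<subseteq> S \<Longrightarrow> Ck_on k T f"
  by (induction k arbitrary: f) (auto intro: continuous_on_subset)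

lemma Ck_on_const: "Ck_on k S (\<lambda>x. c)"
  by (induction k arbitrary: c) (auto simp: frechet_derivative_const)

lemma Ck_on_bounded_linear:
  assumes h: "bounded_linear h" and S: "open S" and f: "Ck_on k S f"
  shows "Ck_on k S (\<lambda>x. h (f x))"
  using f
proof (induction k arbitrary: f)
  case 0
  then show ?case
    using bounded_linear.continuous_on[OF h] by auto
next
  case (Suc k)
  have d: "((\<lambda>x. h (f x)) has_derivative (\<lambda>v. h (FD f x v))) (at x)" if "x \<in> S" for x
    by (rule bounded_linear.has_derivative[OF h FD_works]) (use Suc.prems that in auto)
  have "Ck_on k S (\<lambda>x. FD (\<lambda>x. h (f x)) x v)" for v
  proof (rule Ck_on_cong[OF S])
    show "Ck_on k S (\<lambda>x. h (FD f x v))" using Suc by auto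
  qed (simp add: FD_eqI[OF d])
  then show ?case using d by (auto simp: differentiable_def)
qed

lemma Ck_on_add:
  assumes S: "open S" and f: "Ck_on k S f" and g: "Ck_on k S g"
  shows "Ck_on k S (\<lambda>x. f x + g x)"
  using f g
proof (induction k arbitrary: f g)
  case 0
  then show ?case by (auto intro: continuous_intros)
next
  case (Suc k)
  have d: "((\<lambda>x. f x + g x) has_derivative (\<lambda>v. FD f x v + FD g x v)) (at x)" if "x \<in> S" for x
    by (intro derivative_intros FD_works) (use Suc.prems that in auto)
  have "Ck_on k S (\<lambda>x. FD (\<lambda>x. f x + g x) x v)" for v
  proof (rule Ck_on_cong[OF S])
    show "Ck_on k S (\<lambda>x. FD f x v + FD g x v)" using Suc by auto
  qed (simp add: FD_eqI[OF d])
  then show ?case using d by (auto simp: differentiable_def)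
qed

lemma Ck_on_sum:
  assumes "open S" "\<And>i. i \<in> I \<Longrightarrow> Ck_on k S (f i)"
  shows "Ck_on k S (\<lambda>x. \<Sum>i\<in>I. f i x)"
  using assms(2) by (induction I rule: infinite_finite_induct)
    (auto intro: Ck_on_const Ck_on_add[OF assms(1)])

lemma Ck_on_bilinear:
  assumes h: "bounded_bilinear h" and S: "open S" and f: "Ck_on k S f" and g: "Ck_on k S g"
  shows "Ck_on k S (\<lambda>x. h (f x) (g x))"
  using f g
proof (induction k arbitrary: f g)
  case 0
  then show ?case
    using bounded_bilinear.continuous_on[OF h] by auto
next
  case (Suc k)
  have d: "((\<lambda>x. h (f x) (g x)) has_derivative (\<lambda>v. h (f x) (FD g x v) + h (FD f x v) (g x))) (at x)"
    if "x \<in> S" for x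
    by (rule bounded_bilinear.FDERIV[OF h FD_works FD_works]) (use Suc.prems that in auto)
  have "Ck_on k S (\<lambda>x. FD (\<lambda>x. h (f x) (g x)) x v)" for v
  proof (rule Ck_on_cong[OF S])
    show "Ck_on k S (\<lambda>x. h (f x) (FD g x v) + h (FD f x v) (g x))"
      by (intro Ck_on_add S Suc.IH) (use Suc.prems Ck_on_Suc_imp in auto)
  qed (simp add: FD_eqI[OF d])
  then show ?case using d by (auto simp: differentiable_def)
qed

lemma Ck_on_compose:
  fixes g :: "'a::real_normed_vector \<Rightarrow> 'b::euclidean_space"
  assumes S: "open S" and f: "Ck_on k T f" and g: "Ck_on k S g" and gS: "g ` S \<subseteq> T"
  shows "Ck_on k S (\<lambda>x. f (g x))"
  using f g
proof (induction k arbitrary: f)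
  case 0
  then show ?case using continuous_on_compose2[of T f S g] gS by simp
next
  case (Suc k)
  have gx: "g x \<in> T" if "x \<in> S" for x using gS that by auto
  have d: "((\<lambda>x. f (g x)) has_derivative (\<lambda>v. FD f (g x) (FD g x v))) (at x)" if "x \<in> S" for x
    by (rule has_derivative_compose[OF FD_works FD_works]) (use Suc.prems that gx in auto)
  have "Ck_on k S (\<lambda>x. FD (\<lambda>x. f (g x)) x v)" for v
  proof (rule Ck_on_cong[OF S])
    \<comment> \<open>The chain rule applies \<open>FD f\<close> in the moving direction
      \<open>FD g x v\<close>, while \<open>Ck_on\<close> speaks of fixed directions; the expansion
      in \<open>Basis\<close> leads back to those.\<close>
    show "Ck_on k S (\<lambda>x. \<Sum>b\<in>Basis. (FD g x v \<bullet> b) *\<^sub>R FD f (g x) b)"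
      by (intro Ck_on_sum S Ck_on_bilinear[OF bounded_bilinear_scaleR]
            Ck_on_bounded_linear[OF bounded_linear_inner_left] Suc.IH)
        (use Suc.prems Ck_on_Suc_imp in auto)
    fix y assume y: "y \<in> S"
    have l: "linear (FD f (g y))" using FD_linear Suc.prems gx[OF y] by auto
    have "FD f (g y) (FD g y v) = FD f (g y) (\<Sum>b\<in>Basis. (FD g y v \<bullet> b) *\<^sub>R b)"
      by (simp add: euclidean_representation)
    then show "(\<Sum>b\<in>Basis. (FD g y v \<bullet> b) *\<^sub>R FD f (g y) b) = FD (\<lambda>x. f (g x)) y v"
      by (simp add: FD_eqI[OF d[OF y]] linear_sum[OF l] linear_cmul[OF l])
  qed
  then show ?case using d by (auto simp: differentiable_def)
qed

text \<open>The derivative of the reciprocal is polynomial in the reciprocal itself and in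
  \<open>FD g\<close>, so order \<open>k\<close> for the same function gives order
  \<open>k + 1\<close>; \<open>g\<close> stays fixed in the induction.\<close>

lemma Ck_on_inverse:
  fixes g :: "'a::real_normed_vector \<Rightarrow> real"
  assumes S: "open S" and g: "Ck_on k S g" and g0: "\<And>x. x \<in> S \<Longrightarrow> g x \<noteq> 0"
  shows "Ck_on k S (\<lambda>x. inverse (g x))"
  using g
proof (induction k)
  case 0
  then show ?case using g0 by (auto intro: continuous_intros)
next
  case (Suc k)
  have d: "((\<lambda>x. inverse (g x)) has_derivative (\<lambda>v. - (inverse (g x) * FD g x v * inverse (g x)))) (at x)"
    if "x \<in> S" for x
    by (rule Deriv.has_derivative_inverse[OF _ FD_works]) (use Suc.prems that g0 in auto)
  have 1: "Ck_on k S (\<lambda>x. inverse (g x))" by (rule Suc.IH[OF Ck_on_Suc_imp[OF Suc.prems]])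
  have "Ck_on k S (\<lambda>x. FD (\<lambda>x. inverse (g x)) x v)" for v
  proof (rule Ck_on_cong[OF S])
    show "Ck_on k S (\<lambda>x. - (inverse (g x) * FD g x v * inverse (g x)))"
      by (intro Ck_on_bounded_linear[of uminus] S bounded_linear_minus bounded_linear_ident
          Ck_on_bilinear[OF bounded_bilinear_mult] 1) (use Suc.prems in auto)
  qed (simp add: FD_eqI[OF d])
  then show ?case using d by (auto simp: differentiable_def)
qed

lemma Ck_on_sqrt:
  fixes g :: "'a::real_normed_vector \<Rightarrow> real"
  assumes S: "open S" and g: "Ck_on k S g" and g0: "\<And>x. x \<in> S \<Longrightarrow> g x > 0"
  shows "Ck_on k S (\<lambda>x. sqrt (g x))"
  using g
proof (induction k)
  case 0
  then show ?case by (auto intro: continuous_intros)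
next
  case (Suc k)
  have d: "((\<lambda>x. sqrt (g x)) has_derivative (\<lambda>v. FD g x v * (inverse (sqrt (g x)) * (1/2)))) (at x)"
    if "x \<in> S" for x
  proof -
    have "(g has_derivative FD g x) (at x)" using Suc.prems that by (auto intro: FD_works)
    from has_derivative_real_sqrt[of g x, OF g0[OF that] this] show ?thesis
      by (simp add: mult.assoc)
  qed
  have 1: "Ck_on k S (\<lambda>x. sqrt (g x))" by (rule Suc.IH[OF Ck_on_Suc_imp[OF Suc.prems]])
  have "Ck_on k S (\<lambda>x. FD (\<lambda>x. sqrt (g x)) x v)" for v
  proof (rule Ck_on_cong[OF S])
    show "Ck_on k S (\<lambda>x. FD g x v * (inverse (sqrt (g x)) * (1/2)))"
    proof (intro Ck_on_bilinear[OF bounded_bilinear_mult] S Ck_on_inverse 1 Ck_on_const)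
      show "Ck_on k S (\<lambda>x. FD g x v)" using Suc.prems by simp
      show "sqrt (g x) \<noteq> 0" if "x \<in> S" for x using g0[OF that] by simp
    qed
  qed (simp add: FD_eqI[OF d])
  then show ?case using d by (auto simp: differentiable_def)
qed

lemma smooth_on_differentiable: "smooth_on S f \<Longrightarrow> x \<in> S \<Longrightarrow> f differentiable (at x)"
  unfolding smooth_on_def by (metis Ck_on.simps(2))

lemma smooth_on_FD: "smooth_on S f \<Longrightarrow> smooth_on S (\<lambda>x. FD f x v)"
  unfolding smooth_on_def by (metis Ck_on.simps(2))

lemma smooth_on_has_derivative: "smooth_on S f \<Longrightarrow> x \<in> S \<Longrightarrow> (f has_derivative FD f x) (at x)"
  by (simp add: smooth_on_differentiable FD_works)

lemma smooth_on_FD_linear: "smooth_on S f \<Longrightarrow> x \<in> S \<Longrightarrow> linear (FD f x)"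
  by (simp add: smooth_on_differentiable FD_linear)

lemma smooth_on_continuous: "smooth_on S f \<Longrightarrow> continuous_on S f"
  unfolding smooth_on_def by (metis Ck_on.simps(1))

lemma smooth_on_subset: "smooth_on S f \<Longrightarrow> T \<subseteq> S \<Longrightarrow> smooth_on T f"
  by (auto simp: smooth_on_def intro: Ck_on_subset)

lemma smooth_on_cong:
  "open S \<Longrightarrow> (\<And>y. y \<in> S \<Longrightarrow> f y = g y) \<Longrightarrow> smooth_on S f \<Longrightarrow> smooth_on S g"
  unfolding smooth_on_def using Ck_on_cong by blast

lemma smooth_on_const: "smooth_on S (\<lambda>x. c)"
  by (simp add: smooth_on_def Ck_on_const)

lemma smooth_on_bounded_linear:
  "bounded_linear h \<Longrightarrow> open S \<Longrightarrow> smooth_on S f \<Longrightarrow> smooth_on S (\<lambda>x. h (f x))"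
  by (simp add: smooth_on_def Ck_on_bounded_linear)

lemma smooth_on_add:
  "open S \<Longrightarrow> smooth_on S f \<Longrightarrow> smooth_on S g \<Longrightarrow> smooth_on S (\<lambda>x. f x + g x)"
  by (simp add: smooth_on_def Ck_on_add)

lemma smooth_on_minus: "open S \<Longrightarrow> smooth_on S f \<Longrightarrow> smooth_on S (\<lambda>x. - f x)"
  using smooth_on_bounded_linear[OF bounded_linear_minus[OF bounded_linear_ident]] .

lemma smooth_on_diff:
  "open S \<Longrightarrow> smooth_on S f \<Longrightarrow> smooth_on S g \<Longrightarrow> smooth_on S (\<lambda>x. f x - g x)"
  using smooth_on_add[of S f "\<lambda>x. - g x"] smooth_on_minus[of S g] by simp

lemma smooth_on_sum:
  "open S \<Longrightarrow> (\<And>i. i \<in> I \<Longrightarrow> smooth_on S (f i)) \<Longrightarrow> smooth_on S (\<lambda>x. \<Sum>i\<in>I. f i x)"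
  by (simp add: smooth_on_def Ck_on_sum)

lemma smooth_on_bilinear:
  "bounded_bilinear h \<Longrightarrow> open S \<Longrightarrow> smooth_on S f \<Longrightarrow> smooth_on S g \<Longrightarrow> smooth_on S (\<lambda>x. h (f x) (g x))"
  by (simp add: smooth_on_def Ck_on_bilinear)

lemmas smooth_on_scaleR = smooth_on_bilinear[OF bounded_bilinear_scaleR]
lemmas smooth_on_mult = smooth_on_bilinear[OF bounded_bilinear_mult]
lemmas smooth_on_inner = smooth_on_bilinear[OF bounded_bilinear_inner]

lemma smooth_on_compose:
  fixes g :: "'a::real_normed_vector \<Rightarrow> 'b::euclidean_space"
  shows "open S \<Longrightarrow> smooth_on T f \<Longrightarrow> smooth_on S g \<Longrightarrow> g ` S \<subseteq> T \<Longrightarrow> smooth_on S (\<lambda>x. f (g x))"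
  unfolding smooth_on_def by (blast intro: Ck_on_compose)

lemma smooth_on_inverse:
  fixes g :: "'a::real_normed_vector \<Rightarrow> real"
  shows "open S \<Longrightarrow> smooth_on S g \<Longrightarrow> (\<And>x. x \<in> S \<Longrightarrow> g x \<noteq> 0) \<Longrightarrow> smooth_on S (\<lambda>x. inverse (g x))"
  by (simp add: smooth_on_def Ck_on_inverse)

lemma smooth_on_sqrt:
  fixes g :: "'a::real_normed_vector \<Rightarrow> real"
  shows "open S \<Longrightarrow> smooth_on S g \<Longrightarrow> (\<And>x. x \<in> S \<Longrightarrow> g x > 0) \<Longrightarrow> smooth_on S (\<lambda>x. sqrt (g x))"
  by (simp add: smooth_on_def Ck_on_sqrt)

section \<open>Fields of linear and bilinear maps applied to moving vectors\<close>

lemma linear_on_Basis: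
  fixes v :: "'b::euclidean_space"
  assumes "linear A"
  shows "A v = (\<Sum>b\<in>Basis. (v \<bullet> b) *\<^sub>R A b)"
proof -
  have "A v = A (\<Sum>b\<in>Basis. (v \<bullet> b) *\<^sub>R b)" by (simp add: euclidean_representation)
  then show ?thesis by (simp add: linear_sum[OF assms] linear_cmul[OF assms])
qed

lemma smooth_on_apply_linear:
  fixes Y :: "'a::real_normed_vector \<Rightarrow> 'b::euclidean_space"
    and A :: "'a \<Rightarrow> 'b \<Rightarrow> 'c::real_normed_vector"
  assumes "open S" "\<And>v. smooth_on S (\<lambda>x. A x v)" "\<And>x. x \<in> S \<Longrightarrow> linear (A x)" "smooth_on S Y"
  shows "smooth_on S (\<lambda>x. A x (Y x))"
proof (rule smooth_on_cong[OF assms(1)])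
  show "smooth_on S (\<lambda>x. \<Sum>b\<in>Basis. (Y x \<bullet> b) *\<^sub>R A x b)"
    by (intro smooth_on_sum smooth_on_scaleR smooth_on_inner assms smooth_on_const)
qed (rule linear_on_Basis[OF assms(3), symmetric])

lemma smooth_on_apply_bilinear:
  fixes Y :: "'a::real_normed_vector \<Rightarrow> 'b::euclidean_space" and Z :: "'a \<Rightarrow> 'd::euclidean_space"
    and A :: "'a \<Rightarrow> 'b \<Rightarrow> 'd \<Rightarrow> 'c::real_normed_vector"
  assumes S: "open S" and A: "\<And>u v. smooth_on S (\<lambda>x. A x u v)"
    and l: "\<And>x. x \<in> S \<Longrightarrow> bilinear (A x)" and Y: "smooth_on S Y" and Z: "smooth_on S Z"
  shows "smooth_on S (\<lambda>x. A x (Y x) (Z x))"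
proof (rule smooth_on_apply_linear[OF S, of "\<lambda>x v. A x (Y x) v"])
  show "smooth_on S (\<lambda>x. A x (Y x) v)" for v
    by (rule smooth_on_apply_linear[OF S, of "\<lambda>x u. A x u v"]) (use A l Y in \<open>auto simp: bilinear_def\<close>)
qed (use l Z in \<open>auto simp: bilinear_def\<close>)

lemma smooth_on_FD_apply:
  fixes X :: "'a::euclidean_space \<Rightarrow> 'a"
  assumes "open S" "smooth_on S f" "smooth_on S X"
  shows "smooth_on S (\<lambda>x. FD f x (X x))"
  by (rule smooth_on_apply_linear[OF assms(1)])
    (use assms in \<open>auto intro: smooth_on_FD smooth_on_FD_linear\<close>)

text \<open>Product rule for a tensor field that is only known on constant arguments. The
  coordinates of the moving argument carry its derivative; the derivative of the field is taken with
  the argument frozen at \<open>Y x\<close>.\<close>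

lemma has_derivative_apply_linear:
  fixes Y :: "'a::real_normed_vector \<Rightarrow> 'b::euclidean_space"
    and A :: "'a \<Rightarrow> 'b \<Rightarrow> 'c::real_normed_vector"
  assumes S: "open S" and x: "x \<in> S" and A: "\<And>v. (\<lambda>y. A y v) differentiable (at x)"
    and l: "\<And>y. y \<in> S \<Longrightarrow> linear (A y)" and Y: "(Y has_derivative Y') (at x)"
  shows "((\<lambda>y. A y (Y y)) has_derivative (\<lambda>u. FD (\<lambda>y. A y (Y x)) x u + A x (Y' u))) (at x)"
proof -
  have "((\<lambda>y. \<Sum>b\<in>Basis. (Y y \<bullet> b) *\<^sub>R A y b) has_derivative
     (\<lambda>u. \<Sum>b\<in>Basis. (Y x \<bullet> b) *\<^sub>R FD (\<lambda>y. A y b) x u + (Y' u \<bullet> b) *\<^sub>R A x b)) (at x)"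
    by (intro derivative_intros Y FD_works A)
  then have 1: "((\<lambda>y. A y (Y y)) has_derivative
     (\<lambda>u. \<Sum>b\<in>Basis. (Y x \<bullet> b) *\<^sub>R FD (\<lambda>y. A y b) x u + (Y' u \<bullet> b) *\<^sub>R A x b)) (at x)"
    by (rule has_derivative_transform_within_open[OF _ S x]) (rule linear_on_Basis[OF l, symmetric])
  have "((\<lambda>y. \<Sum>b\<in>Basis. (Y x \<bullet> b) *\<^sub>R A y b) has_derivative
     (\<lambda>u. \<Sum>b\<in>Basis. (Y x \<bullet> b) *\<^sub>R FD (\<lambda>y. A y b) x u)) (at x)"
    by (auto intro!: derivative_eq_intros FD_works[OF A])
  then have "((\<lambda>y. A y (Y x)) has_derivative
     (\<lambda>u. \<Sum>b\<in>Basis. (Y x \<bullet> b) *\<^sub>R FD (\<lambda>y. A y b) x u)) (at x)"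
    by (rule has_derivative_transform_within_open[OF _ S x]) (rule linear_on_Basis[OF l, symmetric])
  then have 2: "FD (\<lambda>y. A y (Y x)) x u = (\<Sum>b\<in>Basis. (Y x \<bullet> b) *\<^sub>R FD (\<lambda>y. A y b) x u)" for u
    by (simp add: FD_eqI)
  have "(\<lambda>u. \<Sum>b\<in>Basis. (Y x \<bullet> b) *\<^sub>R FD (\<lambda>y. A y b) x u + (Y' u \<bullet> b) *\<^sub>R A x b)
     = (\<lambda>u. FD (\<lambda>y. A y (Y x)) x u + A x (Y' u))"
    by (rule ext) (simp add: 2 sum.distrib linear_on_Basis[OF l[OF x], of "Y' _"])
  with 1 show ?thesis by simp
qed

lemma has_derivative_apply_bilinear:
  fixes Y :: "'a::real_normed_vector \<Rightarrow> 'b::euclidean_space" and Z :: "'a \<Rightarrow> 'd::euclidean_space"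
    and A :: "'a \<Rightarrow> 'b \<Rightarrow> 'd \<Rightarrow> 'c::real_normed_vector"
  assumes S: "open S" and x: "x \<in> S" and A: "\<And>u v. (\<lambda>y. A y u v) differentiable (at x)"
    and l: "\<And>y. y \<in> S \<Longrightarrow> bilinear (A y)"
    and Y: "(Y has_derivative Y') (at x)" and Z: "(Z has_derivative Z') (at x)"
  shows "((\<lambda>y. A y (Y y) (Z y)) has_derivative
    (\<lambda>u. FD (\<lambda>y. A y (Y x) (Z x)) x u + A x (Y' u) (Z x) + A x (Y x) (Z' u))) (at x)"
proof -
  have l1: "linear (\<lambda>u. A y u v)" "linear (A y u)" if "y \<in> S" for y u v
    using l[OF that] by (auto simp: bilinear_def)
  have *: "((\<lambda>y. A y (Y y) v) has_derivative (\<lambda>u. FD (\<lambda>y. A y (Y x) v) x u + A x (Y' u) v)) (at x)" for v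
    by (rule has_derivative_apply_linear[OF S x, of "\<lambda>y u. A y u v"]) (use A l1 Y in auto)
  have "((\<lambda>y. A y (Y y) (Z y)) has_derivative
      (\<lambda>u. FD (\<lambda>y. A y (Y y) (Z x)) x u + A x (Y x) (Z' u))) (at x)"
    by (rule has_derivative_apply_linear[OF S x, of "\<lambda>y. A y (Y y)"]) (use * l1 Z in \<open>auto simp: differentiable_def\<close>)
  then show ?thesis by (simp add: FD_eqI[OF *])
qed

section \<open>A planar system without solutions\<close>

lemma has_real_derivative_sum:
  "(\<And>i. i \<in> I \<Longrightarrow> (f i has_real_derivative f' i) (at s)) \<Longrightarrow>
    ((\<lambda>s. \<Sum>i\<in>I. f i s) has_real_derivative (\<Sum>i\<in>I. f' i)) (at s)"
  by (rule DERIV_sum[where f="\<lambda>x i. f i x" and f'=f'])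

text \<open>
  The pair \<open>(\<omega> i, \<nu> i)\<close> is the unit tangent and normal of a plane curve of curvature \<open>l\<close>
  paired with the normal of a line at distance \<open>d i\<close>, divided by \<open>d i\<close>. The curve stays inside
  its osculating circles, which shrink because \<open>l\<close> increases.
\<close>

locale planar_system =
  fixes I :: "'i set" and \<nu> \<omega> d :: "'i \<Rightarrow> real \<Rightarrow> real" and l l1 l2 :: "real \<Rightarrow> real"
    and \<epsilon> K :: real and t :: "nat \<Rightarrow> real"
  assumes fin: "finite I" and eps: "\<epsilon> > 0" and t0: "t 0 = 0" and tmono: "strict_mono t"
    and K0: "K \<ge> 0"
    and dnu: "\<And>i s. i \<in> I \<Longrightarrow> - \<epsilon> < s \<Longrightarrow> \<exists>n. s < t n \<Longrightarrow>
        (\<nu> i has_real_derivative (l s - \<nu> i s) * \<omega> i s) (at s)"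
    and dom: "\<And>i s. i \<in> I \<Longrightarrow> - \<epsilon> < s \<Longrightarrow> \<exists>n. s < t n \<Longrightarrow>
        (\<omega> i has_real_derivative - (\<omega> i s)\<^sup>2 - l s * \<nu> i s) (at s)"
    and dd: "\<And>i s. i \<in> I \<Longrightarrow> - \<epsilon> < s \<Longrightarrow> \<exists>n. s < t n \<Longrightarrow>
        (d i has_real_derivative \<omega> i s * d i s) (at s)"
    and dl: "\<And>s. - \<epsilon> < s \<Longrightarrow> \<exists>n. s < t n \<Longrightarrow> (l has_real_derivative l1 s) (at s)"
    and dl1: "\<And>s. - \<epsilon> < s \<Longrightarrow> \<exists>n. s < t n \<Longrightarrow> (l1 has_real_derivative l2 s) (at s)"
    and leq: "\<And>s. 0 \<le> s \<Longrightarrow> \<exists>n. s < t n \<Longrightarrow> 3 * l s = - (\<Sum>i\<in>I. \<nu> i s)"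
    and l2eq: "\<And>s. 0 \<le> s \<Longrightarrow> \<exists>n. s < t n \<Longrightarrow>
        l2 s + (\<Sum>i\<in>I. \<omega> i s) * l1 s = l s * ((l s)\<^sup>2 + (\<Sum>i\<in>I. (\<nu> i s)\<^sup>2) + K)"
    and d0: "\<And>i. i \<in> I \<Longrightarrow> d i 0 > 0"
    and norm0: "\<And>i. i \<in> I \<Longrightarrow> (d i 0)\<^sup>2 * ((\<omega> i 0)\<^sup>2 + (\<nu> i 0)\<^sup>2) = 1"
    and l0: "l 0 > 0" and l10: "l1 0 > 0"
    and blow: "\<And>B. bdd_above (range t) \<Longrightarrow>
        \<exists>N. \<forall>n\<ge>N. B < (\<Sum>i\<in>I. \<bar>\<nu> i (t n)\<bar> + \<bar>\<omega> i (t n)\<bar> + \<bar>d i (t n)\<bar>)"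
begin

text \<open>The times \<open>t n\<close> increase to the right end of the solution, which may be
  infinite; it is therefore expressed by "some \<open>t n\<close>" and not by a real number. The
  margin \<open>\<epsilon>\<close> to the left of 0 makes the derivatives at 0 two-sided.\<close>

definition J where "J = {s. 0 \<le> s \<and> (\<exists>n. s < t n)}"

lemma J_mid: "a \<in> J \<Longrightarrow> b \<in> J \<Longrightarrow> a \<le> x \<Longrightarrow> x \<le> b \<Longrightarrow> x \<in> J"
  unfolding J_def by (auto intro: order.strict_trans1)

lemma zero_J: "0 \<in> J"
  using strict_monoD[OF tmono, of 0 1] t0 by (auto simp: J_def)

lemma t_J: "t n \<in> J"
  using strict_monoD[OF tmono, of n "Suc n"] strict_mono_less_eq[OF tmono, of 0 n] t0
  unfolding J_def by auto

lemma J_ge0: "s \<in> J \<Longrightarrow> 0 \<le> s" by (simp add: J_def)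

lemma J_dom: "s \<in> J \<Longrightarrow> - \<epsilon> < s" "s \<in> J \<Longrightarrow> \<exists>n. s < t n"
  using eps by (auto simp: J_def)

lemma derivs:
  "i \<in> I \<Longrightarrow> s \<in> J \<Longrightarrow> (\<nu> i has_real_derivative (l s - \<nu> i s) * \<omega> i s) (at s)"
  "i \<in> I \<Longrightarrow> s \<in> J \<Longrightarrow> (\<omega> i has_real_derivative - (\<omega> i s)\<^sup>2 - l s * \<nu> i s) (at s)"
  "i \<in> I \<Longrightarrow> s \<in> J \<Longrightarrow> (d i has_real_derivative \<omega> i s * d i s) (at s)"
  "s \<in> J \<Longrightarrow> (l has_real_derivative l1 s) (at s)"
  "s \<in> J \<Longrightarrow> (l1 has_real_derivative l2 s) (at s)"
  using dnu dom dd dl dl1 J_dom by auto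

lemma max_J: "finite A \<Longrightarrow> A \<subseteq> J \<Longrightarrow> \<exists>s\<in>J. \<forall>a\<in>A. a \<le> s"
proof (induction A rule: finite_induct)
  case empty
  then show ?case using zero_J by auto
next
  case (insert x A)
  then obtain s where "s \<in> J" "\<forall>a\<in>A. a \<le> s" by auto
  then show ?case using insert.prems by (intro bexI[of _ "max x s"]) (auto simp: max_def)
qed

lemma mono_J:
  assumes "\<And>s. s \<in> J \<Longrightarrow> a \<le> s \<Longrightarrow> (f has_real_derivative f' s) (at s)" "\<And>s. s \<in> J \<Longrightarrow> a \<le> s \<Longrightarrow> 0 \<le> f' s"
    "a \<in> J" "b \<in> J" "a \<le> b"
  shows "f a \<le> f b"
  using assms J_mid[OF \<open>a \<in> J\<close> \<open>b \<in> J\<close>]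
  by (intro DERIV_nonneg_imp_nondecreasing[OF \<open>a \<le> b\<close>]) blast

lemma const_J:
  assumes "\<And>s. s \<in> J \<Longrightarrow> (f has_real_derivative 0) (at s)" "b \<in> J"
  shows "f b = f 0"
  using mono_J[of 0 f "\<lambda>_. 0" b] mono_J[of 0 "\<lambda>x. - f x" "\<lambda>_. 0" b] assms zero_J J_ge0
    DERIV_minus[of f 0] by fastforce

lemma pos_J:
  assumes "\<And>s. s \<in> J \<Longrightarrow> isCont f s" "\<And>s. s \<in> J \<Longrightarrow> f s \<noteq> (0::real)" "f 0 > 0" "b \<in> J"
  shows "f b > 0"
proof (rule ccontr)
  assume "\<not> ?thesis"
  then have "f b \<le> 0" by simp
  then obtain z where "0 \<le> z" "z \<le> b" "f z = 0"
    using IVT2[of f b 0 0] assms J_mid[OF zero_J assms(4)] J_ge0[OF assms(4)] by fastforce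
  then show False using assms J_mid[OF zero_J assms(4)] by blast
qed

text \<open>The growth rate \<open>- 2 * \<omega>\<close> of \<open>\<omega>^2 + \<nu>^2\<close> is
  cancelled by that of \<open>d^2\<close>. The conserved value 1 also keeps \<open>d\<close> away
  from 0, which fixes its sign.\<close>

lemma norm1:
  assumes i: "i \<in> I" and s: "s \<in> J" shows "(d i s)\<^sup>2 * ((\<omega> i s)\<^sup>2 + (\<nu> i s)\<^sup>2) = 1"
proof -
  have "((\<lambda>s. (d i s)\<^sup>2 * ((\<omega> i s)\<^sup>2 + (\<nu> i s)\<^sup>2)) has_real_derivative 0) (at s)" if "s \<in> J" for s
    by (rule derivative_eq_intros derivs that i refl)+ (simp add: algebra_simps power2_eq_square)
  from const_J[OF this s] show ?thesis using norm0[OF i] by simp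
qed

lemma d_pos:
  assumes i: "i \<in> I" and s: "s \<in> J" shows "d i s > 0"
proof (rule pos_J[of "d i" s])
  show "isCont (d i) s" if "s \<in> J" for s using DERIV_isCont[OF derivs(3)[OF i that]] .
  show "d i s \<noteq> 0" if "s \<in> J" for s using norm1[OF i that] by auto
qed (use d0 i s in auto)

definition p where "p i s = \<omega> i s * d i s"
definition q where "q i s = \<nu> i s * d i s"

lemma pq: "i \<in> I \<Longrightarrow> s \<in> J \<Longrightarrow> (p i s)\<^sup>2 + (q i s)\<^sup>2 = 1"
  using norm1[of i s] by (simp add: p_def q_def algebra_simps power_mult_distrib)

lemma pq_bounds:
  assumes "i \<in> I" "s \<in> J"
  shows "\<bar>p i s\<bar> \<le> 1" "\<bar>q i s\<bar> \<le> 1"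
proof -
  have "(p i s)\<^sup>2 \<le> 1" "(q i s)\<^sup>2 \<le> 1"
    using pq[OF assms] zero_le_power2[of "p i s"] zero_le_power2[of "q i s"] by linarith+
  then show "\<bar>p i s\<bar> \<le> 1" "\<bar>q i s\<bar> \<le> 1" by (simp_all add: abs_square_le_1)
qed

lemma p_deriv: "i \<in> I \<Longrightarrow> s \<in> J \<Longrightarrow> (p i has_real_derivative - l s * q i s) (at s)"
  unfolding p_def[abs_def] q_def
  by (rule derivative_eq_intros derivs refl | assumption)+ (simp add: algebra_simps power2_eq_square)

lemma q_deriv: "i \<in> I \<Longrightarrow> s \<in> J \<Longrightarrow> (q i has_real_derivative l s * p i s) (at s)"
  unfolding q_def[abs_def] p_def
  by (rule derivative_eq_intros derivs refl | assumption)+ (simp add: algebra_simps power2_eq_square)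

lemma d_deriv: "i \<in> I \<Longrightarrow> s \<in> J \<Longrightarrow> (d i has_real_derivative p i s) (at s)"
  using derivs(3) by (simp add: p_def)

text \<open>The product of the distances, an integrating factor for the second order equation
  because its logarithmic derivative is the sum of the \<open>\<omega> i\<close>. As an exponential
  it is positive at every argument, also outside \<open>J\<close>.\<close>

definition E where "E s = exp (\<Sum>i\<in>I. ln (d i s))"

lemma E_prod: "s \<in> J \<Longrightarrow> E s = (\<Prod>i\<in>I. d i s)"
  unfolding E_def using d_pos by (simp add: exp_sum[OF fin])

lemma E_pos: "E s > 0" by (simp add: E_def)

lemma E_deriv:
  assumes s: "s \<in> J" shows "(E has_real_derivative E s * (\<Sum>i\<in>I. \<omega> i s)) (at s)"
proof -
  have "((\<lambda>s. \<Sum>i\<in>I. ln (d i s)) has_real_derivative (\<Sum>i\<in>I. \<omega> i s)) (at s)"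
  proof (rule has_real_derivative_sum)
    fix i assume i: "i \<in> I"
    show "((\<lambda>s. ln (d i s)) has_real_derivative \<omega> i s) (at s)"
      by (rule derivative_eq_intros derivs(3) i s d_pos refl)+ (use d_pos[OF i s] in simp)
  qed
  from DERIV_fun_exp[OF this] show ?thesis by (simp add: E_def[abs_def])
qed

text \<open>The derivative is \<open>E\<close> times
  \<open>l1^2 + l * (l2 + l1 * sum of \<omega>)\<close>, and the second order equation makes the
  last product \<open>l^2\<close> times a nonnegative number. So the sign of \<open>l\<close> need
  not be known; it follows, because \<open>l * l1\<close> cannot vanish.\<close>

lemma Ell1:
  assumes "s \<in> J" shows "E s * (l s * l1 s) \<ge> E 0 * (l 0 * l1 0)"
proof (rule mono_J[of 0 "\<lambda>s. E s * (l s * l1 s)"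
    "\<lambda>s. E s * ((l1 s)\<^sup>2 + (l s)\<^sup>2 * ((l s)\<^sup>2 + (\<Sum>i\<in>I. (\<nu> i s)\<^sup>2) + K))"])
  fix s assume s: "s \<in> J"
  have l2: "l2 s = l s * ((l s)\<^sup>2 + (\<Sum>i\<in>I. (\<nu> i s)\<^sup>2) + K) - (\<Sum>i\<in>I. \<omega> i s) * l1 s"
    using l2eq[OF J_ge0[OF s] J_dom(2)[OF s]] by simp
  show "((\<lambda>s. E s * (l s * l1 s)) has_real_derivative
       E s * ((l1 s)\<^sup>2 + (l s)\<^sup>2 * ((l s)\<^sup>2 + (\<Sum>i\<in>I. (\<nu> i s)\<^sup>2) + K))) (at s)"
    by (rule derivative_eq_intros derivs E_deriv s refl)+
      (simp add: l2 algebra_simps power2_eq_square)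
  show "0 \<le> E s * ((l1 s)\<^sup>2 + (l s)\<^sup>2 * ((l s)\<^sup>2 + (\<Sum>i\<in>I. (\<nu> i s)\<^sup>2) + K))"
    by (intro mult_nonneg_nonneg add_nonneg_nonneg sum_nonneg K0) (use E_pos in \<open>auto intro: less_imp_le\<close>)
qed (use assms zero_J J_ge0 in auto)

lemma Ell1_pos: "s \<in> J \<Longrightarrow> l s * l1 s > 0"
  using Ell1[of s] E_pos[of s] E_pos[of 0] l0 l10
  by (smt (verit) mult_pos_pos zero_less_mult_iff)

lemma l_pos:
  assumes s: "s \<in> J" shows "l s > 0"
proof (rule pos_J[of l s])
  show "isCont l s" if "s \<in> J" for s using DERIV_isCont[OF derivs(4)[OF that]] .
  show "l s \<noteq> 0" if "s \<in> J" for s using Ell1_pos[OF that] by auto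
qed (use l0 s in auto)

lemma l1_pos: "s \<in> J \<Longrightarrow> l1 s > 0"
  using Ell1_pos[of s] l_pos[of s] by (simp add: zero_less_mult_iff)

lemma El1:
  assumes "s \<in> J" shows "E s * l1 s \<ge> E 0 * l1 0"
proof (rule mono_J[of 0 "\<lambda>s. E s * l1 s"
    "\<lambda>s. E s * (l s * ((l s)\<^sup>2 + (\<Sum>i\<in>I. (\<nu> i s)\<^sup>2) + K))"])
  fix s assume s: "s \<in> J"
  have l2: "l2 s = l s * ((l s)\<^sup>2 + (\<Sum>i\<in>I. (\<nu> i s)\<^sup>2) + K) - (\<Sum>i\<in>I. \<omega> i s) * l1 s"
    using l2eq[OF J_ge0[OF s] J_dom(2)[OF s]] by simp
  show "((\<lambda>s. E s * l1 s) has_real_derivative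
       E s * (l s * ((l s)\<^sup>2 + (\<Sum>i\<in>I. (\<nu> i s)\<^sup>2) + K))) (at s)"
    by (rule derivative_eq_intros derivs E_deriv s refl)+
      (simp add: l2 algebra_simps power2_eq_square)
  show "0 \<le> E s * (l s * ((l s)\<^sup>2 + (\<Sum>i\<in>I. (\<nu> i s)\<^sup>2) + K))"
    by (intro mult_nonneg_nonneg add_nonneg_nonneg sum_nonneg K0)
      (use E_pos l_pos[OF s] in \<open>auto intro: less_imp_le\<close>)
qed (use assms zero_J J_ge0 in auto)

lemma l_mono: "a \<in> J \<Longrightarrow> b \<in> J \<Longrightarrow> a \<le> b \<Longrightarrow> l a \<le> l b"
  by (rule mono_J[of a l l1]) (auto intro: derivs(4) less_imp_le[OF l1_pos])

text \<open>Signed distance of the centre of the osculating circle from the line \<open>i\<close>.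
  The numbers \<open>D i - 1 / l\<close> and \<open>D i + 1 / l\<close> are the extreme distances
  over the osculating disc; their monotonicity in \<open>D_up\<close> and \<open>D_down\<close> is
  the nesting of these discs for increasing curvature.\<close>

definition D where "D i s = d i s - q i s / l s"

lemma D_deriv:
  assumes "i \<in> I" "s \<in> J"
  shows "(D i has_real_derivative q i s * l1 s / (l s)\<^sup>2) (at s)"
    "((\<lambda>s. 1 / l s) has_real_derivative - l1 s / (l s)\<^sup>2) (at s)"
proof -
  have l: "l s \<noteq> 0" using l_pos[OF assms(2)] by simp
  show "((\<lambda>s. 1 / l s) has_real_derivative - l1 s / (l s)\<^sup>2) (at s)"
    using DERIV_divide[OF DERIV_const[of 1] derivs(4)[OF assms(2)] l] assms(2) by (simp add: power2_eq_square)
  have "(D i has_real_derivative p i s - (l s * p i s * l s - q i s * l1 s) / (l s * l s)) (at s)"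
    unfolding D_def[abs_def]
    by (intro DERIV_diff DERIV_divide d_deriv q_deriv derivs(4) assms l)
  then show "(D i has_real_derivative q i s * l1 s / (l s)\<^sup>2) (at s)"
    using l by (simp add: power2_eq_square diff_divide_distrib)
qed

lemma D_up:
  assumes "i \<in> I" "a \<in> J" "b \<in> J" "a \<le> b"
  shows "D i a - 1 / l a \<le> D i b - 1 / l b"
proof (rule mono_J[of a "\<lambda>s. D i s - 1 / l s" "\<lambda>s. (1 + q i s) * l1 s / (l s)\<^sup>2"])
  fix s assume s: "s \<in> J"
  show "((\<lambda>s. D i s - 1 / l s) has_real_derivative (1 + q i s) * l1 s / (l s)\<^sup>2) (at s)"
    using DERIV_diff[OF D_deriv[OF assms(1) s]] by (simp add: algebra_simps add_divide_distrib)
  show "0 \<le> (1 + q i s) * l1 s / (l s)\<^sup>2"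
    using pq_bounds[OF assms(1) s] l1_pos[OF s] by simp
qed (use assms in auto)

lemma D_down:
  assumes "i \<in> I" "a \<in> J" "b \<in> J" "a \<le> b"
  shows "D i b + 1 / l b \<le> D i a + 1 / l a"
proof -
  have "- (D i a + 1 / l a) \<le> - (D i b + 1 / l b)"
  proof (rule mono_J[of a "\<lambda>s. - (D i s + 1 / l s)" "\<lambda>s. (1 - q i s) * l1 s / (l s)\<^sup>2"])
    fix s assume s: "s \<in> J"
    show "((\<lambda>s. - (D i s + 1 / l s)) has_real_derivative (1 - q i s) * l1 s / (l s)\<^sup>2) (at s)"
      using DERIV_minus[OF DERIV_add[OF D_deriv[OF assms(1) s]]]
      by (simp add: algebra_simps diff_divide_distrib)
    show "0 \<le> (1 - q i s) * l1 s / (l s)\<^sup>2"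
      using pq_bounds[OF assms(1) s] l1_pos[OF s] by simp
  qed (use assms in auto)
  then show ?thesis by simp
qed

lemma d_D:
  assumes "i \<in> I" "s \<in> J"
  shows "D i s - 1 / l s \<le> d i s" "d i s \<le> D i s + 1 / l s"
proof -
  have "\<bar>q i s / l s\<bar> \<le> 1 / l s"
    using pq_bounds[OF assms] l_pos[OF assms(2)] by (simp add: abs_divide divide_right_mono)
  then show "D i s - 1 / l s \<le> d i s" "d i s \<le> D i s + 1 / l s" by (simp_all add: D_def abs_le_iff del: abs_divide)
qed

text \<open>Largest distance over the initial osculating disc, in which the whole later curve
  stays.\<close>

definition C where "C i = D i 0 + 1 / l 0"

lemma d_le_C: "i \<in> I \<Longrightarrow> s \<in> J \<Longrightarrow> d i s \<le> C i"
  using d_D(2)[of i s] D_down[of i 0 s] zero_J J_ge0[of s] by (auto simp: C_def)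

lemma C_pos: "i \<in> I \<Longrightarrow> C i > 0"
  using d_le_C[of i 0] d_pos[of i 0] zero_J by simp

lemma nu_le: "i \<in> I \<Longrightarrow> s \<in> J \<Longrightarrow> \<bar>\<nu> i s\<bar> \<le> 1 / d i s"
  using pq_bounds(2)[of i s] d_pos[of i s] by (simp add: q_def abs_mult field_simps)

lemma om_le: "i \<in> I \<Longrightarrow> s \<in> J \<Longrightarrow> \<bar>\<omega> i s\<bar> \<le> 1 / d i s"
  using pq_bounds(1)[of i s] d_pos[of i s] by (simp add: p_def abs_mult field_simps)

lemma d_lipschitz: "i \<in> I \<Longrightarrow> a \<in> J \<Longrightarrow> b \<in> J \<Longrightarrow> a \<le> b \<Longrightarrow> d i a - (b - a) \<le> d i b"
  using mono_J[of a "\<lambda>s. d i s + s" "\<lambda>s. p i s + 1" b] pq_bounds(1)[of i]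
  by (fastforce intro: derivative_eq_intros d_deriv)

text \<open>The turning angle of the curve. The integral starts at a negative time inside the
  domain, so that its derivative at 0 is two-sided.\<close>

definition \<theta> where "\<theta> s = integral {-\<epsilon>/2..s} l"

lemma theta_deriv:
  assumes "s \<in> J" shows "(\<theta> has_real_derivative l s) (at s)"
proof -
  obtain n where n: "s < t n" using assms J_dom by blast
  have c: "continuous_on {-\<epsilon>/2..t n} l"
  proof (rule continuous_at_imp_continuous_on, rule ballI)
    fix x assume "x \<in> {-\<epsilon>/2..t n}"
    then have "- \<epsilon> < x" "x < t (Suc n)"
      using eps strict_monoD[OF tmono, of n "Suc n"] by auto
    then show "isCont l x" using dl DERIV_isCont by blast
  qed
  have "(\<theta> has_real_derivative l s) (at s within {-\<epsilon>/2..t n})"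
    unfolding \<theta>_def[abs_def]
    by (rule integral_has_real_derivative[OF c]) (use assms n eps J_ge0[of s] in auto)
  moreover have "at s within {-\<epsilon>/2..t n} = at s"
    by (rule at_within_Icc_at) (use assms n eps J_ge0[of s] in auto)
  ultimately show ?thesis by simp
qed

text \<open>In the frame rotated by \<open>\<theta>\<close> the unit vector \<open>(p, q)\<close>
  has constant components \<open>u\<close>, \<open>v\<close>. Hence \<open>q\<close> is the sine of
  \<open>\<theta>\<close> plus a phase, and an unbounded continuous angle passes through a minimum
  of the sine.\<close>

lemma theta_hits:
  assumes i: "i \<in> I" and unb: "\<And>B. \<exists>s\<in>J. \<theta> s > B"
  shows "\<exists>s\<in>J. q i s = -1"
proof -
  define u where "u s = p i s * cos (\<theta> s) + q i s * sin (\<theta> s)" for s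
  define v where "v s = q i s * cos (\<theta> s) - p i s * sin (\<theta> s)" for s
  have "(u has_real_derivative 0) (at s)" "(v has_real_derivative 0) (at s)" if "s \<in> J" for s
    unfolding u_def[abs_def] v_def[abs_def]
    by (rule derivative_eq_intros p_deriv q_deriv theta_deriv i that refl | simp add: algebra_simps)+
  then have uv: "u s = u 0" "v s = v 0" if "s \<in> J" for s using const_J that by auto
  have "(u 0)\<^sup>2 + (v 0)\<^sup>2 = ((p i 0)\<^sup>2 + (q i 0)\<^sup>2) * ((sin (\<theta> 0))\<^sup>2 + (cos (\<theta> 0))\<^sup>2)"
    unfolding u_def v_def by algebra
  then have "(u 0)\<^sup>2 + (v 0)\<^sup>2 = 1" using pq[OF i zero_J] by simp
  then obtain \<alpha> where \<alpha>: "u 0 = cos \<alpha>" "v 0 = sin \<alpha>" using sincos_total_2pi by metis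
  have q: "q i s = sin (\<theta> s + \<alpha>)" if "s \<in> J" for s
  proof -
    have "q i s * ((sin (\<theta> s))\<^sup>2 + (cos (\<theta> s))\<^sup>2) = u s * sin (\<theta> s) + v s * cos (\<theta> s)"
      unfolding u_def v_def by algebra
    then show ?thesis using uv[OF that] \<alpha> by (simp add: sin_add algebra_simps)
  qed
  \<comment> \<open>Large enough that the target angle \<open>y\<close>, at which the sine is -1,
    has not been passed at time 0.\<close>
  obtain k :: nat where k: "real k > (\<theta> 0 + \<alpha> + pi / 2) / (2 * pi)" using reals_Archimedean2 by blast
  define y where "y = 2 * pi * real k - pi / 2 - \<alpha>"
  have y0: "\<theta> 0 \<le> y" using k by (simp add: y_def field_simps)
  obtain b where b: "b \<in> J" "\<theta> b > y" using unb by blast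
  have "\<exists>x. 0 \<le> x \<and> x \<le> b \<and> \<theta> x = y"
  proof (rule IVT)
    show "\<forall>x. 0 \<le> x \<and> x \<le> b \<longrightarrow> isCont \<theta> x"
      using DERIV_isCont[OF theta_deriv] J_mid[OF zero_J b(1)] by blast
  qed (use y0 b J_ge0 in auto)
  then obtain x where x: "x \<in> J" "\<theta> x = y" using J_mid[OF zero_J b(1)] by blast
  have "q i x = sin (2 * pi * real k - pi / 2)" using q[OF x(1)] x(2) by (simp add: y_def)
  also have "\<dots> = - 1" using sin_diff[of "2 * pi * real k" "pi/2"] cos_2npi[of k] sin_2npi[of k]
    by (simp add: mult.commute mult.left_commute)
  finally show ?thesis using x(1) by blast
qed

lemma E_le:
  assumes "s \<in> J" "A \<subseteq> I"
  shows "E s \<le> (\<Prod>i\<in>A. d i s) * (\<Prod>i\<in>I - A. C i)"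
proof -
  have "E s = (\<Prod>i\<in>A. d i s) * (\<Prod>i\<in>I - A. d i s)"
    unfolding E_prod[OF assms(1)] using prod.subset_diff[OF assms(2) fin, of "\<lambda>i. d i s"] by (simp add: mult.commute)
  also have "\<dots> \<le> (\<Prod>i\<in>A. d i s) * (\<Prod>i\<in>I - A. C i)"
    by (intro mult_left_mono prod_mono prod_nonneg)
      (use assms in \<open>auto intro: d_le_C less_imp_le[OF d_pos]\<close>)
  finally show ?thesis .
qed

text \<open>If the curve turned without bound, \<open>l\<close> would be unbounded, and since
  \<open>3 * l\<close> is minus the sum of the \<open>\<nu>\<close> there would be a line
  \<open>j\<close> whose osculating discs always reach it. At a time with \<open>q = - 1\<close> the
  curve is at the end of the disc towards that line, so \<open>d j = D j - 1 / l\<close> is not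
  positive.\<close>

lemma theta_bounded: "\<exists>B. \<forall>s\<in>J. \<theta> s \<le> B"
proof (rule ccontr)
  assume "\<not> ?thesis"
  then have unb: "\<exists>s\<in>J. \<theta> s > B" for B by (meson not_le)
  have lunb: "\<exists>s\<in>J. l s > B" for B
  proof (rule ccontr)
    assume "\<not> ?thesis"
    then have lB: "l s \<le> B" if "s \<in> J" for s using that by (meson not_le)
    have th: "\<theta> s \<le> \<theta> 0 + B * s" if "s \<in> J" for s
      using mono_J[of 0 "\<lambda>s. B * s - \<theta> s" "\<lambda>s. B - l s" s] lB that zero_J J_ge0
      by (fastforce intro: derivative_eq_intros theta_deriv)
    have B0: "B > 0" using lB[OF zero_J] l0 by simp
    define P where "P = (\<Prod>i\<in>I. C i)"
    have P: "P > 0" unfolding P_def by (intro prod_pos C_pos)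
    \<comment> \<open>A lower bound for \<open>l * l1\<close>, since the product of the distances is
      at most \<open>P\<close>. So \<open>l^2\<close> grows at least linearly; a bounded
      \<open>l\<close> would leave only bounded time, hence a bounded angle.\<close>
    define c where "c = E 0 * (l 0 * l1 0) / P"
    have c: "c > 0" using P E_pos l0 l10 by (simp add: c_def)
    have c1: "l s * l1 s \<ge> c" if "s \<in> J" for s
    proof -
      have "E 0 * (l 0 * l1 0) \<le> E s * (l s * l1 s)" by (rule Ell1[OF that])
      also have "\<dots> \<le> P * (l s * l1 s)"
        using E_le[OF that, of "{}"] Ell1_pos[OF that] by (intro mult_right_mono) (auto simp: P_def)
      finally show ?thesis using P by (simp add: c_def field_simps)
    qed
    have l2: "(l s)\<^sup>2 \<ge> 2 * c * s" if "s \<in> J" for s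
    proof -
      have "(l 0)\<^sup>2 - 2 * c * 0 \<le> (l s)\<^sup>2 - 2 * c * s"
      proof (rule mono_J[of 0 _ "\<lambda>s. 2 * (l s * l1 s) - 2 * c"])
        show "((\<lambda>s. (l s)\<^sup>2 - 2 * c * s) has_real_derivative 2 * (l s * l1 s) - 2 * c) (at s)" if "s \<in> J" for s
          by (rule derivative_eq_intros derivs that refl | simp)+
      qed (use c1 that zero_J J_ge0 in auto)
      then show ?thesis using zero_le_power2[of "l 0"] by linarith
    qed
    obtain s where s: "s \<in> J" "\<theta> s > \<theta> 0 + B * (B\<^sup>2 / (2 * c))" using unb by blast
    have "B * (B\<^sup>2 / (2 * c)) < B * s" using s th[OF s(1)] by linarith
    then have "B\<^sup>2 < 2 * c * s" using B0 c by (simp add: field_simps)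
    moreover have "(l s)\<^sup>2 \<le> B\<^sup>2" using lB[OF s(1)] l_pos[OF s(1)] by (simp add: power_mono)
    ultimately show False using l2[OF s(1)] by linarith
  qed
  \<comment> \<open>Otherwise each disc lies eventually on the positive side of its line. By
    \<open>D_up\<close> all distances stay above positive bounds, which bounds the
    \<open>\<nu>\<close> and with them \<open>l\<close>.\<close>
  have "\<exists>j\<in>I. \<forall>s\<in>J. D j s - 1 / l s \<le> 0"
  proof (rule ccontr)
    assume "\<not> ?thesis"
    then have "\<forall>j\<in>I. \<exists>s\<in>J. D j s - 1 / l s > 0" by (meson not_le)
    then obtain \<sigma> where \<sigma>: "\<And>j. j \<in> I \<Longrightarrow> \<sigma> j \<in> J" "\<And>j. j \<in> I \<Longrightarrow> D j (\<sigma> j) - 1 / l (\<sigma> j) > 0" by metis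
    obtain s0 where s0: "s0 \<in> J" "\<And>j. j \<in> I \<Longrightarrow> \<sigma> j \<le> s0" using max_J[of "\<sigma> ` I"] fin \<sigma> by blast
    define B where "B = (\<Sum>j\<in>I. 1 / (D j (\<sigma> j) - 1 / l (\<sigma> j)))"
    obtain s' where s': "s' \<in> J" "l s' > B / 3" using lunb by blast
    define s where "s = max s0 s'"
    have sJ: "s \<in> J" and ls: "l s > B / 3"
      using s' s0(1) l_mono[of s' s0] by (auto simp: s_def max_def)
    have "3 * l s \<le> (\<Sum>j\<in>I. \<bar>\<nu> j s\<bar>)"
      unfolding leq[OF J_ge0[OF sJ] J_dom(2)[OF sJ]] sum_negf[symmetric] by (rule sum_mono) simp
    also have "\<dots> \<le> B" unfolding B_def
    proof (rule sum_mono)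
      fix j assume j: "j \<in> I"
      have "D j (\<sigma> j) - 1 / l (\<sigma> j) \<le> d j s"
        using D_up[OF j \<sigma>(1)[OF j] sJ] d_D(1)[OF j sJ] s0(2)[OF j] unfolding s_def by linarith
      then have "1 / d j s \<le> 1 / (D j (\<sigma> j) - 1 / l (\<sigma> j))"
        using \<sigma>(2)[OF j] by (simp add: frac_le)
      then show "\<bar>\<nu> j s\<bar> \<le> 1 / (D j (\<sigma> j) - 1 / l (\<sigma> j))" using nu_le[OF j sJ] by simp
    qed
    finally show False using ls by simp
  qed
  then obtain j where j: "j \<in> I" "\<And>s. s \<in> J \<Longrightarrow> D j s - 1 / l s \<le> 0" by blast
  obtain s where s: "s \<in> J" "q j s = -1" using theta_hits[OF j(1) unb] by blast
  have "d j s = D j s - 1 / l s" using s l_pos[OF s(1)] by (simp add: D_def)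
  then show False using j(2)[OF s(1)] d_pos[OF j(1) s(1)] by simp
qed

text \<open>Bounded angle and \<open>l \<ge> l 0\<close> make the life time \<open>T\<close> finite,
  so the state blows up there, which means that some distance tends to 0. Such a distance is at most
  \<open>T - s\<close>, and this forces \<open>l\<close> to grow like \<open>1 / (T - s)\<close>,
  whose integral diverges, against the bounded angle.\<close>

theorem contradiction: False
proof -
  obtain B where B: "\<And>s. s \<in> J \<Longrightarrow> \<theta> s \<le> B" using theta_bounded by blast
  have thl: "\<theta> s \<ge> \<theta> 0 + l 0 * s" if "s \<in> J" for s
    using mono_J[of 0 "\<lambda>s. \<theta> s - l 0 * s" "\<lambda>s. l s - l 0" s] l_mono[OF zero_J] that zero_J J_ge0
    by (fastforce intro: derivative_eq_intros theta_deriv)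
  have tb: "t n \<le> (B - \<theta> 0) / l 0" for n
    using thl[OF t_J[of n]] B[OF t_J[of n]] l0 by (simp add: field_simps)
  then have bdd: "bdd_above (range t)" by (intro bdd_aboveI2)
  define T where "T = (SUP n. t n)"
  have T: "t n < T" for n
    using cSUP_upper[OF _ bdd, of "Suc n"] strict_monoD[OF tmono, of n "Suc n"] by (simp add: T_def)
  have JT: "s \<in> J \<longleftrightarrow> 0 \<le> s \<and> s < T" for s
    using less_cSUP_iff[of UNIV t s] bdd by (auto simp: J_def T_def)
  \<comment> \<open>Excludes a growth of \<open>l\<close> like \<open>a / (T - s)\<close>: its
    integral, the angle, would diverge logarithmically.\<close>
  have nolog: False if a: "a > 0" and s1: "s1 \<in> J"
    and lb: "\<And>s. s \<in> J \<Longrightarrow> s1 \<le> s \<Longrightarrow> l s \<ge> a / (T - s) - b" for a b s1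
  proof -
    have th: "\<theta> s1 + a * ln (T - s1) + b * s1 \<le> \<theta> s + a * ln (T - s) + b * s"
      if s: "s \<in> J" "s1 \<le> s" for s
    proof (rule mono_J[of s1 _ "\<lambda>s. l s - a / (T - s) + b"])
      show "((\<lambda>s. \<theta> s + a * ln (T - s) + b * s) has_real_derivative l s - a / (T - s) + b) (at s)"
        if "s \<in> J" for s
        by (rule derivative_eq_intros theta_deriv that refl | use that JT in \<open>simp add: field_simps\<close>)+
      show "0 \<le> l s - a / (T - s) + b" if "s \<in> J" "s1 \<le> s" for s using lb[OF that] by simp
    qed (use s s1 in auto)
    define c where "c = (B + \<bar>b\<bar> * T - \<theta> s1 - a * ln (T - s1) - b * s1) / a"
    \<comment> \<open>At this time \<open>ln (T - s)\<close> is at most \<open>- c - 1\<close>, one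
      below the value \<open>- c\<close> that the bound on the angle allows.\<close>
    define s where "s = max s1 (T - exp (- c - 1))"
    have "s1 \<le> s" "s < T" using JT[of s1] s1 unfolding s_def by simp_all
    then have s: "s \<in> J" "s1 \<le> s" using JT[of s1] JT[of s] s1 by simp_all
    have "ln (T - s) \<le> ln (exp (- c - 1))"
      by (rule ln_mono) (use s JT[of s] in \<open>simp_all add: s_def\<close>)
    then have "a * ln (T - s) \<le> a * (- c - 1)" using a by simp
    moreover have "b * s \<le> \<bar>b\<bar> * T"
    proof -
      have "b * s \<le> \<bar>b\<bar> * s" using s JT by (intro mult_right_mono) auto
      also have "\<dots> \<le> \<bar>b\<bar> * T" using s JT by (intro mult_left_mono) auto
      finally show ?thesis .
    qed
    moreover have "a * c = B + \<bar>b\<bar> * T - \<theta> s1 - a * ln (T - s1) - b * s1" using a by (simp add: c_def)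
    ultimately show False using th[OF s] B[OF s(1)] a by (simp add: algebra_simps)
  qed
  \<comment> \<open>The distances that tend to 0. As a distance changes with speed at most 1, a
    single violation of \<open>d j s \<le> T - s\<close> keeps it above a positive bound up to
    \<open>T\<close>.\<close>
  define I0 where "I0 = {j \<in> I. \<forall>s\<in>J. d j s \<le> T - s}"
  have far: "\<exists>\<delta>>0. \<exists>s0\<in>J. \<forall>s\<in>J. s0 \<le> s \<longrightarrow> \<delta> \<le> d j s" if j: "j \<in> I" "j \<notin> I0" for j
  proof -
    obtain s0 where s0: "s0 \<in> J" "d j s0 > T - s0" using j by (auto simp: I0_def not_le)
    have "d j s0 - (T - s0) \<le> d j s" if "s \<in> J" "s0 \<le> s" for s
      using d_lipschitz[OF j(1) s0(1) that] that JT by auto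
    then show ?thesis using s0 by (intro exI[of _ "d j s0 - (T - s0)"]) auto
  qed
  have "\<forall>j\<in>I - I0. \<exists>y. fst y > 0 \<and> snd y \<in> J \<and> (\<forall>s\<in>J. snd y \<le> s \<longrightarrow> fst y \<le> d j s)"
    using far by fastforce
  then obtain y where y: "\<And>j. j \<in> I - I0 \<Longrightarrow>
      fst (y j) > 0 \<and> snd (y j) \<in> J \<and> (\<forall>s\<in>J. snd (y j) \<le> s \<longrightarrow> fst (y j) \<le> d j s)"
    by metis
  define \<delta> where "\<delta> j = fst (y j)" for j
  define \<sigma> where "\<sigma> j = snd (y j)" for j
  have \<delta>: "\<delta> j > 0" if "j \<in> I" "j \<notin> I0" for j using y[of j] that by (simp add: \<delta>_def)
  have \<sigma>: "\<And>j. j \<in> I - I0 \<Longrightarrow> \<sigma> j \<in> J"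
    "\<And>j s. j \<in> I - I0 \<Longrightarrow> s \<in> J \<Longrightarrow> \<sigma> j \<le> s \<Longrightarrow> \<delta> j \<le> d j s"
    using y by (auto simp: \<delta>_def \<sigma>_def)
  obtain s1 where s1: "s1 \<in> J" "\<And>j. j \<in> I - I0 \<Longrightarrow> \<sigma> j \<le> s1"
    using max_J[of "\<sigma> ` (I - I0)"] fin \<sigma>(1) by blast
  have \<delta>s1: "\<delta> j \<le> d j s" if "j \<in> I - I0" "s \<in> J" "s1 \<le> s" for j s
    using \<sigma>(2)[of j s] s1(2)[of j] that by auto
  \<comment> \<open>With all distances bounded from below the whole state is bounded, against
    \<open>blow\<close>.\<close>
  have "I0 \<noteq> {}"
  proof
    assume e: "I0 = {}"
    obtain N where N: "\<And>n. n \<ge> N \<Longrightarrow> (\<Sum>i\<in>I. 2 / \<delta> i + C i) < (\<Sum>i\<in>I. \<bar>\<nu> i (t n)\<bar> + \<bar>\<omega> i (t n)\<bar> + \<bar>d i (t n)\<bar>)"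
      using blow[OF bdd] by blast
    obtain n1 where n1: "s1 < t n1" using s1 J_dom by blast
    define n where "n = max N n1"
    have n: "s1 \<le> t n" "n \<ge> N" using n1 strict_mono_less_eq[OF tmono, of n1 n] by (auto simp: n_def)
    have "(\<Sum>i\<in>I. \<bar>\<nu> i (t n)\<bar> + \<bar>\<omega> i (t n)\<bar> + \<bar>d i (t n)\<bar>) \<le> (\<Sum>i\<in>I. 2 / \<delta> i + C i)"
    proof (rule sum_mono)
      fix i assume i: "i \<in> I"
      have "1 / d i (t n) \<le> 1 / \<delta> i" using \<delta>s1[OF _ t_J n(1), of i] \<delta>[of i] i e by (simp add: frac_le)
      then show "\<bar>\<nu> i (t n)\<bar> + \<bar>\<omega> i (t n)\<bar> + \<bar>d i (t n)\<bar> \<le> 2 / \<delta> i + C i"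
        using nu_le[OF i t_J] om_le[OF i t_J] d_le_C[OF i t_J] d_pos[OF i t_J] by (smt (verit) add_divide_distrib)
    qed
    then show False using N[OF n(2)] by simp
  qed
  then obtain j where j: "j \<in> I0" by blast
  have jI: "j \<in> I" using j by (simp add: I0_def)
  have dj: "d j s \<le> T - s" if "j \<in> I0" "s \<in> J" for j s using that by (simp add: I0_def)
  define c0 where "c0 = E 0 * l1 0"
  have c0: "c0 > 0" using E_pos l10 by (simp add: c0_def)
  show False
  proof (cases "\<exists>k\<in>I0. k \<noteq> j")
    case True
    then obtain k where k: "k \<in> I0" "k \<noteq> j" by blast
    \<comment> \<open>Two vanishing distances bound \<open>E\<close> by a multiple of
      \<open>(T - s)^2\<close>; then \<open>E * l1 \<ge> c0\<close> integrates to the rate that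
      \<open>nolog\<close> excludes.\<close>
    define P where "P = (\<Prod>i\<in>I - {j, k}. C i)"
    have P: "P > 0" unfolding P_def by (intro prod_pos) (use C_pos in auto)
    have l1: "l1 s \<ge> c0 / P / (T - s)\<^sup>2" if s: "s \<in> J" for s
    proof -
      have "c0 \<le> E s * l1 s" using El1[OF s] by (simp add: c0_def)
      also have "\<dots> \<le> ((T - s)\<^sup>2 * P) * l1 s"
      proof (rule mult_right_mono)
        have "E s \<le> (d j s * d k s) * P" using E_le[OF s, of "{j,k}"] jI k by (simp add: P_def I0_def)
        also have "\<dots> \<le> ((T - s) * (T - s)) * P"
          by (intro mult_right_mono mult_mono) (use dj j k s d_pos[OF _ s] P JT I0_def in \<open>auto intro: less_imp_le\<close>)
        finally show "E s \<le> (T - s)\<^sup>2 * P" by (simp add: power2_eq_square)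
      qed (use l1_pos[OF s] in simp)
      finally show ?thesis using P s JT by (simp add: field_simps)
    qed
    have "l s \<ge> c0 / P / (T - s) - (c0 / P / T)" if s: "s \<in> J" for s
    proof -
      have "l 0 - c0 / P / (T - 0) \<le> l s - c0 / P / (T - s)"
      proof (rule mono_J[of 0 _ "\<lambda>s. l1 s - c0 / P / (T - s)\<^sup>2"])
        show "((\<lambda>s. l s - c0 / P / (T - s)) has_real_derivative l1 s - c0 / P / (T - s)\<^sup>2) (at s)"
          if "s \<in> J" for s
          by (rule derivative_eq_intros derivs that refl | use that JT in \<open>simp add: field_simps power2_eq_square\<close>)+
        show "0 \<le> l1 s - c0 / P / (T - s)\<^sup>2" if "s \<in> J" for s using l1[OF that] by simp
      qed (use s zero_J JT in auto)
      then show ?thesis using l0 by simp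
    qed
    then show False using nolog[of "c0 / P" 0 "c0 / P / T"] c0 P zero_J by simp
  next
    case False
    then have I0: "I0 = {j}" using j by blast
    \<comment> \<open>A single vanishing distance yields only a logarithm for \<open>l\<close>, too
      weak for \<open>nolog\<close>. It still makes \<open>l\<close> unbounded, and as the other
      \<open>\<nu>\<close> are bounded, \<open>\<nu> j\<close> becomes negative; the required rate
      is then read off from \<open>\<nu> j\<close> itself.\<close>
    define P where "P = (\<Prod>i\<in>I - {j}. C i)"
    have P: "P > 0" unfolding P_def by (intro prod_pos) (use C_pos in auto)
    have l1: "l1 s \<ge> c0 / P / (T - s)" if s: "s \<in> J" for s
    proof -
      have "c0 \<le> E s * l1 s" using El1[OF s] by (simp add: c0_def)
      also have "\<dots> \<le> ((T - s) * P) * l1 s"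
      proof (rule mult_right_mono)
        have "E s \<le> d j s * P" using E_le[OF s, of "{j}"] jI by (simp add: P_def)
        also have "\<dots> \<le> (T - s) * P"
          by (intro mult_right_mono) (use dj j s P in \<open>auto intro: less_imp_le\<close>)
        finally show "E s \<le> (T - s) * P" .
      qed (use l1_pos[OF s] in simp)
      finally show ?thesis using P s JT by (simp add: field_simps)
    qed
    define b where "b = (\<Sum>i\<in>I - {j}. 1 / \<delta> i)"
    have rest: "\<bar>3 * l s + \<nu> j s\<bar> \<le> b" if s: "s \<in> J" "s1 \<le> s" for s
    proof -
      have "3 * l s + \<nu> j s = - (\<Sum>i\<in>I - {j}. \<nu> i s)"
        unfolding leq[OF J_ge0[OF s(1)] J_dom(2)[OF s(1)]] using sum.remove[OF fin jI, of "\<lambda>i. \<nu> i s"] by simp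
      also have "\<bar>\<dots>\<bar> \<le> (\<Sum>i\<in>I - {j}. \<bar>\<nu> i s\<bar>)" by simp
      also have "\<dots> \<le> b" unfolding b_def
      proof (rule sum_mono)
        fix i assume i: "i \<in> I - {j}"
        have "1 / d i s \<le> 1 / \<delta> i" using \<delta>s1[of i s] \<delta>[of i] i I0 s by (simp add: frac_le)
        then show "\<bar>\<nu> i s\<bar> \<le> 1 / \<delta> i" using nu_le[of i s] i s by auto
      qed
      finally show ?thesis .
    qed
    have "\<exists>s2\<in>J. s1 \<le> s2 \<and> 3 * l s2 > b"
    proof (rule ccontr)
      assume "\<not> ?thesis"
      then have lb: "3 * l s \<le> b" if "s \<in> J" "s1 \<le> s" for s using that by (meson not_le)
      define a where "a = c0 / P"
      have a: "a > 0" using c0 P by (simp add: a_def)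
      have m: "l s1 + a * ln (T - s1) \<le> l s + a * ln (T - s)" if s: "s \<in> J" "s1 \<le> s" for s
      proof (rule mono_J[of s1 _ "\<lambda>s. l1 s - a / (T - s)"])
        show "((\<lambda>s. l s + a * ln (T - s)) has_real_derivative l1 s - a / (T - s)) (at s)"
          if "s \<in> J" for s
          by (rule derivative_eq_intros derivs that refl | use that JT in \<open>simp add: field_simps\<close>)+
        show "0 \<le> l1 s - a / (T - s)" if "s \<in> J" for s using l1[OF that] by (simp add: a_def)
      qed (use s s1 in auto)
      define c where "c = (b / 3 - l s1 - a * ln (T - s1)) / a"
      define s where "s = max s1 (T - exp (- c - 1))"
      have "s1 \<le> s" "s < T" using JT[of s1] s1 unfolding s_def by simp_all
      then have s: "s \<in> J" "s1 \<le> s" using JT[of s1] JT[of s] s1 by simp_all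
      have "ln (T - s) \<le> ln (exp (- c - 1))"
        by (rule ln_mono) (use s JT[of s] in \<open>simp_all add: s_def\<close>)
      then have "a * ln (T - s) \<le> a * (- c - 1)" using a by simp
      moreover have "a * c = b / 3 - l s1 - a * ln (T - s1)" using a by (simp add: c_def)
      ultimately show False using m[OF s] lb[OF s] a by (simp add: algebra_simps)
    qed
    then obtain s2 where s2: "s2 \<in> J" "s1 \<le> s2" "3 * l s2 > b" by blast
    have nuneg: "\<nu> j s < 0" if s: "s \<in> J" "s2 \<le> s" for s
      using rest[of s] l_mono[OF s2(1) s] s2 s by linarith
    have qneg: "q j s < 0" if s: "s \<in> J" "s2 \<le> s" for s
      using nuneg[OF s] d_pos[OF jI s(1)] by (simp add: q_def mult_neg_pos)
    \<comment> \<open>Once nonnegative, \<open>p j\<close> would remain so because its derivative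
      \<open>- l * q j\<close> is positive, and \<open>d j\<close> would stop decreasing instead of
      tending to 0.\<close>
    have pneg: "p j s3 < 0" if s3: "s3 \<in> J" "s2 \<le> s3" for s3
    proof (rule ccontr)
      assume "\<not> ?thesis"
      then have p0: "p j s3 \<ge> 0" by simp
      have pp: "p j s \<ge> 0" if s: "s \<in> J" "s3 \<le> s" for s
      proof -
        have "p j s3 \<le> p j s"
          by (rule mono_J[of s3 "p j" "\<lambda>s. - l s * q j s"])
            (use p_deriv jI s s3 qneg l_pos in \<open>auto simp: mult_le_0_iff not_le intro!: less_imp_le\<close>)
        then show ?thesis using p0 by simp
      qed
      have dd: "d j s3 \<le> d j s" if s: "s \<in> J" "s3 \<le> s" for s
        by (rule mono_J[of s3 "d j" "p j"]) (use d_deriv jI s s3 pp in auto)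
      define s where "s = max s3 (T - d j s3 / 2)"
      have "s3 \<le> s" "s < T" using JT[of s3] s3 d_pos[OF jI s3(1)] unfolding s_def by simp_all
      then have s: "s \<in> J" "s3 \<le> s" using JT[of s3] JT[of s] s3 by simp_all
      show False using dd[OF s] dj[OF j s(1)] d_pos[OF jI s3(1)] by (auto simp: s_def)
    qed
    \<comment> \<open>From here on \<open>q j\<close> stays below the negative number
      \<open>q j s2\<close>, so \<open>\<nu> j\<close>, the quotient of \<open>q j\<close> by
      \<open>d j \<le> T - s\<close>, lies below a negative multiple of
      \<open>1 / (T - s)\<close>.\<close>
    have qle: "q j s \<le> q j s2" if s: "s \<in> J" "s2 \<le> s" for s
    proof -
      have "- q j s2 \<le> - q j s"
      proof (rule mono_J[of s2 "\<lambda>s. - q j s" "\<lambda>s. - (l s * p j s)"])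
        show "0 \<le> - (l s * p j s)" if "s \<in> J" "s2 \<le> s" for s
          using pneg[OF that] l_pos[OF that(1)] by (simp add: mult_le_0_iff)
      qed (use s s2 q_deriv[OF jI] in \<open>auto intro: DERIV_minus\<close>)
      then show ?thesis by simp
    qed
    have "l s \<ge> - (q j s2 / 3) / (T - s) - b / 3" if s: "s \<in> J" "s2 \<le> s" for s
    proof -
      have "- q j s2 / (T - s) \<le> - q j s2 / d j s"
        by (rule divide_left_mono) (use dj[OF j s(1)] qneg[OF s2(1)] d_pos[OF jI s(1)] JT s in auto)
      also have "\<dots> \<le> - q j s / d j s"
        by (rule divide_right_mono) (use qle[OF s] d_pos[OF jI s(1)] in auto)
      also have "\<dots> = - \<nu> j s" using d_pos[OF jI s(1)] by (simp add: q_def)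
      finally have "\<nu> j s \<le> q j s2 / (T - s)" by simp
      moreover have "- (q j s2 / 3) / (T - s) = - (q j s2 / (T - s)) / 3" by simp
      ultimately show ?thesis using rest[of s] s s2 by linarith
    qed
    then show False using nolog[of "- (q j s2 / 3)" s2 "b / 3"] qneg[OF s2(1)] s2(1) by simp
  qed
qed

end

section \<open>Taylor series along a vector field\<close>

definition dirD :: "('f::euclidean_space \<Rightarrow> 'f) \<Rightarrow> ('f \<Rightarrow> real) \<Rightarrow> 'f \<Rightarrow> real"
  where "dirD e F x = FD F x (e x)"

text \<open>Formal Taylor series of \<open>F\<close> along the integral curve of \<open>e\<close>
  through \<open>x\<close>, built by iterating the derivation \<open>dirD e\<close>; neither the
  curve nor any convergence is involved.\<close>

definition tay :: "('f::euclidean_space \<Rightarrow> 'f) \<Rightarrow> 'f \<Rightarrow> ('f \<Rightarrow> real) \<Rightarrow> real fps"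
  where "tay e x F = Abs_fps (\<lambda>k. (dirD e ^^ k) F x / fact k)"

locale taylor =
  fixes W :: "'f::euclidean_space set" and e :: "'f \<Rightarrow> 'f" and x0 :: 'f
  assumes W: "open W" and e: "smooth_on W e" and x0: "x0 \<in> W"
begin

lemma dirD_smooth: "smooth_on W F \<Longrightarrow> smooth_on W (dirD e F)"
  unfolding dirD_def[abs_def] by (intro smooth_on_FD_apply W e)

lemma dirD_cong: "(\<And>x. x \<in> W \<Longrightarrow> F x = G x) \<Longrightarrow> x \<in> W \<Longrightarrow> dirD e F x = dirD e G x"
  unfolding dirD_def using FD_cong_open[OF W, of x F G] by simp

lemma dirD_pow_cong:
  "(\<And>x. x \<in> W \<Longrightarrow> F x = G x) \<Longrightarrow> x \<in> W \<Longrightarrow> (dirD e ^^ k) F x = (dirD e ^^ k) G x"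
  by (induction k arbitrary: x) (auto intro: dirD_cong)

lemma tay_cong: "(\<And>x. x \<in> W \<Longrightarrow> F x = G x) \<Longrightarrow> tay e x0 F = tay e x0 G"
  unfolding tay_def using dirD_pow_cong[of F G x0] x0 by simp

lemma tay_0: "fps_nth (tay e x0 F) 0 = F x0"
  by (simp add: tay_def)

lemma tay_deriv: "fps_deriv (tay e x0 F) = tay e x0 (dirD e F)"
  by (rule fps_ext) (simp add: tay_def funpow_swap1[symmetric] del: of_nat_Suc)

lemma dirD_arith:
  assumes "smooth_on W F" "smooth_on W G" "x \<in> W"
  shows "dirD e (\<lambda>x. F x + G x) x = dirD e F x + dirD e G x"
    "dirD e (\<lambda>x. F x * G x) x = dirD e F x * G x + F x * dirD e G x"
proof -
  note d = smooth_on_has_derivative[OF assms(1,3)] smooth_on_has_derivative[OF assms(2,3)]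
  show "dirD e (\<lambda>x. F x + G x) x = dirD e F x + dirD e G x"
    using FD_eqI[OF has_derivative_add[OF d]] by (simp add: dirD_def)
  show "dirD e (\<lambda>x. F x * G x) x = dirD e F x * G x + F x * dirD e G x"
    using FD_eqI[OF has_derivative_mult[OF d]] by (simp add: dirD_def)
qed

lemma dirD_const: "dirD e (\<lambda>x. c) x = 0"
  by (simp add: dirD_def)

lemma fps_eq_by_deriv: "fps_nth f (Suc n) = fps_nth g (Suc n)"
  if "fps_nth (fps_deriv f) n = fps_nth (fps_deriv g) n" for f g :: "real fps"
  using that by simp

lemma tay_const: "tay e x0 (\<lambda>x. c) = fps_const c"
proof (rule fps_ext)
  fix n
  have "(dirD e ^^ k) (\<lambda>x. 0) x0 = 0" for k
    using x0 by (induction k) (auto simp: funpow_swap1 dirD_const[abs_def] fun_eq_iff[symmetric]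
        simp del: funpow.simps(2) simp add: funpow_Suc_right)
  then show "fps_nth (tay e x0 (\<lambda>x. c)) n = fps_nth (fps_const c) n"
    by (cases n) (auto simp: tay_def funpow_Suc_right dirD_const[abs_def] simp del: funpow.simps(2))
qed

lemma tay_add:
  assumes "smooth_on W F" "smooth_on W G"
  shows "tay e x0 (\<lambda>x. F x + G x) = tay e x0 F + tay e x0 G"
proof -
  have "fps_nth (tay e x0 (\<lambda>x. F x + G x)) n = fps_nth (tay e x0 F + tay e x0 G) n" for n
    using assms
  proof (induction n arbitrary: F G)
    case 0
    then show ?case by (simp add: tay_0)
  next
    case (Suc n)
    have "fps_deriv (tay e x0 (\<lambda>x. F x + G x)) = tay e x0 (\<lambda>x. dirD e F x + dirD e G x)"
      unfolding tay_deriv by (rule tay_cong) (rule dirD_arith(1)[OF Suc.prems])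
    then show ?case
      using Suc.IH[OF dirD_smooth[OF Suc.prems(1)] dirD_smooth[OF Suc.prems(2)]]
      by (intro fps_eq_by_deriv) (simp add: tay_deriv del: fps_deriv_nth)
  qed
  then show ?thesis by (rule fps_ext)
qed

text \<open>A series is determined by its constant term and its derivative, and \<open>tay\<close>
  turns \<open>dirD\<close> into the formal derivative; so induction on the coefficient reduces to
  the Leibniz rule. With \<open>tay_add\<close> this makes \<open>tay\<close> a homomorphism of
  differential rings: differential equations on \<open>W\<close> become equations of power
  series.\<close>

lemma tay_mult:
  assumes "smooth_on W F" "smooth_on W G"
  shows "tay e x0 (\<lambda>x. F x * G x) = tay e x0 F * tay e x0 G"
proof -
  have "fps_nth (tay e x0 (\<lambda>x. F x * G x)) n = fps_nth (tay e x0 F * tay e x0 G) n" for n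
    using assms
  proof (induction n arbitrary: F G)
    case 0
    then show ?case by (simp add: tay_0)
  next
    case (Suc n)
    note s = dirD_smooth[OF Suc.prems(1)] dirD_smooth[OF Suc.prems(2)]
    have "fps_deriv (tay e x0 (\<lambda>x. F x * G x)) = tay e x0 (\<lambda>x. dirD e F x * G x + F x * dirD e G x)"
      unfolding tay_deriv by (rule tay_cong) (rule dirD_arith(2)[OF Suc.prems])
    also have "\<dots> = tay e x0 (\<lambda>x. dirD e F x * G x) + tay e x0 (\<lambda>x. F x * dirD e G x)"
      by (intro tay_add smooth_on_mult W Suc.prems s)
    finally show ?case
      using Suc.IH[OF s(1) Suc.prems(2)] Suc.IH[OF Suc.prems(1) s(2)]
      by (intro fps_eq_by_deriv) (simp add: tay_deriv del: fps_deriv_nth)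
  qed
  then show ?thesis by (rule fps_ext)
qed

lemma tay_cmult: "smooth_on W F \<Longrightarrow> tay e x0 (\<lambda>x. c * F x) = fps_const c * tay e x0 F"
  using tay_mult[OF smooth_on_const] tay_const by simp

lemma tay_sum:
  "(\<And>i. i \<in> I \<Longrightarrow> smooth_on W (F i)) \<Longrightarrow> tay e x0 (\<lambda>x. \<Sum>i\<in>I. F i x) = (\<Sum>i\<in>I. tay e x0 (F i))"
proof (induction I rule: infinite_finite_induct)
  case (insert i I)
  then show ?case using tay_add[of "F i" "\<lambda>x. \<Sum>i\<in>I. F i x"] smooth_on_sum[OF W, of I F] by simp
qed (use tay_const[of 0] in auto)

lemma tay_combination:
  assumes "smooth_on W A" "smooth_on W B" "smooth_on W C" "smooth_on W L" "smooth_on W D"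
  shows "tay e x0 (\<lambda>x. A x + (B x * C x + c * (L x * (L x * L x + (D x + k))))) =
    tay e x0 A + (tay e x0 B * tay e x0 C
      + fps_const c * (tay e x0 L * (tay e x0 L * tay e x0 L + (tay e x0 D + fps_const k))))"
  by (simp add: tay_add tay_mult tay_const smooth_on_add smooth_on_mult smooth_on_const W assms)

end

text \<open>
  Power series solution of the quadratic system \<open>\<nu>' = (l - \<nu>) \<omega>\<close>, \<open>\<omega>' = - \<omega>\<^sup>2 - l \<nu>\<close>,
  \<open>d' = \<omega> d\<close> with \<open>3 l = - \<Sum> \<nu>\<close>; the components \<open>0, 1, 2\<close> of a state are \<open>\<nu>, \<omega>, d\<close>.
\<close>

fun cf :: "'i set \<Rightarrow> (nat \<Rightarrow> 'i \<Rightarrow> real) \<Rightarrow> nat \<Rightarrow> nat \<Rightarrow> 'i \<Rightarrow> real" where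
  "cf I a 0 c i = a c i"
| "cf I a (Suc n) c i = (\<Sum>j\<le>n.
     if c = 0 then (- (\<Sum>k\<in>I. cf I a j 0 k) / 3 - cf I a j 0 i) * cf I a (n - j) 1 i
     else if c = 1 then - (cf I a j 1 i * cf I a (n - j) 1 i)
        - (- (\<Sum>k\<in>I. cf I a j 0 k) / 3) * cf I a (n - j) 0 i
     else cf I a j 1 i * cf I a (n - j) 2 i) / real (Suc n)"

text \<open>A geometric majorant. The products in the convolution all have the same bound, and the
  denominator \<open>Suc n\<close> cancels their number. The factor \<open>card I + 2\<close> leaves
  room for the sum over \<open>I\<close> hidden in \<open>l\<close> and for one more term.\<close>

lemma cf_bound:
  assumes a: "\<And>c i. c < 3 \<Longrightarrow> i \<in> I \<Longrightarrow> \<bar>a c i\<bar> \<le> M" and c: "c < 3" and i: "i \<in> I"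
  shows "\<bar>cf I a n c i\<bar> \<le> M * ((real (card I) + 2) * M) ^ n"
  using c i
proof (induction n arbitrary: c i rule: less_induct)
  case (less n)
  show ?case
  proof (cases n)
    case 0
    then show ?thesis using a less.prems by simp
  next
    case (Suc k)
    define q where "q = (real (card I) + 2) * M"
    have M: "M \<ge> 0" using a[OF less.prems] by linarith
    have q: "q \<ge> 0" using M by (simp add: q_def)
    have IH: "\<bar>cf I a j c i\<bar> \<le> M * q ^ j" if "j \<le> k" "c < 3" "i \<in> I" for j c i
      using less.IH[of j c i] that Suc by (simp add: q_def)
    have S: "\<bar>- (\<Sum>k\<in>I. cf I a j 0 k) / 3\<bar> \<le> real (card I) * (M * q ^ j)" if j: "j \<le> k" for j
    proof -
      have "\<bar>\<Sum>k\<in>I. cf I a j 0 k\<bar> \<le> (\<Sum>k\<in>I. \<bar>cf I a j 0 k\<bar>)" by (rule sum_abs)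
      also have "\<dots> \<le> (\<Sum>k\<in>I. M * q ^ j)" by (intro sum_mono IH j) auto
      finally show ?thesis using M q by simp
    qed
    have P: "\<bar>x * y\<bar> \<le> (r * (M * q ^ j)) * (M * q ^ (k - j))"
      if "\<bar>x\<bar> \<le> r * (M * q ^ j)" "\<bar>y\<bar> \<le> M * q ^ (k - j)" for x y r j
      unfolding abs_mult by (rule mult_mono) (use that M q in auto)
    define T where "T j = (if c = 0 then (- (\<Sum>k\<in>I. cf I a j 0 k) / 3 - cf I a j 0 i) * cf I a (k - j) 1 i
     else if c = 1 then - (cf I a j 1 i * cf I a (k - j) 1 i)
        - (- (\<Sum>k\<in>I. cf I a j 0 k) / 3) * cf I a (k - j) 0 i
     else cf I a j 1 i * cf I a (k - j) 2 i)" for j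
    have T: "\<bar>T j\<bar> \<le> M * q ^ Suc k" if j: "j \<le> k" for j
    proof -
      have r: "((real (card I) + 1) * (M * q ^ j)) * (M * q ^ (k - j)) \<le> M * q ^ Suc k"
        "(1 * (M * q ^ j)) * (M * q ^ (k - j)) \<le> M * q ^ Suc k"
      proof -
        have e: "(r * (M * q ^ j)) * (M * q ^ (k - j)) = (r * M) * (M * q ^ k)" for r
        proof -
          have "q ^ j * q ^ (k - j) = q ^ k" using j by (simp add: power_add[symmetric])
          then show ?thesis by (simp add: ac_simps)
        qed
        have "(r * M) * (M * q ^ k) \<le> q * (M * q ^ k)" if "r \<le> real (card I) + 2" for r
          using that M q by (intro mult_right_mono) (auto simp: q_def intro: mult_right_mono)
        from this[of "real (card I) + 1"] this[of 1]
        show "((real (card I) + 1) * (M * q ^ j)) * (M * q ^ (k - j)) \<le> M * q ^ Suc k"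
          "(1 * (M * q ^ j)) * (M * q ^ (k - j)) \<le> M * q ^ Suc k"
          unfolding e by (simp_all add: ac_simps)
      qed
      consider "c = 0" | "c = 1" | "c = 2" using less.prems by linarith
      then show ?thesis
      proof cases
        case 1
        have "\<bar>- (\<Sum>k\<in>I. cf I a j 0 k) / 3 - cf I a j 0 i\<bar> \<le> (real (card I) + 1) * (M * q ^ j)"
          using S[OF j] IH[OF j, of 0 i] less.prems by (simp add: algebra_simps)
        from P[OF this IH[of "k - j" 1 i]] show ?thesis
          using 1 r(1) less.prems by (auto simp: T_def)
      next
        case 2
        have "\<bar>cf I a j 1 i * cf I a (k - j) 1 i\<bar> \<le> (1 * (M * q ^ j)) * (M * q ^ (k - j))"
          by (rule P) (use IH j less.prems in auto)
        moreover have "\<bar>(- (\<Sum>k\<in>I. cf I a j 0 k) / 3) * cf I a (k - j) 0 i\<bar>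
            \<le> (real (card I) * (M * q ^ j)) * (M * q ^ (k - j))"
          by (rule P[OF S[OF j]]) (use IH less.prems in auto)
        moreover have "T j = - (cf I a j 1 i * cf I a (k - j) 1 i)
            - (- (\<Sum>k\<in>I. cf I a j 0 k) / 3) * cf I a (k - j) 0 i"
          using 2 by (simp add: T_def)
        moreover have "((real (card I) + 1) * (M * q ^ j)) * (M * q ^ (k - j))
            = (1 * (M * q ^ j)) * (M * q ^ (k - j)) + (real (card I) * (M * q ^ j)) * (M * q ^ (k - j))"
          by (simp add: algebra_simps)
        ultimately have "\<bar>T j\<bar> \<le> ((real (card I) + 1) * (M * q ^ j)) * (M * q ^ (k - j))"
          by linarith
        then show ?thesis using r(1) by linarith
      next
        case 3
        have "\<bar>cf I a j 1 i * cf I a (k - j) 2 i\<bar> \<le> (1 * (M * q ^ j)) * (M * q ^ (k - j))"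
          by (rule P) (use IH j less.prems in auto)
        then show ?thesis using 3 r(2) by (simp add: T_def)
      qed
    qed
    have "\<bar>cf I a n c i\<bar> = \<bar>\<Sum>j\<le>k. T j\<bar> / real (Suc k)"
      unfolding Suc cf.simps T_def by simp
    also have "\<bar>\<Sum>j\<le>k. T j\<bar> \<le> (\<Sum>j\<le>k. M * q ^ Suc k)"
      by (rule order_trans[OF sum_abs]) (intro sum_mono T, auto)
    finally show ?thesis by (simp add: Suc q_def divide_right_mono)
  qed
qed

definition sol :: "'i set \<Rightarrow> (nat \<Rightarrow> 'i \<Rightarrow> real) \<Rightarrow> nat \<Rightarrow> 'i \<Rightarrow> real fps"
  where "sol I a c i = Abs_fps (\<lambda>n. cf I a n c i)"

definition lam :: "'i set \<Rightarrow> ('i \<Rightarrow> real fps) \<Rightarrow> real fps"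
  where "lam I N = fps_const (- 1 / 3) * (\<Sum>i\<in>I. N i)"

lemma sol_0: "fps_nth (sol I a c i) 0 = a c i"
  by (simp add: sol_def)

lemma lam_nth: "fps_nth (lam I N) n = - (\<Sum>i\<in>I. fps_nth (N i) n) / 3"
  by (simp add: lam_def fps_sum_nth)

lemma sol_deriv:
  "fps_deriv (sol I a 0 i) = (lam I (sol I a 0) - sol I a 0 i) * sol I a 1 i"
  "fps_deriv (sol I a 1 i) = - (sol I a 1 i * sol I a 1 i) - lam I (sol I a 0) * sol I a 0 i"
  "fps_deriv (sol I a 2 i) = sol I a 1 i * sol I a 2 i"
proof -
  have *: "real (Suc n) * (x / real (Suc n)) = x" for n x by simp
  show "fps_deriv (sol I a 0 i) = (lam I (sol I a 0) - sol I a 0 i) * sol I a 1 i"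
    by (rule fps_ext, simp only: fps_deriv_nth Suc_eq_plus1[symmetric])
      (simp add: sol_def lam_nth fps_mult_nth atLeast0AtMost del: of_nat_Suc)
  show "fps_deriv (sol I a 1 i) = - (sol I a 1 i * sol I a 1 i) - lam I (sol I a 0) * sol I a 0 i"
    by (rule fps_ext, simp only: fps_deriv_nth Suc_eq_plus1[symmetric])
      (simp add: sol_def lam_nth fps_mult_nth atLeast0AtMost sum_negf[symmetric] sum_subtractf[symmetric] del: of_nat_Suc)
  show "fps_deriv (sol I a 2 i) = sol I a 1 i * sol I a 2 i"
    by (rule fps_ext, simp only: fps_deriv_nth Suc_eq_plus1[symmetric])
      (simp add: sol_def lam_nth fps_mult_nth atLeast0AtMost del: of_nat_Suc)
qed

text \<open>Components 0 and 1 form a closed system, and its equations give coefficient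
  \<open>n + 1\<close> from the coefficients up to \<open>n\<close>.\<close>

lemma sol_unique:
  assumes N: "\<And>i. i \<in> I \<Longrightarrow> fps_deriv (N i) = (lam I N - N i) * Om i"
    and Om: "\<And>i. i \<in> I \<Longrightarrow> fps_deriv (Om i) = - (Om i * Om i) - lam I N * N i"
    and 0: "\<And>i. i \<in> I \<Longrightarrow> fps_nth (N i) 0 = a 0 i" "\<And>i. i \<in> I \<Longrightarrow> fps_nth (Om i) 0 = a 1 i"
    and i: "i \<in> I"
  shows "N i = sol I a 0 i" "Om i = sol I a 1 i"
proof -
  have "\<forall>i\<in>I. fps_nth (N i) n = fps_nth (sol I a 0 i) n \<and> fps_nth (Om i) n = fps_nth (sol I a 1 i) n" for n
  proof (induction n rule: less_induct)
    case (less n)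
    show ?case
    proof (cases n)
      case 0
      then show ?thesis using assms by (simp add: sol_0)
    next
      case (Suc k)
      have IH: "fps_nth (N i) j = fps_nth (sol I a 0 i) j" "fps_nth (Om i) j = fps_nth (sol I a 1 i) j"
        if "j \<le> k" "i \<in> I" for i j using less.IH[of j] that Suc by auto
      then have L: "fps_nth (lam I N) j = fps_nth (lam I (sol I a 0)) j" if "j \<le> k" for j
        unfolding lam_nth using that by simp
      have "fps_nth (fps_deriv (N i)) k = fps_nth (fps_deriv (sol I a 0 i)) k"
        "fps_nth (fps_deriv (Om i)) k = fps_nth (fps_deriv (sol I a 1 i)) k" if i: "i \<in> I" for i
        unfolding N[OF i] Om[OF i] sol_deriv using IH L i
        by (simp_all add: fps_mult_nth)
      then show ?thesis using Suc by auto
    qed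
  qed
  then show "N i = sol I a 0 i" "Om i = sol I a 1 i" using i by (auto intro: fps_ext)
qed

text \<open>Defect of the second order equation for \<open>l = lam I N\<close>. The quadratic system
  determines \<open>l\<close> already, so the vanishing of this series is a constraint on the
  initial values.\<close>

definition GG :: "'i set \<Rightarrow> real \<Rightarrow> ('i \<Rightarrow> real fps) \<Rightarrow> ('i \<Rightarrow> real fps) \<Rightarrow> real fps"
  where "GG I K N Om = fps_deriv (fps_deriv (lam I N)) + (\<Sum>i\<in>I. Om i) * fps_deriv (lam I N)
    - lam I N * (lam I N * lam I N + (\<Sum>i\<in>I. N i * N i) + fps_const K)"

definition flat :: "'i set \<Rightarrow> real \<Rightarrow> (nat \<Rightarrow> 'i \<Rightarrow> real) \<Rightarrow> bool"
  where "flat I K a \<longleftrightarrow> GG I K (sol I a 0) (sol I a 1) = 0"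

section \<open>Convergence of the series solution and its evaluation\<close>

lemma conv_radius_deriv': "ereal r \<le> fps_conv_radius (f :: real fps) \<Longrightarrow> ereal r \<le> fps_conv_radius (fps_deriv f)"
  using fps_conv_radius_deriv[of f] by (rule order_trans[rotated])

lemma conv_radius_mult': "ereal r \<le> fps_conv_radius (f :: real fps) \<Longrightarrow> ereal r \<le> fps_conv_radius g
    \<Longrightarrow> ereal r \<le> fps_conv_radius (f * g)"
  by (rule order_trans[OF _ fps_conv_radius_mult]) simp

lemma conv_radius_add': "ereal r \<le> fps_conv_radius (f :: real fps) \<Longrightarrow> ereal r \<le> fps_conv_radius g
    \<Longrightarrow> ereal r \<le> fps_conv_radius (f + g)"
  by (rule order_trans[OF _ fps_conv_radius_add]) simp

lemma conv_radius_sum': "(\<And>i. i \<in> I \<Longrightarrow> ereal r \<le> fps_conv_radius (f i :: real fps))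
    \<Longrightarrow> ereal r \<le> fps_conv_radius (\<Sum>i\<in>I. f i)"
  by (induction I rule: infinite_finite_induct) (auto intro: conv_radius_add')

lemma eval_fps_sum:
  assumes "\<And>i. i \<in> I \<Longrightarrow> ereal r \<le> fps_conv_radius (f i)" "\<bar>z\<bar> < r"
  shows "eval_fps (\<Sum>i\<in>I. f i) (z::real) = (\<Sum>i\<in>I. eval_fps (f i) z)"
  using assms(1)
proof (induction I rule: infinite_finite_induct)
  case (insert i I)
  have "ereal \<bar>z\<bar> < ereal r" using assms(2) by simp
  then have "ereal (norm z) < fps_conv_radius (f i)" "ereal (norm z) < fps_conv_radius (\<Sum>i\<in>I. f i)"
    using order.strict_trans2[of "ereal \<bar>z\<bar>" "ereal r"] insert.prems conv_radius_sum'[of I r f] by simp_all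
  then show ?case using insert by (simp add: eval_fps_add)
qed auto

lemma eval_fps_real_derivative:
  assumes "ereal r \<le> fps_conv_radius f" "\<bar>z\<bar> < r"
  shows "(eval_fps f has_real_derivative eval_fps (fps_deriv f) z) (at z)"
proof -
  have "ereal \<bar>z\<bar> < ereal r" using assms(2) by simp
  then have "ereal (norm z) < fps_conv_radius f" using order.strict_trans2[of "ereal \<bar>z\<bar>" "ereal r"] assms(1) by simp
  then show ?thesis by (rule has_field_derivative_eval_fps)
qed

lemma eval_fps_smooth:
  assumes "ereal r \<le> fps_conv_radius f"
  shows "smooth_on {-r<..<r} (eval_fps (f :: real fps))"
proof -
  have "Ck_on k {-r<..<r} (eval_fps f)" if "ereal r \<le> fps_conv_radius f" for k f
    using that
  proof (induction k arbitrary: f)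
    case 0
    then have "isCont (eval_fps f) x" if "x \<in> {-r<..<r}" for x
      using DERIV_isCont[OF eval_fps_real_derivative[OF 0, of x]] that by (simp add: abs_less_iff)
    then show ?case by (simp add: continuous_at_imp_continuous_on)
  next
    case (Suc k)
    have d: "(eval_fps f has_derivative (\<lambda>v. v * eval_fps (fps_deriv f) x)) (at x)" if "x \<in> {-r<..<r}" for x
    proof -
      have "\<bar>x\<bar> < r" using that by (simp add: abs_less_iff)
      then have "(eval_fps f has_derivative (*) (eval_fps (fps_deriv f) x)) (at x)"
        using eval_fps_real_derivative[OF Suc.prems] by (simp add: has_field_derivative_def)
      moreover have "(\<lambda>v. v * c) = (*) c" for c :: real by (simp add: fun_eq_iff)
      ultimately show ?thesis by simp
    qed
    have "Ck_on k {-r<..<r} (\<lambda>x. FD (eval_fps f) x v)" for v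
    proof (rule Ck_on_cong[OF open_greaterThanLessThan])
      show "Ck_on k {-r<..<r} (\<lambda>x. v * eval_fps (fps_deriv f) x)"
        by (intro Ck_on_bilinear[OF bounded_bilinear_mult] Ck_on_const Suc.IH conv_radius_deriv' Suc.prems) auto
    qed (simp add: FD_eqI[OF d])
    then show ?case using d unfolding Ck_on.simps differentiable_def by blast
  qed
  then show ?thesis using assms by (simp add: smooth_on_def)
qed

definition bnd :: "'i set \<Rightarrow> (nat \<Rightarrow> 'i \<Rightarrow> real) \<Rightarrow> real"
  where "bnd I a = 1 + (\<Sum>i\<in>I. \<bar>a 0 i\<bar> + \<bar>a 1 i\<bar> + \<bar>a 2 i\<bar>)"

text \<open>A radius of convergence that depends only on the size of the state. While the state
  stays bounded the solution can be continued by steps of a definite length; this is the origin of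
  the blow-up alternative.\<close>

definition rad :: "'i set \<Rightarrow> (nat \<Rightarrow> 'i \<Rightarrow> real) \<Rightarrow> real"
  where "rad I a = 1 / ((real (card I) + 2) * bnd I a)"

lemma bnd_pos: "bnd I a > 0"
  unfolding bnd_def by (rule add_pos_nonneg) (auto intro: sum_nonneg)

lemma rad_pos: "rad I a > 0"
  unfolding rad_def using bnd_pos[of I a] by (simp add: add_nonneg_pos)

lemma bnd_ge:
  assumes "finite I" "c < 3" "i \<in> I"
  shows "\<bar>a c i\<bar> \<le> bnd I a"
proof -
  have "c = 0 \<or> c = 1 \<or> c = 2" using assms(2) by auto
  then have "\<bar>a c i\<bar> \<le> \<bar>a 0 i\<bar> + \<bar>a 1 i\<bar> + \<bar>a 2 i\<bar>" by auto
  also have "\<dots> \<le> (\<Sum>i\<in>I. \<bar>a 0 i\<bar> + \<bar>a 1 i\<bar> + \<bar>a 2 i\<bar>)"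
    by (rule member_le_sum) (use assms in auto)
  finally show ?thesis by (simp add: bnd_def)
qed

lemma sol_conv_radius:
  assumes "finite I" "c < 3" "i \<in> I"
  shows "ereal (rad I a) \<le> fps_conv_radius (sol I a c i)"
  unfolding fps_conv_radius_def
proof (rule conv_radius_geI_ex)
  fix r :: real assume r: "0 < r" "ereal r < ereal (rad I a)"
  define q where "q = (real (card I) + 2) * bnd I a"
  have q: "q > 0" unfolding q_def using bnd_pos[of I a] by (simp add: add_nonneg_pos)
  have "r < 1 / q" using r by (simp add: rad_def q_def)
  then have "r * q < 1" using q by (simp only: pos_less_divide_eq)
  have "summable (\<lambda>n. fps_nth (sol I a c i) n * r ^ n)"
  proof (rule summable_comparison_test')
    show "summable (\<lambda>n. bnd I a * (q * r) ^ n)"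
      by (intro summable_mult summable_geometric) (use \<open>r * q < 1\<close> r q in \<open>auto simp: mult.commute abs_mult\<close>)
    show "norm (fps_nth (sol I a c i) n * r ^ n) \<le> bnd I a * (q * r) ^ n" for n
    proof -
      have "\<bar>cf I a n c i\<bar> \<le> bnd I a * q ^ n"
        unfolding q_def by (rule cf_bound[OF _ assms(2,3)]) (rule bnd_ge[OF assms(1)])
      then have "\<bar>cf I a n c i\<bar> * r ^ n \<le> (bnd I a * q ^ n) * r ^ n"
        using r by (intro mult_right_mono) auto
      then show ?thesis using r by (simp add: sol_def abs_mult power_mult_distrib mult.assoc)
    qed
  qed
  then show "\<exists>z. norm z = r \<and> summable (\<lambda>n. fps_nth (sol I a c i) n * z ^ n)"
    using r by (intro exI[of _ r]) auto
qed

definition pc :: "'i set \<Rightarrow> (nat \<Rightarrow> 'i \<Rightarrow> real) \<Rightarrow> real \<Rightarrow> nat \<Rightarrow> 'i \<Rightarrow> real"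
  where "pc I a s c i = eval_fps (sol I a c i) s"

definition ell :: "'i set \<Rightarrow> (nat \<Rightarrow> 'i \<Rightarrow> real) \<Rightarrow> real"
  where "ell I a = - (\<Sum>i\<in>I. a 0 i) / 3"

definition rhs :: "'i set \<Rightarrow> (nat \<Rightarrow> 'i \<Rightarrow> real) \<Rightarrow> nat \<Rightarrow> 'i \<Rightarrow> real"
  where "rhs I a c i = (if c = 0 then (ell I a - a 0 i) * a 1 i
    else if c = 1 then - (a 1 i)\<^sup>2 - ell I a * a 0 i else a 1 i * a 2 i)"

lemma pc_0: "pc I a 0 c i = a c i"
  by (simp add: pc_def eval_fps_at_0 sol_0)

context
  fixes I :: "'i set"
  assumes fin: "finite I"
begin

lemma lam_conv_radius: "ereal (rad I a) \<le> fps_conv_radius (lam I (sol I a 0))"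
  unfolding lam_def
  by (intro conv_radius_mult' conv_radius_sum' sol_conv_radius fin) auto

lemma eval_hom:
  assumes "ereal r \<le> fps_conv_radius f" "ereal r \<le> fps_conv_radius g" "\<bar>z\<bar> < r"
  shows "eval_fps (f * g) (z::real) = eval_fps f z * eval_fps g z"
    "eval_fps (f + g) z = eval_fps f z + eval_fps g z"
    "eval_fps (f - g) z = eval_fps f z - eval_fps g z"
proof -
  have "ereal \<bar>z\<bar> < ereal r" using assms by simp
  then have "ereal (norm z) < fps_conv_radius f" "ereal (norm z) < fps_conv_radius g"
    using order.strict_trans2[of "ereal \<bar>z\<bar>" "ereal r"] assms by simp_all
  then show "eval_fps (f * g) (z::real) = eval_fps f z * eval_fps g z"
    "eval_fps (f + g) z = eval_fps f z + eval_fps g z"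
    "eval_fps (f - g) z = eval_fps f z - eval_fps g z"
    by (simp_all add: eval_fps_mult eval_fps_add eval_fps_diff)
qed

lemma eval_lam: "\<bar>s\<bar> < rad I a \<Longrightarrow> eval_fps (lam I (sol I a 0)) s = ell I (pc I a s)"
  unfolding lam_def
  by (subst eval_hom(1)[of "rad I a"])
    (auto intro!: conv_radius_sum' sol_conv_radius fin simp: eval_fps_sum[of _ "rad I a"] pc_def ell_def
      sol_conv_radius fin)

lemma conv_radius_diff': "ereal r \<le> fps_conv_radius f \<Longrightarrow> ereal r \<le> fps_conv_radius g
    \<Longrightarrow> ereal r \<le> fps_conv_radius (f - g :: real fps)"
  by (rule order_trans[OF _ fps_conv_radius_diff]) simp

lemma pc_deriv:
  assumes s: "\<bar>s\<bar> < rad I a" and i: "i \<in> I" and c: "c < 3"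
  shows "((\<lambda>s. pc I a s c i) has_real_derivative rhs I (pc I a s) c i) (at s)"
proof -
  note R = sol_conv_radius[OF fin _ i] lam_conv_radius conv_radius_diff' conv_radius_mult'
  have "eval_fps (fps_deriv (sol I a c i)) s = rhs I (pc I a s) c i"
  proof -
    have "c = 0 \<or> c = 1 \<or> c = 2" using c by auto
    moreover have "eval_fps (fps_deriv (sol I a 0 i)) s = rhs I (pc I a s) 0 i"
      unfolding sol_deriv rhs_def using s
      by (simp add: eval_hom[of "rad I a"] R eval_lam) (simp add: pc_def)
    moreover have "eval_fps (fps_deriv (sol I a 1 i)) s = rhs I (pc I a s) 1 i"
    proof -
      have "fps_deriv (sol I a 1 i) = fps_const 0 - sol I a 1 i * sol I a 1 i - lam I (sol I a 0) * sol I a 0 i"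
        unfolding sol_deriv by simp
      then show ?thesis unfolding rhs_def using s
        by (simp add: eval_hom[of "rad I a"] R eval_lam eval_hom(3)[of "rad I a" "fps_const 0"] del: fps_const_0_eq_0)
          (simp add: pc_def power2_eq_square)
    qed
    moreover have "eval_fps (fps_deriv (sol I a 2 i)) s = rhs I (pc I a s) 2 i"
      unfolding sol_deriv rhs_def using s
      by (simp add: eval_hom[of "rad I a"] R) (simp add: pc_def)
    ultimately show ?thesis by auto
  qed
  then show ?thesis
    using eval_fps_real_derivative[OF sol_conv_radius[OF fin c i] s] by (simp add: pc_def[abs_def])
qed

lemma eval_GG:
  assumes s: "\<bar>s\<bar> < rad I a"
  shows "eval_fps (GG I K (sol I a 0) (sol I a 1)) s =
    eval_fps (fps_deriv (fps_deriv (lam I (sol I a 0)))) s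
    + (\<Sum>i\<in>I. pc I a s 1 i) * eval_fps (fps_deriv (lam I (sol I a 0))) s
    - ell I (pc I a s) * ((ell I (pc I a s))\<^sup>2 + (\<Sum>i\<in>I. (pc I a s 0 i)\<^sup>2) + K)"
proof -
  note R = sol_conv_radius[OF fin] lam_conv_radius conv_radius_diff' conv_radius_mult' conv_radius_add'
    conv_radius_deriv' conv_radius_sum'
  show ?thesis
    unfolding GG_def using s
    by (simp add: eval_hom[of "rad I a"] eval_fps_sum[of _ "rad I a"] R eval_lam power2_eq_square)
      (simp add: pc_def)
qed

text \<open>By uniqueness the Taylor series of the solution at time \<open>t\<close> is the series
  solution with the state at \<open>t\<close> as initial value. Its defect is then the Taylor series
  at \<open>t\<close> of a function that vanishes on an interval.\<close>

lemma flat_pc: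
  assumes flat: "flat I K a" and t: "\<bar>t\<bar> < rad I a"
  shows "flat I K (pc I a t)"
proof -
  define r where "r = rad I a"
  define W where "W = {-r<..<r}"
  \<comment> \<open>The Taylor calculus on the real line: along the constant field 1 the derivation
    is the ordinary derivative.\<close>
  interpret taylor W "\<lambda>_. 1" t
    by unfold_locales (use t in \<open>auto simp: W_def r_def abs_less_iff smooth_on_const\<close>)
  have Wr: "\<bar>s\<bar> < rad I a" if "s \<in> W" for s using that by (auto simp: W_def r_def abs_less_iff)
  define y where "y c i s = pc I a s c i" for c i s
  define L where "L s = ell I (pc I a s)" for s
  have ys: "smooth_on W (y c i)" if "c < 3" "i \<in> I" for c i
    unfolding y_def pc_def W_def r_def by (rule eval_fps_smooth[OF sol_conv_radius[OF fin that]])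
  have Leval: "L s = eval_fps (lam I (sol I a 0)) s" if "s \<in> W" for s
    using eval_lam[OF Wr[OF that]] by (simp add: L_def)
  have Ls: "smooth_on W L"
    by (rule smooth_on_cong[OF W Leval[symmetric]]) (simp_all add: W_def r_def eval_fps_smooth lam_conv_radius)
  have dir: "dirD (\<lambda>_. 1) F s = D" if "(F has_real_derivative D) (at s)" for F s D
    unfolding dirD_def using FD_eqI[of F "(*) D" s] that by (simp add: has_field_derivative_def)
  have dy: "dirD (\<lambda>_. 1) (y c i) s = rhs I (pc I a s) c i" if "s \<in> W" "c < 3" "i \<in> I" for c i s
    unfolding y_def by (rule dir) (rule pc_deriv[OF Wr[OF that(1)] that(3,2)])
  define T where "T c i = tay (\<lambda>_. 1) t (y c i)" for c i
  have TL: "tay (\<lambda>_. 1) t L = lam I (T 0)"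
  proof -
    have "tay (\<lambda>_. 1) t L = tay (\<lambda>_. 1) t (\<lambda>s. - (1 / 3) * (\<Sum>i\<in>I. y 0 i s))"
      by (simp add: L_def[abs_def] ell_def y_def[abs_def])
    also have "\<dots> = fps_const (- (1 / 3)) * (\<Sum>i\<in>I. tay (\<lambda>_. 1) t (y 0 i))"
      using tay_cmult[of "\<lambda>s. \<Sum>i\<in>I. y 0 i s" "- (1 / 3)"] tay_sum[of I "y 0"] smooth_on_sum[OF W, of I "y 0"] ys
      by simp
    finally show ?thesis by (simp add: lam_def T_def)
  qed
  have T0: "fps_deriv (T 0 i) = (lam I (T 0) - T 0 i) * T 1 i" if i: "i \<in> I" for i
  proof -
    have "fps_deriv (T 0 i) = tay (\<lambda>_. 1) t (\<lambda>s. L s * y 1 i s + (- 1) * (y 0 i s * y 1 i s))"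
      unfolding T_def tay_deriv
      by (rule tay_cong) (simp add: dy i rhs_def L_def y_def algebra_simps)
    also have "\<dots> = lam I (T 0) * T 1 i + fps_const (- 1) * (T 0 i * T 1 i)"
      unfolding TL[symmetric] T_def
      by (subst tay_add tay_mult tay_cmult | intro smooth_on_mult smooth_on_const Ls ys W i | simp)+
    finally show ?thesis by (simp add: algebra_simps flip: fps_const_neg)
  qed
  have T1: "fps_deriv (T 1 i) = - (T 1 i * T 1 i) - lam I (T 0) * T 0 i" if i: "i \<in> I" for i
  proof -
    have "fps_deriv (T 1 i) = tay (\<lambda>_. 1) t (\<lambda>s. (- 1) * (y 1 i s * y 1 i s) + (- 1) * (L s * y 0 i s))"
      unfolding T_def tay_deriv
      by (rule tay_cong) (simp add: dy i rhs_def L_def y_def algebra_simps power2_eq_square)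
    also have "\<dots> = fps_const (- 1) * (T 1 i * T 1 i) + fps_const (- 1) * (lam I (T 0) * T 0 i)"
      unfolding TL[symmetric] T_def
      by (subst tay_add tay_mult tay_cmult | intro smooth_on_mult smooth_on_const Ls ys W i | simp)+
    finally show ?thesis by (simp flip: fps_const_neg)
  qed
  have Teq: "T 0 i = sol I (pc I a t) 0 i" "T 1 i = sol I (pc I a t) 1 i" if "i \<in> I" for i
    using sol_unique[of I "T 0" "T 1" "pc I a t", OF T0 T1 _ _ that]
    by (simp_all add: T_def tay_0 y_def)
  have L1: "dirD (\<lambda>_. 1) L s = eval_fps (fps_deriv (lam I (sol I a 0))) s" if "s \<in> W" for s
    using dirD_cong[OF Leval that] dir[OF eval_fps_real_derivative[OF lam_conv_radius Wr[OF that]]] by simp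
  have L2: "dirD (\<lambda>_. 1) (dirD (\<lambda>_. 1) L) s = eval_fps (fps_deriv (fps_deriv (lam I (sol I a 0)))) s"
    if "s \<in> W" for s
    using dirD_cong[OF L1 that] dir[OF eval_fps_real_derivative[OF conv_radius_deriv'[OF lam_conv_radius] Wr[OF that]]] by simp
  have "GG I K (T 0) (T 1) = tay (\<lambda>_. 1) t (\<lambda>s. dirD (\<lambda>_. 1) (dirD (\<lambda>_. 1) L) s
      + ((\<Sum>i\<in>I. y 1 i s) * dirD (\<lambda>_. 1) L s
      + (- 1) * (L s * (L s * L s + ((\<Sum>i\<in>I. y 0 i s * y 0 i s) + K)))))"
  proof -
    have yy: "tay (\<lambda>_. 1) t (\<lambda>s. \<Sum>i\<in>I. y 1 i s) = (\<Sum>i\<in>I. T 1 i)"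
      "tay (\<lambda>_. 1) t (\<lambda>s. \<Sum>i\<in>I. y 0 i s * y 0 i s) = (\<Sum>i\<in>I. T 0 i * T 0 i)"
      by (simp_all add: tay_sum tay_mult smooth_on_mult W ys T_def)
    have "tay (\<lambda>_. 1) t (\<lambda>s. dirD (\<lambda>_. 1) (dirD (\<lambda>_. 1) L) s
      + ((\<Sum>i\<in>I. y 1 i s) * dirD (\<lambda>_. 1) L s
      + (- 1) * (L s * (L s * L s + ((\<Sum>i\<in>I. y 0 i s * y 0 i s) + K)))))
     = tay (\<lambda>_. 1) t (dirD (\<lambda>_. 1) (dirD (\<lambda>_. 1) L)) + ((\<Sum>i\<in>I. T 1 i) * tay (\<lambda>_. 1) t (dirD (\<lambda>_. 1) L)
      + fps_const (- 1) * (tay (\<lambda>_. 1) t L * (tay (\<lambda>_. 1) t L * tay (\<lambda>_. 1) t L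
      + ((\<Sum>i\<in>I. T 0 i * T 0 i) + fps_const K))))"
      unfolding yy[symmetric]
      by (rule tay_combination) (auto intro!: smooth_on_sum smooth_on_mult dirD_smooth Ls ys W)
    then show ?thesis
      unfolding GG_def TL[symmetric] tay_deriv by (simp add: algebra_simps flip: fps_const_neg)
  qed
  also have "\<dots> = tay (\<lambda>_. 1) t (\<lambda>s. 0)"
  proof (rule tay_cong)
    fix s assume s: "s \<in> W"
    have "eval_fps (GG I K (sol I a 0) (sol I a 1)) s = 0" using flat by (simp add: flat_def)
    then show "dirD (\<lambda>_. 1) (dirD (\<lambda>_. 1) L) s
      + ((\<Sum>i\<in>I. y 1 i s) * dirD (\<lambda>_. 1) L s
      + (- 1) * (L s * (L s * L s + ((\<Sum>i\<in>I. y 0 i s * y 0 i s) + K)))) = 0"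
      unfolding eval_GG[OF Wr[OF s]] using L1[OF s] L2[OF s]
      by (simp add: L_def y_def power2_eq_square algebra_simps)
  qed
  finally have "GG I K (T 0) (T 1) = 0" by (simp add: tay_const)
  moreover have "lam I (T 0) = lam I (sol I (pc I a t) 0)" by (simp add: lam_def Teq)
  moreover have "sum (T 1) I = sum (sol I (pc I a t) 1) I" by (rule sum.cong) (simp_all only: Teq)
  ultimately show ?thesis by (simp add: flat_def GG_def Teq)
qed

end

section \<open>Power series solutions of the planar system\<close>

text \<open>Analytic continuation. A step of half the guaranteed radius puts each new centre well
  inside the interval of convergence of the preceding piece.\<close>

primrec st :: "'i set \<Rightarrow> (nat \<Rightarrow> 'i \<Rightarrow> real) \<Rightarrow> nat \<Rightarrow> nat \<Rightarrow> 'i \<Rightarrow> real" where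
  "st I a 0 = a"
| "st I a (Suc n) = pc I (st I a n) (rad I (st I a n) / 2)"

primrec tm :: "'i set \<Rightarrow> (nat \<Rightarrow> 'i \<Rightarrow> real) \<Rightarrow> nat \<Rightarrow> real" where
  "tm I a 0 = 0"
| "tm I a (Suc n) = tm I a n + rad I (st I a n) / 2"

text \<open>At negative times the least index is 0, so the first piece also provides the margin to
  the left of time 0.\<close>

definition glob :: "'i set \<Rightarrow> (nat \<Rightarrow> 'i \<Rightarrow> real) \<Rightarrow> real \<Rightarrow> nat \<Rightarrow> 'i \<Rightarrow> real"
  where "glob I a \<tau> = (let n = (LEAST n. \<tau> < tm I a (Suc n)) in pc I (st I a n) (\<tau> - tm I a n))"

lemma tm_mono: "strict_mono (tm I a)"
  unfolding strict_mono_Suc_iff by (simp add: rad_pos)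

lemma glob_eq:
  assumes "\<tau> < tm I a (Suc n)" "n = 0 \<or> tm I a n \<le> \<tau>"
  shows "glob I a \<tau> = pc I (st I a n) (\<tau> - tm I a n)"
proof -
  have "(LEAST n. \<tau> < tm I a (Suc n)) = n"
  proof (rule Least_equality)
    show "\<tau> < tm I a (Suc n)" by (rule assms(1))
    fix m assume m: "\<tau> < tm I a (Suc m)"
    show "n \<le> m"
    proof (rule ccontr)
      assume "\<not> n \<le> m"
      then have "tm I a (Suc m) \<le> tm I a n" using strict_mono_less_eq[OF tm_mono, of I a "Suc m" n] by simp
      then show False using m assms(2) \<open>\<not> n \<le> m\<close> by auto
    qed
  qed
  then show ?thesis by (simp only: glob_def Let_def)
qed

lemma has_real_derivative_glue:
  assumes "(f has_real_derivative D) (at x)" "(g has_real_derivative D) (at x)" "f x = g x"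
  shows "((\<lambda>s. if s < x then f s else g s) has_real_derivative D) (at x)"
proof -
  have "((\<lambda>y. if y < x then (f y - f x) / (y - x) else (g y - g x) / (y - x)) \<longlongrightarrow> D) (at x)"
    using assms(1,2) unfolding has_field_derivative_iff
    by (intro filterlim_If) (auto intro: tendsto_mono[OF inf_le1])
  moreover have "(\<lambda>y. if y < x then (f y - f x) / (y - x) else (g y - g x) / (y - x))
    = (\<lambda>y. ((if y < x then f y else g y) - (if x < x then f x else g x)) / (y - x))"
    using assms(3) by auto
  ultimately show ?thesis unfolding has_field_derivative_iff by simp
qed

context
  fixes I :: "'i set" and a :: "nat \<Rightarrow> 'i \<Rightarrow> real" and K :: real
  assumes fin: "finite I" and flat: "flat I K a"
begin

lemma flat_st: "flat I K (st I a n)"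
proof (induction n)
  case (Suc n)
  then show ?case using flat_pc[OF fin, of K "st I a n" "rad I (st I a n) / 2"] rad_pos[of I "st I a n"] by simp
qed (use flat in simp)

lemma piece_deriv:
  assumes "\<bar>\<tau> - tm I a n\<bar> < rad I (st I a n)" "i \<in> I" "c < 3"
  shows "((\<lambda>\<tau>. pc I (st I a n) (\<tau> - tm I a n) c i) has_real_derivative
    rhs I (pc I (st I a n) (\<tau> - tm I a n)) c i) (at \<tau>)"
proof -
  have "((\<lambda>\<tau>. \<tau> - tm I a n) has_real_derivative 1) (at \<tau>)"
    by (auto intro!: derivative_eq_intros)
  from DERIV_chain2[where f="\<lambda>s. pc I (st I a n) s c i", OF pc_deriv[OF fin assms] this]
  show ?thesis by simp
qed

lemma glob_cases:
  assumes "- rad I a < \<tau>" "\<exists>N. \<tau> < tm I a N"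
  obtains n where "\<tau> < tm I a (Suc n)" "n = 0 \<or> tm I a n \<le> \<tau>" "\<bar>\<tau> - tm I a n\<bar> < rad I (st I a n)"
proof -
  obtain N where "\<tau> < tm I a N" using assms(2) by blast
  also have "\<dots> < tm I a (Suc N)" using strict_monoD[OF tm_mono, of N "Suc N"] by blast
  finally have ex: "\<tau> < tm I a (Suc N)" .
  define n where "n = (LEAST n. \<tau> < tm I a (Suc n))"
  have 1: "\<tau> < tm I a (Suc n)" unfolding n_def by (rule LeastI[of "\<lambda>n. \<tau> < tm I a (Suc n)", OF ex])
  have 2: "n = 0 \<or> tm I a n \<le> \<tau>"
  proof (cases n)
    case (Suc k)
    have "\<not> \<tau> < tm I a (Suc k)" by (rule not_less_Least) (use Suc n_def in simp)
    then show ?thesis using Suc by simp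
  qed simp
  have "\<bar>\<tau> - tm I a n\<bar> < rad I (st I a n)" using 1 2 assms(1) rad_pos[of I "st I a n"] by (auto simp: abs_less_iff)
  with 1 2 show ?thesis using that by blast
qed

lemma glob_deriv:
  assumes \<tau>: "- rad I a < \<tau>" "\<exists>N. \<tau> < tm I a N" and i: "i \<in> I" and c: "c < 3"
  shows "((\<lambda>\<tau>. glob I a \<tau> c i) has_real_derivative rhs I (glob I a \<tau>) c i) (at \<tau>)"
proof -
  obtain n where n: "\<tau> < tm I a (Suc n)" "n = 0 \<or> tm I a n \<le> \<tau>" "\<bar>\<tau> - tm I a n\<bar> < rad I (st I a n)"
    using glob_cases[OF \<tau>] .
  note d = piece_deriv[OF n(3) i c]
  show ?thesis
  proof (cases "n = 0 \<or> tm I a n < \<tau>")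
    case True
    define S where "S = (if n = 0 then {..<tm I a (Suc n)} else {tm I a n<..<tm I a (Suc n)})"
    have S: "open S" "\<tau> \<in> S" using True n by (auto simp: S_def)
    have "glob I a x = pc I (st I a n) (x - tm I a n)" if "x \<in> S" for x
      by (rule glob_eq) (use that in \<open>auto simp: S_def split: if_splits\<close>)
    then show ?thesis
      using has_field_derivative_transform_within_open[OF d S] S(2) by simp
  next
    case False
    \<comment> \<open>A node between two pieces. They agree in value, and as both solve the same
      first order system they also agree in derivative.\<close>
    then obtain k where k: "n = Suc k" and te: "\<tau> = tm I a n" using n by (cases n) auto
    have "\<bar>\<tau> - tm I a k\<bar> < rad I (st I a k)" using te k rad_pos[of I "st I a k"] by simp
    note d' = piece_deriv[OF this i c]
    have eq: "pc I (st I a k) (\<tau> - tm I a k) = pc I (st I a n) (\<tau> - tm I a n)"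
      using te k pc_0[of I "st I a n"] by (auto simp: fun_eq_iff)
    define S where "S = {tm I a k<..<tm I a (Suc n)}"
    have S: "open S" "\<tau> \<in> S" using n te k rad_pos by (auto simp: S_def)
    have g: "glob I a x = (if x < \<tau> then pc I (st I a k) (x - tm I a k) else pc I (st I a n) (x - tm I a n))"
      if "x \<in> S" for x
      using that te k glob_eq[of x I a k] glob_eq[of x I a n] by (auto simp: S_def)
    have "((\<lambda>x. if x < \<tau> then pc I (st I a k) (x - tm I a k) c i else pc I (st I a n) (x - tm I a n) c i)
      has_real_derivative rhs I (glob I a \<tau>) c i) (at \<tau>)"
      by (rule has_real_derivative_glue) (use d d' eq g[OF S(2)] in auto)
    then show ?thesis
      by (rule has_field_derivative_transform_within_open[OF _ S]) (simp add: g)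
  qed
qed

lemma glob_flat:
  assumes \<tau>: "- rad I a < \<tau>" "\<exists>N. \<tau> < tm I a N"
  shows "flat I K (glob I a \<tau>)"
proof -
  obtain n where n: "\<tau> < tm I a (Suc n)" "n = 0 \<or> tm I a n \<le> \<tau>" "\<bar>\<tau> - tm I a n\<bar> < rad I (st I a n)"
    using glob_cases[OF \<tau>] .
  show ?thesis unfolding glob_eq[OF n(1,2)] by (rule flat_pc[OF fin flat_st n(3)])
qed

end

section \<open>The second order equation along the continued solution\<close>

definition el1 :: "'i set \<Rightarrow> (nat \<Rightarrow> 'i \<Rightarrow> real) \<Rightarrow> real"
  where "el1 I a = - (\<Sum>i\<in>I. rhs I a 0 i) / 3"

definition el2 :: "'i set \<Rightarrow> (nat \<Rightarrow> 'i \<Rightarrow> real) \<Rightarrow> real"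
  where "el2 I a = - (\<Sum>i\<in>I. (el1 I a - rhs I a 0 i) * a 1 i + (ell I a - a 0 i) * rhs I a 1 i) / 3"

lemma lam_sol_nth:
  "fps_nth (lam I (sol I a 0)) 0 = ell I a"
  "fps_nth (fps_deriv (lam I (sol I a 0))) 0 = el1 I a"
  "fps_nth (fps_deriv (fps_deriv (lam I (sol I a 0)))) 0 = el2 I a"
proof -
  show l: "fps_nth (lam I (sol I a 0)) 0 = ell I a"
    by (simp add: lam_nth ell_def sol_0)
  have d: "fps_nth (fps_deriv (sol I a 0 i)) 0 = rhs I a 0 i" for i
    unfolding sol_deriv by (simp add: sol_0 l rhs_def)
  have d1: "fps_nth (fps_deriv (sol I a 1 i)) 0 = rhs I a 1 i" for i
    unfolding sol_deriv by (simp add: sol_0 l rhs_def power2_eq_square)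
  have D: "fps_deriv (lam I (sol I a 0)) = fps_const (- 1 / 3) * (\<Sum>i\<in>I. fps_deriv (sol I a 0 i))"
    by (simp add: lam_def fps_deriv_sum)
  show l1: "fps_nth (fps_deriv (lam I (sol I a 0))) 0 = el1 I a"
    unfolding D by (simp add: fps_sum_nth d el1_def del: fps_deriv_nth)
  have "fps_deriv (fps_deriv (lam I (sol I a 0))) = fps_const (- 1 / 3) *
      (\<Sum>i\<in>I. (fps_deriv (lam I (sol I a 0)) - fps_deriv (sol I a 0 i)) * sol I a 1 i
        + (lam I (sol I a 0) - sol I a 0 i) * fps_deriv (sol I a 1 i))"
  proof -
    have "fps_deriv (fps_deriv (lam I (sol I a 0))) = fps_const (- 1 / 3) * (\<Sum>i\<in>I. fps_deriv (fps_deriv (sol I a 0 i)))"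
      unfolding D by (simp add: fps_deriv_sum)
    also have "(\<Sum>i\<in>I. fps_deriv (fps_deriv (sol I a 0 i))) =
      (\<Sum>i\<in>I. (fps_deriv (lam I (sol I a 0)) - fps_deriv (sol I a 0 i)) * sol I a 1 i
        + (lam I (sol I a 0) - sol I a 0 i) * fps_deriv (sol I a 1 i))"
      by (rule sum.cong[OF refl], subst (1) sol_deriv(1)) (simp add: algebra_simps)
    finally show ?thesis .
  qed
  then show "fps_nth (fps_deriv (fps_deriv (lam I (sol I a 0)))) 0 = el2 I a"
    by (simp add: fps_sum_nth d d1[unfolded One_nat_def] l l1 el2_def sol_0 del: fps_deriv_nth)
qed

text \<open>This is the constant coefficient of the defect. Since all states on the continued
  solution are flat, it yields the second order equation at every time.\<close>

lemma flat_nth: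
  assumes "flat I K a"
  shows "el2 I a + (\<Sum>i\<in>I. a 1 i) * el1 I a = ell I a * ((ell I a)\<^sup>2 + (\<Sum>i\<in>I. (a 0 i)\<^sup>2) + K)"
proof -
  have "fps_nth (GG I K (sol I a 0) (sol I a 1)) 0 = 0" using assms by (simp add: flat_def)
  then show ?thesis
    unfolding GG_def by (simp add: lam_sol_nth fps_sum_nth sol_0 power2_eq_square del: fps_deriv_nth)
qed

text \<open>
  No hypersurface of a flat space whose principal curvature in direction of the gradient is minus
  the sum of all principal curvatures is biharmonic: \<open>\<nu>\<close> and \<open>\<omega>\<close> are the Taylor series of the other
  principal curvatures and of the principal curvatures of the level sets.
\<close>

theorem no_planar_series:
  fixes I :: "'i set" and N Om :: "'i \<Rightarrow> real fps" and L :: "real fps"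
  assumes fin: "finite I" and K: "K \<ge> 0"
    and N: "\<And>i. i \<in> I \<Longrightarrow> fps_deriv (N i) = (L - N i) * Om i"
    and Om: "\<And>i. i \<in> I \<Longrightarrow> fps_deriv (Om i) = - (Om i * Om i) - L * N i"
    and L: "L = lam I N"
    and G: "fps_deriv (fps_deriv L) + (\<Sum>i\<in>I. Om i) * fps_deriv L
      = L * (L * L + (\<Sum>i\<in>I. N i * N i) + fps_const K)"
    and nz: "\<And>i. i \<in> I \<Longrightarrow> fps_nth (N i) 0 \<noteq> 0 \<or> fps_nth (Om i) 0 \<noteq> 0"
    and L0: "fps_nth L 0 > 0" and L1: "fps_nth (fps_deriv L) 0 > 0"
  shows False
proof -
  \<comment> \<open>The third component is the initial distance. Its value makes
    \<open>(p, q)\<close> a unit vector, which is possible because no initial pair vanishes.\<close>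
  define a where "a c i = (if c = (0::nat) then fps_nth (N i) 0 else if c = 1 then fps_nth (Om i) 0
    else 1 / sqrt ((fps_nth (Om i) 0)\<^sup>2 + (fps_nth (N i) 0)\<^sup>2))" for c i
  have NS: "N i = sol I a 0 i" "Om i = sol I a 1 i" if "i \<in> I" for i
    using sol_unique[of I N Om a, OF _ _ _ _ that] N Om L by (auto simp: a_def)
  have LS: "L = lam I (sol I a 0)" unfolding L lam_def using NS by simp
  have flat: "flat I K a"
    unfolding flat_def GG_def using G NS LS by simp
  have t0: "glob I a 0 = a"
    using glob_eq[of 0 I a 0] rad_pos[of I a] pc_0[of I a] by (auto simp: fun_eq_iff)
  have r: "(fps_nth (Om i) 0)\<^sup>2 + (fps_nth (N i) 0)\<^sup>2 > 0" if "i \<in> I" for i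
    using nz[OF that] by (simp add: sum_power2_gt_zero_iff) blast
  note gd = glob_deriv[OF fin flat]
  note rs = rhs_def
  interpret planar_system I "\<lambda>i s. glob I a s 0 i" "\<lambda>i s. glob I a s 1 i" "\<lambda>i s. glob I a s 2 i"
    "\<lambda>s. ell I (glob I a s)" "\<lambda>s. el1 I (glob I a s)" "\<lambda>s. el2 I (glob I a s)" "rad I a" K "tm I a"
  proof
    show "finite I" "rad I a > 0" "tm I a 0 = 0" "strict_mono (tm I a)" "0 \<le> K"
      using fin rad_pos tm_mono K by auto
    show "((\<lambda>s. glob I a s 0 i) has_real_derivative (ell I (glob I a s) - glob I a s 0 i) * glob I a s 1 i) (at s)"
      "((\<lambda>s. glob I a s 1 i) has_real_derivative - (glob I a s 1 i)\<^sup>2 - ell I (glob I a s) * glob I a s 0 i) (at s)"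
      "((\<lambda>s. glob I a s 2 i) has_real_derivative glob I a s 1 i * glob I a s 2 i) (at s)"
      if "i \<in> I" "- rad I a < s" "\<exists>n. s < tm I a n" for i s
      using gd[OF that(2,3,1), of 0] gd[OF that(2,3,1), of 1] gd[OF that(2,3,1), of 2] by (simp_all add: rs)
    show dl: "((\<lambda>s. ell I (glob I a s)) has_real_derivative el1 I (glob I a s)) (at s)"
      if "- rad I a < s" "\<exists>n. s < tm I a n" for s
      unfolding ell_def el1_def
      by (intro DERIV_cdivide DERIV_minus has_real_derivative_sum gd that) auto
    show "((\<lambda>s. el1 I (glob I a s)) has_real_derivative el2 I (glob I a s)) (at s)"
      if "- rad I a < s" "\<exists>n. s < tm I a n" for s
    proof -
      have "((\<lambda>s. - (\<Sum>i\<in>I. (ell I (glob I a s) - glob I a s 0 i) * glob I a s 1 i) / 3) has_real_derivative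
        - (\<Sum>i\<in>I. (el1 I (glob I a s) - rhs I (glob I a s) 0 i) * glob I a s 1 i
          + rhs I (glob I a s) 1 i * (ell I (glob I a s) - glob I a s 0 i)) / 3) (at s)"
        by (intro DERIV_cdivide DERIV_minus has_real_derivative_sum DERIV_mult DERIV_diff dl gd that) auto
      moreover have "- (\<Sum>i\<in>I. (el1 I (glob I a s) - rhs I (glob I a s) 0 i) * glob I a s 1 i
          + rhs I (glob I a s) 1 i * (ell I (glob I a s) - glob I a s 0 i)) / 3 = el2 I (glob I a s)"
        unfolding el2_def by (simp add: mult.commute)
      moreover have "el1 I (glob I a s) = - (\<Sum>i\<in>I. (ell I (glob I a s) - glob I a s 0 i) * glob I a s 1 i) / 3" for s
        by (simp add: el1_def rs)
      ultimately show ?thesis by simp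
    qed
    show "3 * ell I (glob I a s) = - (\<Sum>i\<in>I. glob I a s 0 i)" for s by (simp add: ell_def)
    show "el2 I (glob I a s) + (\<Sum>i\<in>I. glob I a s 1 i) * el1 I (glob I a s) =
      ell I (glob I a s) * ((ell I (glob I a s))\<^sup>2 + (\<Sum>i\<in>I. (glob I a s 0 i)\<^sup>2) + K)"
      if "0 \<le> s" "\<exists>n. s < tm I a n" for s
      by (rule flat_nth, rule glob_flat[OF fin flat]) (use that rad_pos[of I a] in auto)
    show "glob I a 0 2 i > 0" if "i \<in> I" for i
      using r[OF that] by (simp add: t0 a_def)
    show "(glob I a 0 2 i)\<^sup>2 * ((glob I a 0 1 i)\<^sup>2 + (glob I a 0 0 i)\<^sup>2) = 1" if "i \<in> I" for i
      using r[OF that] nz[OF that] by (auto simp: t0 a_def power_divide)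
    show "ell I (glob I a 0) > 0" "el1 I (glob I a 0) > 0"
      using L0 L1 unfolding t0 LS lam_sol_nth by auto
    \<comment> \<open>If the times converge, the step lengths tend to 0. These are half of
      \<open>rad\<close>, which is inversely proportional to \<open>bnd\<close>, so the size of the
      state tends to infinity.\<close>
    show "\<exists>N. \<forall>n\<ge>N. B < (\<Sum>i\<in>I. \<bar>glob I a (tm I a n) 0 i\<bar> + \<bar>glob I a (tm I a n) 1 i\<bar> + \<bar>glob I a (tm I a n) 2 i\<bar>)"
      if bdd: "bdd_above (range (tm I a))" for B
    proof -
      have gt: "glob I a (tm I a n) = st I a n" for n
        using glob_eq[of "tm I a n" I a n] rad_pos[of I "st I a n"] pc_0[of I "st I a n"] by (auto simp: fun_eq_iff)
      obtain T where T: "tm I a \<longlonglongrightarrow> T"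
        using LIMSEQ_incseq_SUP[OF bdd strict_mono_mono[OF tm_mono]] by blast
      have "(\<lambda>n. tm I a (Suc n) - tm I a n) \<longlonglongrightarrow> T - T"
        by (intro tendsto_diff LIMSEQ_Suc T)
      then have "(\<lambda>n. rad I (st I a n) / 2) \<longlonglongrightarrow> 0" by simp
      moreover define C where "C = real (card I) + 2"
      moreover have "1 / (2 * C * (\<bar>B\<bar> + 1)) > 0" by (simp add: C_def add_nonneg_pos)
      ultimately obtain M where M: "\<And>n. n \<ge> M \<Longrightarrow> rad I (st I a n) / 2 < 1 / (2 * C * (\<bar>B\<bar> + 1))"
        using order_tendstoD(2)[of "\<lambda>n. rad I (st I a n) / 2" 0 sequentially] unfolding eventually_sequentially by blast
      have "B < (\<Sum>i\<in>I. \<bar>st I a n 0 i\<bar> + \<bar>st I a n 1 i\<bar> + \<bar>st I a n 2 i\<bar>)" if "n \<ge> M" for n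
      proof -
        have C: "C > 0" by (simp add: C_def add_nonneg_pos)
        have inv: "y < x" if "0 < x" "0 < y" "1 / x < 1 / y" for x y :: real
          using that by (simp add: field_simps)
        have "rad I (st I a n) / 2 = 1 / (2 * C * bnd I (st I a n))"
          unfolding rad_def C_def[symmetric] by simp
        then have "2 * C * (\<bar>B\<bar> + 1) < 2 * C * bnd I (st I a n)"
          using inv[of "2 * C * bnd I (st I a n)" "2 * C * (\<bar>B\<bar> + 1)"] M[OF that] C bnd_pos[of I "st I a n"] by simp
        then show ?thesis using C by (simp add: bnd_def)
      qed
      then show ?thesis unfolding gt by blast
    qed
  qed
  show False by (rule contradiction)
qed

section \<open>Inner products and traces\<close>

locale inner_form =
  fixes h :: "'a::euclidean_space \<Rightarrow> 'a \<Rightarrow> real"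
  assumes bil: "bilinear h" and sym: "h u v = h v u" and pos: "u \<noteq> 0 \<Longrightarrow> h u u > 0"
begin

lemma lin: "linear (h u)" "linear (\<lambda>u. h u v)"
  using bil by (auto simp: bilinear_def)

lemma h_add [simp]: "h (u + v) w = h u w + h v w" "h w (u + v) = h w u + h w v"
  using bilinear_ladd[OF bil] bilinear_radd[OF bil] by auto

lemma h_diff [simp]: "h (u - v) w = h u w - h v w" "h w (u - v) = h w u - h w v"
  using bilinear_lsub[OF bil] bilinear_rsub[OF bil] by auto

lemma h_scale [simp]: "h (r *\<^sub>R u) w = r * h u w" "h w (r *\<^sub>R u) = r * h w u"
  using bilinear_lmul[OF bil] bilinear_rmul[OF bil] by auto

lemma h_minus [simp]: "h (- u) w = - h u w" "h w (- u) = - h w u"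
  using bilinear_lneg[OF bil] bilinear_rneg[OF bil] by auto

lemma h_zero [simp]: "h 0 w = 0" "h w 0 = 0"
  using bilinear_lzero[OF bil] bilinear_rzero[OF bil] by auto

lemma h_sum: "h (\<Sum>i\<in>I. f i) w = (\<Sum>i\<in>I. h (f i) w)" "h w (\<Sum>i\<in>I. f i) = (\<Sum>i\<in>I. h w (f i))"
  using linear_sum[OF lin(2), of f I w] linear_sum[OF lin(1), of w f I] by auto

lemma h_nonneg: "h u u \<ge> 0"
  using pos[of u] by (cases "u = 0") auto

lemma h_eq_0: "h u u = 0 \<longleftrightarrow> u = 0"
  using pos[of u] by (cases "u = 0") auto

lemma h_ext: "(\<And>w. h u w = h v w) \<Longrightarrow> u = v"
  using h_eq_0[of "u - v"] by simp

definition orth :: "'a set \<Rightarrow> bool"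
  where "orth S \<longleftrightarrow> (\<forall>u\<in>S. \<forall>v\<in>S. h u v = (if u = v then 1 else 0))"

lemma orthD: "orth S \<Longrightarrow> u \<in> S \<Longrightarrow> v \<in> S \<Longrightarrow> h u v = (if u = v then 1 else 0)"
  by (simp add: orth_def)

lemma orth_coeff:
  assumes "orth S" "finite T" "T \<subseteq> S" "v \<in> T"
  shows "h (\<Sum>u\<in>T. r u *\<^sub>R u) v = r v"
proof -
  have "(\<Sum>u\<in>T. r u * h u v) = (\<Sum>u\<in>T. if u = v then r v else 0)"
    by (rule sum.cong) (use assms in \<open>auto simp: orth_def subset_iff\<close>)
  then show ?thesis using assms by (simp add: h_sum)
qed

lemma orth_independent: "orth S \<Longrightarrow> independent S"
  unfolding independent_explicit_module using orth_coeff
  by (metis h_zero(1))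

lemma orth_finite: "orth S \<Longrightarrow> finite S" "orth S \<Longrightarrow> card S \<le> DIM('a)"
  using orth_independent independent_bound by auto

lemma orth_expand:
  assumes S: "orth S" and v: "v \<in> span S"
  shows "v = (\<Sum>u\<in>S. h v u *\<^sub>R u)"
proof -
  obtain r where r: "v = (\<Sum>u\<in>S. r u *\<^sub>R u)" using v orth_finite[OF S] by (auto simp: span_finite)
  have "h v u = r u" if "u \<in> S" for u
    unfolding r by (rule orth_coeff[OF S orth_finite(1)[OF S] order_refl that])
  then show ?thesis using r by simp
qed

lemma orth_insert:
  assumes S: "orth S" and v: "v \<notin> span S"
  shows "\<exists>w. w \<notin> span S \<and> orth (insert w S) \<and> w \<in> span (insert v S)"
proof -
  define z where "z = v - (\<Sum>u\<in>S. h v u *\<^sub>R u)"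
  have sp: "(\<Sum>u\<in>S. h v u *\<^sub>R u) \<in> span S" by (intro span_sum span_scale span_base)
  have zs: "z \<notin> span S"
    using v span_add[OF _ sp, of z] by (auto simp: z_def)
  then have z0: "h z z > 0" using pos[of z] span_zero by blast
  define w where "w = (1 / sqrt (h z z)) *\<^sub>R z"
  have ws: "w \<notin> span S"
    using zs span_scale[of w S "sqrt (h z z)"] z0 by (auto simp: w_def)
  have zu: "h z u = 0" if "u \<in> S" for u
    unfolding z_def using orth_coeff[OF S orth_finite(1)[OF S] order_refl that, of "h v"] by simp
  have "h w w = 1" using z0 by (simp add: w_def)
  moreover have "h w u = 0" if "u \<in> S" for u using zu[OF that] by (simp add: w_def)
  moreover have "h u w = 0" if "u \<in> S" for u using zu[OF that] sym[of u w] by (simp add: w_def)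
  ultimately have "orth (insert w S)"
    using S ws span_base[of w S] unfolding orth_def by auto
  moreover have "w \<in> span (insert v S)"
    unfolding w_def z_def
    by (intro span_scale span_diff span_base insertI1 span_mono[THEN subsetD, OF _ sp] subset_insertI)
  ultimately show ?thesis using ws by blast
qed

lemma orth_extend:
  assumes "subspace T" "orth S" "S \<subseteq> T"
  shows "\<exists>S'. S \<subseteq> S' \<and> orth S' \<and> S' \<subseteq> T \<and> span S' = T"
  using assms(2,3)
proof (induction "DIM('a) - card S" arbitrary: S rule: less_induct)
  case less
  have sub: "span S \<subseteq> T" by (rule span_minimal[OF less.prems(2) assms(1)])
  show ?case
  proof (cases "span S = T")
    case True
    then show ?thesis using less.prems by blast
  next
    case False
    then obtain v where v: "v \<in> T" "v \<notin> span S" using sub by auto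
    obtain w where w: "w \<notin> span S" "orth (insert w S)" "w \<in> span (insert v S)"
      using orth_insert[OF less.prems(1) v(2)] by blast
    have "w \<in> T"
      using span_minimal[of "insert v S" T] assms(1) less.prems(2) v(1) w(3) by blast
    have "w \<notin> S" using w(1) span_base by blast
    then have "card (insert w S) = Suc (card S)" using orth_finite[OF less.prems(1)] by simp
    then have "DIM('a) - card (insert w S) < DIM('a) - card S"
      using orth_finite(2)[OF w(2)] by simp
    from less.hyps[OF this w(2)] \<open>w \<in> T\<close> less.prems(2) show ?thesis by blast
  qed
qed

definition onb :: "'a set \<Rightarrow> bool" where "onb S \<longleftrightarrow> orth S \<and> span S = UNIV"

lemma onb_extend: "orth S \<Longrightarrow> \<exists>S'. S \<subseteq> S' \<and> onb S'"
  using orth_extend[OF subspace_UNIV, of S] by (auto simp: onb_def)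

lemma onb_card: "onb S \<Longrightarrow> card S = DIM('a)"
  using dim_eq_card_independent[OF orth_independent, of S] dim_span[of S] by (simp add: onb_def)

lemma orth_card_onb: "orth S \<Longrightarrow> card S = DIM('a) \<Longrightarrow> onb S"
  using card_eq_dim[of S UNIV] orth_independent orth_finite unfolding onb_def by auto

lemma onb_expand: "onb S \<Longrightarrow> v = (\<Sum>u\<in>S. h v u *\<^sub>R u)"
  using orth_expand by (simp add: onb_def)

lemma sharp_works:
  assumes "linear \<alpha>" shows "h (sharp h \<alpha>) z = \<alpha> z"
proof -
  obtain S where S: "onb S" using onb_extend[of "{}"] by (auto simp: orth_def)
  define w where "w = (\<Sum>u\<in>S. \<alpha> u *\<^sub>R u)"
  have w: "h w z = \<alpha> z" for z
  proof -
    have "\<alpha> z = \<alpha> (\<Sum>u\<in>S. h z u *\<^sub>R u)" using onb_expand[OF S, of z] by simp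
    also have "\<dots> = (\<Sum>u\<in>S. \<alpha> u * h u z)"
      unfolding linear_sum[OF assms] linear_cmul[OF assms] by (intro sum.cong refl) (metis mult.commute real_scaleR_def sym)
    finally show ?thesis by (simp add: w_def h_sum)
  qed
  have "sharp h \<alpha> = w"
    unfolding sharp_def by (rule the_equality) (use w h_ext in auto)
  then show ?thesis using w by simp
qed

lemma sharp_eqI: "(\<And>z. h w z = \<alpha> z) \<Longrightarrow> sharp h \<alpha> = w"
  unfolding sharp_def by (rule the_equality) (auto intro: h_ext)

lemma sharp_onb: "linear \<alpha> \<Longrightarrow> onb S \<Longrightarrow> sharp h \<alpha> = (\<Sum>u\<in>S. \<alpha> u *\<^sub>R u)"
  by (subst onb_expand[of S]) (auto simp: sharp_works)

lemma metric_trace_onb: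
  "bilinear T \<Longrightarrow> onb S \<Longrightarrow> metric_trace h T = (\<Sum>u\<in>S. T u u)"
  using metric_trace_orthogonal_frame[OF bil, of T S "\<lambda>_. 1" "\<lambda>u. u"] onb_card[of S] orth_finite[of S]
  by (auto simp: onb_def orth_def)

end

text \<open>The trace is taken in the coordinate basis, hence without a metric, and can be
  differentiated term by term; \<open>trc_onb\<close> evaluates it in an orthonormal basis of any
  inner product.\<close>

definition trc :: "('a::euclidean_space \<Rightarrow> 'a) \<Rightarrow> real"
  where "trc A = (\<Sum>b\<in>Basis. A b \<bullet> b)"

lemma trc_add: "trc (\<lambda>v. A v + B v) = trc A + trc B"
  by (simp add: trc_def inner_add_left sum.distrib)

lemma trc_diff: "trc (\<lambda>v. A v - B v) = trc A - trc B"
  by (simp add: trc_def inner_diff_left sum_subtractf)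

lemma trc_scale: "trc (\<lambda>v. r *\<^sub>R A v) = r * trc A"
  by (simp add: trc_def sum_distrib_left)

lemma trc_minus: "trc (\<lambda>v. - A v) = - trc A"
  by (simp add: trc_def sum_negf)

lemma (in inner_form) trc_onb:
  assumes "linear A" "onb S"
  shows "trc A = (\<Sum>u\<in>S. h (A u) u)"
proof -
  have T: "bilinear (\<lambda>u v. h (A u) v)"
    unfolding bilinear_def using lin linear_compose[OF assms(1) lin(2)] by (simp add: o_def)
  have "h (A b) (sharp h (\<lambda>z. b \<bullet> z)) = A b \<bullet> b" for b
    using sharp_works[of "\<lambda>z. b \<bullet> z" "A b"] sym[of "A b"] inner_commute[of "A b" b]
      bounded_linear.linear[OF bounded_linear_inner_right[of b]] by simp
  then have "metric_trace h (\<lambda>u v. h (A u) v) = trc A"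
    by (simp add: metric_trace_def trc_def)
  with metric_trace_onb[OF T assms(2)] show ?thesis by simp
qed

lemma trc_comm:
  assumes A: "linear A" and B: "linear B"
  shows "trc (\<lambda>v. A (B v)) = trc (\<lambda>v. B (A (v :: 'a::euclidean_space)))"
proof -
  have "trc (\<lambda>v. A (B v)) = (\<Sum>b\<in>Basis. \<Sum>c\<in>Basis. (B b \<bullet> c) * (A c \<bullet> b))"
    unfolding trc_def by (subst linear_on_Basis[OF A]) (simp add: inner_sum_left)
  also have "\<dots> = (\<Sum>c\<in>Basis. \<Sum>b\<in>Basis. (A c \<bullet> b) * (B b \<bullet> c))"
    by (subst sum.swap) (simp add: mult.commute)
  also have "\<dots> = trc (\<lambda>v. B (A v))"
    unfolding trc_def by (subst linear_on_Basis[OF B]) (simp add: inner_sum_left)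
  finally show ?thesis .
qed

context inner_form
begin

lemma trc_adjoint:
  assumes "linear A" "linear B" "\<And>u v. h (A u) v = h u (B v)"
  shows "trc A = trc B"
proof -
  obtain S where S: "onb S" using onb_extend[of "{}"] by (auto simp: orth_def)
  show ?thesis
    unfolding trc_onb[OF assms(1) S] trc_onb[OF assms(2) S] using assms(3) sym by (intro sum.cong) auto
qed

lemma continuous_form: "continuous_on X f \<Longrightarrow> continuous_on X g \<Longrightarrow> continuous_on X (\<lambda>x. h (f x) (g x))"
  using bounded_bilinear.continuous_on bilinear_conv_bounded_bilinear[of h] bil by blast

lemma norm_bound: "\<exists>c>0. \<forall>u. c * (norm u)\<^sup>2 \<le> h u u"
proof -
  have "\<exists>x\<in>sphere 0 1. \<forall>y\<in>sphere 0 1. h x x \<le> h y y"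
    by (rule continuous_attains_inf) (auto intro!: continuous_form continuous_on_id)
  then obtain x where x: "norm x = 1" "\<And>y. norm y = 1 \<Longrightarrow> h x x \<le> h y y" by auto
  have "x \<noteq> 0" using x(1) by auto
  then have "h x x > 0" by (rule pos)
  moreover have "h x x * (norm u)\<^sup>2 \<le> h u u" for u
  proof (cases "u = 0")
    case False
    then have "h x x \<le> h ((1 / norm u) *\<^sub>R u) ((1 / norm u) *\<^sub>R u)" by (intro x(2)) simp
    then show ?thesis using False by (simp add: field_simps power2_eq_square)
  qed simp
  ultimately show ?thesis by blast
qed

text \<open>Maximum of the Rayleigh quotient on the compact unit sphere of \<open>T\<close>. At a
  maximum the vector \<open>A v - r v\<close> is orthogonal to \<open>T\<close>, and by invariance
  it lies in \<open>T\<close>.\<close>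

lemma eigenvector_exists:
  assumes T: "subspace T" "T \<noteq> {0}" and A: "linear A" "\<And>u. u \<in> T \<Longrightarrow> A u \<in> T"
    "\<And>u v. u \<in> T \<Longrightarrow> v \<in> T \<Longrightarrow> h (A u) v = h u (A v)"
  shows "\<exists>v\<in>T. h v v = 1 \<and> (\<exists>r. A v = r *\<^sub>R v)"
proof -
  define X where "X = {v \<in> T. h v v = 1}"
  obtain c where c: "c > 0" "\<And>u. c * (norm u)\<^sup>2 \<le> h u u" using norm_bound by blast
  have "compact X"
  proof -
    have "X = T \<inter> {v. h v v = 1}" by (auto simp: X_def)
    moreover have "closed {v. h v v = 1}"
      by (intro closed_Collect_eq continuous_form continuous_on_id continuous_on_const)
    ultimately have "closed X" using closed_subspace[OF T(1)] by auto
    moreover have "norm v \<le> sqrt (1 / c)" if "v \<in> X" for v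
      using c(2)[of v] c(1) that by (intro real_le_rsqrt) (simp add: X_def field_simps)
    ultimately show ?thesis by (auto simp: compact_eq_bounded_closed bounded_iff)
  qed
  moreover have "X \<noteq> {}"
  proof -
    obtain u where u: "u \<in> T" "u \<noteq> 0" using T subspace_0 by blast
    then have "(1 / sqrt (h u u)) *\<^sub>R u \<in> X"
      using pos[of u] T(1) by (simp add: X_def subspace_scale)
    then show ?thesis by auto
  qed
  moreover have "continuous_on X (\<lambda>v. h (A v) v)"
    using A(1) by (intro continuous_form continuous_on_id linear_continuous_on linear_conv_bounded_linear[THEN iffD1])
  ultimately obtain v where v: "v \<in> X" "\<And>u. u \<in> X \<Longrightarrow> h (A u) u \<le> h (A v) v"
    using continuous_attains_sup[of X "\<lambda>v. h (A v) v"] by blast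
  define r where "r = h (A v) v"
  have vT: "v \<in> T" "h v v = 1" using v by (auto simp: X_def)
  have le: "h (A u) u \<le> r * h u u" if u: "u \<in> T" for u
  proof (cases "u = 0")
    case False
    then have "(1 / sqrt (h u u)) *\<^sub>R u \<in> X"
      using pos[of u] T(1) u by (simp add: X_def subspace_scale)
    from v(2)[OF this] show ?thesis
      using pos[OF False] by (simp add: linear_cmul[OF A(1)] r_def field_simps)
  qed (simp add: linear_0[OF A(1)])
  have "h (A v - r *\<^sub>R v) w = 0" if w: "w \<in> T" for w
  proof (rule ccontr)
    define D where "D = h (A v - r *\<^sub>R v) w"
    define C where "C = \<bar>r * h w w - h (A w) w\<bar> + 1"
    assume "h (A v - r *\<^sub>R v) w \<noteq> 0"
    then have D: "D \<noteq> 0" by (simp add: D_def)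
    \<comment> \<open>\<open>C\<close> exceeds the quadratic coefficient of the variation, so for
      this \<open>t\<close> the linear gain outweighs the quadratic loss.\<close>
    define t where "t = D / C"
    have "h (A (v + t *\<^sub>R w)) (v + t *\<^sub>R w) \<le> r * h (v + t *\<^sub>R w) (v + t *\<^sub>R w)"
      by (intro le subspace_add subspace_scale T vT w)
    then have "2 * t * D \<le> t\<^sup>2 * (r * h w w - h (A w) w)"
      using vT A(3)[OF w vT(1)] sym[of w "A v"] sym[of w v]
      by (simp add: linear_add[OF A(1)] linear_cmul[OF A(1)] D_def r_def algebra_simps power2_eq_square)
    also have "\<dots> \<le> t\<^sup>2 * C" by (intro mult_left_mono) (auto simp: C_def)
    also have "\<dots> = t * D" using D by (simp add: t_def C_def power2_eq_square)
    finally have "t * D \<le> 0" by (simp add: mult.commute)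
    moreover have "t * D > 0" using D by (simp add: t_def C_def add_nonneg_pos flip: power2_eq_square)
    ultimately show False by simp
  qed
  moreover have "A v - r *\<^sub>R v \<in> T" by (intro subspace_diff subspace_scale T A vT)
  ultimately have "h (A v - r *\<^sub>R v) (A v - r *\<^sub>R v) = 0" by blast
  then have "A v = r *\<^sub>R v" unfolding h_eq_0 by simp
  then show ?thesis using vT by blast
qed

text \<open>As long as an orthonormal set of common eigenvectors does not span, it can be enlarged:
  its complement is invariant under both operators and meets an eigenspace of \<open>A\<close>, and
  \<open>B\<close> preserves this intersection because the operators commute.\<close>

lemma simultaneous_diagonalization:
  assumes A: "linear A" "\<And>u v. h (A u) v = h u (A v)"
    and B: "linear B" "\<And>u v. h (B u) v = h u (B v)" and AB: "\<And>u. A (B u) = B (A u)"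
  shows "\<exists>S \<alpha> \<beta>. onb S \<and> (\<forall>u\<in>S. A u = \<alpha> u *\<^sub>R u \<and> B u = \<beta> u *\<^sub>R u)"
proof -
  have "\<exists>S'. S \<subseteq> S' \<and> onb S' \<and> (\<forall>u\<in>S'. (\<exists>r. A u = r *\<^sub>R u) \<and> (\<exists>r. B u = r *\<^sub>R u))"
    if "orth S" "\<forall>u\<in>S. (\<exists>r. A u = r *\<^sub>R u) \<and> (\<exists>r. B u = r *\<^sub>R u)" for S
    using that
  proof (induction "DIM('a) - card S" arbitrary: S rule: less_induct)
    case less
    show ?case
    proof (cases "span S = UNIV")
      case True
      then show ?thesis using less.prems by (auto simp: onb_def)
    next
      case False
      define T where "T = {v. \<forall>u\<in>S. h v u = 0}"
      have T: "subspace T" by (auto simp: T_def subspace_def)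
      obtain v where "v \<notin> span S" using False by auto
      then obtain w where w: "w \<notin> span S" "orth (insert w S)" using orth_insert[OF less.prems(1)] by blast
      have "w \<in> T" "w \<noteq> 0" using w span_zero[of S] span_base[of w S] by (auto simp: T_def orth_def)
      then have T0: "T \<noteq> {0}" by blast
      have inv: "L u \<in> T" if L: "u \<in> T" "\<And>u v. h (L u) v = h u (L v)" "\<forall>u\<in>S. \<exists>r. L u = r *\<^sub>R u" for L u
      proof -
        have "h (L u) s = 0" if s: "s \<in> S" for s
        proof -
          obtain r where "L s = r *\<^sub>R s" using s L(3) by blast
          then show ?thesis using L(1,2) s by (simp add: T_def)
        qed
        then show ?thesis by (simp add: T_def)
      qed
      have AT: "A u \<in> T" "B u \<in> T" if "u \<in> T" for u
        using inv[of u A] inv[of u B] that A B less.prems by auto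
      obtain v r where v: "v \<in> T" "h v v = 1" "A v = r *\<^sub>R v"
        using eigenvector_exists[OF T T0 A(1) AT(1) A(2)] by blast
      define E where "E = {u \<in> T. A u = r *\<^sub>R u}"
      have E: "subspace E"
        using T by (auto simp: E_def subspace_def linear_0[OF A(1)] linear_add[OF A(1)] linear_cmul[OF A(1)] scaleR_add_right)
      have "v \<noteq> 0" using v(2) by auto
      then have "E \<noteq> {0}" using v by (auto simp: E_def)
      moreover have "B u \<in> E" if "u \<in> E" for u
        using that AT(2)[of u] AB[of u] by (simp add: E_def linear_cmul[OF B(1)])
      ultimately obtain z s where z: "z \<in> E" "h z z = 1" "B z = s *\<^sub>R z"
        using eigenvector_exists[OF E _ B(1) _ B(2)] by blast
      have zS: "h z u = 0" if "u \<in> S" for u using z that by (auto simp: E_def T_def)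
      then have "z \<notin> S" using z(2) by auto
      have o: "orth (insert z S)"
      proof -
        have "h u z = 0" if "u \<in> S" for u using zS[OF that] sym[of u z] by simp
        then show ?thesis using less.prems(1) zS z(2) by (auto simp: orth_def)
      qed
      have "card (insert z S) = Suc (card S)" using orth_finite[OF less.prems(1)] \<open>z \<notin> S\<close> by simp
      then have "DIM('a) - card (insert z S) < DIM('a) - card S"
        using orth_finite(2)[OF o] by simp
      from less.hyps[OF this o] less.prems(2) z show ?thesis by (auto simp: E_def)
    qed
  qed
  from this[of "{}"] obtain S where S: "onb S" "\<forall>u\<in>S. (\<exists>r. A u = r *\<^sub>R u) \<and> (\<exists>r. B u = r *\<^sub>R u)"
    by (auto simp: orth_def)
  then show ?thesis by metis
qed

end

section \<open>Smooth orthonormal frames and dual vectors\<close>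

lemma riemannian_inner_form: "riemannian_metric_on U g \<Longrightarrow> x \<in> U \<Longrightarrow> inner_form (g x)"
  unfolding riemannian_metric_on_def inner_form_def by blast

text \<open>Gram-Schmidt applied to the constant basis at all points at once. The induction also
  records that the new vectors stay in the span of the constant vectors used so far; this keeps the
  next difference \<open>z\<close> nonzero.\<close>

lemma smooth_orthonormal_frame:
  fixes U :: "'a::euclidean_space set"
  assumes U: "open U" and g: "riemannian_metric_on U g"
  shows "\<exists>\<epsilon> :: 'a \<Rightarrow> 'a \<Rightarrow> 'a. (\<forall>b\<in>Basis. smooth_on U (\<epsilon> b)) \<and>
    (\<forall>x\<in>U. \<forall>b\<in>Basis. \<forall>c\<in>Basis. g x (\<epsilon> b x) (\<epsilon> c x) = (if b = c then 1 else 0))"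
proof -
  note inn = riemannian_inner_form[OF g]
  have gs: "smooth_on U (\<lambda>x. g x (Y x) (Z x))" if "smooth_on U Y" "smooth_on U Z" for Y Z
    by (rule smooth_on_apply_bilinear[OF U]) (use g that in \<open>auto simp: riemannian_metric_on_def\<close>)
  have "\<exists>\<epsilon> :: 'a \<Rightarrow> 'a \<Rightarrow> 'a. (\<forall>b\<in>B. smooth_on U (\<epsilon> b)) \<and>
    (\<forall>x\<in>U. (\<forall>b\<in>B. \<forall>c\<in>B. g x (\<epsilon> b x) (\<epsilon> c x) = (if b = c then 1 else 0)) \<and> (\<lambda>b. \<epsilon> b x) ` B \<subseteq> span B)"
    if "finite B" "B \<subseteq> Basis" for B :: "'a set"
    using that
  proof (induction B rule: finite_induct)
    case (insert a B)
    then have "\<exists>\<epsilon> :: 'a \<Rightarrow> 'a \<Rightarrow> 'a. (\<forall>b\<in>B. smooth_on U (\<epsilon> b)) \<and>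
      (\<forall>x\<in>U. (\<forall>b\<in>B. \<forall>c\<in>B. g x (\<epsilon> b x) (\<epsilon> c x) = (if b = c then 1 else 0)) \<and> (\<lambda>b. \<epsilon> b x) ` B \<subseteq> span B)"
      by blast
    then obtain \<epsilon> :: "'a \<Rightarrow> 'a \<Rightarrow> 'a" where e: "\<forall>b\<in>B. smooth_on U (\<epsilon> b)"
      "\<forall>x\<in>U. (\<forall>b\<in>B. \<forall>c\<in>B. g x (\<epsilon> b x) (\<epsilon> c x) = (if b = c then 1 else 0)) \<and> (\<lambda>b. \<epsilon> b x) ` B \<subseteq> span B"
      by blast
    then have \<epsilon>: "\<And>b. b \<in> B \<Longrightarrow> smooth_on U (\<epsilon> b)"
      "\<And>x b c. x \<in> U \<Longrightarrow> b \<in> B \<Longrightarrow> c \<in> B \<Longrightarrow> g x (\<epsilon> b x) (\<epsilon> c x) = (if b = c then 1 else 0)"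
      "\<And>x b. x \<in> U \<Longrightarrow> b \<in> B \<Longrightarrow> \<epsilon> b x \<in> span B" by (blast, blast, blast)
    define z where "z x = a - (\<Sum>b\<in>B. g x a (\<epsilon> b x) *\<^sub>R \<epsilon> b x)" for x
    have zs: "smooth_on U z"
      unfolding z_def by (intro smooth_on_diff smooth_on_sum smooth_on_scaleR smooth_on_const gs \<epsilon>(1) U)
    have ind: "independent (insert a B)"
      using insert.prems independent_Basis independent_mono by blast
    have zsp: "z x \<in> span (insert a B)" if "x \<in> U" for x
      unfolding z_def using \<epsilon>(3)[OF that] span_mono[of B "insert a B"]
      by (intro span_diff span_sum span_scale) (auto intro: span_base)
    have zn: "z x \<noteq> 0" if x: "x \<in> U" for x
    proof
      assume "z x = 0"
      moreover have "(\<Sum>b\<in>B. g x a (\<epsilon> b x) *\<^sub>R \<epsilon> b x) \<in> span B"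
        by (intro span_sum span_scale \<epsilon>(3)[OF x])
      ultimately have "a \<in> span B" by (simp add: z_def)
      then show False using ind insert.hyps by (simp add: independent_insert)
    qed
    have zp: "g x (z x) (z x) > 0" if "x \<in> U" for x
      using zn[OF that] inner_form.pos[OF inn[OF that]] by blast
    define w where "w x = inverse (sqrt (g x (z x) (z x))) *\<^sub>R z x" for x
    have ws: "smooth_on U w"
      unfolding w_def
    proof (intro smooth_on_scaleR smooth_on_inverse smooth_on_sqrt gs zs U zp)
      show "sqrt (g x (z x) (z x)) \<noteq> 0" if "x \<in> U" for x using zp[OF that] by simp
    qed
    have zb: "g x (z x) (\<epsilon> b x) = 0" if x: "x \<in> U" and b: "b \<in> B" for x b
    proof -
      interpret inner_form "g x" by (rule inn[OF x])
      have "(\<Sum>c\<in>B. g x a (\<epsilon> c x) * g x (\<epsilon> c x) (\<epsilon> b x)) = (\<Sum>c\<in>B. if c = b then g x a (\<epsilon> b x) else 0)"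
        by (rule sum.cong) (use \<epsilon>(2)[OF x _ b] in auto)
      then show ?thesis using insert.hyps b by (simp add: z_def h_sum)
    qed
    have w1: "g x (w x) (w x) = 1" "b \<in> B \<Longrightarrow> g x (w x) (\<epsilon> b x) = 0" "b \<in> B \<Longrightarrow> g x (\<epsilon> b x) (w x) = 0"
      if x: "x \<in> U" for x b
    proof -
      interpret inner_form "g x" by (rule inn[OF x])
      show "g x (w x) (w x) = 1" using zp[OF x] by (simp add: w_def field_simps)
      show "b \<in> B \<Longrightarrow> g x (w x) (\<epsilon> b x) = 0" using zb[OF x] by (simp add: w_def)
      then show "b \<in> B \<Longrightarrow> g x (\<epsilon> b x) (w x) = 0" by (simp add: sym)
    qed
    have wsp: "w x \<in> span (insert a B)" if "x \<in> U" for x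
      unfolding w_def by (intro span_scale zsp that)
    show ?case
    proof (intro exI[of _ "\<epsilon>(a := w)"] conjI ballI)
      show "smooth_on U ((\<epsilon>(a := w)) b)" if "b \<in> insert a B" for b
        using that ws \<epsilon>(1) by auto
      show "g x ((\<epsilon>(a := w)) b x) ((\<epsilon>(a := w)) c x) = (if b = c then 1 else 0)"
        if "x \<in> U" "b \<in> insert a B" "c \<in> insert a B" for x b c
        using that w1[OF that(1)] \<epsilon>(2)[OF that(1)] insert.hyps by auto
      show "(\<lambda>b. (\<epsilon>(a := w)) b x) ` insert a B \<subseteq> span (insert a B)" if x: "x \<in> U" for x
        using wsp[OF x] subsetD[OF span_mono[OF subset_insertI] \<epsilon>(3)[OF x], of _ a] insert.hyps by auto
    qed
  qed auto
  from this[OF finite_Basis order_refl] show ?thesis by blast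
qed

lemma frame_onb:
  assumes h: "inner_form h" and e: "\<And>b c. b \<in> Basis \<Longrightarrow> c \<in> Basis \<Longrightarrow> h (e b) (e c) = (if b = c then 1 else 0)"
  shows "inner_form.onb h (e ` Basis)" "inj_on (e :: 'a::euclidean_space \<Rightarrow> 'a) Basis"
proof -
  interpret inner_form h by (rule h)
  show i: "inj_on e Basis" by (rule inj_onI) (metis e zero_neq_one)
  have "orth (e ` Basis)" unfolding orth_def using e i by (auto simp: inj_on_eq_iff)
  then show "onb (e ` Basis)" by (rule orth_card_onb) (simp add: card_image i)
qed

lemma smooth_on_sharp:
  fixes U :: "'a::euclidean_space set"
  assumes U: "open U" and g: "riemannian_metric_on U g"
    and a: "\<And>v. smooth_on U (\<lambda>x. \<alpha> x v)" "\<And>x. x \<in> U \<Longrightarrow> linear (\<alpha> x)"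
  shows "smooth_on U (\<lambda>x. sharp (g x) (\<alpha> x))"
proof -
  obtain \<epsilon> :: "'a \<Rightarrow> 'a \<Rightarrow> 'a" where \<epsilon>: "\<And>b. b \<in> Basis \<Longrightarrow> smooth_on U (\<epsilon> b)"
    "\<And>x b c. x \<in> U \<Longrightarrow> b \<in> Basis \<Longrightarrow> c \<in> Basis \<Longrightarrow> g x (\<epsilon> b x) (\<epsilon> c x) = (if b = c then 1 else 0)"
    using smooth_orthonormal_frame[OF U g] by blast
  show ?thesis
  proof (rule smooth_on_cong[OF U])
    show "smooth_on U (\<lambda>x. \<Sum>b\<in>Basis. \<alpha> x (\<epsilon> b x) *\<^sub>R \<epsilon> b x)"
    proof (intro smooth_on_sum smooth_on_scaleR U)
      fix b :: 'a assume b: "b \<in> Basis"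
      show "smooth_on U (\<epsilon> b)" using \<epsilon>(1)[OF b] .
      show "smooth_on U (\<lambda>x. \<alpha> x (\<epsilon> b x))" by (rule smooth_on_apply_linear[OF U a \<epsilon>(1)[OF b]])
    qed
    fix x assume x: "x \<in> U"
    note f = frame_onb[OF riemannian_inner_form[OF g x] \<epsilon>(2)[OF x]]
    show "(\<Sum>b\<in>Basis. \<alpha> x (\<epsilon> b x) *\<^sub>R \<epsilon> b x) = sharp (g x) (\<alpha> x)"
      using inner_form.sharp_onb[OF riemannian_inner_form[OF g x] a(2)[OF x] f(1)]
      by (simp add: sum.reindex[OF f(2)])
  qed
qed

section \<open>The Levi-Civita connection\<close>

lemma FD_along_line:
  assumes S: "open S" and f: "smooth_on S f" and x: "x + s *\<^sub>R u \<in> S"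
  shows "((\<lambda>s. f (x + s *\<^sub>R u)) has_real_derivative FD f (x + s *\<^sub>R u) u) (at s)"
proof -
  have l: "linear (FD f (x + s *\<^sub>R u))" by (rule smooth_on_FD_linear[OF f x])
  have "((\<lambda>s. x + s *\<^sub>R u) has_derivative (\<lambda>s. s *\<^sub>R u)) (at s)"
    by (auto intro!: derivative_eq_intros)
  from has_derivative_compose[OF this smooth_on_has_derivative[OF f x]]
  show ?thesis by (simp add: has_field_derivative_def linear_cmul[OF l] mult_commute_abs)
qed

lemma second_difference:
  fixes f :: "'a::euclidean_space \<Rightarrow> real"
  assumes S: "open S" and f: "smooth_on S f" and h: "h > 0"
    and in_S: "\<And>s t. 0 \<le> s \<Longrightarrow> s \<le> h \<Longrightarrow> 0 \<le> t \<Longrightarrow> t \<le> h \<Longrightarrow> x + s *\<^sub>R u + t *\<^sub>R v \<in> S"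
  shows "\<exists>s t. 0 \<le> s \<and> s \<le> h \<and> 0 \<le> t \<and> t \<le> h \<and>
    f (x + h *\<^sub>R u + h *\<^sub>R v) - f (x + h *\<^sub>R u) - (f (x + h *\<^sub>R v) - f x)
      = h * h * FD (\<lambda>z. FD f z u) (x + s *\<^sub>R u + t *\<^sub>R v) v"
proof -
  have 1: "((\<lambda>s. f (x + s *\<^sub>R u + h *\<^sub>R v) - f (x + s *\<^sub>R u)) has_real_derivative
    FD f (x + s *\<^sub>R u + h *\<^sub>R v) u - FD f (x + s *\<^sub>R u) u) (at s)" if "0 \<le> s" "s \<le> h" for s
    using FD_along_line[OF S f, of "x + h *\<^sub>R v" s u] FD_along_line[OF S f, of x s u]
      in_S[OF that, of h] in_S[OF that, of 0] h
    by (intro DERIV_diff) (simp_all add: add.commute add.left_commute)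
  obtain s where s: "0 < s" "s < h" "f (x + h *\<^sub>R u + h *\<^sub>R v) - f (x + h *\<^sub>R u) - (f (x + h *\<^sub>R v) - f x)
      = h * (FD f (x + s *\<^sub>R u + h *\<^sub>R v) u - FD f (x + s *\<^sub>R u) u)"
    using MVT2[OF h 1] by auto
  have 2: "((\<lambda>t. FD f (x + s *\<^sub>R u + t *\<^sub>R v) u) has_real_derivative
    FD (\<lambda>z. FD f z u) (x + s *\<^sub>R u + t *\<^sub>R v) v) (at t)" if "0 \<le> t" "t \<le> h" for t
    by (rule FD_along_line[OF S smooth_on_FD[OF f]]) (use in_S that s in auto)
  obtain t where "0 < t" "t < h" "FD f (x + s *\<^sub>R u + h *\<^sub>R v) u - FD f (x + s *\<^sub>R u) u
     = h * FD (\<lambda>z. FD f z u) (x + s *\<^sub>R u + t *\<^sub>R v) v"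
    using MVT2[OF h 2] by auto
  then show ?thesis using s by (intro exI[of _ s] exI[of _ t]) auto
qed

text \<open>The second difference over a small parallelogram equals its scaled mixed derivative at
  some nearby point, for either order of differentiation; continuity gives the equality in the
  limit.\<close>

lemma FD_commute_real:
  fixes f :: "'a::euclidean_space \<Rightarrow> real"
  assumes S: "open S" and f: "smooth_on S f" and x: "x \<in> S"
  shows "FD (\<lambda>z. FD f z u) x v = FD (\<lambda>z. FD f z v) x u"
proof -
  obtain r where r: "r > 0" "ball x r \<subseteq> S" using S x openE by blast
  \<comment> \<open>Tends to 0 and keeps the parallelograms inside the ball; the summand 1 in the
    denominator covers \<open>u = v = 0\<close>.\<close>
  define h where "h n = (r / (norm u + norm v + 1) / 2) * (1 / real (Suc n))" for n
  have c: "norm u + norm v + 1 > 0" by (simp add: add_nonneg_pos)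
  have h0: "h n > 0" for n using r c by (simp add: h_def)
  have hlim: "h \<longlonglongrightarrow> 0"
  proof -
    have "(\<lambda>n. (r / (norm u + norm v + 1) / 2) * (1 / real (Suc n))) \<longlonglongrightarrow> (r / (norm u + norm v + 1) / 2) * 0"
      by (intro tendsto_mult tendsto_const LIMSEQ_Suc lim_1_over_n)
    then show ?thesis unfolding h_def[abs_def] by simp
  qed
  have hle: "h n * (norm u + norm v) < r" for n
  proof -
    have "h n * (norm u + norm v) \<le> (r / (norm u + norm v + 1) / 2) * (norm u + norm v)"
      unfolding h_def
    proof (rule mult_right_mono)
      show "(r / (norm u + norm v + 1) / 2) * (1 / real (Suc n)) \<le> r / (norm u + norm v + 1) / 2"
        using r c by (intro mult_right_le_one_le) auto
    qed auto
    also have "\<dots> < r"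
    proof -
      have "r * (norm u + norm v) < r * (2 * (norm u + norm v + 1))"
      proof (rule mult_strict_left_mono[OF _ r(1)])
        show "norm u + norm v < 2 * (norm u + norm v + 1)"
          using norm_ge_zero[of u] norm_ge_zero[of v] by (smt (verit))
      qed
      then show ?thesis using c by (simp add: divide_simps mult.commute mult.left_commute)
    qed
    finally show ?thesis .
  qed
  have near: "norm (s *\<^sub>R u + t *\<^sub>R v) \<le> h n * (norm u + norm v)"
    if "0 \<le> s" "s \<le> h n" "0 \<le> t" "t \<le> h n" for s t n u v
  proof -
    have "norm (s *\<^sub>R u + t *\<^sub>R v) \<le> s * norm u + t * norm v"
      using norm_triangle_ineq[of "s *\<^sub>R u" "t *\<^sub>R v"] that by simp
    also have "\<dots> \<le> h n * norm u + h n * norm v" by (intro add_mono mult_right_mono that) auto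
    finally show ?thesis by (simp add: algebra_simps)
  qed
  have inS: "x + s *\<^sub>R u' + t *\<^sub>R v' \<in> S" if "0 \<le> s" "s \<le> h n" "0 \<le> t" "t \<le> h n"
    "norm u' + norm v' = norm u + norm v" for s t n u' v'
    using near[OF that(1-4), of u' v'] hle[of n] r that(5)
    by (intro subsetD[OF r(2)]) (simp add: dist_norm norm_minus_commute algebra_simps)
  define Q where "Q u v n st \<longleftrightarrow> 0 \<le> fst st \<and> fst st \<le> h n \<and> 0 \<le> snd st \<and> snd st \<le> h n \<and>
    f (x + h n *\<^sub>R u + h n *\<^sub>R v) - f (x + h n *\<^sub>R u) - (f (x + h n *\<^sub>R v) - f x)
      = h n * h n * FD (\<lambda>z. FD f z u) (x + fst st *\<^sub>R u + snd st *\<^sub>R v) v" for u v n st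
  have D: "\<forall>n. \<exists>st. Q u' v' n st" if uv: "norm u' + norm v' = norm u + norm v" for u' v'
  proof
    fix n
    have in': "x + s *\<^sub>R u' + t *\<^sub>R v' \<in> S" if "0 \<le> s" "s \<le> h n" "0 \<le> t" "t \<le> h n" for s t
      by (rule inS[OF that uv])
    obtain s t where "0 \<le> s \<and> s \<le> h n \<and> 0 \<le> t \<and> t \<le> h n \<and>
      f (x + h n *\<^sub>R u' + h n *\<^sub>R v') - f (x + h n *\<^sub>R u') - (f (x + h n *\<^sub>R v') - f x)
        = h n * h n * FD (\<lambda>z. FD f z u') (x + s *\<^sub>R u' + t *\<^sub>R v') v'"
      using second_difference[OF S f h0 in', of n] by blast
    then show "\<exists>st. Q u' v' n st" unfolding Q_def by (intro exI[of _ "(s, t)"]) simp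
  qed
  obtain \<sigma> where \<sigma>: "\<forall>n. Q u v n (\<sigma> n)" using choice[OF D[OF refl]] by blast
  obtain \<sigma>' where \<sigma>': "\<forall>n. Q v u n (\<sigma>' n)" using choice[OF D[OF add.commute]] by blast
  define s t s' t' where "s n = fst (\<sigma> n)" and "t n = snd (\<sigma> n)"
    and "s' n = fst (\<sigma>' n)" and "t' n = snd (\<sigma>' n)" for n
  have st: "0 \<le> s n \<and> s n \<le> h n \<and> 0 \<le> t n \<and> t n \<le> h n \<and>
    f (x + h n *\<^sub>R u + h n *\<^sub>R v) - f (x + h n *\<^sub>R u) - (f (x + h n *\<^sub>R v) - f x)
      = h n * h n * FD (\<lambda>z. FD f z u) (x + s n *\<^sub>R u + t n *\<^sub>R v) v" for n
    using \<sigma>[rule_format, of n] unfolding Q_def s_def t_def .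
  have st': "0 \<le> s' n \<and> s' n \<le> h n \<and> 0 \<le> t' n \<and> t' n \<le> h n \<and>
    f (x + h n *\<^sub>R v + h n *\<^sub>R u) - f (x + h n *\<^sub>R v) - (f (x + h n *\<^sub>R u) - f x)
      = h n * h n * FD (\<lambda>z. FD f z v) (x + s' n *\<^sub>R v + t' n *\<^sub>R u) u" for n
    using \<sigma>'[rule_format, of n] unfolding Q_def s'_def t'_def .
  have eq: "FD (\<lambda>z. FD f z u) (x + s n *\<^sub>R u + t n *\<^sub>R v) v = FD (\<lambda>z. FD f z v) (x + s' n *\<^sub>R v + t' n *\<^sub>R u) u" for n
  proof -
    have "x + h n *\<^sub>R v + h n *\<^sub>R u = x + h n *\<^sub>R u + h n *\<^sub>R v" by (simp add: algebra_simps)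
    then have "h n * h n * FD (\<lambda>z. FD f z u) (x + s n *\<^sub>R u + t n *\<^sub>R v) v
      = h n * h n * FD (\<lambda>z. FD f z v) (x + s' n *\<^sub>R v + t' n *\<^sub>R u) u"
      using st[of n] st'[of n] unfolding \<open>x + h n *\<^sub>R v + h n *\<^sub>R u = _\<close> by linarith
    then show ?thesis using h0[of n] by simp
  qed
  have lim: "(\<lambda>n. F (x + s n *\<^sub>R u' + t n *\<^sub>R v')) \<longlonglongrightarrow> F x"
    if F: "smooth_on S F" and b: "\<And>n. 0 \<le> s n \<and> s n \<le> h n \<and> 0 \<le> t n \<and> t n \<le> h n"
    for F :: "'a \<Rightarrow> real" and s t u' v'
  proof -
    have "s \<longlonglongrightarrow> 0" "t \<longlonglongrightarrow> 0"
      using tendsto_sandwich[of "\<lambda>_. 0" s sequentially h 0] tendsto_sandwich[of "\<lambda>_. 0" t sequentially h 0] b hlim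
      by auto
    then have "(\<lambda>n. x + s n *\<^sub>R u' + t n *\<^sub>R v') \<longlonglongrightarrow> x + 0 *\<^sub>R u' + 0 *\<^sub>R v'"
      by (intro tendsto_intros)
    moreover have "isCont F x" using smooth_on_continuous[OF F] S x continuous_on_eq_continuous_at by blast
    ultimately show ?thesis using isCont_tendsto_compose[of x F] by simp
  qed
  have "(\<lambda>n. FD (\<lambda>z. FD f z u) (x + s n *\<^sub>R u + t n *\<^sub>R v) v) \<longlonglongrightarrow> FD (\<lambda>z. FD f z u) x v"
    using lim[of "\<lambda>y. FD (\<lambda>z. FD f z u) y v" s t u v] st by (blast intro: smooth_on_FD f)
  moreover have "(\<lambda>n. FD (\<lambda>z. FD f z v) (x + s' n *\<^sub>R v + t' n *\<^sub>R u) u) \<longlonglongrightarrow> FD (\<lambda>z. FD f z v) x u"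
    using lim[of "\<lambda>y. FD (\<lambda>z. FD f z v) y u" s' t' v u] st' by (blast intro: smooth_on_FD f)
  ultimately show ?thesis using eq LIMSEQ_unique by simp
qed

lemma FD_inner:
  assumes "f differentiable (at x)" shows "FD (\<lambda>z. f z \<bullet> b) x u = FD f x u \<bullet> b"
proof -
  have "((\<lambda>z. f z \<bullet> b) has_derivative (\<lambda>u. FD f x u \<bullet> b)) (at x)"
    using bounded_linear.has_derivative[OF bounded_linear_inner_left FD_works[OF assms]] .
  then show ?thesis by (simp add: FD_eqI)
qed

lemma FD_commute:
  fixes f :: "'a::euclidean_space \<Rightarrow> 'b::euclidean_space"
  assumes S: "open S" and f: "smooth_on S f" and x: "x \<in> S"
  shows "FD (\<lambda>z. FD f z u) x v = FD (\<lambda>z. FD f z v) x u"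
proof (rule euclidean_eqI)
  fix b :: 'b
  have fb: "smooth_on S (\<lambda>z. f z \<bullet> b)" by (intro smooth_on_inner S f smooth_on_const)
  have 1: "FD (\<lambda>z. FD (\<lambda>z. f z \<bullet> b) z u) x v = FD (\<lambda>z. FD f z u) x v \<bullet> b" for u v
  proof -
    have "FD (\<lambda>z. FD (\<lambda>z. f z \<bullet> b) z u) x v = FD (\<lambda>z. FD f z u \<bullet> b) x v"
      using FD_cong_open[OF S x, of "\<lambda>z. FD (\<lambda>z. f z \<bullet> b) z u" "\<lambda>z. FD f z u \<bullet> b"]
        FD_inner[OF smooth_on_differentiable[OF f]] by simp
    also have "\<dots> = FD (\<lambda>z. FD f z u) x v \<bullet> b"
      by (rule FD_inner[OF smooth_on_differentiable[OF smooth_on_FD[OF f] x]])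
    finally show ?thesis .
  qed
  show "FD (\<lambda>z. FD f z u) x v \<bullet> b = FD (\<lambda>z. FD f z v) x u \<bullet> b"
    using FD_commute_real[OF S fb x, of u v] unfolding 1 .
qed

text \<open>Two such connections differ by a form \<open>T\<close> that is symmetric in the first
  two arguments and skew in the last two, hence zero. Nondegeneracy takes the place of positivity,
  so that the indefinite Ricci metric is covered.\<close>

lemma levi_civita_eqI:
  fixes g :: "'e::euclidean_space \<Rightarrow> 'e \<Rightarrow> 'e \<Rightarrow> real"
  assumes G: "bilinear G" "\<And>u v. G u v = G v u"
    "\<And>u v w. FD (\<lambda>y. g y v w) x u = g x (G u v) w + g x v (G u w)"
    and g: "bilinear (g x)" "\<And>u v. g x u v = g x v u" "\<And>z. (\<And>w. g x z w = 0) \<Longrightarrow> z = 0"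
  shows "levi_civita g x = G"
  unfolding levi_civita_def
proof (rule the_equality)
  show "bilinear G \<and> (\<forall>u v. G u v = G v u) \<and>
    (\<forall>u v w. FD (\<lambda>y. g y v w) x u = g x (G u v) w + g x v (G u w))" using G by auto
next
  fix G' assume G': "bilinear G' \<and> (\<forall>u v. G' u v = G' v u) \<and>
    (\<forall>u v w. FD (\<lambda>y. g y v w) x u = g x (G' u v) w + g x v (G' u w))"
  define T where "T u v w = g x (G' u v) w - g x (G u v) w" for u v w
  have s: "T u v w = T v u w" for u v w using G' G(2)[of u v] by (simp add: T_def)
  have a: "T u v w = - T u w v" for u v w
    using G' G(3)[of v w u] g(2)[of v "G' u w"] g(2)[of v "G u w"] by (simp add: T_def)
  have "T u v w = 0" for u v w
    using a[of u v w] s[of u w v] a[of w u v] s[of w v u] a[of v w u] s[of v u w] by simp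
  then have "g x (G' u v - G u v) w = 0" for u v w
    using g(1) by (simp add: T_def bilinear_lsub)
  then show "G' = G" using g(3) by (metis ext eq_iff_diff_eq_0)
qed

locale riemannian =
  fixes U :: "'e::euclidean_space set" and g :: "'e \<Rightarrow> 'e \<Rightarrow> 'e \<Rightarrow> real"
  assumes U: "open U" and g: "riemannian_metric_on U g"
begin

lemma inner_g: "x \<in> U \<Longrightarrow> inner_form (g x)"
  using g by (rule riemannian_inner_form)

lemma g_smooth: "smooth_on U (\<lambda>x. g x u v)"
  using g by (simp add: riemannian_metric_on_def)

lemma g_bilinear: "x \<in> U \<Longrightarrow> bilinear (g x)"
  using g by (simp add: riemannian_metric_on_def)

lemma g_sym: "x \<in> U \<Longrightarrow> g x u v = g x v u"
  using g by (simp add: riemannian_metric_on_def)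

definition dg where "dg x u v w = FD (\<lambda>y. g y v w) x u"

lemma dg_linear:
  assumes x: "x \<in> U"
  shows "linear (\<lambda>u. dg x u v w)" "linear (\<lambda>v. dg x u v w)" "linear (\<lambda>w. dg x u v w)"
proof -
  have d: "((\<lambda>y. g y v w) has_derivative FD (\<lambda>y. g y v w) x) (at x)" for v w
    by (rule smooth_on_has_derivative[OF g_smooth x])
  show "linear (\<lambda>u. dg x u v w)"
    unfolding dg_def by (rule smooth_on_FD_linear[OF g_smooth x])
  show l: "linear (\<lambda>v. dg x u v w)" for u w
  proof
    fix a b :: 'e and r :: real
    have "FD (\<lambda>y. g y (a + b) w) x = FD (\<lambda>y. g y a w + g y b w) x"
      by (rule FD_cong_open[OF U x]) (simp add: bilinear_ladd g_bilinear)
    then show "dg x u (a + b) w = dg x u a w + dg x u b w"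
      using FD_eqI[OF has_derivative_add[OF d d]] by (simp add: dg_def)
    have "FD (\<lambda>y. g y (r *\<^sub>R a) w) x = FD (\<lambda>y. r *\<^sub>R g y a w) x"
      by (rule FD_cong_open[OF U x]) (simp add: bilinear_lmul g_bilinear)
    then show "dg x u (r *\<^sub>R a) w = r *\<^sub>R dg x u a w"
      using FD_eqI[OF has_derivative_scaleR_right[OF d]] by (simp add: dg_def)
  qed
  have "dg x u v w = dg x u w v" for w
    unfolding dg_def using FD_cong_open[OF U x, of "\<lambda>y. g y v w" "\<lambda>y. g y w v"] g_sym by simp
  then show "linear (\<lambda>w. dg x u v w)" using l[of u v] by simp
qed

lemma dg_sym: "x \<in> U \<Longrightarrow> dg x u v w = dg x u w v"
  unfolding dg_def using FD_cong_open[OF U, of x "\<lambda>y. g y v w" "\<lambda>y. g y w v"] g_sym by simp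

text \<open>The Koszul formula on coordinate-constant fields, whose brackets vanish.\<close>

definition koszul where "koszul x u v w = (dg x u v w + dg x v u w - dg x w u v) / 2"

lemma koszul_linear:
  assumes x: "x \<in> U"
  shows "linear (\<lambda>u. koszul x u v w)" "linear (\<lambda>v. koszul x u v w)" "linear (\<lambda>w. koszul x u v w)"
  unfolding koszul_def using dg_linear[OF x]
  by (auto simp: linear_iff add_divide_distrib diff_divide_distrib algebra_simps)

definition lc where "lc x u v = sharp (g x) (koszul x u v)"

lemma lc_inner: "x \<in> U \<Longrightarrow> g x (lc x u v) w = koszul x u v w"
  unfolding lc_def using inner_form.sharp_works[OF inner_g koszul_linear(3)] .

lemma lc_eq:
  assumes x: "x \<in> U" shows "levi_civita g x = lc x"
proof (rule levi_civita_eqI)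
  interpret inner_form "g x" by (rule inner_g[OF x])
  note k = koszul_linear[OF x]
  show "bilinear (lc x)"
    unfolding bilinear_def linear_iff
    by (auto intro!: h_ext simp: lc_inner[OF x] linear_add[OF k(1)] linear_add[OF k(2)]
        linear_cmul[OF k(1)] linear_cmul[OF k(2)])
  show "lc x u v = lc x v u" for u v
    by (rule h_ext) (simp add: lc_inner[OF x] koszul_def dg_sym[OF x])
  show "FD (\<lambda>y. g y v w) x u = g x (lc x u v) w + g x v (lc x u w)" for u v w
  proof -
    have "g x v (lc x u w) = koszul x u w v" using sym lc_inner[OF x] by simp
    then show ?thesis
      by (simp add: lc_inner[OF x] koszul_def dg_sym[OF x, of _ w] dg_def[symmetric] dg_sym[OF x, of u w v] add_divide_distrib diff_divide_distrib)
  qed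
  show "bilinear (g x)" by (rule bil)
  show "g x u v = g x v u" for u v by (rule sym)
  show "z = 0" if "\<And>w. g x z w = 0" for z using that h_eq_0 by blast
qed

lemma lc_bilinear: "x \<in> U \<Longrightarrow> bilinear (levi_civita g x)"
  and lc_sym: "x \<in> U \<Longrightarrow> levi_civita g x u v = levi_civita g x v u"
  and lc_compat: "x \<in> U \<Longrightarrow> FD (\<lambda>y. g y v w) x u = g x (levi_civita g x u v) w + g x v (levi_civita g x u w)"
proof -
  assume x: "x \<in> U"
  interpret inner_form "g x" by (rule inner_g[OF x])
  note k = koszul_linear[OF x]
  show "bilinear (levi_civita g x)"
    unfolding lc_eq[OF x] bilinear_def linear_iff
    by (auto intro!: h_ext simp: lc_inner[OF x] linear_add[OF k(1)] linear_add[OF k(2)]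
        linear_cmul[OF k(1)] linear_cmul[OF k(2)])
  show "levi_civita g x u v = levi_civita g x v u"
    unfolding lc_eq[OF x] by (rule h_ext) (simp add: lc_inner[OF x] koszul_def dg_sym[OF x])
  have "g x v (lc x u w) = koszul x u w v" using sym lc_inner[OF x] by simp
  then show "FD (\<lambda>y. g y v w) x u = g x (levi_civita g x u v) w + g x v (levi_civita g x u w)"
    unfolding lc_eq[OF x]
    by (simp add: lc_inner[OF x] koszul_def dg_sym[OF x, of _ w] dg_def[symmetric] dg_sym[OF x, of u w v] add_divide_distrib diff_divide_distrib)
qed

lemma lc_smooth: "smooth_on U (\<lambda>x. levi_civita g x u v)"
proof (rule smooth_on_cong[OF U])
  show "smooth_on U (\<lambda>x. lc x u v)"
    unfolding lc_def
  proof (rule smooth_on_sharp[OF U g])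
    show "smooth_on U (\<lambda>x. koszul x u v w)" for w
      unfolding koszul_def dg_def divide_real_def
      by (intro smooth_on_mult smooth_on_add smooth_on_diff smooth_on_const smooth_on_FD g_smooth U)
  qed (rule koszul_linear(3))
qed (simp add: lc_eq)

end

lemma nabla_zero: "bilinear (G x) \<Longrightarrow> linear (FD Y x) \<Longrightarrow> nabla G (\<lambda>_. 0) Y x = 0"
  by (simp add: nabla_def linear_0 bilinear_lzero)

lemma curv_at_eq:
  assumes U: "open U" and p: "p \<in> U" and G: "\<And>u v. smooth_on U (\<lambda>q. G q u v)" "\<And>q. q \<in> U \<Longrightarrow> bilinear (G q)"
  shows "curv_at G p a b w = FD (\<lambda>q. G q b w) p a - FD (\<lambda>q. G q a w) p b + G p a (G p b w) - G p b (G p a w)"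
proof -
  have "bracket (\<lambda>_. a) (\<lambda>_. b) = (\<lambda>_. 0)" by (simp add: bracket_def fun_eq_iff)
  then show ?thesis
    using nabla_zero[of G p "\<lambda>_. w"] G(2)[OF p]
    by (simp add: curv_at_def curvature_def nabla_def[abs_def] module_hom_zero linear_iff)
qed

section \<open>Covariant derivatives along a map\<close>

text \<open>The connection is a general torsion-free one because this calculus is used twice: for
  the ambient Levi-Civita connection and for the connection of the Ricci tensor.\<close>

locale along_map =
  fixes U :: "'e::euclidean_space set" and G :: "'e \<Rightarrow> 'e \<Rightarrow> 'e \<Rightarrow> 'e"
    and W :: "'f::euclidean_space set" and P :: "'f \<Rightarrow> 'e"
  assumes oU: "open U" and oW: "open W" and P: "smooth_on W P" and PU: "P ` W \<subseteq> U"
    and Gs: "\<And>u v. smooth_on U (\<lambda>q. G q u v)" and Gb: "\<And>q. q \<in> U \<Longrightarrow> bilinear (G q)"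
    and Gsym: "\<And>q u v. q \<in> U \<Longrightarrow> G q u v = G q v u"
begin

lemma Px: "x \<in> W \<Longrightarrow> P x \<in> U" using PU by auto

lemma G_linear: "q \<in> U \<Longrightarrow> linear (G q u)" "q \<in> U \<Longrightarrow> linear (\<lambda>u. G q u v)"
  using Gb by (auto simp: bilinear_def)

lemmas G_simps [simp] = linear_add[OF G_linear(1)] linear_add[OF G_linear(2)]
  linear_diff[OF G_linear(1)] linear_diff[OF G_linear(2)] linear_cmul[OF G_linear(1)]
  linear_cmul[OF G_linear(2)] linear_0[OF G_linear(1)] linear_0[OF G_linear(2)]

definition cd :: "'f \<Rightarrow> ('f \<Rightarrow> 'e) \<Rightarrow> 'f \<Rightarrow> 'e"
  where "cd u Y x = FD Y x u + G (P x) (FD P x u) (Y x)"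

lemma along_cd: "along G P X Y x = cd (X x) Y x"
  by (simp add: along_def cd_def)

lemma dP_linear: "x \<in> W \<Longrightarrow> linear (FD P x)"
  by (rule smooth_on_FD_linear[OF P])

lemma compose_smooth: "smooth_on U F \<Longrightarrow> smooth_on W (\<lambda>x. F (P x))"
  by (rule smooth_on_compose[OF oW _ P PU])

lemma compose_apply1:
  fixes A :: "'e \<Rightarrow> 'b::euclidean_space \<Rightarrow> 'c::real_normed_vector"
  assumes "\<And>v. smooth_on U (\<lambda>q. A q v)" "\<And>q. q \<in> U \<Longrightarrow> linear (A q)" "smooth_on W Y"
  shows "smooth_on W (\<lambda>x. A (P x) (Y x))"
  by (rule smooth_on_apply_linear[OF oW, of "\<lambda>x. A (P x)"]) (use assms Px compose_smooth in auto)

lemma compose_apply2: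
  fixes A :: "'e \<Rightarrow> 'b::euclidean_space \<Rightarrow> 'd::euclidean_space \<Rightarrow> 'c::real_normed_vector"
  assumes "\<And>u v. smooth_on U (\<lambda>q. A q u v)" "\<And>q. q \<in> U \<Longrightarrow> bilinear (A q)" "smooth_on W Y" "smooth_on W Z"
  shows "smooth_on W (\<lambda>x. A (P x) (Y x) (Z x))"
  by (rule smooth_on_apply_bilinear[OF oW, of "\<lambda>x. A (P x)"]) (use assms Px in \<open>auto intro: compose_smooth[of "\<lambda>q. A q _ _"]\<close>)

lemma compose_derivative:
  assumes "smooth_on U F" "x \<in> W"
  shows "((\<lambda>x. F (P x)) has_derivative (\<lambda>u. FD F (P x) (FD P x u))) (at x)"
  by (rule has_derivative_compose[OF smooth_on_has_derivative[OF P assms(2)] smooth_on_has_derivative[OF assms(1) Px[OF assms(2)]]])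

lemma compose_apply1_derivative:
  fixes A :: "'e \<Rightarrow> 'b::euclidean_space \<Rightarrow> 'c::real_normed_vector"
  assumes A: "\<And>v. smooth_on U (\<lambda>q. A q v)" "\<And>q. q \<in> U \<Longrightarrow> linear (A q)" and Y: "smooth_on W Y" and x: "x \<in> W"
  shows "((\<lambda>y. A (P y) (Y y)) has_derivative
    (\<lambda>u. FD (\<lambda>q. A q (Y x)) (P x) (FD P x u) + A (P x) (FD Y x u))) (at x)"
proof -
  note d = compose_derivative[OF A(1) x]
  have "((\<lambda>y. A (P y) (Y y)) has_derivative (\<lambda>u. FD (\<lambda>y. A (P y) (Y x)) x u + A (P x) (FD Y x u))) (at x)"
    by (rule has_derivative_apply_linear[OF oW x, of "\<lambda>y. A (P y)"])
      (use d A(2) Px smooth_on_has_derivative[OF Y x] in \<open>auto simp: differentiable_def\<close>)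
  then show ?thesis by (simp add: FD_eqI[OF d])
qed

lemma compose_apply2_derivative:
  fixes A :: "'e \<Rightarrow> 'b::euclidean_space \<Rightarrow> 'd::euclidean_space \<Rightarrow> 'c::real_normed_vector"
  assumes A: "\<And>u v. smooth_on U (\<lambda>q. A q u v)" "\<And>q. q \<in> U \<Longrightarrow> bilinear (A q)"
    and Y: "smooth_on W Y" and Z: "smooth_on W Z" and x: "x \<in> W"
  shows "((\<lambda>y. A (P y) (Y y) (Z y)) has_derivative
    (\<lambda>u. FD (\<lambda>q. A q (Y x) (Z x)) (P x) (FD P x u) + A (P x) (FD Y x u) (Z x) + A (P x) (Y x) (FD Z x u))) (at x)"
proof -
  have d: "((\<lambda>y. A (P y) u v) has_derivative (\<lambda>w. FD (\<lambda>q. A q u v) (P x) (FD P x w))) (at x)" for u v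
    by (rule compose_derivative[OF A(1) x])
  have "((\<lambda>y. A (P y) (Y y) (Z y)) has_derivative (\<lambda>u. FD (\<lambda>y. A (P y) (Y x) (Z x)) x u
      + A (P x) (FD Y x u) (Z x) + A (P x) (Y x) (FD Z x u))) (at x)"
    by (rule has_derivative_apply_bilinear[OF oW x, of "\<lambda>y. A (P y)"])
      (use d A(2) Px smooth_on_has_derivative[OF Y x] smooth_on_has_derivative[OF Z x] in \<open>auto simp: differentiable_def\<close>)
  then show ?thesis by (simp add: FD_eqI[OF d])
qed

lemma cd_linear:
  assumes Y: "smooth_on W Y" and x: "x \<in> W"
  shows "linear (\<lambda>u. cd u Y x)"
proof -
  have "linear ((\<lambda>u. G (P x) u (Y x)) \<circ> FD P x)"
    by (rule linear_compose[OF dP_linear[OF x] G_linear(2)[OF Px[OF x]]])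
  from linear_compose_add[OF smooth_on_FD_linear[OF Y x] this] show ?thesis
    by (simp add: cd_def o_def)
qed

lemma cd_smooth_const: "smooth_on W Y \<Longrightarrow> smooth_on W (\<lambda>x. cd u Y x)"
  unfolding cd_def
  using smooth_on_add[OF oW smooth_on_FD compose_apply2[OF Gs Gb smooth_on_FD[OF P]], of Y Y u u] .

lemma cd_smooth: "smooth_on W X \<Longrightarrow> smooth_on W Y \<Longrightarrow> smooth_on W (\<lambda>x. cd (X x) Y x)"
  by (rule smooth_on_apply_linear[OF oW, of "\<lambda>x u. cd u Y x"]) (auto intro: cd_smooth_const cd_linear)

lemma dP_smooth: "smooth_on W X \<Longrightarrow> smooth_on W (\<lambda>x. FD P x (X x))"
  by (rule smooth_on_FD_apply[OF oW P])

lemma cd_cong: "(\<And>y. y \<in> W \<Longrightarrow> Y y = Z y) \<Longrightarrow> x \<in> W \<Longrightarrow> cd u Y x = cd u Z x"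
  unfolding cd_def using FD_cong_open[OF oW, of x Y Z] by simp

lemma cd_add: "smooth_on W Y \<Longrightarrow> smooth_on W Z \<Longrightarrow> x \<in> W \<Longrightarrow> cd u (\<lambda>y. Y y + Z y) x = cd u Y x + cd u Z x"
  unfolding cd_def using FD_eqI[OF has_derivative_add[OF smooth_on_has_derivative smooth_on_has_derivative], of W Y x W Z] Px
  by (simp add: algebra_simps)

lemma cd_scale:
  assumes "smooth_on W F" "smooth_on W Y" "x \<in> W"
  shows "cd u (\<lambda>y. F y *\<^sub>R Y y) x = FD F x u *\<^sub>R Y x + F x *\<^sub>R cd u Y x"
  unfolding cd_def using FD_eqI[OF has_derivative_scaleR[OF smooth_on_has_derivative[OF assms(1,3)] smooth_on_has_derivative[OF assms(2,3)]]] Px[OF assms(3)]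
  by (simp add: algebra_simps)

lemma cd_const_scale:
  assumes "smooth_on W Y" "x \<in> W"
  shows "cd u (\<lambda>y. r *\<^sub>R Y y) x = r *\<^sub>R cd u Y x"
  using cd_scale[OF smooth_on_const assms] by simp

lemma cd_minus: "smooth_on W Y \<Longrightarrow> x \<in> W \<Longrightarrow> cd u (\<lambda>y. - Y y) x = - cd u Y x"
  using cd_const_scale[of Y x u "-1"] by simp

lemma cd_diff: "smooth_on W Y \<Longrightarrow> smooth_on W Z \<Longrightarrow> x \<in> W \<Longrightarrow> cd u (\<lambda>y. Y y - Z y) x = cd u Y x - cd u Z x"
  using cd_add[of Y "\<lambda>y. - Z y" x u] cd_minus[of Z x u] smooth_on_minus[OF oW, of Z] by simp

lemma cd_zero: "x \<in> W \<Longrightarrow> cd u (\<lambda>_. 0) x = 0"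
  using Px[of x] by (simp add: cd_def)

lemma FD_apply_field:
  assumes Y: "smooth_on W Y" and Z: "smooth_on W Z" and x: "x \<in> W"
  shows "FD (\<lambda>y. FD Y y (Z y)) x u = FD (\<lambda>y. FD Y y (Z x)) x u + FD Y x (FD Z x u)"
proof -
  have "((\<lambda>y. FD Y y (Z y)) has_derivative (\<lambda>u. FD (\<lambda>y. FD Y y (Z x)) x u + FD Y x (FD Z x u))) (at x)"
    by (rule has_derivative_apply_linear[OF oW x])
      (use x Y Z in \<open>auto intro: smooth_on_differentiable smooth_on_FD smooth_on_FD_linear smooth_on_has_derivative\<close>)
  then show ?thesis by (simp add: FD_eqI)
qed

text \<open>A moving direction contributes its coordinate derivative; antisymmetrised, these
  contributions form the bracket term in \<open>cd_curv\<close>.\<close>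

lemma cd_field:
  assumes Y: "smooth_on W Y" and Z: "smooth_on W Z" and x: "x \<in> W"
  shows "cd u (\<lambda>y. cd (Z y) Y y) x = cd u (\<lambda>y. cd (Z x) Y y) x + cd (FD Z x u) Y x"
proof -
  have "((\<lambda>y. cd (Z y) Y y) has_derivative (\<lambda>u. FD (\<lambda>y. cd (Z x) Y y) x u + cd (FD Z x u) Y x)) (at x)"
    by (rule has_derivative_apply_linear[OF oW x, of "\<lambda>y u. cd u Y y"])
      (use x Y Z in \<open>auto intro: smooth_on_differentiable cd_smooth_const cd_linear smooth_on_has_derivative\<close>)
  from FD_eqI[OF this] show ?thesis by (simp add: cd_def[of u] )
qed

lemma cd_dP:
  assumes Z: "smooth_on W Z" and x: "x \<in> W"
  shows "cd u (\<lambda>y. FD P y (Z y)) x = cd u (\<lambda>y. FD P y (Z x)) x + FD P x (FD Z x u)"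
  using FD_apply_field[OF P Z x] by (simp add: cd_def)

lemma cd_torsion: "x \<in> W \<Longrightarrow> cd u (\<lambda>y. FD P y v) x = cd v (\<lambda>y. FD P y u) x"
  unfolding cd_def using FD_commute[OF oW P, of x v u] Gsym[OF Px] by simp

lemma FD_cd_const:
  assumes Y: "smooth_on W Y" and x: "x \<in> W"
  shows "FD (\<lambda>y. cd v Y y) x u = FD (\<lambda>y. FD Y y v) x u + (FD (\<lambda>q. G q (FD P x v) (Y x)) (P x) (FD P x u)
    + G (P x) (FD (\<lambda>y. FD P y v) x u) (Y x) + G (P x) (FD P x v) (FD Y x u))"
proof -
  have "((\<lambda>y. cd v Y y) has_derivative (\<lambda>u. FD (\<lambda>y. FD Y y v) x u + (FD (\<lambda>q. G q (FD P x v) (Y x)) (P x) (FD P x u)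
    + G (P x) (FD (\<lambda>y. FD P y v) x u) (Y x) + G (P x) (FD P x v) (FD Y x u)))) (at x)"
    unfolding cd_def
    by (rule has_derivative_add[OF smooth_on_has_derivative[OF smooth_on_FD[OF Y] x]
        compose_apply2_derivative[OF Gs Gb smooth_on_FD[OF P] Y x]])
  then show ?thesis by (simp add: FD_eqI)
qed

text \<open>The second derivatives of \<open>P\<close> and of \<open>Y\<close> commute and cancel;
  what remains is the curvature expression of \<open>G\<close> at \<open>P x\<close>.\<close>

lemma cd_curv_const:
  assumes Y: "smooth_on W Y" and x: "x \<in> W"
  shows "cd u (\<lambda>y. cd v Y y) x - cd v (\<lambda>y. cd u Y y) x = curv_at G (P x) (FD P x u) (FD P x v) (Y x)"
proof -
  have 1: "cd u (\<lambda>y. cd v Y y) x = FD (\<lambda>y. FD Y y v) x u + FD (\<lambda>q. G q (FD P x v) (Y x)) (P x) (FD P x u)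
    + G (P x) (FD (\<lambda>y. FD P y v) x u) (Y x) + G (P x) (FD P x v) (FD Y x u)
    + G (P x) (FD P x u) (FD Y x v) + G (P x) (FD P x u) (G (P x) (FD P x v) (Y x))" for u v
    using Px[OF x] by (subst cd_def, subst FD_cd_const[OF Y x]) (simp add: cd_def algebra_simps)
  show ?thesis
    unfolding 1
    using FD_commute[OF oW Y x, of v u] FD_commute[OF oW P x, of v u]
      curv_at_eq[of U "P x" G "FD P x u" "FD P x v" "Y x", OF oU Px[OF x] Gs Gb] by simp
qed

lemma cd_curv:
  assumes Y: "smooth_on W Y" and X: "smooth_on W X" and Z: "smooth_on W Z" and x: "x \<in> W"
  shows "cd (X x) (\<lambda>y. cd (Z y) Y y) x - cd (Z x) (\<lambda>y. cd (X y) Y y) x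
    = curv_at G (P x) (FD P x (X x)) (FD P x (Z x)) (Y x) + cd (FD Z x (X x) - FD X x (Z x)) Y x"
  unfolding cd_field[OF Y Z x] cd_field[OF Y X x] linear_diff[OF cd_linear[OF Y x]]
  using cd_curv_const[OF Y x, of "X x" "Z x"] by simp

lemma cd_bracket:
  assumes X: "smooth_on W X" and Z: "smooth_on W Z" and x: "x \<in> W"
  shows "cd (X x) (\<lambda>y. FD P y (Z y)) x - cd (Z x) (\<lambda>y. FD P y (X y)) x = FD P x (FD Z x (X x) - FD X x (Z x))"
  unfolding cd_dP[OF X x] cd_dP[OF Z x] linear_diff[OF dP_linear[OF x]]
  using cd_torsion[OF x, of "X x" "Z x"] by simp

lemma cd_vector_field:
  assumes "smooth_on U \<xi>" "x \<in> W"
  shows "cd u (\<lambda>y. \<xi> (P y)) x = nabla G (\<lambda>_. FD P x u) \<xi> (P x)"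
  by (simp add: cd_def nabla_def FD_eqI[OF compose_derivative[OF assms]])

lemma cd_endo:
  assumes \<phi>: "\<And>v. smooth_on U (\<lambda>q. \<phi> q v)" "\<And>q. q \<in> U \<Longrightarrow> linear (\<phi> q)" and Y: "smooth_on W Y" and x: "x \<in> W"
  shows "cd u (\<lambda>y. \<phi> (P y) (Y y)) x = nabla_endo G \<phi> (P x) (FD P x u) (Y x) + \<phi> (P x) (cd u Y x)"
  using Px[OF x] linear_add[OF \<phi>(2)[OF Px[OF x]]]
  by (simp add: cd_def FD_eqI[OF compose_apply1_derivative[OF \<phi> Y x]] nabla_endo_def nabla_def)

end

locale along_metric = riemannian U g + along_map U "levi_civita g" W P
  for U :: "'e::euclidean_space set" and g :: "'e \<Rightarrow> 'e \<Rightarrow> 'e \<Rightarrow> real"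
    and W :: "'f::euclidean_space set" and P :: "'f \<Rightarrow> 'e"
begin

definition ip where "ip x = g (P x)"

lemma ip_smooth: "smooth_on W Y \<Longrightarrow> smooth_on W Z \<Longrightarrow> smooth_on W (\<lambda>x. ip x (Y x) (Z x))"
  unfolding ip_def by (rule compose_apply2[OF g_smooth g_bilinear])

lemma inner_ip: "x \<in> W \<Longrightarrow> inner_form (ip x)"
  unfolding ip_def by (rule inner_g[OF Px])

lemma FD_ip:
  assumes "smooth_on W Y" "smooth_on W Z" "x \<in> W"
  shows "FD (\<lambda>y. ip y (Y y) (Z y)) x u = ip x (cd u Y x) (Z x) + ip x (Y x) (cd u Z x)"
proof -
  interpret i: inner_form "ip x" by (rule inner_ip[OF assms(3)])
  show ?thesis
    using FD_eqI[OF compose_apply2_derivative[OF g_smooth g_bilinear assms]] lc_compat[OF Px[OF assms(3)]]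
    by (simp add: ip_def[abs_def] cd_def i.h_add[unfolded ip_def])
qed

end

lemma along_metric_intro:
  assumes "open U" "riemannian_metric_on U g" "open W" "smooth_on W P" "P ` W \<subseteq> U"
  shows "along_metric U g W P"
proof -
  interpret r: riemannian U g using assms by unfold_locales
  show ?thesis
    by unfold_locales (use assms r.lc_smooth r.lc_bilinear r.lc_sym in auto)
qed

section \<open>Hypersurfaces of Sasakian space forms\<close>

locale imm = along_metric U g W P
  for U :: "'e::euclidean_space set" and g :: "'e \<Rightarrow> 'e \<Rightarrow> 'e \<Rightarrow> real"
    and W :: "'f::euclidean_space set" and P :: "'f \<Rightarrow> 'e" +
  assumes injP: "\<And>x. x \<in> W \<Longrightarrow> inj (FD P x)"
begin

definition pb where "pb x = pullback_form g P x"
text \<open>The adjoint of \<open>FD P x\<close>: it inverts \<open>FD P x\<close> on tangent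
  vectors and kills normal ones. Through it the geometry is written with ambient vectors.\<close>

definition tau where "tau x Y = sharp (pb x) (\<lambda>z. ip x Y (FD P x z))"

lemma pb_ip: "pb x u v = ip x (FD P x u) (FD P x v)"
  by (simp add: pb_def pullback_form_def ip_def)

lemma pb_riemannian: "riemannian_metric_on W pb"
  unfolding riemannian_metric_on_def
proof (intro conjI ballI allI impI)
  show "smooth_on W (\<lambda>x. pb x u v)" for u v
    unfolding pb_ip by (intro ip_smooth dP_smooth smooth_on_const)
  fix x assume x: "x \<in> W"
  interpret i: inner_form "ip x" by (rule inner_ip[OF x])
  note l = dP_linear[OF x]
  show "bilinear (pb x)"
    unfolding pb_ip[abs_def] bilinear_def linear_iff
    by (simp add: linear_add[OF l] linear_cmul[OF l])
  show "pb x u v = pb x v u" for u v unfolding pb_ip by (rule i.sym)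
  show "pb x u u > 0" if "u \<noteq> 0" for u
    unfolding pb_ip
  proof (rule i.pos)
    show "FD P x u \<noteq> 0" using injD[OF injP[OF x], of u 0] that linear_0[OF l] by auto
  qed
qed

lemma inner_pb: "x \<in> W \<Longrightarrow> inner_form (pb x)"
  by (rule riemannian_inner_form[OF pb_riemannian])

sublocale rW: riemannian W pb by unfold_locales (use oW pb_riemannian in auto)

context
  fixes x assumes x: "x \<in> W"
begin

interpretation i: inner_form "ip x" by (rule inner_ip[OF x])
interpretation b: inner_form "pb x" by (rule inner_pb[OF x])

lemma tau_pb: "pb x (tau x Y) z = ip x Y (FD P x z)"
proof -
  have "linear (ip x Y \<circ> FD P x)" by (rule linear_compose[OF dP_linear[OF x] i.lin(1)])
  from b.sharp_works[OF this, of z] show ?thesis by (simp add: tau_def o_def)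
qed

lemma tau_linear: "linear (tau x)"
proof
  show "tau x (Y + Z) = tau x Y + tau x Z" for Y Z
    by (rule b.h_ext) (simp add: tau_pb)
  show "tau x (r *\<^sub>R Y) = r *\<^sub>R tau x Y" for r Y
    by (rule b.h_ext) (simp add: tau_pb)
qed

end

lemma tau_smooth_const: "smooth_on W (\<lambda>x. tau x Y)"
  unfolding tau_def
proof (rule smooth_on_sharp[OF oW pb_riemannian])
  show "smooth_on W (\<lambda>x. ip x Y (FD P x v))" for v
    by (intro ip_smooth smooth_on_const dP_smooth)
  fix x assume x: "x \<in> W"
  interpret i: inner_form "ip x" by (rule inner_ip[OF x])
  show "linear (\<lambda>z. ip x Y (FD P x z))"
    using linear_compose[OF dP_linear[OF x] i.lin(1)] by (simp add: o_def)
qed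

lemma tau_smooth: "smooth_on W Y \<Longrightarrow> smooth_on W (\<lambda>x. tau x (Y x))"
  by (rule smooth_on_apply_linear[OF oW tau_smooth_const tau_linear])

end

locale hyp = imm U "cmet S" W P
  for U :: "'e::euclidean_space set" and S :: "'e contact_metric" and W :: "'f::euclidean_space set" and P +
  fixes N :: "'f \<Rightarrow> 'e" and m :: nat and c :: real
  assumes S: "sasakian_space_form_on c U S"
    and dime: "DIM('e) = 2 * m + 1" and dimf: "DIM('f) = 2 * m"
    and N: "unit_normal_on S P W N"
    and xi_range: "xi_tangent S W P"
begin

definition xi where "xi x = cxi S (P x)"
definition phi where "phi x = cphi S (P x)"
definition V where "V x = - phi x (N x)"
text \<open>The direction is an ambient vector of which only the tangential part counts. Derivatives
  such as \<open>B\<close> thereby become operators on the whole ambient space, with value 0 in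
  normal directions.\<close>

definition nab where "nab X Y x = cd (tau x X) Y x"
definition dr :: "'e \<Rightarrow> ('f \<Rightarrow> real) \<Rightarrow> 'f \<Rightarrow> real" where "dr X F x = FD F x (tau x X)"
text \<open>Minus the Weingarten operator, extended by 0 to the normal.\<close>

definition B where "B x Y = nab Y N x"

definition CR where "CR x X Y Z =
  - ((c - 1) / 4) *\<^sub>R
            (ip x (xi x) Z *\<^sub>R (ip x (xi x) Y *\<^sub>R X - ip x (xi x) X *\<^sub>R Y)
             + (ip x Y Z * ip x (xi x) X - ip x X Z * ip x (xi x) Y) *\<^sub>R xi x
             + ip x (phi x X) Z *\<^sub>R phi x Y + (2 * ip x (phi x X) Y) *\<^sub>R phi x Z - ip x (phi x Y) Z *\<^sub>R phi x X)
        + ((c + 3) / 4) *\<^sub>R (ip x Y Z *\<^sub>R X - ip x X Z *\<^sub>R Y)"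

section \<open>Contact metric identities along the hypersurface\<close>

lemma sas: "sasakian_on U S" using S by (simp add: sasakian_space_form_on_def)

lemma sas_x:
  assumes q: "q \<in> U"
  shows "linear (cphi S q)" "cphi S q (cxi S q) = 0" "cmet S q (cxi S q) (cxi S q) = 1"
    "cphi S q (cphi S q u) = - u + cmet S q (cxi S q) u *\<^sub>R cxi S q"
    "cmet S q (cphi S q u) (cphi S q v) = cmet S q u v - cmet S q (cxi S q) u * cmet S q (cxi S q) v"
    "nabla_endo (levi_civita (cmet S)) (cphi S) q u v = cmet S q u v *\<^sub>R cxi S q - cmet S q (cxi S q) v *\<^sub>R u"
    "nabla (levi_civita (cmet S)) (\<lambda>_. u) (cxi S) q = - cphi S q u"
    "ceta S q u = cmet S q (cxi S q) u"
proof -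
  have *: "linear (cphi S q) \<and> linear (ceta S q) \<and> ceta S q (cxi S q) = 1 \<and> cphi S q (cxi S q) = 0
        \<and> (\<forall>u v.
            cphi S q (cphi S q u) = - u + ceta S q u *\<^sub>R cxi S q
          \<and> ceta S q u = cmet S q (cxi S q) u
          \<and> cmet S q (cphi S q u) (cphi S q v) = cmet S q u v - ceta S q u * ceta S q v
          \<and> ext_deriv (ceta S) q u v = cmet S q u (cphi S q v)
          \<and> nabla_endo (levi_civita (cmet S)) (cphi S) q u v = cmet S q u v *\<^sub>R cxi S q - ceta S q v *\<^sub>R u
          \<and> nabla (levi_civita (cmet S)) (\<lambda>_. u) (cxi S) q = - cphi S q u)"
    using sas q unfolding sasakian_on_def Let_def by blast
  then have e: "ceta S q u = cmet S q (cxi S q) u" for u by blast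
  show "linear (cphi S q)" "cphi S q (cxi S q) = 0" "cmet S q (cxi S q) (cxi S q) = 1"
    "cphi S q (cphi S q u) = - u + cmet S q (cxi S q) u *\<^sub>R cxi S q"
    "cmet S q (cphi S q u) (cphi S q v) = cmet S q u v - cmet S q (cxi S q) u * cmet S q (cxi S q) v"
    "nabla_endo (levi_civita (cmet S)) (cphi S) q u v = cmet S q u v *\<^sub>R cxi S q - cmet S q (cxi S q) v *\<^sub>R u"
    "nabla (levi_civita (cmet S)) (\<lambda>_. u) (cxi S) q = - cphi S q u"
    "ceta S q u = cmet S q (cxi S q) u"
    using * unfolding e by blast+
qed

lemma sas_smooth: "smooth_on U (cxi S)" "smooth_on U (\<lambda>q. cphi S q v)"
  using sas unfolding sasakian_on_def Let_def by blast+

lemma xi_smooth: "smooth_on W xi"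
  unfolding xi_def[abs_def] by (rule compose_smooth[OF sas_smooth(1)])

lemma phi_smooth: "smooth_on W Y \<Longrightarrow> smooth_on W (\<lambda>x. phi x (Y x))"
  unfolding phi_def by (rule compose_apply1[OF sas_smooth(2) sas_x(1)])

lemma N_smooth: "smooth_on W N" using N by (simp add: unit_normal_on_def)

lemma V_smooth: "smooth_on W V"
  unfolding V_def[abs_def] by (intro smooth_on_minus oW phi_smooth N_smooth)

lemma phi_linear: "x \<in> W \<Longrightarrow> linear (phi x)"
  unfolding phi_def by (rule sas_x(1)[OF Px])

lemma NN: "x \<in> W \<Longrightarrow> ip x (N x) (N x) = 1"
  using N by (simp add: unit_normal_on_def ip_def)

lemma N_dP: "x \<in> W \<Longrightarrow> ip x (N x) (FD P x u) = 0"
  using N by (simp add: unit_normal_on_def ip_def)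

lemma dP_N: "x \<in> W \<Longrightarrow> ip x (FD P x u) (N x) = 0"
  using N_dP inner_form.sym[OF inner_ip] by metis

context
  fixes x assumes x: "x \<in> W"
begin

interpretation i: inner_form "ip x" by (rule inner_ip[OF x])
interpretation b: inner_form "pb x" by (rule inner_pb[OF x])

lemma frame_onb:
  assumes F: "b.onb F"
  shows "i.onb (insert (N x) (FD P x ` F))" "inj_on (FD P x) F" "N x \<notin> FD P x ` F"
proof -
  show inj: "inj_on (FD P x) F" using injP[OF x] inj_on_subset by blast
  have oF: "b.orth F" using F by (simp add: b.onb_def)
  have N0: "N x \<noteq> FD P x u" for u using NN[OF x] N_dP[OF x, of u] by auto
  then show nF: "N x \<notin> FD P x ` F" by auto
  have "i.orth (insert (N x) (FD P x ` F))"
    unfolding i.orth_def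
  proof (intro ballI)
    have PN: "ip x (FD P x u) (N x) = 0" for u by (rule dP_N[OF x])
    fix Y Z assume Y: "Y \<in> insert (N x) (FD P x ` F)" and Z: "Z \<in> insert (N x) (FD P x ` F)"
    show "ip x Y Z = (if Y = Z then 1 else 0)"
    proof (cases "Y = N x \<or> Z = N x")
      case True
      then show ?thesis using Y Z NN[OF x] N_dP[OF x] PN N0 by (elim disjE) (auto simp: eq_commute[of _ "N x"])
    next
      case False
      then obtain u v where uv: "u \<in> F" "v \<in> F" "Y = FD P x u" "Z = FD P x v" using Y Z by auto
      then show ?thesis using b.orthD[OF oF uv(1,2)] inj_on_eq_iff[OF inj uv(1,2)] by (simp add: pb_ip)
    qed
  qed
  moreover have "card (insert (N x) (FD P x ` F)) = DIM('e)"
    using nF card_image[OF inj] b.onb_card[OF F] b.orth_finite(1)[OF oF] dime dimf by simp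
  ultimately show "i.onb (insert (N x) (FD P x ` F))" by (rule i.orth_card_onb)
qed

lemma dP_tau: "FD P x (tau x Y) = Y - ip x Y (N x) *\<^sub>R N x"
proof -
  obtain F where F: "b.onb F" using b.onb_extend[of "{}"] by (auto simp: b.orth_def)
  note o = frame_onb[OF F]
  define Z where "Z = FD P x (tau x Y) - (Y - ip x Y (N x) *\<^sub>R N x)"
  have "ip x Z (FD P x z) = 0" for z
    using tau_pb[OF x, of Y z] N_dP[OF x, of z] by (simp add: Z_def pb_ip)
  moreover have "ip x Z (N x) = 0"
    using dP_N[OF x] NN[OF x] by (simp add: Z_def)
  ultimately have "Z = 0" using i.onb_expand[OF o(1), of Z] by (simp add: sum.neutral)
  then show ?thesis by (simp add: Z_def)
qed

lemma dP_tau_tangent: "ip x Y (N x) = 0 \<Longrightarrow> FD P x (tau x Y) = Y"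
  by (simp add: dP_tau)

lemma tau_dP: "tau x (FD P x u) = u"
  using injD[OF injP[OF x], of "tau x (FD P x u)" u] dP_N[OF x, of u] by (simp add: dP_tau)

lemma tau_N: "tau x (N x) = 0"
  using injD[OF injP[OF x], of "tau x (N x)" 0] NN[OF x] linear_0[OF dP_linear[OF x]] by (simp add: dP_tau)

lemma phi_simps:
  "phi x (xi x) = 0" "ip x (xi x) (xi x) = 1" "phi x (phi x u) = - u + ip x (xi x) u *\<^sub>R xi x"
  "ip x (phi x u) (phi x v) = ip x u v - ip x (xi x) u * ip x (xi x) v"
  "ip x (phi x u) (xi x) = 0" "ip x (xi x) (phi x u) = 0"
proof -
  show 1: "phi x (xi x) = 0" "ip x (xi x) (xi x) = 1" "phi x (phi x u) = - u + ip x (xi x) u *\<^sub>R xi x"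
    and 2: "\<And>u v. ip x (phi x u) (phi x v) = ip x u v - ip x (xi x) u * ip x (xi x) v"
    unfolding xi_def phi_def ip_def using sas_x[OF Px[OF x]] by auto
  \<comment> \<open>Computing the cube of \<open>phi\<close> in both groupings isolates the
    \<open>xi\<close>-component of \<open>phi u\<close>.\<close>
  have "phi x (phi x (phi x u)) = - phi x u"
    using sas_x(4)[OF Px[OF x], of u] sas_x(1,2)[OF Px[OF x]]
    by (simp add: phi_def linear_add linear_cmul linear_neg linear_diff)
  moreover have "phi x (phi x (phi x u)) = - phi x u + ip x (xi x) (phi x u) *\<^sub>R xi x"
    unfolding xi_def phi_def ip_def by (rule sas_x(4)[OF Px[OF x]])
  ultimately have "ip x (xi x) (phi x u) *\<^sub>R xi x = 0" by simp
  then have "ip x (xi x) (phi x u) * ip x (xi x) (xi x) = 0" by (metis i.h_scale(2) i.h_zero(2))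
  then show "ip x (xi x) (phi x u) = 0" using 1 by simp
  then show "ip x (phi x u) (xi x) = 0" using i.sym by simp
qed

lemma phi_skew: "ip x (phi x u) v = - ip x u (phi x v)"
proof -
  have "ip x (phi x u) (phi x (phi x v)) = ip x u (phi x v)"
    using phi_simps(4)[of u "phi x v"] phi_simps(6) by simp
  then show ?thesis using phi_simps(5)[of u] by (simp add: phi_simps(3))
qed

lemma xi_N: "ip x (xi x) (N x) = 0" "ip x (N x) (xi x) = 0"
proof -
  obtain u where "xi x = FD P x u" using xi_range x by (auto simp: xi_tangent_def xi_def)
  then show "ip x (N x) (xi x) = 0" using N_dP[OF x] by simp
  then show "ip x (xi x) (N x) = 0" using i.sym by simp
qed

lemma phi_self: "ip x (phi x u) u = 0" "ip x u (phi x u) = 0"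
  using phi_skew[of u u] i.sym[of u "phi x u"] by auto

lemma V_simps:
  "ip x (V x) (V x) = 1" "ip x (V x) (xi x) = 0" "ip x (xi x) (V x) = 0" "ip x (V x) (N x) = 0"
  "ip x (N x) (V x) = 0" "phi x (V x) = N x" "phi x (N x) = - V x"
  using phi_simps(4)[of "N x" "N x"] phi_simps(3)[of "N x"] phi_simps(5,6)[of "N x"] phi_self[of "N x"] NN[OF x] xi_N
    linear_neg[OF phi_linear[OF x], of "phi x (N x)"]
  by (simp_all add: V_def)

end

section \<open>Calculus of derivatives in tangential directions\<close>

lemma nab_smooth: "smooth_on W X \<Longrightarrow> smooth_on W Y \<Longrightarrow> smooth_on W (\<lambda>x. nab (X x) Y x)"
  unfolding nab_def by (intro cd_smooth tau_smooth)

lemma nab_linear: "smooth_on W Y \<Longrightarrow> x \<in> W \<Longrightarrow> linear (\<lambda>X. nab X Y x)"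
  using linear_compose[OF tau_linear cd_linear, of x Y x] by (simp add: nab_def o_def)

lemma nab_add: "smooth_on W Y \<Longrightarrow> smooth_on W Z \<Longrightarrow> x \<in> W \<Longrightarrow> nab X (\<lambda>y. Y y + Z y) x = nab X Y x + nab X Z x"
  unfolding nab_def by (rule cd_add)

lemma nab_diff: "smooth_on W Y \<Longrightarrow> smooth_on W Z \<Longrightarrow> x \<in> W \<Longrightarrow> nab X (\<lambda>y. Y y - Z y) x = nab X Y x - nab X Z x"
  unfolding nab_def by (rule cd_diff)

lemma nab_minus: "smooth_on W Y \<Longrightarrow> x \<in> W \<Longrightarrow> nab X (\<lambda>y. - Y y) x = - nab X Y x"
  unfolding nab_def by (rule cd_minus)

lemma nab_scale: "smooth_on W F \<Longrightarrow> smooth_on W Y \<Longrightarrow> x \<in> W \<Longrightarrow>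
    nab X (\<lambda>y. F y *\<^sub>R Y y) x = dr X F x *\<^sub>R Y x + F x *\<^sub>R nab X Y x"
  unfolding nab_def dr_def by (rule cd_scale)

lemma nab_cong: "(\<And>y. y \<in> W \<Longrightarrow> Y y = Z y) \<Longrightarrow> x \<in> W \<Longrightarrow> nab X Y x = nab X Z x"
  unfolding nab_def by (rule cd_cong)

lemma dr_cong: "(\<And>y. y \<in> W \<Longrightarrow> F y = H y) \<Longrightarrow> x \<in> W \<Longrightarrow> dr X F x = dr X H x"
  unfolding dr_def using FD_cong_open[OF oW, of x F H] by simp

lemma dr_linear: "smooth_on W F \<Longrightarrow> x \<in> W \<Longrightarrow> linear (\<lambda>X. dr X F x)"
  using linear_compose[OF tau_linear smooth_on_FD_linear, of x W F x] by (simp add: dr_def o_def)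

lemma dr_const: "dr X (\<lambda>_. r) x = 0"
  by (simp add: dr_def)

lemma dr_arith:
  assumes "smooth_on W F" "smooth_on W H" "x \<in> W"
  shows "dr X (\<lambda>y. F y + H y) x = dr X F x + dr X H x"
    "dr X (\<lambda>y. F y - H y) x = dr X F x - dr X H x"
    "dr X (\<lambda>y. F y * H y) x = dr X F x * H x + F x * dr X H x"
proof -
  note d = smooth_on_has_derivative[OF assms(1,3)] smooth_on_has_derivative[OF assms(2,3)]
  show "dr X (\<lambda>y. F y + H y) x = dr X F x + dr X H x"
    using FD_eqI[OF has_derivative_add[OF d]] by (simp add: dr_def)
  show "dr X (\<lambda>y. F y - H y) x = dr X F x - dr X H x"
    using FD_eqI[OF has_derivative_diff[OF d]] by (simp add: dr_def)
  show "dr X (\<lambda>y. F y * H y) x = dr X F x * H x + F x * dr X H x"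
    using FD_eqI[OF has_derivative_mult[OF d]] by (simp add: dr_def)
qed

lemma dr_cmult: "smooth_on W F \<Longrightarrow> x \<in> W \<Longrightarrow> dr X (\<lambda>y. r * F y) x = r * dr X F x"
  using dr_arith(3)[OF smooth_on_const, of F x X r] by (simp add: dr_const)

lemma dr_ip:
  assumes "smooth_on W Y" "smooth_on W Z" "x \<in> W"
  shows "dr X (\<lambda>y. ip y (Y y) (Z y)) x = ip x (nab X Y x) (Z x) + ip x (Y x) (nab X Z x)"
  unfolding dr_def nab_def by (rule FD_ip[OF assms])

lemma nab_ip_const:
  assumes "smooth_on W Y" "smooth_on W Z" "x \<in> W" "\<And>y. y \<in> W \<Longrightarrow> ip y (Y y) (Z y) = r"
  shows "ip x (nab X Y x) (Z x) = - ip x (Y x) (nab X Z x)"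
  using dr_ip[OF assms(1-3), of X] dr_cong[of "\<lambda>y. ip y (Y y) (Z y)" "\<lambda>_. r" x X, OF assms(4,3)]
  by (simp add: dr_const)

lemma nab_N_arg: "x \<in> W \<Longrightarrow> smooth_on W Y \<Longrightarrow> nab (N x) Y x = 0"
  unfolding nab_def using linear_0[OF cd_linear] by (simp add: tau_N)

lemma nab_xi: "x \<in> W \<Longrightarrow> ip x X (N x) = 0 \<Longrightarrow> nab X xi x = - phi x X"
  unfolding nab_def xi_def[abs_def]
  using cd_vector_field[OF sas_smooth(1), of x "tau x X"] sas_x(7)[OF Px] by (simp add: dP_tau_tangent phi_def)

lemma nab_phi:
  assumes "smooth_on W Y" "x \<in> W" "ip x X (N x) = 0"
  shows "nab X (\<lambda>y. phi y (Y y)) x = phi x (nab X Y x) + ip x X (Y x) *\<^sub>R xi x - ip x (xi x) (Y x) *\<^sub>R X"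
  unfolding nab_def phi_def
  using cd_endo[OF sas_smooth(2) sas_x(1) assms(1,2), of "tau x X"] sas_x(6)[OF Px[OF assms(2)]] assms(3)
  by (simp add: dP_tau_tangent[OF assms(2)] ip_def xi_def)

lemma curv_CR: "x \<in> W \<Longrightarrow> curv_at (levi_civita (cmet S)) (P x) X Y Z = CR x X Y Z"
  using S Px[of x] unfolding sasakian_space_form_on_def Let_def CR_def ip_def xi_def phi_def
  by (auto simp: sas_x(8))

text \<open>Tangential fields are images under \<open>FD P\<close> of fields on the parameter
  domain, and torsion-freeness leaves only the bracket of the latter.\<close>

lemma tangent_bracket:
  assumes X: "smooth_on W X" and Z: "smooth_on W Z" and x: "x \<in> W"
    and tX: "\<And>y. y \<in> W \<Longrightarrow> ip y (X y) (N y) = 0" and tZ: "\<And>y. y \<in> W \<Longrightarrow> ip y (Z y) (N y) = 0"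
  shows "nab (X x) Z x - nab (Z x) X x = FD P x (FD (\<lambda>y. tau y (Z y)) x (tau x (X x)) - FD (\<lambda>y. tau y (X y)) x (tau x (Z x)))"
proof -
  have "nab (X x) Z x = cd (tau x (X x)) (\<lambda>y. FD P y (tau y (Z y))) x"
    unfolding nab_def by (rule cd_cong[OF _ x]) (simp add: dP_tau_tangent tZ)
  moreover have "nab (Z x) X x = cd (tau x (Z x)) (\<lambda>y. FD P y (tau y (X y))) x"
    unfolding nab_def by (rule cd_cong[OF _ x]) (simp add: dP_tau_tangent tX)
  ultimately show ?thesis
    using cd_bracket[OF tau_smooth[OF X] tau_smooth[OF Z] x] by simp
qed

lemma bracket_tangent:
  assumes "smooth_on W X" "smooth_on W Z" "x \<in> W"
    "\<And>y. y \<in> W \<Longrightarrow> ip y (X y) (N y) = 0" "\<And>y. y \<in> W \<Longrightarrow> ip y (Z y) (N y) = 0"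
  shows "ip x (nab (X x) Z x) (N x) = ip x (nab (Z x) X x) (N x)"
proof -
  interpret i: inner_form "ip x" by (rule inner_ip[OF assms(3)])
  have "nab (X x) Z x - nab (Z x) X x = FD P x (FD (\<lambda>y. tau y (Z y)) x (tau x (X x)) - FD (\<lambda>y. tau y (X y)) x (tau x (Z x)))"
    by (rule tangent_bracket[OF assms])
  then have "ip x (nab (X x) Z x - nab (Z x) X x) (N x) = 0"
    using dP_N[OF assms(3)] by simp
  then show ?thesis by simp
qed

text \<open>The bracket term of the curvature is expressed by the difference of the two derivatives
  of the directions, so that brackets never have to be carried along.\<close>

lemma nab_curv:
  assumes Y: "smooth_on W Y" and X: "smooth_on W X" and Z: "smooth_on W Z" and x: "x \<in> W"
    and tX: "\<And>y. y \<in> W \<Longrightarrow> ip y (X y) (N y) = 0" and tZ: "\<And>y. y \<in> W \<Longrightarrow> ip y (Z y) (N y) = 0"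
  shows "nab (X x) (\<lambda>y. nab (Z y) Y y) x - nab (Z x) (\<lambda>y. nab (X y) Y y) x
    = CR x (X x) (Z x) (Y x) + nab (nab (X x) Z x) Y x - nab (nab (Z x) X x) Y x"
proof -
  have "nab (nab (X x) Z x) Y x - nab (nab (Z x) X x) Y x = nab (nab (X x) Z x - nab (Z x) X x) Y x"
    by (simp add: linear_diff[OF nab_linear[OF Y x]])
  also have "\<dots> = cd (FD (\<lambda>y. tau y (Z y)) x (tau x (X x)) - FD (\<lambda>y. tau y (X y)) x (tau x (Z x))) Y x"
  proof -
    have "nab (X x) Z x - nab (Z x) X x = FD P x (FD (\<lambda>y. tau y (Z y)) x (tau x (X x)) - FD (\<lambda>y. tau y (X y)) x (tau x (Z x)))"
      by (rule tangent_bracket[OF X Z x tX tZ])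
    then have "nab (nab (X x) Z x - nab (Z x) X x) Y x = nab (FD P x (FD (\<lambda>y. tau y (Z y)) x (tau x (X x)) - FD (\<lambda>y. tau y (X y)) x (tau x (Z x)))) Y x"
      by simp
    then show ?thesis by (simp only: nab_def[of "FD P _ _"] tau_dP[OF x])
  qed
  finally show ?thesis
    using cd_curv[OF Y tau_smooth[OF X] tau_smooth[OF Z] x] tX[OF x] tZ[OF x]
    by (simp add: nab_def dP_tau_tangent[OF x] curv_CR[OF x])
qed

definition sop :: "('f \<Rightarrow> 'e \<Rightarrow> 'e) \<Rightarrow> bool"
  where "sop A \<longleftrightarrow> (\<forall>v. smooth_on W (\<lambda>x. A x v)) \<and> (\<forall>x\<in>W. linear (A x))"

text \<open>Covariant derivative of a field of endomorphisms. The constant extension of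
  \<open>v\<close> is legitimate because the expression is tensorial in \<open>v\<close>;
  \<open>nab_op\<close> is the resulting Leibniz rule for arbitrary fields.\<close>

definition dop :: "'e \<Rightarrow> ('f \<Rightarrow> 'e \<Rightarrow> 'e) \<Rightarrow> 'f \<Rightarrow> 'e \<Rightarrow> 'e"
  where "dop X A x v = nab X (\<lambda>y. A y v) x - A x (nab X (\<lambda>_. v) x)"

lemma sop_linear: "sop A \<Longrightarrow> x \<in> W \<Longrightarrow> linear (A x)"
  by (simp add: sop_def)

lemma sop_smooth: "sop A \<Longrightarrow> smooth_on W Y \<Longrightarrow> smooth_on W (\<lambda>x. A x (Y x))"
  by (rule smooth_on_apply_linear[OF oW]) (auto simp: sop_def)

lemma sop_compose: "sop A \<Longrightarrow> sop C \<Longrightarrow> sop (\<lambda>x v. A x (C x v))"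
  using sop_smooth[of A] linear_compose[of "C _" "A _"] by (auto simp: sop_def o_def)

lemma nab_op:
  assumes A: "sop A" and Y: "smooth_on W Y" and x: "x \<in> W"
  shows "nab X (\<lambda>y. A y (Y y)) x = dop X A x (Y x) + A x (nab X Y x)"
proof -
  have "((\<lambda>y. A y (Y y)) has_derivative (\<lambda>u. FD (\<lambda>y. A y (Y x)) x u + A x (FD Y x u))) (at x)"
    by (rule has_derivative_apply_linear[OF oW x _ _ smooth_on_has_derivative[OF Y x]])
      (use A x in \<open>auto simp: sop_def intro: smooth_on_differentiable\<close>)
  from FD_eqI[OF this] show ?thesis
    by (simp add: nab_def dop_def cd_def linear_add[OF sop_linear[OF A x]])
qed

lemma dop_linear:
  assumes A: "sop A" and x: "x \<in> W" shows "linear (dop X A x)"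
proof
  note l = sop_linear[OF A]
  have s: "smooth_on W (\<lambda>y. A y v)" for v using A by (simp add: sop_def)
  fix u v :: 'e and r :: real
  have "nab X (\<lambda>y. A y (u + v)) x = nab X (\<lambda>y. A y u + A y v) x"
    by (rule nab_cong[OF _ x]) (simp add: linear_add[OF l])
  moreover have "nab X (\<lambda>_. u + v) x = nab X (\<lambda>_. u) x + nab X (\<lambda>_. v) x"
    using nab_add[OF smooth_on_const smooth_on_const x] .
  ultimately show "dop X A x (u + v) = dop X A x u + dop X A x v"
    by (simp add: dop_def nab_add[OF s s x] linear_add[OF l[OF x]])
  have "nab X (\<lambda>y. A y (r *\<^sub>R u)) x = nab X (\<lambda>y. r *\<^sub>R A y u) x"
    by (rule nab_cong[OF _ x]) (simp add: linear_cmul[OF l])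
  moreover have "nab X (\<lambda>_. r *\<^sub>R u) x = r *\<^sub>R nab X (\<lambda>_. u) x"
    using nab_scale[OF smooth_on_const smooth_on_const x, of X r u] by (simp add: dr_const)
  ultimately show "dop X A x (r *\<^sub>R u) = r *\<^sub>R dop X A x u"
    using nab_scale[OF smooth_on_const s x, of X r u]
    by (simp add: dop_def dr_const linear_cmul[OF l[OF x]] algebra_simps)
qed

lemma dop_compose:
  assumes "sop A" "sop C" "x \<in> W"
  shows "dop X (\<lambda>x v. A x (C x v)) x v = dop X A x (C x v) + A x (dop X C x v)"
proof -
  have "smooth_on W (\<lambda>y. C y v)" using assms by (simp add: sop_def)
  then show ?thesis
    using nab_op[OF assms(1) _ assms(3), of "\<lambda>y. C y v" X] linear_diff[OF sop_linear[OF assms(1,3)]]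
    by (simp add: dop_def)
qed

lemma dop_self_adjoint:
  assumes A: "sop A" and sa: "\<And>y u v. y \<in> W \<Longrightarrow> ip y (A y u) v = ip y u (A y v)" and x: "x \<in> W"
  shows "ip x (dop X A x u) v = ip x u (dop X A x v)"
proof -
  interpret i: inner_form "ip x" by (rule inner_ip[OF x])
  have s: "smooth_on W (\<lambda>y. A y v)" for v using A by (simp add: sop_def)
  have "dr X (\<lambda>y. ip y (A y u) v) x = dr X (\<lambda>y. ip y u (A y v)) x"
    by (rule dr_cong[OF sa x])
  then show ?thesis
    using dr_ip[OF s smooth_on_const x, of X u v] dr_ip[OF smooth_on_const s x, of X u v] sa[OF x]
    by (simp add: dop_def)
qed

lemma trc_smooth: "sop A \<Longrightarrow> smooth_on W (\<lambda>x. trc (A x))"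
  unfolding trc_def by (intro smooth_on_sum smooth_on_inner oW smooth_on_const) (simp add: sop_def)

text \<open>The connection enters \<open>dop\<close> through a commutator with \<open>T\<close>,
  which has trace 0.\<close>

lemma dr_trc:
  assumes A: "sop A" and x: "x \<in> W"
  shows "dr X (\<lambda>y. trc (A y)) x = trc (dop X A x)"
proof -
  define T where "T v = levi_civita (cmet S) (P x) (FD P x (tau x X)) v" for v
  have T: "linear T" unfolding T_def[abs_def] using G_linear(1)[OF Px[OF x]] by (simp add: eta_contract_eq)
  have s: "smooth_on W (\<lambda>y. A y v)" for v using A by (simp add: sop_def)
  have d: "((\<lambda>y. trc (A y)) has_derivative (\<lambda>u. \<Sum>b\<in>Basis. FD (\<lambda>y. A y b) x u \<bullet> b)) (at x)"
    unfolding trc_def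
    by (intro has_derivative_sum has_derivative_inner_left smooth_on_has_derivative[OF s x])
  have "dop X A x = (\<lambda>v. (FD (\<lambda>y. A y v) x (tau x X) + T (A x v)) - A x (T v))"
    by (simp add: dop_def nab_def cd_def T_def fun_eq_iff)
  then have "trc (dop X A x) = trc (\<lambda>v. FD (\<lambda>y. A y v) x (tau x X)) + trc (\<lambda>v. T (A x v)) - trc (\<lambda>v. A x (T v))"
    by (simp only: trc_add[symmetric] trc_diff[symmetric])
  then show ?thesis
    using trc_comm[OF T sop_linear[OF A x]] by (simp add: dr_def FD_eqI[OF d[unfolded trc_def]] trc_def)
qed

lemma sop_nab: "smooth_on W Y \<Longrightarrow> sop (\<lambda>x X. nab X Y x)"
  using nab_smooth[OF smooth_on_const, of Y] nab_linear[of Y] by (simp add: sop_def)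

lemma B_sop: "sop B"
  unfolding B_def[abs_def] by (rule sop_nab[OF N_smooth])

lemma sop_rank1: "smooth_on W Y \<Longrightarrow> smooth_on W Z \<Longrightarrow> sop (\<lambda>x v. ip x v (Y x) *\<^sub>R Z x)"
  unfolding sop_def
proof (intro conjI allI ballI)
  assume Y: "smooth_on W Y" and Z: "smooth_on W Z"
  show "smooth_on W (\<lambda>x. ip x v (Y x) *\<^sub>R Z x)" for v
    by (intro smooth_on_scaleR oW ip_smooth smooth_on_const Y Z)
  fix x assume x: "x \<in> W"
  interpret i: inner_form "ip x" by (rule inner_ip[OF x])
  show "linear (\<lambda>v. ip x v (Y x) *\<^sub>R Z x)" by (simp add: linear_iff algebra_simps)
qed

lemma sop_diff: "sop A \<Longrightarrow> sop C \<Longrightarrow> sop (\<lambda>x v. A x v - C x v)"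
  by (auto simp: sop_def intro: smooth_on_diff oW linear_compose_sub)

lemma sop_id: "sop (\<lambda>x v. v)"
  by (simp add: sop_def smooth_on_const linear_iff)

lemma tangential_field:
  assumes x: "x \<in> W" and Y: "ip x Y (N x) = 0"
  obtains Z where "smooth_on W Z" "\<And>y. y \<in> W \<Longrightarrow> ip y (Z y) (N y) = 0" "Z x = Y"
proof
  define Z where "Z y = Y - ip y Y (N y) *\<^sub>R N y" for y
  show "smooth_on W Z" unfolding Z_def
    by (intro smooth_on_diff smooth_on_scaleR oW ip_smooth smooth_on_const N_smooth)
  show "ip y (Z y) (N y) = 0" if "y \<in> W" for y
  proof -
    interpret i: inner_form "ip y" by (rule inner_ip[OF that])
    show ?thesis using NN[OF that] by (simp add: Z_def)
  qed
  show "Z x = Y" by (simp add: Z_def Y)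
qed

section \<open>Shape operator, Codazzi equation and structure vectors\<close>

lemma B_N: "x \<in> W \<Longrightarrow> B x (N x) = 0"
  unfolding B_def by (rule nab_N_arg[OF _ N_smooth])

lemma B_tangent: "x \<in> W \<Longrightarrow> ip x (B x X) (N x) = 0"
  using dr_ip[OF N_smooth N_smooth, of x X] dr_cong[of "\<lambda>y. ip y (N y) (N y)" "\<lambda>_. 1" x X] NN
    inner_form.sym[OF inner_ip, of x "N x" "nab X N x"] by (simp add: B_def dr_const)

lemma B_second_form:
  assumes x: "x \<in> W" and Z: "smooth_on W Z" "\<And>y. y \<in> W \<Longrightarrow> ip y (Z y) (N y) = 0"
  shows "ip x (nab X Z x) (N x) = - ip x (Z x) (B x X)"
  unfolding B_def by (rule nab_ip_const[OF Z(1) N_smooth x Z(2)])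

text \<open>On tangent vectors this is the tangency of the bracket. Normal components do not matter,
  since \<open>B\<close> kills \<open>N\<close> and has tangent values.\<close>

lemma B_self_adjoint:
  assumes x: "x \<in> W" shows "ip x (B x X) Y = ip x X (B x Y)"
proof -
  interpret i: inner_form "ip x" by (rule inner_ip[OF x])
  have t: "ip x (B x X) Y = ip x X (B x Y)" if tX: "ip x X (N x) = 0" and tY: "ip x Y (N x) = 0" for X Y
  proof -
    obtain X' where X': "smooth_on W X'" "\<And>y. y \<in> W \<Longrightarrow> ip y (X' y) (N y) = 0" "X' x = X"
      using tangential_field[OF x tX] by blast
    obtain Y' where Y': "smooth_on W Y'" "\<And>y. y \<in> W \<Longrightarrow> ip y (Y' y) (N y) = 0" "Y' x = Y"
      using tangential_field[OF x tY] by blast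
    show ?thesis
      using bracket_tangent[OF X'(1) Y'(1) x X'(2) Y'(2)] B_second_form[OF x X'(1,2), of Y]
        B_second_form[OF x Y'(1,2), of X] X'(3) Y'(3) i.sym by simp
  qed
  have d: "Z = (Z - ip x Z (N x) *\<^sub>R N x) + ip x Z (N x) *\<^sub>R N x" for Z by simp
  have 0: "ip x (Z - ip x Z (N x) *\<^sub>R N x) (N x) = 0" for Z using NN[OF x] by simp
  have BB: "B x Z = B x (Z - ip x Z (N x) *\<^sub>R N x)" for Z
    using linear_diff[OF sop_linear[OF B_sop x]] linear_cmul[OF sop_linear[OF B_sop x]] B_N[OF x] by simp
  have "ip x (B x X) Y = ip x (B x X) (Y - ip x Y (N x) *\<^sub>R N x)" using B_tangent[OF x] by simp
  also have "\<dots> = ip x (X - ip x X (N x) *\<^sub>R N x) (B x Y)"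
    using t[OF 0 0, of X Y] BB by simp
  also have "\<dots> = ip x X (B x Y)" using B_tangent[OF x] i.sym by simp
  finally show ?thesis .
qed

text \<open>The Ricci identity for the section \<open>N\<close>, with both directions extended to
  tangential fields.\<close>

lemma codazzi:
  assumes x: "x \<in> W" and tX: "ip x X (N x) = 0" and tY: "ip x Y (N x) = 0"
  shows "dop X B x Y - dop Y B x X = CR x X Y (N x)"
proof -
  obtain X' where X': "smooth_on W X'" "\<And>y. y \<in> W \<Longrightarrow> ip y (X' y) (N y) = 0" "X' x = X"
    using tangential_field[OF x tX] by blast
  obtain Y' where Y': "smooth_on W Y'" "\<And>y. y \<in> W \<Longrightarrow> ip y (Y' y) (N y) = 0" "Y' x = Y"
    using tangential_field[OF x tY] by blast
  have "nab X (\<lambda>y. B y (Y' y)) x = dop X B x Y + B x (nab X Y' x)"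
    using nab_op[OF B_sop Y'(1) x] Y'(3) by simp
  moreover have "nab Y (\<lambda>y. B y (X' y)) x = dop Y B x X + B x (nab Y X' x)"
    using nab_op[OF B_sop X'(1) x] X'(3) by simp
  ultimately show ?thesis
    using nab_curv[OF N_smooth X'(1) Y'(1) x X'(2) Y'(2)] X'(3) Y'(3) by (simp add: B_def)
qed

text \<open>Differentiating \<open>ip xi N = 0\<close> and inserting
  \<open>nab Z xi = - phi Z\<close> gives the pairing with every tangent \<open>Z\<close>.\<close>

lemma B_xi:
  assumes x: "x \<in> W" shows "B x (xi x) = V x"
proof -
  interpret i: inner_form "ip x" by (rule inner_ip[OF x])
  have "ip x (B x (xi x)) Y = ip x (V x) Y" for Y
  proof -
    define Z where "Z = Y - ip x Y (N x) *\<^sub>R N x"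
    have Z: "ip x Z (N x) = 0" using NN[OF x] by (simp add: Z_def)
    have "ip x (xi x) (B x Z) = ip x (phi x Z) (N x)"
      using B_second_form[OF x xi_smooth xi_N(1), of Z] nab_xi[OF x Z] by simp
    also have "\<dots> = ip x Z (V x)" using phi_skew[OF x, of Z "N x"] by (simp add: V_def)
    finally have "ip x (B x (xi x)) Z = ip x (V x) Z" using B_self_adjoint[OF x] i.sym by simp
    moreover have "Y = Z + ip x Y (N x) *\<^sub>R N x" by (simp add: Z_def)
    ultimately show ?thesis using B_tangent[OF x] V_simps(4)[OF x] by (simp add: Z_def)
  qed
  then show ?thesis by (rule i.h_ext)
qed

lemma nab_V:
  assumes x: "x \<in> W" and X: "ip x X (N x) = 0"
  shows "nab X V x = - phi x (B x X)"
proof -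
  have "nab X V x = - nab X (\<lambda>y. phi y (N y)) x"
    unfolding V_def[abs_def] by (rule nab_minus[OF phi_smooth[OF N_smooth] x])
  then show ?thesis
    using nab_phi[OF N_smooth x X] X xi_N[OF x] by (simp add: B_def)
qed

end

section \<open>The connection of the Ricci tensor\<close>

lemma trc_rank1: "linear \<alpha> \<Longrightarrow> trc (\<lambda>u. \<alpha> u *\<^sub>R v) = \<alpha> (v :: 'a::euclidean_space)"
  unfolding trc_def using linear_on_Basis[of \<alpha> v] by (simp add: mult.commute)

lemma trc_id: "trc (\<lambda>v :: 'a::euclidean_space. v) = real DIM('a)"
  by (simp add: trc_def)

locale hypk = hyp U S W P N m c
  for U :: "'e::euclidean_space set" and S :: "'e contact_metric" and W :: "'f::euclidean_space set"
    and P N and m :: nat and c :: real +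
  assumes k2nz: "ricci_k2 m c \<noteq> 0"
begin

abbreviation "gb \<equiv> cmet S"
definition eta where "eta q u = gb q (cxi S q) u"
definition k2 where "k2 = ricci_k2 m c"
definition k1 where "k1 = 2 * real m - k2"
definition kk where "kk = k1 / k2"
definition LL where "LL q u v = eta q u *\<^sub>R cphi S q v + eta q v *\<^sub>R cphi S q u"

lemma m_pos: "m > 0"
  using dimf DIM_positive[where 'a='f] by (cases m) auto

lemma k2_pos: "k2 \<noteq> 0" "k1 + k2 = 2 * real m" "1 + kk = 2 * real m / k2" "kk * k2 = k1"
  using k2nz by (auto simp: k2_def k1_def kk_def field_simps)

lemma eta_smooth: "smooth_on U (\<lambda>q. eta q u)"
  unfolding eta_def
  by (rule smooth_on_apply_bilinear[OF U g_smooth g_bilinear sas_smooth(1) smooth_on_const])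

lemma eta_linear: "q \<in> U \<Longrightarrow> linear (eta q)"
  unfolding eta_def[abs_def] using g_bilinear by (auto simp: bilinear_def eta_contract_eq)

context
  fixes q assumes q: "q \<in> U"
begin

interpretation i: inner_form "gb q" by (rule inner_g[OF q])

lemma phq_linear: "linear (cphi S q)" by (rule sas_x(1)[OF q])

lemma phq:
  "cphi S q (cxi S q) = 0" "gb q (cxi S q) (cxi S q) = 1" "eta q (cxi S q) = 1"
  "cphi S q (cphi S q u) = - u + eta q u *\<^sub>R cxi S q"
  "gb q (cphi S q u) (cphi S q v) = gb q u v - eta q u * eta q v"
  using sas_x[OF q] by (simp_all add: eta_def)

lemma eta_phi: "eta q (cphi S q u) = 0"
proof -
  have "cphi S q (cphi S q (cphi S q u)) = - cphi S q u"
    using linear_add[OF phq_linear] linear_neg[OF phq_linear] linear_cmul[OF phq_linear]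
      phq(1) by (simp add: phq(4)[of u] linear_diff[OF phq_linear])
  moreover have "cphi S q (cphi S q (cphi S q u)) = - cphi S q u + eta q (cphi S q u) *\<^sub>R cxi S q"
    by (rule phq(4))
  ultimately have "eta q (cphi S q u) *\<^sub>R cxi S q = 0" by simp
  then have "eta q (cphi S q u) * gb q (cxi S q) (cxi S q) = 0" by (metis i.h_scale(2) i.h_zero(2))
  then show ?thesis using phq(2) by simp
qed

lemma phq_skew: "gb q (cphi S q u) v = - gb q u (cphi S q v)"
proof -
  have "gb q (cphi S q u) (cphi S q (cphi S q v)) = gb q u (cphi S q v)"
    using phq(5)[of u "cphi S q v"] eta_phi by simp
  moreover have "gb q (cphi S q u) (cphi S q (cphi S q v)) = - gb q (cphi S q u) v + eta q v * gb q (cphi S q u) (cxi S q)"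
    by (simp add: phq(4)[of v])
  moreover have "gb q (cphi S q u) (cxi S q) = 0"
    using eta_phi[of u] i.sym by (simp add: eta_def)
  ultimately show ?thesis by simp
qed

lemma phq_trace: "trc (cphi S q) = 0"
proof -
  have "trc (cphi S q) = trc (\<lambda>v. - cphi S q v)"
    by (rule i.trc_adjoint[OF phq_linear linear_compose_neg[OF phq_linear]]) (simp add: phq_skew)
  then show ?thesis by (simp add: trc_minus)
qed

lemma curv_q:
  "curv_at (levi_civita gb) q X Y Z = - ((c - 1) / 4) *\<^sub>R
            (eta q Z *\<^sub>R (eta q Y *\<^sub>R X - eta q X *\<^sub>R Y)
             + (gb q Y Z * eta q X - gb q X Z * eta q Y) *\<^sub>R cxi S q
             + gb q (cphi S q X) Z *\<^sub>R cphi S q Y + (2 * gb q (cphi S q X) Y) *\<^sub>R cphi S q Z - gb q (cphi S q Y) Z *\<^sub>R cphi S q X)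
        + ((c + 3) / 4) *\<^sub>R (gb q Y Z *\<^sub>R X - gb q X Z *\<^sub>R Y)"
  using S q unfolding sasakian_space_form_on_def Let_def eta_def by (simp add: sas_x(8))

lemma ricci_eq: "ricci gb q v w = k2 * gb q v w + k1 * (eta q v * eta q w)"
proof -
  have l: "linear (\<lambda>u. gb q u w)" "linear (\<lambda>u. gb q (cphi S q u) w)" for w
    using i.lin(2) linear_compose[OF phq_linear i.lin(2)] by (auto simp: o_def)
  note le = eta_linear[OF q]
  have "ricci gb q v w = trc (\<lambda>u. curv_at (levi_civita gb) q u v w)"
    by (simp add: ricci_def trc_def)
  \<comment> \<open>Arranged as a combination of the identity, \<open>phi\<close> and maps of rank
    one in \<open>u\<close>, whose traces are known.\<close>
  also have "(\<lambda>u. curv_at (levi_civita gb) q u v w) = (\<lambda>u.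
      (- ((c - 1) / 4)) *\<^sub>R ((((((eta q w * eta q v) *\<^sub>R u - eta q w *\<^sub>R (eta q u *\<^sub>R v))
        + gb q v w *\<^sub>R (eta q u *\<^sub>R cxi S q)) - eta q v *\<^sub>R (gb q u w *\<^sub>R cxi S q))
        + gb q (cphi S q u) w *\<^sub>R cphi S q v) + 2 *\<^sub>R (gb q (cphi S q u) v *\<^sub>R cphi S q w)
        - gb q (cphi S q v) w *\<^sub>R cphi S q u)
      + ((c + 3) / 4) *\<^sub>R (gb q v w *\<^sub>R u - gb q u w *\<^sub>R v))"
    unfolding curv_q by (rule ext) (simp add: algebra_simps)
  also have "trc \<dots> = - ((c - 1) / 4) * (eta q w * eta q v * real DIM('e) - eta q w * eta q v + gb q v w * 1
       - eta q v * eta q w + gb q (cphi S q (cphi S q v)) w + 2 * gb q (cphi S q (cphi S q w)) v)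
      + ((c + 3) / 4) * (gb q v w * real DIM('e) - gb q v w)"
    by (simp only: trc_add trc_diff trc_scale trc_rank1[OF le] trc_rank1[OF l(1)] trc_rank1[OF l(2)] trc_id phq_trace phq(3))
      (simp add: eta_def)
  also have "\<dots> = k2 * gb q v w + k1 * (eta q v * eta q w)"
  proof -
    have pp: "gb q (cphi S q (cphi S q v)) w = - gb q v w + eta q v * eta q w" for v w
      by (simp add: phq(4) eta_def)
    show ?thesis
      unfolding pp i.sym[of w v] dime by (simp add: k1_def k2_def ricci_k2_def field_simps)
  qed
  finally show ?thesis .
qed

end

lemma FD_eta:
  assumes q: "q \<in> U"
  shows "FD (\<lambda>y. eta y v) q u = - gb q (cphi S q u) v + eta q (levi_civita gb q u v)"
proof -
  interpret i: inner_form "gb q" by (rule inner_g[OF q])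
  have "((\<lambda>y. gb y (cxi S y) v) has_derivative (\<lambda>u. FD (\<lambda>y. gb y (cxi S q) v) q u + gb q (FD (cxi S) q u) v)) (at q)"
  proof (rule has_derivative_apply_linear[OF U q, of "\<lambda>y u. gb y u v"])
    show "(\<lambda>y. gb y u v) differentiable at q" for u by (rule smooth_on_differentiable[OF g_smooth q])
    show "linear (\<lambda>u. gb y u v)" if "y \<in> U" for y using g_bilinear[OF that] by (simp add: bilinear_def)
  qed (rule smooth_on_has_derivative[OF sas_smooth(1) q])
  from FD_eqI[OF this] have "FD (\<lambda>y. eta y v) q u = FD (\<lambda>y. gb y (cxi S q) v) q u + gb q (FD (cxi S) q u) v"
    by (simp add: eta_def[abs_def])
  moreover have "FD (cxi S) q u + levi_civita gb q u (cxi S q) = - cphi S q u"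
    using sas_x(7)[OF q, of u] by (simp add: nabla_def)
  then have "gb q (FD (cxi S) q u) v = - gb q (cphi S q u) v - gb q (levi_civita gb q u (cxi S q)) v"
    by (metis add_diff_cancel_right' i.h_diff(1) i.h_minus(1))
  ultimately show ?thesis using lc_compat[OF q, of "cxi S q" v u] by (simp add: eta_def)
qed

lemma FD_phi:
  assumes q: "q \<in> U"
  shows "FD (\<lambda>y. cphi S y v) q u = gb q u v *\<^sub>R cxi S q - eta q v *\<^sub>R u + cphi S q (levi_civita gb q u v) - levi_civita gb q u (cphi S q v)"
  using sas_x(6)[OF q, of u v] by (simp add: nabla_endo_def nabla_def eta_def algebra_simps)

lemma LL_bilinear: "q \<in> U \<Longrightarrow> bilinear (LL q)"
  unfolding LL_def bilinear_def linear_iff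
  using linear_add[OF phq_linear] linear_cmul[OF phq_linear] linear_add[OF eta_linear] linear_cmul[OF eta_linear]
  by (auto simp: algebra_simps)

lemma LL_smooth: "smooth_on U (\<lambda>q. LL q u v)"
  unfolding LL_def by (intro smooth_on_add smooth_on_scaleR U eta_smooth sas_smooth(2))

definition GS where "GS q u v = levi_civita gb q u v - kk *\<^sub>R LL q u v"

lemma GS_bilinear: "q \<in> U \<Longrightarrow> bilinear (GS q)"
  using lc_bilinear[of q] LL_bilinear[of q]
  unfolding bilinear_def GS_def by (auto simp: linear_iff algebra_simps)

lemma star_eq:
  assumes q: "q \<in> U" shows "star_conn S q = GS q"
  unfolding star_conn_def
proof (rule levi_civita_eqI)
  interpret i: inner_form "gb q" by (rule inner_g[OF q])
  show "bilinear (GS q)" by (rule GS_bilinear[OF q])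
  show "GS q u v = GS q v u" for u v using lc_sym[OF q] by (simp add: GS_def LL_def add.commute)
  have ric: "ricci gb q u v = k2 * gb q u v + k1 * (eta q u * eta q v)" for u v by (rule ricci_eq[OF q])
  show "bilinear (ricci gb q)"
    unfolding bilinear_def linear_iff ric
    using linear_add[OF eta_linear[OF q]] linear_cmul[OF eta_linear[OF q]]
    by (auto simp: algebra_simps)
  show "ricci gb q u v = ricci gb q v u" for u v unfolding ric using i.sym[of u v] by simp
  \<comment> \<open>Testing with \<open>xi\<close> gives \<open>k1 + k2 = 2 * m\<close> times
    \<open>eta z\<close>; once \<open>eta z = 0\<close>, testing with \<open>z\<close> leaves
    \<open>k2\<close> times its square length.\<close>
  show "z = 0" if z: "\<And>w. ricci gb q z w = 0" for z
  proof -
    have "ricci gb q z (cxi S q) = (k1 + k2) * eta q z"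
      unfolding ric using phq(3)[OF q] i.sym[of z "cxi S q"] by (simp add: eta_def algebra_simps)
    then have e: "eta q z = 0" using z k2_pos(2) m_pos by simp
    have "ricci gb q z z = k2 * gb q z z" unfolding ric e by simp
    then show ?thesis using z k2_pos(1) i.h_eq_0 by simp
  qed
  show "FD (\<lambda>y. ricci gb y v w) q u = ricci gb q (GS q u v) w + ricci gb q v (GS q u w)" for u v w
  proof -
    have "((\<lambda>y. k2 * gb y v w + k1 * (eta y v * eta y w)) has_derivative
      (\<lambda>u. k2 * FD (\<lambda>y. gb y v w) q u + k1 * (eta q v * FD (\<lambda>y. eta y w) q u + FD (\<lambda>y. eta y v) q u * eta q w))) (at q)"
      by (intro has_derivative_add has_derivative_mult_right has_derivative_mult
          smooth_on_has_derivative[OF g_smooth q] smooth_on_has_derivative[OF eta_smooth q])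
    from FD_eqI[OF this] have "FD (\<lambda>y. ricci gb y v w) q u
      = k2 * FD (\<lambda>y. gb y v w) q u + k1 * (eta q v * FD (\<lambda>y. eta y w) q u + FD (\<lambda>y. eta y v) q u * eta q w)"
      using FD_cong_open[OF U q, of "\<lambda>y. ricci gb y v w" "\<lambda>y. k2 * gb y v w + k1 * (eta y v * eta y w)"] ricci_eq by simp
    moreover have e: "eta q (GS q u v) = eta q (levi_civita gb q u v)" for u v
      using linear_diff[OF eta_linear[OF q]] linear_add[OF eta_linear[OF q]] linear_cmul[OF eta_linear[OF q]] eta_phi[OF q]
      by (simp add: GS_def LL_def)
    have g1: "gb q (GS q u v) w = gb q (levi_civita gb q u v) w - kk * (eta q u * gb q (cphi S q v) w + eta q v * gb q (cphi S q u) w)" for u v w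
      by (simp add: GS_def LL_def)
    have g2: "gb q v (GS q u w) = gb q v (levi_civita gb q u w) - kk * (eta q u * gb q (cphi S q w) v + eta q w * gb q (cphi S q u) v)"
      using g1[of u w v] i.sym by simp
    have sk: "gb q (cphi S q w) v = - gb q (cphi S q v) w" using phq_skew[OF q, of w v] i.sym by simp
    have kk: "k1 = kk * k2" using k2_pos by simp
    show ?thesis
      unfolding calculation ric e g1 g2 FD_eta[OF q] lc_compat[OF q] sk kk by (simp add: algebra_simps)
  qed
qed

sublocale star: along_map U "star_conn S" W P
proof
  show "smooth_on U (\<lambda>q. star_conn S q u v)" for u v
  proof (rule smooth_on_cong[OF U])
    show "smooth_on U (\<lambda>q. GS q u v)"
      unfolding GS_def by (intro smooth_on_diff smooth_on_scaleR smooth_on_const U lc_smooth LL_smooth)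
  qed (simp add: star_eq)
  show "bilinear (star_conn S q)" if "q \<in> U" for q using GS_bilinear[OF that] star_eq[OF that] by simp
  show "star_conn S q u v = star_conn S q v u" if "q \<in> U" for q u v
    using lc_sym[OF that, of u v] by (simp add: star_eq[OF that] GS_def LL_def add.commute)
qed (use U oW P PU in auto)

lemma eta_ip: "eta (P x) Y = ip x (xi x) Y"
  by (simp add: eta_def ip_def xi_def)

lemma star_cd: "x \<in> W \<Longrightarrow> star.cd u Y x = cd u Y x
    - kk *\<^sub>R (ip x (xi x) (FD P x u) *\<^sub>R phi x (Y x) + ip x (xi x) (Y x) *\<^sub>R phi x (FD P x u))"
  by (simp add: star.cd_def cd_def star_eq[OF Px] GS_def LL_def eta_ip phi_def)

text \<open>The connection differs from the Levi-Civita one by the tensor \<open>- kk * LL\<close>.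
  The curvature therefore changes by the antisymmetrised covariant derivative of \<open>LL\<close>,
  which the Sasakian identities make algebraic, and by a commutator quadratic in
  \<open>LL\<close>.\<close>

lemma star_curv:
  assumes q: "q \<in> U"
  shows "curv_at (star_conn S) q a b w = curv_at (levi_civita gb) q a b w
    - kk *\<^sub>R ((- gb q (cphi S q a) b) *\<^sub>R cphi S q w + eta q b *\<^sub>R (gb q a w *\<^sub>R cxi S q - eta q w *\<^sub>R a)
        + (- gb q (cphi S q a) w) *\<^sub>R cphi S q b + eta q w *\<^sub>R (gb q a b *\<^sub>R cxi S q - eta q b *\<^sub>R a)
      - ((- gb q (cphi S q b) a) *\<^sub>R cphi S q w + eta q a *\<^sub>R (gb q b w *\<^sub>R cxi S q - eta q w *\<^sub>R b)
        + (- gb q (cphi S q b) w) *\<^sub>R cphi S q a + eta q w *\<^sub>R (gb q b a *\<^sub>R cxi S q - eta q a *\<^sub>R b)))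
    + (kk * kk) *\<^sub>R (LL q a (LL q b w) - LL q b (LL q a w))"
proof -
  define G where "G = levi_civita gb q"
  have Gb: "bilinear G" unfolding G_def by (rule lc_bilinear[OF q])
  have dLL: "FD (\<lambda>y. LL y b w) q a = (- gb q (cphi S q a) b + eta q (G a b)) *\<^sub>R cphi S q w
      + eta q b *\<^sub>R (gb q a w *\<^sub>R cxi S q - eta q w *\<^sub>R a + cphi S q (G a w) - G a (cphi S q w))
      + ((- gb q (cphi S q a) w + eta q (G a w)) *\<^sub>R cphi S q b
      + eta q w *\<^sub>R (gb q a b *\<^sub>R cxi S q - eta q b *\<^sub>R a + cphi S q (G a b) - G a (cphi S q b)))" for a b w
  proof -
    have "((\<lambda>y. LL y b w) has_derivative (\<lambda>a. (eta q b *\<^sub>R FD (\<lambda>y. cphi S y w) q a + FD (\<lambda>y. eta y b) q a *\<^sub>R cphi S q w)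
      + (eta q w *\<^sub>R FD (\<lambda>y. cphi S y b) q a + FD (\<lambda>y. eta y w) q a *\<^sub>R cphi S q b))) (at q)"
      unfolding LL_def
      by (intro has_derivative_add has_derivative_scaleR smooth_on_has_derivative[OF sas_smooth(2) q]
          smooth_on_has_derivative[OF eta_smooth q])
    from FD_eqI[OF this] show ?thesis
      unfolding FD_eta[OF q] FD_phi[OF q] G_def[symmetric] by (simp add: algebra_simps)
  qed
  have dGS: "FD (\<lambda>y. star_conn S y b w) q a = FD (\<lambda>y. levi_civita gb y b w) q a - kk *\<^sub>R FD (\<lambda>y. LL y b w) q a" for a b w
  proof -
    have "((\<lambda>y. GS y b w) has_derivative (\<lambda>a. FD (\<lambda>y. levi_civita gb y b w) q a - kk *\<^sub>R FD (\<lambda>y. LL y b w) q a)) (at q)"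
      unfolding GS_def
      by (intro has_derivative_diff has_derivative_scaleR_right smooth_on_has_derivative[OF lc_smooth q]
          smooth_on_has_derivative[OF LL_smooth q])
    from FD_eqI[OF this] show ?thesis
      using FD_cong_open[OF U q, of "\<lambda>y. star_conn S y b w" "\<lambda>y. GS y b w"] star_eq by simp
  qed
  have c1: "curv_at (star_conn S) q a b w = FD (\<lambda>y. star_conn S y b w) q a - FD (\<lambda>y. star_conn S y a w) q b
      + star_conn S q a (star_conn S q b w) - star_conn S q b (star_conn S q a w)"
    by (rule curv_at_eq[OF U q star.Gs star.Gb])
  have c2: "curv_at (levi_civita gb) q a b w = FD (\<lambda>y. levi_civita gb y b w) q a - FD (\<lambda>y. levi_civita gb y a w) q b
      + G a (G b w) - G b (G a w)"
    unfolding G_def by (rule curv_at_eq[OF U q lc_smooth lc_bilinear])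
  have GSq: "star_conn S q u v = G u v - kk *\<^sub>R LL q u v" for u v
    by (simp add: star_eq[OF q] GS_def G_def)
  note Ll = bilinear_radd[OF LL_bilinear[OF q]] bilinear_rsub[OF LL_bilinear[OF q]] bilinear_rmul[OF LL_bilinear[OF q]]
  note Gl = bilinear_radd[OF Gb] bilinear_rsub[OF Gb] bilinear_rmul[OF Gb]
  have LG: "LL q a (G b w) = eta q a *\<^sub>R cphi S q (G b w) + eta q (G b w) *\<^sub>R cphi S q a" for a b w
    by (simp add: LL_def)
  have GL: "G a (LL q b w) = eta q b *\<^sub>R G a (cphi S q w) + eta q w *\<^sub>R G a (cphi S q b)" for a b w
    by (simp add: LL_def Gl)
  have Gs: "G b a = G a b" unfolding G_def by (rule lc_sym[OF q])
  show ?thesis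
    unfolding c1 dGS c2 GSq dLL Gl Ll LG GL Gs by (simp add: algebra_simps)
qed

end

section \<open>The Ricci-bitension field\<close>

lemma scaleR_double:
  "(2 * a) *\<^sub>R v = a *\<^sub>R v + a *\<^sub>R (v :: 'v::real_vector)"
  "(r * (2 * a)) *\<^sub>R v = (r * a) *\<^sub>R v + (r * a) *\<^sub>R v"
  by (simp_all flip: scaleR_add_left)

lemma scaleR_triple: "(3 * a) *\<^sub>R v = a *\<^sub>R v + (a *\<^sub>R v + a *\<^sub>R (v :: 'v::real_vector))"
  by (simp flip: scaleR_add_left)

context hypk
begin

text \<open>The mean curvature with respect to \<open>N\<close>, so that \<open>H = f N\<close>; the
  sign is there because \<open>B\<close> is minus the Weingarten operator.\<close>

definition f where "f x = - trc (B x) / (2 * real m)"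
definition Gf where "Gf x = FD P x (sharp (pb x) (FD f x))"
text \<open>Derivative of \<open>N\<close> for the connection of the Ricci tensor; the second term
  is the contribution of the difference tensor.\<close>

definition Zop where "Zop x Y = B x Y + (kk * ip x Y (xi x)) *\<^sub>R V x"

lemma f_smooth: "smooth_on W f"
  unfolding f_def divide_real_def
  by (intro smooth_on_mult smooth_on_minus trc_smooth B_sop smooth_on_const oW)

lemma Gf_smooth: "smooth_on W Gf"
  unfolding Gf_def
  by (intro dP_smooth smooth_on_sharp[OF oW pb_riemannian] smooth_on_FD f_smooth smooth_on_FD_linear[OF f_smooth])

lemma Gf_N: "x \<in> W \<Longrightarrow> ip x (Gf x) (N x) = 0"
  unfolding Gf_def by (rule dP_N)

lemma Gf_dr:
  assumes x: "x \<in> W" and X: "ip x X (N x) = 0"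
  shows "dr X f x = ip x (Gf x) X"
proof -
  interpret b: inner_form "pb x" by (rule inner_pb[OF x])
  have "FD f x (tau x X) = pb x (sharp (pb x) (FD f x)) (tau x X)"
    using b.sharp_works[OF smooth_on_FD_linear[OF f_smooth x]] by simp
  then show ?thesis using X by (simp add: dr_def Gf_def pb_ip dP_tau_tangent[OF x])
qed

text \<open>The tangential part of the ambient derivative is torsion-free and compatible with the
  induced metric, so uniqueness applies.\<close>

lemma lc_pb:
  assumes x: "x \<in> W"
  shows "levi_civita pb x u v = tau x (cd u (\<lambda>y. FD P y v) x)"
proof -
  interpret i: inner_form "ip x" by (rule inner_ip[OF x])
  interpret b: inner_form "pb x" by (rule inner_pb[OF x])
  have s: "smooth_on W (\<lambda>y. FD P y v)" for v by (rule dP_smooth[OF smooth_on_const])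
  have lv: "linear (\<lambda>v. cd u (\<lambda>y. FD P y v) x)" for u
  proof -
    have "cd u (\<lambda>y. FD P y v) x = cd v (\<lambda>y. FD P y u) x" for v by (rule cd_torsion[OF x])
    then show ?thesis using cd_linear[OF s x, of u] by simp
  qed
  have "levi_civita pb x = (\<lambda>u v. tau x (cd u (\<lambda>y. FD P y v) x))"
  proof (rule levi_civita_eqI)
    show "bilinear (\<lambda>u v. tau x (cd u (\<lambda>y. FD P y v) x))"
      unfolding bilinear_def
      using linear_compose[OF lv tau_linear[OF x]] linear_compose[OF cd_linear[OF s x] tau_linear[OF x]]
      by (simp add: o_def)
    show "tau x (cd u (\<lambda>y. FD P y v) x) = tau x (cd v (\<lambda>y. FD P y u) x)" for u v
      using cd_torsion[OF x, of u v] by simp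
    show "FD (\<lambda>y. pb y v w) x u = pb x (tau x (cd u (\<lambda>y. FD P y v) x)) w + pb x v (tau x (cd u (\<lambda>y. FD P y w) x))" for u v w
    proof -
      have "pb x v (tau x (cd u (\<lambda>y. FD P y w) x)) = ip x (FD P x v) (cd u (\<lambda>y. FD P y w) x)"
        using b.sym[of v] i.sym[of "FD P x v"] tau_pb[OF x] by simp
      then show ?thesis unfolding pb_ip[of _ v w] using FD_ip[OF s s x, of v w u] tau_pb[OF x] by simp
    qed
    show "bilinear (pb x)" by (rule b.bil)
    show "pb x u v = pb x v u" for u v by (rule b.sym)
    show "z = 0" if "\<And>w. pb x z w = 0" for z using that b.h_eq_0 by blast
  qed
  then show ?thesis by simp
qed

lemma pb_eq: "pullback_form (cmet S) P = pb"
  by (simp add: pb_def[abs_def])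

lemma nab_dP: "x \<in> W \<Longrightarrow> cd u Y x = nab (FD P x u) Y x"
  by (simp add: nab_def tau_dP)

section \<open>Mean curvature vector and sums over tangent frames\<close>

lemma second_ff_eq:
  assumes x: "x \<in> W"
  shows "second_ff S P x u v = - ip x (FD P x v) (B x (FD P x u)) *\<^sub>R N x"
proof -
  define Y where "Y = cd u (\<lambda>y. FD P y v) x"
  have s: "smooth_on W (\<lambda>y. FD P y v)" by (rule dP_smooth[OF smooth_on_const])
  have "ip x Y (N x) = - ip x (FD P x v) (B x (FD P x u))"
    unfolding Y_def nab_dP[OF x] by (rule B_second_form[OF x s]) (rule dP_N)
  moreover have "second_ff S P x u v = Y - FD P x (tau x Y)"
    by (simp add: second_ff_def along_cd pb_eq nabla_def lc_pb[OF x] Y_def)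
  ultimately show ?thesis by (simp add: dP_tau[OF x])
qed

context
  fixes x F assumes x: "x \<in> W" and F: "inner_form.onb (pb x) F"
begin

interpretation i: inner_form "ip x" by (rule inner_ip[OF x])
interpretation b: inner_form "pb x" by (rule inner_pb[OF x])

lemma frame_split: "(\<Sum>w\<in>insert (N x) (FD P x ` F). h w) = h (N x) + (\<Sum>u\<in>F. h (FD P x u))"
  for h :: "'e \<Rightarrow> 'z::comm_monoid_add"
  using frame_onb[OF x F] b.orth_finite(1)[of F] F
  by (simp add: b.onb_def sum.reindex)

lemma frame_sum:
  assumes L: "linear L" shows "(\<Sum>u\<in>F. ip x A (FD P x u) *\<^sub>R L (FD P x u)) = L (A - ip x A (N x) *\<^sub>R N x)"
proof -
  have "A = ip x A (N x) *\<^sub>R N x + (\<Sum>u\<in>F. ip x A (FD P x u) *\<^sub>R FD P x u)"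
    using i.onb_expand[OF frame_onb(1)[OF x F], of A] frame_split[of "\<lambda>w. ip x A w *\<^sub>R w"] by simp
  then have "L (A - ip x A (N x) *\<^sub>R N x) = L (\<Sum>u\<in>F. ip x A (FD P x u) *\<^sub>R FD P x u)"
    by (metis add_diff_cancel_left')
  then show ?thesis by (simp add: linear_sum[OF L] linear_cmul[OF L])
qed

lemma frame_trc:
  assumes L: "linear L" shows "(\<Sum>u\<in>F. ip x (L (FD P x u)) (FD P x u)) = trc L - ip x (L (N x)) (N x)"
  unfolding i.trc_onb[OF L frame_onb(1)[OF x F]] frame_split[of "\<lambda>w. ip x (L w) w"] by simp

text \<open>Divergence of \<open>B\<close>. By Codazzi its tangential part is the derivative of the
  trace of \<open>B\<close>; the normal part arises because the derivative is taken in the ambient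
  bundle.\<close>

lemma frame_codazzi:
  "(\<Sum>u\<in>F. dop (FD P x u) B x (FD P x u)) = - trc (\<lambda>v. B x (B x v)) *\<^sub>R N x - (2 * real m) *\<^sub>R Gf x"
proof (rule i.h_ext)
  fix w
  define cod where "cod = (\<Sum>u\<in>F. dop (FD P x u) B x (FD P x u))"
  note lB = sop_linear[OF B_sop x]
  have s: "smooth_on W (\<lambda>y. FD P y v)" for v by (rule dP_smooth[OF smooth_on_const])
  have n: "ip x (dop (FD P x u) B x (FD P x u)) (N x) = - ip x (B x (B x (FD P x u))) (FD P x u)" for u
  proof -
    have "ip x (nab (FD P x u) (\<lambda>y. B y (FD P y u)) x) (N x) = - ip x (B x (FD P x u)) (nab (FD P x u) N x)"
      by (rule nab_ip_const[OF sop_smooth[OF B_sop s] N_smooth x B_tangent])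
    then have "ip x (dop (FD P x u) B x (FD P x u)) (N x) = - ip x (B x (FD P x u)) (B x (FD P x u))"
      using nab_op[OF B_sop s x, of "FD P x u" u] B_tangent[OF x] by (simp add: B_def[of x "FD P x u"])
    then show ?thesis using B_self_adjoint[OF x] by simp
  qed
  have nN: "ip x cod (N x) = - trc (\<lambda>v. B x (B x v))"
  proof -
    have "linear (\<lambda>v. B x (B x v))" using linear_compose[OF lB lB] by (simp add: o_def)
    from frame_trc[OF this] show ?thesis
      unfolding cod_def i.h_sum n sum_negf using B_N[OF x] linear_0[OF lB] by simp
  qed
  have t: "ip x cod Y = - (2 * real m) * ip x (Gf x) Y" if Y: "ip x Y (N x) = 0" for Y
  proof -
    have tE: "ip x (FD P x u) (N x) = 0" for u by (rule dP_N[OF x])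
    \<comment> \<open>The sum of \<open>ip V e\<close> times \<open>phi e\<close> over the frame is
      \<open>phi V = N\<close>, which is orthogonal to \<open>Y\<close>.\<close>
    have CRn: "(\<Sum>u\<in>F. ip x (CR x (FD P x u) Y (N x)) (FD P x u)) = 0"
    proof -
      have V1: "phi x (N x) = - V x" using V_simps[OF x] by simp
      have a: "ip x (phi x (FD P x u)) (N x) = ip x (V x) (FD P x u)" for u
        using phi_skew[OF x, of "FD P x u" "N x"] V1 i.sym by simp
      have "ip x (CR x (FD P x u) Y (N x)) (FD P x u) =
        ((c - 1) / 4) * (2 * (ip x (V x) (FD P x u) * ip x (phi x (FD P x u)) Y) - ip x (V x) (FD P x u) * ip x (phi x Y) (FD P x u))" for u
        using Y tE[of u] xi_N[OF x] a[of u] phi_self[OF x, of "FD P x u"] i.sym[of "V x" "FD P x u"]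
        by (simp add: CR_def V1 algebra_simps)
      also have "\<dots> u = ((c - 1) / 4) * (3 * ip x (ip x (V x) (FD P x u) *\<^sub>R phi x (FD P x u)) Y)" for u
        using phi_skew[OF x, of Y "FD P x u"] i.sym[of Y] by simp
      finally have "(\<Sum>u\<in>F. ip x (CR x (FD P x u) Y (N x)) (FD P x u))
          = ((c - 1) / 4) * (3 * ip x (\<Sum>u\<in>F. ip x (V x) (FD P x u) *\<^sub>R phi x (FD P x u)) Y)"
        by (simp only: i.h_sum sum_distrib_left)
      also have "(\<Sum>u\<in>F. ip x (V x) (FD P x u) *\<^sub>R phi x (FD P x u)) = N x"
        using frame_sum[OF phi_linear[OF x], of "V x"] V_simps[OF x] by simp
      finally show ?thesis using Y i.sym by simp
    qed
    have "ip x (dop (FD P x u) B x (FD P x u)) Y = ip x (dop Y B x (FD P x u)) (FD P x u) + ip x (CR x (FD P x u) Y (N x)) (FD P x u)" for u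
    proof -
      have "ip x (dop (FD P x u) B x (FD P x u)) Y = ip x (FD P x u) (dop (FD P x u) B x Y)"
        by (rule dop_self_adjoint[OF B_sop B_self_adjoint x])
      moreover have "dop (FD P x u) B x Y = dop Y B x (FD P x u) + CR x (FD P x u) Y (N x)"
        using codazzi[OF x tE Y, of u] by (simp add: algebra_simps)
      ultimately show ?thesis using i.sym by simp
    qed
    then have "ip x cod Y = (\<Sum>u\<in>F. ip x (dop Y B x (FD P x u)) (FD P x u))"
      unfolding cod_def i.h_sum using CRn by (simp add: sum.distrib)
    also have "\<dots> = trc (dop Y B x) - ip x (dop Y B x (N x)) (N x)"
      by (rule frame_trc[OF dop_linear[OF B_sop x]])
    also have "ip x (dop Y B x (N x)) (N x) = 0"
    proof -
      have "nab Y (\<lambda>y. B y (N y)) x = 0"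
        using nab_cong[of "\<lambda>y. B y (N y)" "\<lambda>_. 0", OF B_N x] cd_zero[OF x] by (simp add: nab_def)
      then have "dop Y B x (N x) = - B x (nab Y N x)"
        using nab_op[OF B_sop N_smooth x, of Y] by (simp add: eq_neg_iff_add_eq_0)
      then show ?thesis using B_tangent[OF x] by simp
    qed
    also have "trc (dop Y B x) = dr Y (\<lambda>y. trc (B y)) x" by (rule dr_trc[OF B_sop x, symmetric])
    also have "\<dots> = dr Y (\<lambda>y. (- 2 * real m) * f y) x"
      by (rule dr_cong[OF _ x]) (use m_pos in \<open>simp add: f_def\<close>)
    also have "\<dots> = - (2 * real m) * ip x (Gf x) Y"
      using dr_cmult[OF f_smooth x, of Y "- 2 * real m"] Gf_dr[OF x Y] by simp
    finally show ?thesis by simp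
  qed
  define Y where "Y = w - ip x w (N x) *\<^sub>R N x"
  have Y: "ip x Y (N x) = 0" "w = Y + ip x w (N x) *\<^sub>R N x" using NN[OF x] by (simp_all add: Y_def)
  have "ip x cod w = - (2 * real m) * ip x (Gf x) Y - ip x w (N x) * trc (\<lambda>v. B x (B x v))"
    by (subst Y(2)) (simp add: nN t[OF Y(1)])
  also have "\<dots> = ip x (- trc (\<lambda>v. B x (B x v)) *\<^sub>R N x - (2 * real m) *\<^sub>R Gf x) w"
    using Gf_N[OF x] i.sym[of w] by (simp add: Y_def)
  finally show "ip x (\<Sum>u\<in>F. dop (FD P x u) B x (FD P x u)) w
    = ip x (- trc (\<lambda>v. B x (B x v)) *\<^sub>R N x - (2 * real m) *\<^sub>R Gf x) w" unfolding cod_def .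
qed

end

lemma mean_curv_eq:
  assumes x: "x \<in> W" shows "mean_curv S P x = f x *\<^sub>R N x"
proof -
  interpret i: inner_form "ip x" by (rule inner_ip[OF x])
  interpret b: inner_form "pb x" by (rule inner_pb[OF x])
  obtain F where F: "b.onb F" using b.onb_extend[of "{}"] by (auto simp: b.orth_def)
  note lB = sop_linear[OF B_sop x]
  have l: "linear (\<lambda>u. B x (FD P x u))" using linear_compose[OF dP_linear[OF x] lB] by (simp add: o_def)
  have "bilinear (\<lambda>u v. - ip x (FD P x v) (B x (FD P x u)) *\<^sub>R N x)"
    unfolding bilinear_def linear_iff
    using linear_add[OF dP_linear[OF x]] linear_cmul[OF dP_linear[OF x]] linear_add[OF l] linear_cmul[OF l]
    by (simp add: algebra_simps)
  then have "metric_trace (pb x) (second_ff S P x) = (\<Sum>u\<in>F. second_ff S P x u u)"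
    using b.metric_trace_onb[OF _ F] by (simp add: second_ff_eq[OF x, abs_def])
  also have "\<dots> = - (\<Sum>u\<in>F. ip x (B x (FD P x u)) (FD P x u)) *\<^sub>R N x"
    using i.sym by (simp add: second_ff_eq[OF x] scaleR_sum_left sum_negf)
  also have "(\<Sum>u\<in>F. ip x (B x (FD P x u)) (FD P x u)) = trc (B x)"
    using frame_trc[OF x F lB] B_N[OF x] by simp
  finally show ?thesis using m_pos by (simp add: mean_curv_def pb_eq dimf f_def)
qed

section \<open>Laplacian and curvature term of the mean curvature vector\<close>

lemma Zop_linear: "x \<in> W \<Longrightarrow> linear (Zop x)"
proof -
  assume x: "x \<in> W"
  interpret i: inner_form "ip x" by (rule inner_ip[OF x])
  show ?thesis unfolding Zop_def linear_iff
    using linear_add[OF sop_linear[OF B_sop x]] linear_cmul[OF sop_linear[OF B_sop x]] by (simp add: algebra_simps)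
qed

lemma star_cd_H:
  assumes x: "x \<in> W"
  shows "star.cd v (mean_curv S P) x = ip x (Gf x) (FD P x v) *\<^sub>R N x + f x *\<^sub>R Zop x (FD P x v)"
proof -
  interpret i: inner_form "ip x" by (rule inner_ip[OF x])
  have "star.cd v (mean_curv S P) x = star.cd v (\<lambda>y. f y *\<^sub>R N y) x"
    by (rule star.cd_cong[OF mean_curv_eq x])
  also have "\<dots> = dr (FD P x v) f x *\<^sub>R N x + f x *\<^sub>R B x (FD P x v)
     - kk *\<^sub>R (ip x (xi x) (FD P x v) *\<^sub>R phi x (f x *\<^sub>R N x))"
    using xi_N[OF x] nab_scale[OF f_smooth N_smooth x, of "FD P x v"]
    by (simp add: star_cd[OF x] nab_dP[OF x] B_def)
  also have "\<dots> = ip x (Gf x) (FD P x v) *\<^sub>R N x + f x *\<^sub>R Zop x (FD P x v)"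
    using Gf_dr[OF x dP_N[OF x]] V_simps[OF x] linear_cmul[OF phi_linear[OF x]] i.sym[of "xi x" "FD P x v"]
    by (simp add: Zop_def algebra_simps)
  finally show ?thesis .
qed

definition hessT where
  "hessT x u v = star.cd u (star.cd v (mean_curv S P)) x - star.cd (levi_civita pb x u v) (mean_curv S P) x"

text \<open>The terms with the derivative \<open>nE\<close> of the coordinate field cancel against
  the correction by the induced connection; what remains is tensorial.\<close>

lemma hessT_eq:
  assumes x: "x \<in> W"
  shows "hessT x u v = (let X = FD P x u; E = FD P x v in
    ip x (nab X Gf x) E *\<^sub>R N x + ip x (Gf x) E *\<^sub>R Zop x X + ip x (Gf x) X *\<^sub>R Zop x E
    + f x *\<^sub>R (dop X B x E - kk *\<^sub>R (ip x E (phi x X) *\<^sub>R V x + ip x E (xi x) *\<^sub>R phi x (B x X))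
      - kk *\<^sub>R (ip x X (xi x) *\<^sub>R phi x (Zop x E) + ip x E (V x) *\<^sub>R phi x X)))"
proof -
  interpret i: inner_form "ip x" by (rule inner_ip[OF x])
  define E where "E y = FD P y v" for y
  define X where "X = FD P x u"
  have E: "smooth_on W E" unfolding E_def by (rule dP_smooth[OF smooth_on_const])
  have EN: "ip y (E y) (N y) = 0" if "y \<in> W" for y unfolding E_def by (rule dP_N[OF that])
  have XN: "ip x X (N x) = 0" unfolding X_def by (rule dP_N[OF x])
  define nE where "nE = nab X E x"
  define K where "K y = ip y (Gf y) (E y) *\<^sub>R N y + f y *\<^sub>R Zop y (E y)" for y
  have BE: "smooth_on W (\<lambda>y. B y (E y))" by (rule sop_smooth[OF B_sop E])
  have eV: "smooth_on W (\<lambda>y. (kk * ip y (E y) (xi y)) *\<^sub>R V y)"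
    by (intro smooth_on_scaleR smooth_on_mult smooth_on_const ip_smooth E xi_smooth V_smooth oW)
  have ZE: "smooth_on W (\<lambda>y. Zop y (E y))" unfolding Zop_def by (intro smooth_on_add oW BE eV)
  have GE: "smooth_on W (\<lambda>y. ip y (Gf y) (E y))" by (intro ip_smooth Gf_smooth E)
  have nZ: "nab X (\<lambda>y. Zop y (E y)) x = dop X B x (E x) + Zop x nE
     - kk *\<^sub>R (ip x (E x) (phi x X) *\<^sub>R V x + ip x (E x) (xi x) *\<^sub>R phi x (B x X))"
  proof -
    have "nab X (\<lambda>y. Zop y (E y)) x = (dop X B x (E x) + B x nE)
      + (dr X (\<lambda>y. kk * ip y (E y) (xi y)) x *\<^sub>R V x + (kk * ip x (E x) (xi x)) *\<^sub>R nab X V x)"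
      unfolding Zop_def nab_add[OF BE eV x] nE_def
      using nab_op[OF B_sop E x, of X] nab_scale[OF smooth_on_mult[OF oW smooth_on_const ip_smooth[OF E xi_smooth]] V_smooth x, of X kk]
      by simp
    moreover have "dr X (\<lambda>y. kk * ip y (E y) (xi y)) x = kk * (ip x nE (xi x) - ip x (E x) (phi x X))"
      unfolding dr_cmult[OF ip_smooth[OF E xi_smooth] x] dr_ip[OF E xi_smooth x] nab_xi[OF x XN] nE_def by simp
    ultimately show ?thesis unfolding nab_V[OF x XN] Zop_def by (simp add: algebra_simps)
  qed
  have Ks: "smooth_on W K" unfolding K_def
    by (intro smooth_on_add smooth_on_scaleR oW GE N_smooth f_smooth ZE)
  have "nab X K x = nab X (\<lambda>y. ip y (Gf y) (E y) *\<^sub>R N y) x + nab X (\<lambda>y. f y *\<^sub>R Zop y (E y)) x"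
    unfolding K_def by (rule nab_add[OF smooth_on_scaleR[OF oW GE N_smooth] smooth_on_scaleR[OF oW f_smooth ZE] x])
  also have "\<dots> = (ip x (nab X Gf x) (E x) + ip x (Gf x) nE) *\<^sub>R N x + ip x (Gf x) (E x) *\<^sub>R B x X
    + (ip x (Gf x) X *\<^sub>R Zop x (E x) + f x *\<^sub>R nab X (\<lambda>y. Zop y (E y)) x)"
    unfolding nab_scale[OF GE N_smooth x] nab_scale[OF f_smooth ZE x] dr_ip[OF Gf_smooth E x] Gf_dr[OF x XN]
    by (simp add: B_def nE_def)
  finally have nK: "nab X K x = \<dots>" .
  have s1: "star.cd u (star.cd v (mean_curv S P)) x = nab X K x
      - kk *\<^sub>R (ip x (xi x) X *\<^sub>R phi x (K x) + ip x (xi x) (K x) *\<^sub>R phi x X)"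
  proof -
    have "star.cd u (star.cd v (mean_curv S P)) x = star.cd u K x"
      by (rule star.cd_cong[OF _ x]) (simp add: star_cd_H K_def E_def)
    then show ?thesis by (simp add: star_cd[OF x] nab_dP[OF x] X_def)
  qed
  have xK: "ip x (xi x) (K x) = f x * ip x (E x) (V x)"
  proof -
    have "ip x (xi x) (B x (E x)) = ip x (V x) (E x)"
      using B_self_adjoint[OF x, of "xi x" "E x"] B_xi[OF x] by simp
    then show ?thesis using xi_N[OF x] V_simps[OF x] i.sym[of "V x" "E x"] by (simp add: K_def Zop_def)
  qed
  have pK: "phi x (K x) = - ip x (Gf x) (E x) *\<^sub>R V x + f x *\<^sub>R phi x (Zop x (E x))"
    using V_simps[OF x] by (simp add: K_def linear_add[OF phi_linear[OF x]] linear_cmul[OF phi_linear[OF x]])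
  have s2: "star.cd (levi_civita pb x u v) (mean_curv S P) x = ip x (Gf x) nE *\<^sub>R N x + f x *\<^sub>R Zop x nE"
  proof -
    have t: "levi_civita pb x u v = tau x nE"
      unfolding lc_pb[OF x] by (simp add: nE_def X_def E_def[abs_def] nab_def tau_dP[OF x])
    have "Zop x (N x) = 0" using B_N[OF x] i.sym[of "N x" "xi x"] xi_N[OF x] by (simp add: Zop_def)
    then show ?thesis
      unfolding star_cd_H[OF x] t dP_tau[OF x]
      using Gf_N[OF x] by (simp add: linear_diff[OF Zop_linear[OF x]] linear_cmul[OF Zop_linear[OF x]])
  qed
  have ZX: "Zop x X = B x X + (kk * ip x (xi x) X) *\<^sub>R V x" using i.sym[of X "xi x"] by (simp add: Zop_def)
  show ?thesis
    unfolding hessT_def s1 s2 xK pK nK nZ Let_def E_def[symmetric] X_def[symmetric] ZX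
    using i.sym[of X "xi x"] by (simp add: algebra_simps)
qed

lemma hessT_bilinear:
  assumes x: "x \<in> W" shows "bilinear (hessT x)"
proof -
  interpret i: inner_form "ip x" by (rule inner_ip[OF x])
  have s: "smooth_on W (\<lambda>y. B y v)" for v using B_sop by (simp add: sop_def)
  have d1: "dop (X + Y) B x v = dop X B x v + dop Y B x v" "dop (r *\<^sub>R X) B x v = r *\<^sub>R dop X B x v" for X Y v r
    unfolding dop_def
    using linear_add[OF nab_linear[OF s x]] linear_add[OF nab_linear[OF smooth_on_const x]]
      linear_cmul[OF nab_linear[OF s x]] linear_cmul[OF nab_linear[OF smooth_on_const x]]
    by (simp_all add: linear_add[OF sop_linear[OF B_sop x]] linear_cmul[OF sop_linear[OF B_sop x]] algebra_simps)
  note lins = linear_add[OF dP_linear[OF x]] linear_cmul[OF dP_linear[OF x]]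
    linear_add[OF nab_linear[OF Gf_smooth x]] linear_cmul[OF nab_linear[OF Gf_smooth x]]
    linear_add[OF Zop_linear[OF x]] linear_cmul[OF Zop_linear[OF x]]
    linear_add[OF phi_linear[OF x]] linear_cmul[OF phi_linear[OF x]]
    linear_add[OF sop_linear[OF B_sop x]] linear_cmul[OF sop_linear[OF B_sop x]]
    linear_add[OF dop_linear[OF B_sop x]] linear_cmul[OF dop_linear[OF B_sop x]] d1
  show ?thesis
    unfolding bilinear_def linear_iff hessT_eq[OF x] Let_def by (simp add: lins algebra_simps)
qed

text \<open>The constant of the curvature term \<open>f * Ctot * N\<close>. Its last summand comes
  from the direction \<open>xi\<close>, in which the Ricci metric has the value
  \<open>2 * m\<close>; in the others it has the value \<open>k2\<close>.\<close>

definition Ctot where "Ctot = (- 3 * (c - 1) / 4 + 3 * kk - (2 * real m - 1) * (c + 3) / 4) / k2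
   - (1 + kk)\<^sup>2 / (2 * real m)"

lemma star_laplacian_eq:
  assumes x: "x \<in> W"
  shows "- star_laplacian S P (mean_curv S P) x = (trc (\<lambda>X. nab X Gf x)
     - f x * (trc (\<lambda>v. B x (B x v)) + 3 * kk + kk\<^sup>2)) *\<^sub>R N x
     + 2 *\<^sub>R Zop x (Gf x) - (2 * real m * f x) *\<^sub>R Gf x"
proof -
  interpret i: inner_form "ip x" by (rule inner_ip[OF x])
  interpret b: inner_form "pb x" by (rule inner_pb[OF x])
  obtain F where F: "b.onb F" using b.onb_extend[of "{}"] by (auto simp: b.orth_def)
  define E where "E u = FD P x u" for u
  have "nabla (levi_civita pb) (\<lambda>_. u) (\<lambda>_. v) = (\<lambda>y. levi_civita pb y u v)" for u v
    by (simp add: nabla_def fun_eq_iff)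
  then have "- star_laplacian S P (mean_curv S P) x = metric_trace (pb x) (hessT x)"
    unfolding star_laplacian_def pb_eq hessT_def star.along_cd[abs_def] by simp
  also have "\<dots> = (\<Sum>u\<in>F. hessT x u u)" by (rule b.metric_trace_onb[OF hessT_bilinear[OF x] F])
  also have "\<dots> = (\<Sum>u\<in>F. ip x (nab (E u) Gf x) (E u)) *\<^sub>R N x
    + 2 *\<^sub>R (\<Sum>u\<in>F. ip x (Gf x) (E u) *\<^sub>R Zop x (E u))
    + f x *\<^sub>R ((\<Sum>u\<in>F. dop (E u) B x (E u)) - kk *\<^sub>R (\<Sum>u\<in>F. ip x (xi x) (E u) *\<^sub>R phi x (B x (E u)))
      - kk *\<^sub>R (\<Sum>u\<in>F. ip x (xi x) (E u) *\<^sub>R phi x (Zop x (E u))) - kk *\<^sub>R (\<Sum>u\<in>F. ip x (V x) (E u) *\<^sub>R phi x (E u)))"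
  proof -
    have "hessT x u u = ip x (nab (E u) Gf x) (E u) *\<^sub>R N x + 2 *\<^sub>R (ip x (Gf x) (E u) *\<^sub>R Zop x (E u))
      + f x *\<^sub>R (dop (E u) B x (E u) - kk *\<^sub>R (ip x (xi x) (E u) *\<^sub>R phi x (B x (E u)))
      - kk *\<^sub>R (ip x (xi x) (E u) *\<^sub>R phi x (Zop x (E u))) - kk *\<^sub>R (ip x (V x) (E u) *\<^sub>R phi x (E u)))" for u
      unfolding hessT_eq[OF x] Let_def E_def[symmetric]
      using phi_self[OF x, of "E u"] i.sym[of "xi x" "E u"] i.sym[of "V x" "E u"]
      by (simp add: algebra_simps scaleR_2 scaleR_double)
    then show ?thesis
      by (simp only: sum.distrib sum_subtractf scaleR_sum_right scaleR_sum_left scaleR_diff_right)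
  qed
  also have "(\<Sum>u\<in>F. ip x (nab (E u) Gf x) (E u)) = trc (\<lambda>X. nab X Gf x)"
    using frame_trc[OF x F nab_linear[OF Gf_smooth x]] nab_N_arg[OF x Gf_smooth] by (simp add: E_def)
  also have "(\<Sum>u\<in>F. ip x (Gf x) (E u) *\<^sub>R Zop x (E u)) = Zop x (Gf x)"
    using frame_sum[OF x F Zop_linear[OF x], of "Gf x"] Gf_N[OF x] by (simp add: E_def)
  also have "(\<Sum>u\<in>F. dop (E u) B x (E u)) = - trc (\<lambda>v. B x (B x v)) *\<^sub>R N x - (2 * real m) *\<^sub>R Gf x"
    unfolding E_def by (rule frame_codazzi[OF x F])
  also have "(\<Sum>u\<in>F. ip x (xi x) (E u) *\<^sub>R phi x (B x (E u))) = N x"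
    using frame_sum[OF x F linear_compose[OF sop_linear[OF B_sop x] phi_linear[OF x]], of "xi x"] xi_N[OF x] B_xi[OF x] V_simps[OF x]
    by (simp add: E_def)
  also have "(\<Sum>u\<in>F. ip x (xi x) (E u) *\<^sub>R phi x (Zop x (E u))) = (1 + kk) *\<^sub>R N x"
    using frame_sum[OF x F linear_compose[OF Zop_linear[OF x] phi_linear[OF x]], of "xi x"] xi_N[OF x] B_xi[OF x] V_simps[OF x]
      phi_simps(2)[OF x] linear_add[OF phi_linear[OF x]] linear_cmul[OF phi_linear[OF x]]
    by (simp add: E_def Zop_def algebra_simps)
  also have "(\<Sum>u\<in>F. ip x (V x) (E u) *\<^sub>R phi x (E u)) = N x"
    using frame_sum[OF x F phi_linear[OF x], of "V x"] V_simps[OF x] by (simp add: E_def)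
  finally show ?thesis by (simp add: algebra_simps power2_eq_square scaleR_triple)
qed

text \<open>Curvature of the Ricci connection on the pair \<open>X\<close>, \<open>N\<close>,
  applied to \<open>Z\<close>, for tangent \<open>X\<close> and \<open>Z\<close>.\<close>

definition RN where "RN x X Z = ((c - 1) / 4) *\<^sub>R ((ip x (xi x) Z * ip x (xi x) X) *\<^sub>R N x + ip x (phi x X) Z *\<^sub>R V x
      - (2 * ip x (V x) X) *\<^sub>R phi x Z - ip x (V x) Z *\<^sub>R phi x X) - ((c + 3) / 4 * ip x X Z) *\<^sub>R N x
    - kk *\<^sub>R (ip x (phi x X) Z *\<^sub>R V x - (2 * ip x (V x) X) *\<^sub>R phi x Z - ip x (V x) Z *\<^sub>R phi x X
      + (2 * ip x (xi x) X * ip x (xi x) Z) *\<^sub>R N x) - (kk * kk * ip x (xi x) X * ip x (xi x) Z) *\<^sub>R N x"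

lemma star_RN:
  assumes x: "x \<in> W" and X: "ip x X (N x) = 0" and Z: "ip x Z (N x) = 0"
  shows "curv_at (star_conn S) (P x) X (r *\<^sub>R N x) Z = r *\<^sub>R RN x X Z"
proof -
  interpret i: inner_form "ip x" by (rule inner_ip[OF x])
  have V1: "phi x (N x) = - V x" using V_simps[OF x] by simp
  have XN: "ip x (N x) X = 0" "ip x (N x) Z = 0" using X Z i.sym by auto
  have a: "ip x (phi x X) (N x) = ip x (V x) X" using phi_skew[OF x, of X "N x"] V1 i.sym[of X "V x"] by simp
  have L1: "LL (P x) Y Z = ip x (xi x) Y *\<^sub>R phi x Z + ip x (xi x) Z *\<^sub>R phi x Y" for Y Z
    by (simp add: LL_def eta_ip phi_def)
  have ph: "phi x (r *\<^sub>R N x) = - r *\<^sub>R V x" using V1 linear_cmul[OF phi_linear[OF x]] by simp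
  note lp = linear_add[OF phi_linear[OF x]] linear_cmul[OF phi_linear[OF x]] linear_neg[OF phi_linear[OF x]]
  have LLs: "LL (P x) X (LL (P x) (r *\<^sub>R N x) Z) - LL (P x) (r *\<^sub>R N x) (LL (P x) X Z) = - (r * ip x (xi x) X * ip x (xi x) Z) *\<^sub>R N x"
    using xi_N[OF x] phi_simps(6)[OF x] V_simps[OF x] by (simp add: L1 lp V1)
  have c0: "curv_at (levi_civita gb) (P x) X (r *\<^sub>R N x) Z = r *\<^sub>R (((c - 1) / 4) *\<^sub>R ((ip x (xi x) Z * ip x (xi x) X) *\<^sub>R N x + ip x (phi x X) Z *\<^sub>R V x
      - (2 * ip x (V x) X) *\<^sub>R phi x Z - ip x (V x) Z *\<^sub>R phi x X) - ((c + 3) / 4 * ip x X Z) *\<^sub>R N x)"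
    unfolding curv_CR[OF x] CR_def using xi_N[OF x] X XN a by (simp add: V1 lp algebra_simps)
  show ?thesis
    unfolding star_curv[OF Px[OF x]] LLs c0 RN_def eta_ip phi_def[symmetric] ip_def[symmetric] xi_def[symmetric]
    using xi_N[OF x] X XN a by (simp add: V1 lp algebra_simps scaleR_double)
qed

lemma curvature_trace:
  assumes x: "x \<in> W"
  shows "metric_trace (pullback_form (ricci (cmet S)) P x)
        (\<lambda>u v. curv_at (star_conn S) (P x) (FD P x u) (mean_curv S P x) (FD P x v)) = (f x * Ctot) *\<^sub>R N x"
proof -
  interpret i: inner_form "ip x" by (rule inner_ip[OF x])
  interpret b: inner_form "pb x" by (rule inner_pb[OF x])
  define h where "h = pullback_form (ricci (cmet S)) P x"
  define T where "T u v = f x *\<^sub>R RN x (FD P x u) (FD P x v)" for u v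
  define E where "E u = FD P x u" for u
  define z where "z = tau x (xi x)"
  have z: "FD P x z = xi x" unfolding z_def using dP_tau_tangent[OF x xi_N(1)[OF x]] .
  \<comment> \<open>The orthonormal frame is made to contain \<open>xi\<close>, so that the pulled
    back Ricci metric is diagonal in it.\<close>
  have "b.orth {z}" using z phi_simps(2)[OF x] by (simp add: b.orth_def pb_ip)
  then obtain F where F: "z \<in> F" "b.onb F" using b.onb_extend by blast
  have oF: "b.orth F" "finite F" "card F = 2 * m"
    using F(2) b.orth_finite(1)[of F] b.onb_card[OF F(2)] dimf by (auto simp: b.onb_def)
  have h: "h u v = k2 * pb x u v + k1 * (ip x (xi x) (FD P x u) * ip x (xi x) (FD P x v))" for u v
    unfolding h_def pullback_form_def ricci_eq[OF Px[OF x]] eta_ip by (simp add: pb_ip ip_def)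
  have xF: "ip x (xi x) (E u) = (if u = z then 1 else 0)" if "u \<in> F" for u
    using b.orthD[OF oF(1) F(1) that] by (auto simp: pb_ip z E_def)
  define \<epsilon> where "\<epsilon> u = (if u = z then 2 * real m else k2)" for u
  note lp = linear_add[OF phi_linear[OF x]] linear_cmul[OF phi_linear[OF x]] linear_add[OF dP_linear[OF x]] linear_cmul[OF dP_linear[OF x]]
  have "metric_trace h (\<lambda>u v. T u v) = (\<Sum>u\<in>F. (1 / \<epsilon> u) *\<^sub>R T u u)"
  proof (rule metric_trace_orthogonal_frame[where e="\<lambda>u. u"])
    show "bilinear h" unfolding bilinear_def linear_iff h
      by (simp add: lp algebra_simps)
    show "bilinear T" unfolding bilinear_def linear_iff T_def RN_def
      by (simp add: lp algebra_simps)
    show "\<epsilon> u \<noteq> 0" for u using m_pos k2_pos by (simp add: \<epsilon>_def)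
    show "h u v = (if u = v then \<epsilon> u else 0)" if "u \<in> F" "v \<in> F" for u v
      unfolding h using b.orthD[OF oF(1) that] xF[OF that(1)] xF[OF that(2)] k2_pos
      by (auto simp: \<epsilon>_def E_def)
  qed (use oF dimf in auto)
  also have "\<dots> = (1 / (2 * real m)) *\<^sub>R T z z + (\<Sum>u\<in>F - {z}. (1 / k2) *\<^sub>R T u u)"
    unfolding sum.remove[OF oF(2) F(1)] by (simp add: \<epsilon>_def)
  also have "T z z = (- f x * (1 + kk)\<^sup>2) *\<^sub>R N x"
  proof -
    have "RN x (xi x) (xi x) = ((c - 1) / 4) *\<^sub>R N x - ((c + 3) / 4) *\<^sub>R N x - (2 * kk) *\<^sub>R N x - (kk * kk) *\<^sub>R N x"
      using phi_simps(1,2)[OF x] V_simps[OF x] by (simp add: RN_def)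
    also have "\<dots> = ((c - 1) / 4 - (c + 3) / 4 - 2 * kk - kk * kk) *\<^sub>R N x"
      by (simp only: scaleR_left_diff_distrib)
    also have "(c - 1) / 4 - (c + 3) / 4 - 2 * kk - kk * kk = - ((1 + kk)\<^sup>2)"
      by (simp add: power2_eq_square field_simps)
    finally show ?thesis by (simp add: T_def z)
  qed
  also have "(\<Sum>u\<in>F - {z}. (1 / k2) *\<^sub>R T u u) = (f x / k2) *\<^sub>R
      ((- 3 * (c - 1) / 4 + 3 * kk) *\<^sub>R (\<Sum>u\<in>F - {z}. ip x (V x) (E u) *\<^sub>R phi x (E u)) - (\<Sum>u\<in>F - {z}. ((c + 3) / 4) *\<^sub>R N x))"
  proof -
    have "(1 / k2) *\<^sub>R T u u = (f x / k2) *\<^sub>R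
      ((- 3 * (c - 1) / 4 + 3 * kk) *\<^sub>R (ip x (V x) (E u) *\<^sub>R phi x (E u)) - ((c + 3) / 4) *\<^sub>R N x)" if u: "u \<in> F - {z}" for u
    proof -
      have e: "ip x (xi x) (E u) = 0" "ip x (E u) (E u) = 1"
        using xF[of u] b.orthD[OF oF(1), of u u] u by (auto simp: pb_ip E_def)
      have "RN x (E u) (E u) = (- 3 * (c - 1) / 4 + 3 * kk) *\<^sub>R (ip x (V x) (E u) *\<^sub>R phi x (E u)) - ((c + 3) / 4) *\<^sub>R N x"
      proof -
        define a where "a = ip x (V x) (E u)"
        have "RN x (E u) (E u) = ((c - 1) / 4) *\<^sub>R (- (2 * a) *\<^sub>R phi x (E u) - a *\<^sub>R phi x (E u)) - ((c + 3) / 4) *\<^sub>R N x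
          - kk *\<^sub>R (- (2 * a) *\<^sub>R phi x (E u) - a *\<^sub>R phi x (E u))"
          by (simp add: RN_def e phi_self[OF x] a_def)
        also have "- (2 * a) *\<^sub>R phi x (E u) - a *\<^sub>R phi x (E u) = (- 3 * a) *\<^sub>R phi x (E u)"
          using scaleR_left_diff_distrib[of "- (2 * a)" a "phi x (E u)"] by simp
        also have "((c - 1) / 4) *\<^sub>R (- 3 * a) *\<^sub>R phi x (E u) - ((c + 3) / 4) *\<^sub>R N x - kk *\<^sub>R (- 3 * a) *\<^sub>R phi x (E u)
          = (((c - 1) / 4) * (- 3 * a) - kk * (- 3 * a)) *\<^sub>R phi x (E u) - ((c + 3) / 4) *\<^sub>R N x"
          by (simp only: scaleR_left_diff_distrib scaleR_scaleR) simp
        also have "((c - 1) / 4) * (- 3 * a) - kk * (- 3 * a) = (- 3 * (c - 1) / 4 + 3 * kk) * a"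
          by (simp add: field_simps)
        also have "\<dots> *\<^sub>R phi x (E u) - ((c + 3) / 4) *\<^sub>R N x
          = (- 3 * (c - 1) / 4 + 3 * kk) *\<^sub>R (a *\<^sub>R phi x (E u)) - ((c + 3) / 4) *\<^sub>R N x"
          by (simp only: scaleR_scaleR)
        finally show ?thesis by (simp add: a_def)
      qed
      then show ?thesis by (simp add: T_def E_def)
    qed
    then show ?thesis
      by (simp only: sum_subtractf[symmetric] scaleR_sum_right cong: sum.cong)
  qed
  also have "(\<Sum>u\<in>F - {z}. ip x (V x) (E u) *\<^sub>R phi x (E u)) = N x"
    using frame_sum[OF x F(2) phi_linear[OF x], of "V x"] V_simps[OF x] sum.remove[OF oF(2) F(1), of "\<lambda>u. ip x (V x) (E u) *\<^sub>R phi x (E u)"]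
    by (simp add: E_def z)
  also have "(\<Sum>u\<in>F - {z}. ((c + 3) / 4) *\<^sub>R N x) = ((2 * real m - 1) * (c + 3) / 4) *\<^sub>R N x"
    using oF F(1) m_pos by (simp add: of_nat_diff scaleR_sum_left[symmetric] sum_constant_scaleR)
  also have "(1 / (2 * real m)) *\<^sub>R (- f x * (1 + kk)\<^sup>2) *\<^sub>R N x + (f x / k2) *\<^sub>R ((- 3 * (c - 1) / 4 + 3 * kk) *\<^sub>R N x - ((2 * real m - 1) * (c + 3) / 4) *\<^sub>R N x)
     = (f x * Ctot) *\<^sub>R N x"
  proof -
    have "(1 / (2 * real m)) * (- f x * (1 + kk)\<^sup>2) + (f x / k2) * ((- 3 * (c - 1) / 4 + 3 * kk) - ((2 * real m - 1) * (c + 3) / 4)) = f x * Ctot"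
    proof -
      have "(1 / M) * (- F * Q) + (F / K) * (A - D) = F * ((A - D) / K - Q / M)" for A D F K M Q :: real
        by (simp add: right_diff_distrib diff_divide_distrib)
      then show ?thesis unfolding Ctot_def .
    qed
    then show ?thesis by (simp only: scaleR_scaleR scaleR_left.diff[symmetric] scaleR_left.add[symmetric])
  qed
  finally have "metric_trace h (\<lambda>u v. T u v) = (f x * Ctot) *\<^sub>R N x" .
  moreover have "(\<lambda>u v. curv_at (star_conn S) (P x) (FD P x u) (mean_curv S P x) (FD P x v)) = (\<lambda>u v. T u v)"
    unfolding mean_curv_eq[OF x] T_def using star_RN[OF x dP_N[OF x] dP_N[OF x]] by (intro ext) simp
  ultimately show ?thesis by (simp add: h_def)
qed

theorem bitension_eq:
  assumes x: "x \<in> W"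
  shows "star_bitension S P x = (trc (\<lambda>X. nab X Gf x)
     - f x * (trc (\<lambda>v. B x (B x v)) + 3 * kk + kk\<^sup>2 + Ctot)) *\<^sub>R N x
     + (2 *\<^sub>R B x (Gf x) + (2 * kk * ip x (Gf x) (xi x)) *\<^sub>R V x - (2 * real m * f x) *\<^sub>R Gf x)"
  unfolding star_bitension_def star_laplacian_eq[OF x] curvature_trace[OF x]
  by (simp add: Zop_def algebra_simps)

end

section \<open>Principal curvatures of biharmonic pseudo-Hopf hypersurfaces\<close>

context hypk
begin

text \<open>Pair the divergence of \<open>B\<close> with \<open>xi\<close>. It gives
  \<open>- 2 * m\<close> times the derivative of \<open>f\<close> along \<open>xi\<close>; on the
  other hand, differentiating \<open>B xi = V\<close> turns it into the trace of the commutator of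
  \<open>B\<close> and \<open>phi\<close>, which is 0.\<close>

lemma xi_f:
  assumes x: "x \<in> W" shows "ip x (Gf x) (xi x) = 0"
proof -
  interpret i: inner_form "ip x" by (rule inner_ip[OF x])
  interpret b: inner_form "pb x" by (rule inner_pb[OF x])
  obtain F where F: "b.onb F" using b.onb_extend[of "{}"] by (auto simp: b.orth_def)
  note lB = sop_linear[OF B_sop x] and lp = phi_linear[OF x]
  have "ip x (dop (FD P x u) B x (FD P x u)) (xi x) = ip x (B x (phi x (FD P x u)) - phi x (B x (FD P x u))) (FD P x u)" for u
  proof -
    have t: "ip x (FD P x u) (N x) = 0" by (rule dP_N[OF x])
    have "nab (FD P x u) (\<lambda>y. B y (xi y)) x = nab (FD P x u) V x"
      by (rule nab_cong[OF B_xi x])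
    then have "dop (FD P x u) B x (xi x) = B x (phi x (FD P x u)) - phi x (B x (FD P x u))"
      using nab_op[OF B_sop xi_smooth x, of "FD P x u"]
      by (simp add: nab_V[OF x t] nab_xi[OF x t] linear_neg[OF lB] algebra_simps eq_neg_iff_add_eq_0)
    then show ?thesis
      using dop_self_adjoint[OF B_sop B_self_adjoint x, of "FD P x u" "FD P x u" "xi x"] i.sym[of "FD P x u"] by simp
  qed
  then have "ip x (\<Sum>u\<in>F. dop (FD P x u) B x (FD P x u)) (xi x)
    = (\<Sum>u\<in>F. ip x (B x (phi x (FD P x u)) - phi x (B x (FD P x u))) (FD P x u))"
    by (simp only: i.h_sum)
  also have "\<dots> = trc (\<lambda>v. B x (phi x v) - phi x (B x v)) - ip x (B x (phi x (N x)) - phi x (B x (N x))) (N x)"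
  proof (rule frame_trc[OF x F, of "\<lambda>v. B x (phi x v) - phi x (B x v)"])
    show "linear (\<lambda>v. B x (phi x v) - phi x (B x v))"
      using linear_compose_sub[OF linear_compose[OF lp lB] linear_compose[OF lB lp]] by (simp add: o_def)
  qed
  also have "\<dots> = 0"
    using trc_comm[OF lB lp] B_tangent[OF x] B_N[OF x] linear_0[OF lp] by (simp add: trc_diff)
  finally show ?thesis
    unfolding frame_codazzi[OF x F] using xi_N[OF x] m_pos by simp
qed

lemma CRN:
  assumes x: "x \<in> W" and X: "ip x X (N x) = 0" and Y: "ip x Y (N x) = 0"
  shows "CR x X Y (N x) = - ((c - 1) / 4) *\<^sub>R (ip x (V x) X *\<^sub>R phi x Y - (2 * ip x (phi x X) Y) *\<^sub>R V x - ip x (V x) Y *\<^sub>R phi x X)"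
proof -
  interpret i: inner_form "ip x" by (rule inner_ip[OF x])
  have V1: "phi x (N x) = - V x" using V_simps[OF x] by simp
  have "ip x (phi x Z) (N x) = ip x (V x) Z" for Z
    using phi_skew[OF x, of Z "N x"] V1 i.sym[of Z "V x"] by simp
  then show ?thesis using X Y xi_N[OF x] by (simp add: CR_def V1)
qed

text \<open>Second derivatives of \<open>f\<close> commute, and the connection terms are symmetric
  by torsion-freeness.\<close>

lemma hess_sym:
  assumes x: "x \<in> W" and X: "ip x X (N x) = 0" and Y: "ip x Y (N x) = 0"
  shows "ip x (nab X Gf x) Y = ip x (nab Y Gf x) X"
proof -
  have s: "smooth_on W (\<lambda>y. FD P y v)" for v by (rule dP_smooth[OF smooth_on_const])
  have 1: "FD (\<lambda>y. FD f y v) x u = ip x (nab (FD P x u) Gf x) (FD P x v) + ip x (Gf x) (cd u (\<lambda>y. FD P y v) x)" for u v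
  proof -
    have "FD (\<lambda>y. FD f y v) x u = FD (\<lambda>y. ip y (Gf y) (FD P y v)) x u"
      using FD_cong_open[OF oW x, of "\<lambda>y. FD f y v" "\<lambda>y. ip y (Gf y) (FD P y v)"]
        Gf_dr[OF _ dP_N] by (simp add: dr_def tau_dP)
    then show ?thesis using FD_ip[OF Gf_smooth s x, of v u] by (simp add: nab_dP[OF x])
  qed
  have "ip x (nab (FD P x u) Gf x) (FD P x v) = ip x (nab (FD P x v) Gf x) (FD P x u)" for u v
    using 1[of v u] 1[of u v] FD_commute[OF oW f_smooth x, of v u] cd_torsion[OF x, of u v] by simp
  from this[of "tau x X" "tau x Y"] show ?thesis
    by (simp add: dP_tau_tangent[OF x X] dP_tau_tangent[OF x Y])
qed

end

locale crit = hypk U S W P N m c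
  for U :: "'e::euclidean_space set" and S :: "'e contact_metric" and W :: "'f::euclidean_space set"
    and P N and m :: nat and c :: real +
  assumes fpos: "\<And>x. x \<in> W \<Longrightarrow> f x > 0"
    and Gf_nz: "\<And>x. x \<in> W \<Longrightarrow> Gf x \<noteq> 0"
    and bih: "\<And>x. x \<in> W \<Longrightarrow> star_bitension S P x = 0"
    and hopf: "\<And>x. x \<in> W \<Longrightarrow> B x (V x) \<in> span {xi x, V x}"
    and W_ne: "W \<noteq> {}"
begin

text \<open>The eigenvalue forced on the gradient: the \<open>xi\<close>-derivative being 0, the
  tangential bitension equation reads \<open>2 * B (Gf) = 2 * m * f * Gf\<close>.\<close>

definition \<Lambda> where "\<Lambda> x = real m * f x"
definition rho where "rho x = sqrt (ip x (Gf x) (Gf x))"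
definition E where "E x = inverse (rho x) *\<^sub>R Gf x"
definition pE where "pE x = phi x (E x)"
definition beta where "beta x = ip x (B x (V x)) (V x)"

lemma Lam_smooth: "smooth_on W \<Lambda>"
  unfolding \<Lambda>_def by (intro smooth_on_mult smooth_on_const f_smooth oW)

lemma Lam_pos: "x \<in> W \<Longrightarrow> \<Lambda> x > 0"
  using fpos m_pos by (simp add: \<Lambda>_def)

lemma rho_pos: "x \<in> W \<Longrightarrow> rho x > 0"
  using inner_form.pos[OF inner_ip Gf_nz] by (simp add: rho_def)

lemma rho_smooth: "smooth_on W rho"
  unfolding rho_def
  by (intro smooth_on_sqrt oW ip_smooth Gf_smooth inner_form.pos[OF inner_ip Gf_nz])

lemma E_smooth: "smooth_on W E"
  unfolding E_def
proof (intro smooth_on_scaleR smooth_on_inverse oW rho_smooth Gf_smooth)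
  show "rho x \<noteq> 0" if "x \<in> W" for x using rho_pos[OF that] by simp
qed

lemma pE_smooth: "smooth_on W pE"
  unfolding pE_def by (intro phi_smooth E_smooth)

lemma beta_smooth: "smooth_on W beta"
  unfolding beta_def by (intro ip_smooth sop_smooth[OF B_sop] V_smooth)

lemma bih_eqs:
  assumes x: "x \<in> W"
  shows "B x (Gf x) = \<Lambda> x *\<^sub>R Gf x"
    "trc (\<lambda>X. nab X Gf x) = f x * (trc (\<lambda>v. B x (B x v)) + 3 * kk + kk\<^sup>2 + Ctot)"
proof -
  interpret i: inner_form "ip x" by (rule inner_ip[OF x])
  define a where "a = trc (\<lambda>X. nab X Gf x) - f x * (trc (\<lambda>v. B x (B x v)) + 3 * kk + kk\<^sup>2 + Ctot)"
  have e: "a *\<^sub>R N x + (2 *\<^sub>R B x (Gf x) - (2 * real m * f x) *\<^sub>R Gf x) = 0"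
    using bih[OF x] bitension_eq[OF x] xi_f[OF x] by (simp add: a_def)
  have "ip x (a *\<^sub>R N x + (2 *\<^sub>R B x (Gf x) - (2 * real m * f x) *\<^sub>R Gf x)) (N x) = a"
    using NN[OF x] B_tangent[OF x] Gf_N[OF x] by simp
  then have a: "a = 0" unfolding e by simp
  then show "trc (\<lambda>X. nab X Gf x) = f x * (trc (\<lambda>v. B x (B x v)) + 3 * kk + kk\<^sup>2 + Ctot)" by (simp add: a_def)
  have "2 *\<^sub>R (B x (Gf x) - \<Lambda> x *\<^sub>R Gf x) = 0"
    using e unfolding a by (simp add: \<Lambda>_def scaleR_diff_right mult.assoc)
  then show "B x (Gf x) = \<Lambda> x *\<^sub>R Gf x" by simp
qed

lemma Gf_E: "x \<in> W \<Longrightarrow> Gf x = rho x *\<^sub>R E x"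
  using rho_pos[of x] by (simp add: E_def)

lemma E_simps:
  assumes x: "x \<in> W"
  shows "ip x (E x) (E x) = 1" "ip x (E x) (N x) = 0" "ip x (N x) (E x) = 0"
    "ip x (E x) (xi x) = 0" "ip x (xi x) (E x) = 0" "B x (E x) = \<Lambda> x *\<^sub>R E x"
    "ip x (E x) (V x) = 0" "ip x (V x) (E x) = 0"
proof -
  interpret i: inner_form "ip x" by (rule inner_ip[OF x])
  have "ip x (Gf x) (Gf x) > 0" using i.pos Gf_nz[OF x] by blast
  then show "ip x (E x) (E x) = 1"
    by (simp add: E_def rho_def field_simps)
  show 2: "ip x (E x) (N x) = 0" "ip x (E x) (xi x) = 0" "B x (E x) = \<Lambda> x *\<^sub>R E x"
    using Gf_N[OF x] xi_f[OF x] bih_eqs(1)[OF x] by (simp_all add: E_def linear_cmul[OF sop_linear[OF B_sop x]])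
  have "ip x (E x) (V x) = ip x (B x (E x)) (xi x)"
    using B_self_adjoint[OF x, of "E x" "xi x"] B_xi[OF x] by simp
  then show "ip x (E x) (V x) = 0" using 2 by simp
  with 2 show "ip x (N x) (E x) = 0" "ip x (xi x) (E x) = 0" "ip x (V x) (E x) = 0" using i.sym by metis+
qed

lemma pE_simps:
  assumes x: "x \<in> W"
  shows "ip x (pE x) (pE x) = 1" "ip x (pE x) (N x) = 0" "ip x (N x) (pE x) = 0"
    "ip x (pE x) (xi x) = 0" "ip x (xi x) (pE x) = 0" "phi x (pE x) = - E x" "phi x (E x) = pE x"
    "ip x (pE x) (V x) = 0" "ip x (V x) (pE x) = 0" "ip x (pE x) (E x) = 0" "ip x (E x) (pE x) = 0"
proof -
  interpret i: inner_form "ip x" by (rule inner_ip[OF x])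
  show 1: "ip x (pE x) (pE x) = 1" "ip x (pE x) (xi x) = 0" "phi x (pE x) = - E x" "phi x (E x) = pE x"
    "ip x (pE x) (E x) = 0"
    unfolding pE_def using E_simps[OF x] phi_simps[OF x] phi_self[OF x] by simp_all
  have V1: "phi x (N x) = - V x" using V_simps[OF x] by simp
  show 2: "ip x (pE x) (N x) = 0"
    unfolding pE_def using phi_skew[OF x, of "E x" "N x"] E_simps[OF x] V1 by simp
  have "ip x (pE x) (phi x (N x)) = 0"
    unfolding pE_def using phi_simps(4)[OF x, of "E x" "N x"] E_simps[OF x] by simp
  then show 3: "ip x (pE x) (V x) = 0" using V1 by simp
  show "ip x (N x) (pE x) = 0" "ip x (xi x) (pE x) = 0" "ip x (V x) (pE x) = 0" "ip x (E x) (pE x) = 0"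
    using 1 2 3 i.sym by metis+
qed

lemmas frame_simps = NN xi_N V_simps phi_simps(1,2) E_simps pE_simps

lemma dr_f: "x \<in> W \<Longrightarrow> ip x X (N x) = 0 \<Longrightarrow> dr X f x = rho x * ip x (E x) X"
  using Gf_dr[of x X] inner_form.h_scale(1)[OF inner_ip, of x "rho x" "E x" X] by (simp add: Gf_E)

lemma dr_Lam: "x \<in> W \<Longrightarrow> ip x X (N x) = 0 \<Longrightarrow> dr X \<Lambda> x = real m * rho x * ip x (E x) X"
  using dr_cmult[OF f_smooth, of x X "real m"] dr_f[of x X] by (simp add: \<Lambda>_def[abs_def])

text \<open>\<open>E\<close> is the unit normal of the level sets of \<open>f\<close> in the
  hypersurface, and on vectors tangent to them its derivative is the Hessian of \<open>f\<close>
  divided by \<open>rho\<close>.\<close>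

lemma W_sym:
  assumes x: "x \<in> W" and X: "ip x X (N x) = 0" "ip x X (E x) = 0" and Y: "ip x Y (N x) = 0" "ip x Y (E x) = 0"
  shows "ip x (nab X E x) Y = ip x (nab Y E x) X"
proof -
  interpret i: inner_form "ip x" by (rule inner_ip[OF x])
  have s: "smooth_on W (\<lambda>y. inverse (rho y))"
    by (rule smooth_on_inverse[OF oW rho_smooth]) (use rho_pos in fastforce)
  have "ip x (nab Z E x) Y' = inverse (rho x) * ip x (nab Z Gf x) Y'" if "ip x Y' (E x) = 0" for Z Y'
  proof -
    have "ip x (Gf x) Y' = 0" using that i.sym[of Y' "E x"] by (simp add: Gf_E[OF x])
    then show ?thesis unfolding E_def[abs_def] nab_scale[OF s Gf_smooth x] by simp
  qed
  then show ?thesis using hess_sym[OF x X(1) Y(1)] X Y by simp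
qed

text \<open>The pseudo-Hopf condition leaves two coefficients; self-adjointness and
  \<open>B xi = V\<close> make that of \<open>xi\<close> equal to 1.\<close>

lemma B_V:
  assumes x: "x \<in> W" shows "B x (V x) = xi x + beta x *\<^sub>R V x"
proof -
  interpret i: inner_form "ip x" by (rule inner_ip[OF x])
  obtain a b where ab: "B x (V x) = a *\<^sub>R xi x + b *\<^sub>R V x"
    using hopf[OF x] by (auto simp: span_insert span_singleton algebra_simps eq_diff_eq)
  have "ip x (B x (V x)) (xi x) = 1"
    using B_self_adjoint[OF x, of "V x" "xi x"] B_xi[OF x] V_simps[OF x] by simp
  then have "a = 1" using ab V_simps[OF x] phi_simps(2)[OF x] by simp
  moreover have "beta x = b" unfolding beta_def ab using V_simps[OF x] by simp
  ultimately show ?thesis using ab by simp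
qed

lemma dop_B_V:
  assumes x: "x \<in> W" and X: "ip x X (N x) = 0"
  shows "dop X B x (V x) = - phi x X + dr X beta x *\<^sub>R V x - beta x *\<^sub>R phi x (B x X) + B x (phi x (B x X))"
proof -
  have "nab X (\<lambda>y. B y (V y)) x = nab X (\<lambda>y. xi y + beta y *\<^sub>R V y) x"
    by (rule nab_cong[OF B_V x])
  also have "\<dots> = - phi x X + (dr X beta x *\<^sub>R V x - beta x *\<^sub>R phi x (B x X))"
    unfolding nab_add[OF xi_smooth smooth_on_scaleR[OF oW beta_smooth V_smooth] x] nab_scale[OF beta_smooth V_smooth x]
    by (simp add: nab_xi[OF x X] nab_V[OF x X])
  finally show ?thesis
    using nab_op[OF B_sop V_smooth x, of X] nab_V[OF x X] linear_neg[OF sop_linear[OF B_sop x]]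
    by (simp add: algebra_simps)
qed

lemma dop_B_E:
  assumes x: "x \<in> W"
  shows "dop X B x (E x) = dr X \<Lambda> x *\<^sub>R E x + \<Lambda> x *\<^sub>R nab X E x - B x (nab X E x)"
proof -
  have "nab X (\<lambda>y. B y (E y)) x = nab X (\<lambda>y. \<Lambda> y *\<^sub>R E y) x"
    by (rule nab_cong[OF _ x]) (simp add: E_simps)
  then show ?thesis
    using nab_op[OF B_sop E_smooth x, of X] nab_scale[OF Lam_smooth E_smooth x, of X] by (simp add: algebra_simps)
qed

text \<open>Pair the Codazzi equation for \<open>E\<close> and \<open>Z\<close> with
  \<open>V\<close>; differentiating the formula for \<open>B V\<close> makes both sides algebraic.
  Taking for \<open>Z\<close> the difference of the two sides of the claim shows that it is
  orthogonal to itself.\<close>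

lemma hopf_relation:
  assumes x: "x \<in> W"
  shows "(2 * \<Lambda> x - beta x) *\<^sub>R B x (pE x) = (beta x * \<Lambda> x + (c + 3) / 2) *\<^sub>R pE x"
proof -
  interpret i: inner_form "ip x" by (rule inner_ip[OF x])
  define Z where "Z = (2 * \<Lambda> x - beta x) *\<^sub>R B x (pE x) - (beta x * \<Lambda> x + (c + 3) / 2) *\<^sub>R pE x"
  note fr = frame_simps[OF x]
  have Bp: "ip x (B x (pE x)) (xi x) = 0" "ip x (B x (pE x)) (V x) = 0" "ip x (B x (pE x)) (N x) = 0"
    using B_self_adjoint[OF x, of "pE x" "xi x"] B_self_adjoint[OF x, of "pE x" "V x"] B_xi[OF x] B_V[OF x] B_tangent[OF x] fr
    by simp_all
  have Z: "ip x Z (xi x) = 0" "ip x Z (V x) = 0" "ip x Z (N x) = 0"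
    using Bp fr by (simp_all add: Z_def)
  have VZ: "ip x (V x) Z = 0" using Z i.sym by simp
  have sk: "ip x (E x) (phi x Y) = - ip x Y (pE x)" for Y
    using phi_skew[OF x, of "E x" Y] i.sym[of Y "pE x"] by (simp add: fr)
  note sa = dop_self_adjoint[OF B_sop B_self_adjoint x]
  have "ip x (dop (E x) B x Z - dop Z B x (E x)) (V x) = ip x (CR x (E x) Z (N x)) (V x)"
    using codazzi[OF x _ Z(3), of "E x"] fr by simp
  moreover have "ip x (CR x (E x) Z (N x)) (V x) = ((c - 1) / 2) * ip x (pE x) Z"
    unfolding CRN[OF x E_simps(2)[OF x] Z(3)] using VZ fr by (simp add: field_simps)
  moreover have "ip x (dop (E x) B x Z) (V x) = ip x Z (- pE x - (beta x * \<Lambda> x) *\<^sub>R pE x + \<Lambda> x *\<^sub>R B x (pE x))"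
    using sa[of "E x" Z "V x"] dop_B_V[OF x, of "E x"] Z fr
    by (simp add: linear_cmul[OF phi_linear[OF x]] linear_cmul[OF sop_linear[OF B_sop x]])
  moreover have "ip x (dop Z B x (E x)) (V x) = ip x Z (pE x) + beta x * ip x Z (B x (pE x)) - \<Lambda> x * ip x Z (B x (pE x))"
  proof -
    have 1: "ip x (dop Z B x (E x)) (V x) = ip x (E x) (- phi x Z + dr Z beta x *\<^sub>R V x - beta x *\<^sub>R phi x (B x Z) + B x (phi x (B x Z)))"
      using sa[of Z "E x" "V x"] dop_B_V[OF x Z(3)] by simp
    have 2: "ip x (E x) (phi x (B x Z)) = - ip x Z (B x (pE x))"
      using sk[of "B x Z"] B_self_adjoint[OF x, of Z "pE x"] by simp
    have 3: "ip x (E x) (B x (phi x (B x Z))) = - \<Lambda> x * ip x Z (B x (pE x))"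
      using B_self_adjoint[OF x, of "E x" "phi x (B x Z)"] 2 fr by simp
    show ?thesis unfolding 1 using 2 3 sk[of Z] fr by simp
  qed
  ultimately have "(2 * \<Lambda> x - beta x) * ip x Z (B x (pE x)) = (beta x * \<Lambda> x + (c + 3) / 2) * ip x Z (pE x)"
    using i.sym[of "pE x" Z] by (simp add: field_simps)
  moreover have "ip x Y Z = (2 * \<Lambda> x - beta x) * ip x Y (B x (pE x)) - (beta x * \<Lambda> x + (c + 3) / 2) * ip x Y (pE x)" for Y
    by (simp add: Z_def)
  ultimately have "ip x Z Z = 0" by simp
  then show ?thesis unfolding i.h_eq_0 by (simp add: Z_def)
qed

text \<open>Pairing this equation with \<open>V\<close> will give that \<open>beta\<close> is
  constant along \<open>E\<close>; pairing it with \<open>pE\<close> will determine the eigenvalue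
  of \<open>B\<close> on \<open>pE\<close>.\<close>

lemma codazzi_E_V:
  assumes x: "x \<in> W"
  shows "- pE x + dr (E x) beta x *\<^sub>R V x - (beta x * \<Lambda> x) *\<^sub>R pE x + \<Lambda> x *\<^sub>R B x (pE x)
    - (\<Lambda> x *\<^sub>R nab (V x) E x - B x (nab (V x) E x)) = ((c - 1) / 4) *\<^sub>R pE x"
proof -
  note fr = frame_simps[OF x]
  have "dop (E x) B x (V x) - dop (V x) B x (E x) = CR x (E x) (V x) (N x)"
    by (rule codazzi[OF x]) (simp_all add: fr)
  moreover have "dr (V x) \<Lambda> x = 0" using dr_Lam[OF x, of "V x"] fr by simp
  ultimately show ?thesis
    using dop_B_V[OF x, of "E x"] dop_B_E[OF x, of "V x"] CRN[OF x, of "E x" "V x"]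
    by (simp add: fr linear_cmul[OF phi_linear[OF x]] linear_cmul[OF sop_linear[OF B_sop x]])
qed

lemma nab_E_pairs:
  assumes x: "x \<in> W" and X: "ip x X (N x) = 0"
  shows "ip x (nab X E x) (xi x) = ip x (E x) (phi x X)"
    "ip x (nab X E x) (V x) = ip x (E x) (phi x (B x X))"
    "ip x (nab X E x) (E x) = 0" "ip x (nab X E x) (N x) = - ip x (E x) (B x X)"
proof -
  interpret i: inner_form "ip x" by (rule inner_ip[OF x])
  show "ip x (nab X E x) (xi x) = ip x (E x) (phi x X)"
    using nab_ip_const[OF E_smooth xi_smooth x E_simps(4), of X] nab_xi[OF x X] by simp
  show "ip x (nab X E x) (V x) = ip x (E x) (phi x (B x X))"
    using nab_ip_const[OF E_smooth V_smooth x E_simps(7), of X] nab_V[OF x X] by simp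
  show "ip x (nab X E x) (E x) = 0"
    using nab_ip_const[OF E_smooth E_smooth x E_simps(1), of X] i.sym[of "E x" "nab X E x"] by simp
  show "ip x (nab X E x) (N x) = - ip x (E x) (B x X)"
    by (rule B_second_form[OF x E_smooth E_simps(2)])
qed

lemma dr_E_beta:
  assumes x: "x \<in> W" shows "dr (E x) beta x = 0"
proof -
  interpret i: inner_form "ip x" by (rule inner_ip[OF x])
  note fr = frame_simps[OF x]
  have Bp: "ip x (B x (pE x)) (V x) = 0"
    using B_self_adjoint[OF x, of "pE x" "V x"] B_V[OF x] fr by simp
  have n: "ip x (nab (V x) E x) (xi x) = 0" "ip x (nab (V x) E x) (V x) = 0"
    using nab_E_pairs[OF x, of "V x"] fr B_V[OF x]
    by (simp_all add: linear_add[OF phi_linear[OF x]] linear_cmul[OF phi_linear[OF x]])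
  have "ip x (B x (nab (V x) E x)) (V x) = 0"
    using B_self_adjoint[OF x, of "nab (V x) E x" "V x"] B_V[OF x] n by simp
  then show ?thesis
    using arg_cong[OF codazzi_E_V[OF x], of "\<lambda>z. ip x z (V x)"] Bp n fr by simp
qed

end

section \<open>Generic points and the eigenvalue on \<open>pE\<close>\<close>

lemma open_nonzero:
  assumes "open W" "continuous_on W g" shows "open {x \<in> W. g x \<noteq> (0::real)}"
proof -
  have "{x \<in> W. g x \<noteq> 0} = W \<inter> g -` (- {0})" by auto
  then show ?thesis using continuous_open_preimage[OF assms(2,1), of "- {0}"] by (simp add: open_Compl)
qed

context crit
begin

text \<open>Equals \<open>(2 * \<Lambda> - beta) * (\<Lambda> - \<mu>)\<close> for the eigenvalue
  \<open>\<mu>\<close> of \<open>B\<close> on \<open>pE\<close> that \<open>hopf_relation\<close>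
  gives; where both factors are nonzero, \<open>\<mu>\<close> differs from
  \<open>\<Lambda>\<close>.\<close>

definition qq where "qq x = 2 * (\<Lambda> x * \<Lambda> x) - 2 * (beta x * \<Lambda> x) - (c + 3) / 2"

text \<open>Along \<open>E\<close> the function \<open>\<Lambda>\<close> increases strictly while
  \<open>beta\<close> has derivative 0. So \<open>2 * \<Lambda> - beta\<close> cannot vanish on an
  open set, and where it is nonzero the derivative of \<open>qq\<close> along \<open>E\<close> is
  nonzero too.\<close>

lemma exists_generic: "\<exists>x\<in>W. 2 * \<Lambda> x - beta x \<noteq> 0 \<and> qq x \<noteq> 0"
proof (rule ccontr)
  assume "\<not> ?thesis"
  then have n: "2 * \<Lambda> x - beta x = 0 \<or> qq x = 0" if "x \<in> W" for x using that by blast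
  note LL = smooth_on_mult[OF oW smooth_on_const[of W 2] Lam_smooth]
  have s1: "smooth_on W (\<lambda>x. 2 * \<Lambda> x - beta x)"
    by (intro smooth_on_diff LL beta_smooth oW)
  have dL: "dr (E x) \<Lambda> x > 0" if "x \<in> W" for x
    using dr_Lam[OF that E_simps(2)[OF that]] E_simps(1)[OF that] rho_pos[OF that] m_pos by simp
  have d1: "dr (E x) (\<lambda>x. 2 * \<Lambda> x - beta x) x > 0" if "x \<in> W" for x
    using dr_arith(2)[OF LL beta_smooth that] dr_cmult[OF Lam_smooth that] dr_E_beta[OF that] dL[OF that] by simp
  define W1 where "W1 = {x \<in> W. 2 * \<Lambda> x - beta x \<noteq> 0}"
  have W1: "open W1" unfolding W1_def by (rule open_nonzero[OF oW smooth_on_continuous[OF s1]])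
  have "W1 \<noteq> {}"
  proof
    assume e: "W1 = {}"
    obtain x where x: "x \<in> W" using W_ne by auto
    have "dr (E x) (\<lambda>x. 2 * \<Lambda> x - beta x) x = dr (E x) (\<lambda>x. 0) x"
      by (rule dr_cong[OF _ x]) (use e in \<open>auto simp: W1_def\<close>)
    then show False using d1[OF x] by (simp add: dr_const)
  qed
  then obtain x where xW1: "x \<in> W1" by auto
  then have x: "x \<in> W" and x2: "2 * \<Lambda> x - beta x \<noteq> 0" by (auto simp: W1_def)
  have q0: "qq y = 0" if "y \<in> W1" for y using n that by (auto simp: W1_def)
  have "dr (E x) qq x = dr (E x) (\<lambda>_. 0) x"
    unfolding dr_def using FD_cong_open[OF W1 xW1, of qq "\<lambda>_. 0"] q0 by simp
  then have "dr (E x) qq x = 0" by (simp add: dr_const)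
  moreover have "dr (E x) qq x = 2 * (dr (E x) \<Lambda> x * (2 * \<Lambda> x - beta x))"
  proof -
    note a = smooth_on_mult[OF oW Lam_smooth Lam_smooth] and b = smooth_on_mult[OF oW beta_smooth Lam_smooth]
    note a2 = smooth_on_mult[OF oW smooth_on_const[of W 2] a] and b2 = smooth_on_mult[OF oW smooth_on_const[of W 2] b]
    show ?thesis
      unfolding qq_def[abs_def] dr_arith(2)[OF smooth_on_diff[OF oW a2 b2] smooth_on_const x] dr_arith(2)[OF a2 b2 x]
        dr_cmult[OF a x] dr_cmult[OF b x] dr_arith(3)[OF Lam_smooth Lam_smooth x] dr_arith(3)[OF beta_smooth Lam_smooth x]
        dr_E_beta[OF x] dr_const
      by (simp add: algebra_simps)
  qed
  ultimately show False using dL[OF x] x2 by simp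
qed

end

locale crit2 = crit U S W P N m c
  for U :: "'e::euclidean_space set" and S :: "'e contact_metric" and W :: "'f::euclidean_space set"
    and P N and m :: nat and c :: real +
  assumes gen1: "\<And>x. x \<in> W \<Longrightarrow> 2 * \<Lambda> x - beta x \<noteq> 0" and gen2: "\<And>x. x \<in> W \<Longrightarrow> qq x \<noteq> 0"
begin

definition bb where "bb x = beta x / 2"

text \<open>Symmetry of the derivative of \<open>E\<close> gives the component of
  \<open>nab V E\<close> along \<open>pE\<close>. Inserted into \<open>codazzi_E_V\<close> it yields
  \<open>(\<Lambda> - \<mu>) * (2 * \<mu> - beta) = 0\<close>; with \<open>\<mu> = beta / 2\<close>
  the terms with \<open>\<Lambda>\<close> in \<open>hopf_relation\<close> cancel, which leaves a
  condition on \<open>c\<close>.\<close>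

lemma bb_facts:
  assumes x: "x \<in> W"
  shows "B x (pE x) = bb x *\<^sub>R pE x" "\<Lambda> x \<noteq> bb x" "c + 3 = - 4 * (bb x)\<^sup>2"
proof -
  interpret i: inner_form "ip x" by (rule inner_ip[OF x])
  note fr = frame_simps[OF x]
  define \<mu> where "\<mu> = (beta x * \<Lambda> x + (c + 3) / 2) / (2 * \<Lambda> x - beta x)"
  have h: "(2 * \<Lambda> x - beta x) * \<mu> = beta x * \<Lambda> x + (c + 3) / 2" using gen1[OF x] by (simp add: \<mu>_def)
  have "(2 * \<Lambda> x - beta x) *\<^sub>R B x (pE x) = (2 * \<Lambda> x - beta x) *\<^sub>R (\<mu> *\<^sub>R pE x)"
    using hopf_relation[OF x] h by simp
  then have Bp: "B x (pE x) = \<mu> *\<^sub>R pE x" using scaleR_left_imp_eq[OF gen1[OF x]] by blast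
  have "(2 * \<Lambda> x - beta x) * (\<Lambda> x - \<mu>) = qq x"
    using h by (simp add: qq_def algebra_simps)
  then have ne: "\<Lambda> x \<noteq> \<mu>" using gen2[OF x] by auto
  have "ip x (nab (V x) E x) (pE x) = ip x (nab (pE x) E x) (V x)"
    by (rule W_sym[OF x]) (simp_all add: fr)
  also have "\<dots> = - \<mu>" using nab_E_pairs(2)[OF x, of "pE x"] fr Bp by (simp add: linear_cmul[OF phi_linear[OF x]])
  finally have n: "ip x (nab (V x) E x) (pE x) = - \<mu>" .
  have "ip x (B x (nab (V x) E x)) (pE x) = - \<mu> * \<mu>"
    using B_self_adjoint[OF x, of "nab (V x) E x" "pE x"] Bp n by simp
  then have "-1 - beta x * \<Lambda> x + \<Lambda> x * \<mu> + (\<Lambda> x - \<mu>) * \<mu> = (c - 1) / 4"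
    using arg_cong[OF codazzi_E_V[OF x], of "\<lambda>z. ip x z (pE x)"] n fr Bp by (simp add: algebra_simps)
  then have "(\<Lambda> x - \<mu>) * (2 * \<mu> - beta x) = 0"
    using h by (simp add: field_simps) (simp add: algebra_simps)?
  then have mu: "\<mu> = bb x" using ne by (simp add: bb_def)
  show "B x (pE x) = bb x *\<^sub>R pE x" "\<Lambda> x \<noteq> bb x" using Bp ne mu by auto
  show "c + 3 = - 4 * (bb x)\<^sup>2"
    using h unfolding mu by (simp add: bb_def power2_eq_square field_simps)
qed

lemma simple_limit:
  assumes x: "x \<in> W" and Y: "\<And>n. xs n \<in> W" "xs \<longlonglongrightarrow> x"
    "\<And>n. norm (Y n) = 1" "\<And>n. ip (xs n) (Y n) (N (xs n)) = 0" "\<And>n. ip (xs n) (Y n) (E (xs n)) = 0"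
    "\<And>n. B (xs n) (Y n) = \<Lambda> (xs n) *\<^sub>R Y n"
  obtains r Z where "strict_mono r" "(\<lambda>n. Y (r n)) \<longlonglongrightarrow> Z" "norm Z = 1"
    "ip x Z (N x) = 0" "ip x Z (E x) = 0" "B x Z = \<Lambda> x *\<^sub>R Z"
proof -
  obtain Z r where r: "strict_mono (r :: nat \<Rightarrow> nat)" "(Y \<circ> r) \<longlonglongrightarrow> Z" "Z \<in> sphere 0 1"
    using compact_sphere[of "0::'e" 1] Y(3) unfolding compact_def by (metis dist_0_norm mem_sphere)
  have xr: "(\<lambda>n. xs (r n)) \<longlonglongrightarrow> x" using LIMSEQ_subseq_LIMSEQ[OF Y(2) r(1)] by (simp add: o_def)
  have yr: "(\<lambda>n. Y (r n)) \<longlonglongrightarrow> Z" using r(2) by (simp add: o_def)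
  have lin: "(\<lambda>n. A (xs (r n)) (Y (r n))) \<longlonglongrightarrow> A x Z"
    if A: "\<And>v. smooth_on W (\<lambda>x. A x v)" "\<And>x. x \<in> W \<Longrightarrow> linear (A x)" for A :: "'f \<Rightarrow> 'e \<Rightarrow> 'z::real_normed_vector"
  proof -
    have "(\<lambda>n. A (xs (r n)) b) \<longlonglongrightarrow> A x b" for b
      using continuous_on_tendsto_compose[OF smooth_on_continuous[OF A(1)] xr x] Y(1) by simp
    then have "(\<lambda>n. \<Sum>b\<in>Basis. (Y (r n) \<bullet> b) *\<^sub>R A (xs (r n)) b) \<longlonglongrightarrow> (\<Sum>b\<in>Basis. (Z \<bullet> b) *\<^sub>R A x b)"
      by (intro tendsto_sum tendsto_scaleR tendsto_inner yr tendsto_const)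
    then show ?thesis by (simp add: linear_on_Basis[OF A(2)[OF Y(1)], symmetric] linear_on_Basis[OF A(2)[OF x], symmetric])
  qed
  have ipl: "linear (\<lambda>v. ip y v w)" if "y \<in> W" for y w
    using inner_form.lin(2)[OF inner_ip[OF that]] .
  have N0: "ip x Z (N x) = 0"
    using lin[of "\<lambda>y v. ip y v (N y)", OF ip_smooth[OF smooth_on_const N_smooth] ipl] Y(4) LIMSEQ_unique[OF _ tendsto_const] by simp
  have E0: "ip x Z (E x) = 0"
    using lin[of "\<lambda>y v. ip y v (E y)", OF ip_smooth[OF smooth_on_const E_smooth] ipl] Y(5) LIMSEQ_unique[OF _ tendsto_const] by simp
  have "(\<lambda>n. B (xs (r n)) (Y (r n)) - \<Lambda> (xs (r n)) *\<^sub>R Y (r n)) \<longlonglongrightarrow> B x Z - \<Lambda> x *\<^sub>R Z"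
  proof (rule lin[of "\<lambda>y v. B y v - \<Lambda> y *\<^sub>R v"])
    show "smooth_on W (\<lambda>y. B y v - \<Lambda> y *\<^sub>R v)" for v
      using B_sop by (intro smooth_on_diff smooth_on_scaleR oW Lam_smooth smooth_on_const) (simp add: sop_def)
    show "linear (\<lambda>v. B y v - \<Lambda> y *\<^sub>R v)" if "y \<in> W" for y
      by (intro linear_compose_sub sop_linear[OF B_sop that] linear_scale_self)
  qed
  then have "(\<lambda>n. 0) \<longlonglongrightarrow> B x Z - \<Lambda> x *\<^sub>R Z" by (simp add: Y(6))
  from LIMSEQ_unique[OF this tendsto_const] have "B x Z = \<Lambda> x *\<^sub>R Z" by simp
  then show ?thesis using that[OF r(1) yr _ N0 E0] r(3) by simp
qed

text \<open>Suppose a second eigenvector for \<open>\<Lambda>\<close> exists everywhere.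
  Eigenvectors \<open>Y\<close> at points tending to \<open>x\<close> along the velocity of
  \<open>E\<close> have a limit \<open>Z\<close>, and difference quotients of
  \<open>B - \<Lambda>\<close> show that \<open>ip ((nab_E B) Z) Z\<close> equals
  \<open>E \<Lambda>\<close> times the square length of \<open>Z\<close>. By Codazzi the same number
  is 0, although \<open>E \<Lambda> > 0\<close>. No smooth choice of eigenvectors is required for
  this.\<close>

lemma exists_simple: "\<exists>x\<in>W. \<forall>Y. ip x Y (N x) = 0 \<and> ip x Y (E x) = 0 \<and> B x Y = \<Lambda> x *\<^sub>R Y \<longrightarrow> Y = 0"
proof (rule ccontr)
  assume neg: "\<not> ?thesis"
  have bad: "\<exists>Y. norm Y = 1 \<and> ip x Y (N x) = 0 \<and> ip x Y (E x) = 0 \<and> B x Y = \<Lambda> x *\<^sub>R Y" if x: "x \<in> W" for x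
  proof -
    interpret i: inner_form "ip x" by (rule inner_ip[OF x])
    obtain Y where "ip x Y (N x) = 0" "ip x Y (E x) = 0" "B x Y = \<Lambda> x *\<^sub>R Y" "Y \<noteq> 0" using neg x by blast
    then show ?thesis
      by (intro exI[of _ "(1 / norm Y) *\<^sub>R Y"]) (simp add: linear_cmul[OF sop_linear[OF B_sop x]])
  qed
  obtain x where x: "x \<in> W" using W_ne by auto
  interpret i: inner_form "ip x" by (rule inner_ip[OF x])
  note fr = frame_simps[OF x]
  define u where "u = tau x (E x)"
  obtain \<epsilon> where \<epsilon>: "\<epsilon> > 0" "ball x \<epsilon> \<subseteq> W" using oW x openE by blast
  define s where "s n = \<epsilon> / (norm u + 1) / 2 * (1 / real (Suc n))" for n :: nat
  have nu: "norm u + 1 > 0" by (simp add: add_nonneg_pos)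
  have s0: "s n > 0" for n using \<epsilon> nu by (simp add: s_def)
  have sl: "s \<longlonglongrightarrow> 0"
  proof -
    have "(\<lambda>n. \<epsilon> / (norm u + 1) / 2 * (1 / real (Suc n))) \<longlonglongrightarrow> \<epsilon> / (norm u + 1) / 2 * 0"
      by (intro tendsto_mult tendsto_const LIMSEQ_Suc lim_1_over_n)
    then show ?thesis by (simp add: s_def[abs_def])
  qed
  define xs where "xs n = x + s n *\<^sub>R u" for n
  have xsW: "xs n \<in> W" for n
  proof (rule subsetD[OF \<epsilon>(2)])
    have "1 / real (Suc n) \<le> 1" by simp
    then have "s n \<le> \<epsilon> / (norm u + 1) / 2 * 1"
      unfolding s_def using \<epsilon> nu by (intro mult_left_mono) simp_all
    then have "s n * norm u \<le> \<epsilon> / (norm u + 1) / 2 * norm u" by (intro mult_right_mono) simp_all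
    also have "\<dots> = \<epsilon> / 2 * (norm u / (norm u + 1))" by simp
    also have "\<dots> \<le> \<epsilon> / 2 * 1" using \<epsilon> nu by (intro mult_left_mono) simp_all
    also have "\<dots> < \<epsilon>" using \<epsilon> by simp
    finally show "xs n \<in> ball x \<epsilon>" using s0[of n] by (simp add: xs_def dist_norm)
  qed
  have xsl: "xs \<longlonglongrightarrow> x"
    using tendsto_add[OF tendsto_const[of x] tendsto_scaleR[OF sl tendsto_const[of u]]] by (simp add: xs_def[abs_def])
  obtain Y where Y: "\<And>n. norm (Y n) = 1" "\<And>n. ip (xs n) (Y n) (N (xs n)) = 0" "\<And>n. ip (xs n) (Y n) (E (xs n)) = 0"
    "\<And>n. B (xs n) (Y n) = \<Lambda> (xs n) *\<^sub>R Y n"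
    using bad[OF xsW] by metis
  obtain r Z where r: "strict_mono r" "(\<lambda>n. Y (r n)) \<longlonglongrightarrow> Z" "norm Z = 1"
    "ip x Z (N x) = 0" "ip x Z (E x) = 0" "B x Z = \<Lambda> x *\<^sub>R Z"
    using simple_limit[OF x xsW xsl Y] by blast
  define T where "T y v = B y v - \<Lambda> y *\<^sub>R v" for y v
  have T: "sop T" unfolding sop_def T_def
  proof (intro conjI allI ballI)
    show "smooth_on W (\<lambda>y. B y v - \<Lambda> y *\<^sub>R v)" for v
      using B_sop by (intro smooth_on_diff smooth_on_scaleR oW Lam_smooth smooth_on_const) (simp add: sop_def)
    show "linear (\<lambda>v. B y v - \<Lambda> y *\<^sub>R v)" if "y \<in> W" for y
      by (intro linear_compose_sub sop_linear[OF B_sop that] linear_scale_self)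
  qed
  have Ts: "smooth_on W (\<lambda>y. T y v)" for v using T by (simp add: sop_def)
  have Tsa: "ip x (T x v) w = ip x v (T x w)" for v w using B_self_adjoint[OF x] by (simp add: T_def)
  have TZ: "T x Z = 0" using r by (simp add: T_def)
  \<comment> \<open>Only the limit \<open>Z\<close> is used in the pairing, with the inner product
    at \<open>x\<close>. The quotients are thus those of fixed smooth functions, and the vectors
    \<open>Y\<close> enter as convergent coefficients.\<close>
  define \<psi> where "\<psi> v y = ip x (T y v) Z" for v y
  have bl: "bounded_linear (\<lambda>v. ip x v Z)" using i.lin(2) linear_conv_bounded_linear by blast
  have \<psi>s: "smooth_on W (\<psi> v)" for v
    unfolding \<psi>_def by (rule smooth_on_bounded_linear[OF bl oW Ts])
  have lim1: "(\<lambda>n. (\<psi> b (xs (r n)) - \<psi> b x) / s (r n)) \<longlonglongrightarrow> FD (\<psi> b) x u" for b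
  proof -
    have "((\<lambda>t. \<psi> b (x + t *\<^sub>R u)) has_real_derivative FD (\<psi> b) x u) (at 0)"
      using FD_along_line[OF oW \<psi>s, of x 0 u] x by simp
    then have "((\<lambda>t. (\<psi> b (x + t *\<^sub>R u) - \<psi> b x) / t) \<longlongrightarrow> FD (\<psi> b) x u) (at 0)"
      by (simp add: has_field_derivative_iff)
    moreover have "filterlim (\<lambda>n. s (r n)) (at 0) sequentially"
      unfolding filterlim_at using LIMSEQ_subseq_LIMSEQ[OF sl r(1)] s0 by (auto simp: o_def less_imp_neq[symmetric])
    ultimately show ?thesis using filterlim_compose by (fastforce simp: xs_def)
  qed
  have "(\<lambda>n. \<Sum>b\<in>Basis. (Y (r n) \<bullet> b) * ((\<psi> b (xs (r n)) - \<psi> b x) / s (r n))) \<longlonglongrightarrow> (\<Sum>b\<in>Basis. (Z \<bullet> b) * FD (\<psi> b) x u)"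
    by (intro tendsto_sum tendsto_mult tendsto_inner r(2) tendsto_const lim1)
  \<comment> \<open>At the nearby point \<open>T\<close> kills \<open>Y\<close>; at \<open>x\<close>
    self-adjointness moves \<open>T\<close> over to \<open>Z\<close>, which it kills as
    well.\<close>
  moreover have "(\<Sum>b\<in>Basis. (Y (r n) \<bullet> b) * ((\<psi> b (xs (r n)) - \<psi> b x) / s (r n))) = 0" for n
  proof -
    have ex: "(\<Sum>b\<in>Basis. (v \<bullet> b) * \<psi> b y) = ip x (T y v) Z" if y: "y \<in> W" for y v
      unfolding \<psi>_def linear_on_Basis[OF sop_linear[OF T y], of v] by (simp add: i.h_sum)
    have "ip x (T x (Y (r n))) Z = 0" using Tsa[of "Y (r n)" Z] TZ by simp
    moreover have "T (xs (r n)) (Y (r n)) = 0" using Y(4)[of "r n"] by (simp add: T_def)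
    ultimately have "(\<Sum>b\<in>Basis. (Y (r n) \<bullet> b) * \<psi> b (xs (r n))) - (\<Sum>b\<in>Basis. (Y (r n) \<bullet> b) * \<psi> b x) = 0"
      unfolding ex[OF xsW] ex[OF x] by simp
    then show ?thesis
      by (simp add: right_diff_distrib diff_divide_distrib sum_subtractf sum_divide_distrib[symmetric])
  qed
  ultimately have z0: "(\<Sum>b\<in>Basis. (Z \<bullet> b) * FD (\<psi> b) x u) = 0"
    using LIMSEQ_unique[OF _ tendsto_const] by simp
  have FT: "FD (\<psi> b) x u = ip x (FD (\<lambda>y. T y b) x u) Z" for b
    using FD_eqI[OF bounded_linear.has_derivative[OF bl smooth_on_has_derivative[OF Ts x]]] by (simp add: \<psi>_def[abs_def])
  have "((\<lambda>y. T y Z) has_derivative (\<lambda>u. \<Sum>b\<in>Basis. (Z \<bullet> b) *\<^sub>R FD (\<lambda>y. T y b) x u)) (at x)"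
  proof -
    have "((\<lambda>y. \<Sum>b\<in>Basis. (Z \<bullet> b) *\<^sub>R T y b) has_derivative (\<lambda>u. \<Sum>b\<in>Basis. (Z \<bullet> b) *\<^sub>R FD (\<lambda>y. T y b) x u)) (at x)"
      by (intro has_derivative_sum has_derivative_scaleR_right smooth_on_has_derivative[OF Ts x])
    then show ?thesis
      by (rule has_derivative_transform_within_open[OF _ oW x]) (rule linear_on_Basis[OF sop_linear[OF T], symmetric])
  qed
  from FD_eqI[OF this] have FZ: "ip x (FD (\<lambda>y. T y Z) x u) Z = 0"
    using z0 by (simp add: i.h_sum FT)
  have "ip x (dop (E x) T x Z) Z = 0"
  proof -
    have "nab (E x) (\<lambda>y. T y Z) x = FD (\<lambda>y. T y Z) x u"
      using TZ G_linear(1)[OF Px[OF x], of "FD P x u", THEN linear_0] by (simp add: nab_def cd_def u_def)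
    then show ?thesis using FZ Tsa[of _ Z] TZ by (simp add: dop_def)
  qed
  moreover have "dop (E x) T x Z = dop (E x) B x Z - dr (E x) \<Lambda> x *\<^sub>R Z"
  proof -
    have sB: "smooth_on W (\<lambda>y. B y Z)" using B_sop by (simp add: sop_def)
    have sL: "smooth_on W (\<lambda>y. \<Lambda> y *\<^sub>R Z)" by (intro smooth_on_scaleR oW Lam_smooth smooth_on_const)
    have "nab (E x) (\<lambda>y. T y Z) x = nab (E x) (\<lambda>y. B y Z) x - (dr (E x) \<Lambda> x *\<^sub>R Z + \<Lambda> x *\<^sub>R nab (E x) (\<lambda>_. Z) x)"
      unfolding T_def nab_diff[OF sB sL x] nab_scale[OF Lam_smooth smooth_on_const x] ..
    then show ?thesis by (simp add: dop_def T_def)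
  qed
  ultimately have k: "ip x (dop (E x) B x Z) Z = dr (E x) \<Lambda> x * ip x Z Z" by simp
  have EZ: "ip x (E x) Z = 0" "ip x (N x) Z = 0" using r i.sym by auto
  have pZ: "ip x (pE x) Z = 0"
  proof -
    show ?thesis
      using B_self_adjoint[OF x, of "pE x" Z] bb_facts(1,2)[OF x] bb_facts(2)[OF x, symmetric] r(6) by simp
  qed
  have "dop (E x) B x Z = dop Z B x (E x) + CR x (E x) Z (N x)"
    using codazzi[OF x E_simps(2)[OF x] r(4)] by (simp add: algebra_simps)
  moreover have "ip x (CR x (E x) Z (N x)) Z = 0"
    unfolding CRN[OF x E_simps(2)[OF x] r(4)] using pZ by (simp add: fr)
  moreover have "ip x (dop Z B x (E x)) Z = 0"
    unfolding dop_B_E[OF x] using EZ B_self_adjoint[OF x, of "nab Z E x" Z] r(6) by simp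
  ultimately have "dr (E x) \<Lambda> x * ip x Z Z = 0" using k by simp
  moreover have "ip x Z Z > 0" using r(3) by (intro i.pos) auto
  moreover have "dr (E x) \<Lambda> x > 0"
    using dr_Lam[OF x E_simps(2)[OF x]] E_simps(1)[OF x] rho_pos[OF x] m_pos by simp
  ultimately show False by simp
qed

text \<open>Second eigenvectors in arbitrarily small balls would, by \<open>simple_limit\<close>,
  produce one at the centre.\<close>

lemma exists_simple_open:
  obtains W' where "open W'" "W' \<noteq> {}" "W' \<subseteq> W"
    "\<And>x Y. x \<in> W' \<Longrightarrow> ip x Y (N x) = 0 \<Longrightarrow> ip x Y (E x) = 0 \<Longrightarrow> B x Y = \<Lambda> x *\<^sub>R Y \<Longrightarrow> Y = 0"
proof -
  obtain x where x: "x \<in> W" "\<And>Y. ip x Y (N x) = 0 \<Longrightarrow> ip x Y (E x) = 0 \<Longrightarrow> B x Y = \<Lambda> x *\<^sub>R Y \<Longrightarrow> Y = 0"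
    using exists_simple by blast
  obtain \<epsilon> where \<epsilon>: "\<epsilon> > 0" "ball x \<epsilon> \<subseteq> W" using oW x openE by blast
  have "\<exists>n. \<forall>y\<in>ball x (\<epsilon> / real (Suc n)). \<forall>Y. ip y Y (N y) = 0 \<and> ip y Y (E y) = 0 \<and> B y Y = \<Lambda> y *\<^sub>R Y \<longrightarrow> Y = 0"
  proof (rule ccontr)
    assume "\<not> ?thesis"
    then have "\<forall>n. \<exists>y. y \<in> ball x (\<epsilon> / real (Suc n)) \<and> (\<exists>Y. ip y Y (N y) = 0 \<and> ip y Y (E y) = 0 \<and> B y Y = \<Lambda> y *\<^sub>R Y \<and> Y \<noteq> 0)"
      by blast
    then obtain xs where xs: "\<And>n. xs n \<in> ball x (\<epsilon> / real (Suc n))"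
      "\<And>n. \<exists>Y. ip (xs n) Y (N (xs n)) = 0 \<and> ip (xs n) Y (E (xs n)) = 0 \<and> B (xs n) Y = \<Lambda> (xs n) *\<^sub>R Y \<and> Y \<noteq> 0"
      by metis
    have xsW: "xs n \<in> W" for n
    proof (rule subsetD[OF \<epsilon>(2)])
      have "\<epsilon> / real (Suc n) \<le> \<epsilon>" using \<epsilon> by (simp add: field_simps)
      then show "xs n \<in> ball x \<epsilon>" using xs(1)[of n] by simp
    qed
    have bad: "\<exists>Y. norm Y = 1 \<and> ip (xs n) Y (N (xs n)) = 0 \<and> ip (xs n) Y (E (xs n)) = 0 \<and> B (xs n) Y = \<Lambda> (xs n) *\<^sub>R Y" for n
    proof -
      interpret i: inner_form "ip (xs n)" by (rule inner_ip[OF xsW])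
      obtain Y where "ip (xs n) Y (N (xs n)) = 0" "ip (xs n) Y (E (xs n)) = 0" "B (xs n) Y = \<Lambda> (xs n) *\<^sub>R Y" "Y \<noteq> 0"
        using xs(2) by blast
      then show ?thesis
        by (intro exI[of _ "(1 / norm Y) *\<^sub>R Y"]) (simp add: linear_cmul[OF sop_linear[OF B_sop xsW]])
    qed
    have xsl: "xs \<longlonglongrightarrow> x"
    proof -
      have "(\<lambda>n. \<epsilon> * (1 / real (Suc n))) \<longlonglongrightarrow> \<epsilon> * 0"
        by (intro tendsto_mult tendsto_const LIMSEQ_Suc lim_1_over_n)
      then have l: "(\<lambda>n. \<epsilon> / real (Suc n)) \<longlonglongrightarrow> 0" by simp
      have "norm (xs n - x) \<le> \<epsilon> / real (Suc n)" for n
        using xs(1)[of n] unfolding mem_ball dist_norm norm_minus_commute[of x] by (rule less_imp_le)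
      then have "(\<lambda>n. xs n - x) \<longlonglongrightarrow> 0"
        by (rule Lim_null_comparison[OF always_eventually[OF allI] l])
      then show ?thesis by (rule LIM_zero_cancel)
    qed
    obtain Y where Y: "\<And>n. norm (Y n) = 1" "\<And>n. ip (xs n) (Y n) (N (xs n)) = 0" "\<And>n. ip (xs n) (Y n) (E (xs n)) = 0"
      "\<And>n. B (xs n) (Y n) = \<Lambda> (xs n) *\<^sub>R Y n" using bad by metis
    obtain r Z where "strict_mono (r :: nat \<Rightarrow> nat)" "norm Z = 1" "ip x Z (N x) = 0" "ip x Z (E x) = 0" "B x Z = \<Lambda> x *\<^sub>R Z"
      using simple_limit[OF x(1) xsW xsl Y] by blast
    then show False using x(2)[of Z] by simp
  qed
  then obtain n where n: "\<And>y Y. y \<in> ball x (\<epsilon> / real (Suc n)) \<Longrightarrow> ip y Y (N y) = 0 \<Longrightarrow> ip y Y (E y) = 0 \<Longrightarrow> B y Y = \<Lambda> y *\<^sub>R Y \<Longrightarrow> Y = 0"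
    by blast
  have "\<epsilon> / real (Suc n) \<le> \<epsilon>" using \<epsilon> by (simp add: field_simps)
  then have "ball x (\<epsilon> / real (Suc n)) \<subseteq> W" using \<epsilon> by (meson subset_ball subset_trans)
  moreover have "x \<in> ball x (\<epsilon> / real (Suc n))"
    unfolding mem_ball dist_self by (rule divide_pos_pos[OF \<epsilon>(1)]) simp
  ultimately show ?thesis
    by (intro that[of "ball x (\<epsilon> / real (Suc n))"] open_ball) (auto simp del: mem_ball intro: n)
qed

end

section \<open>Evolution of the moments of the shape operator\<close>

locale crit3 = crit2 U S W P N m c
  for U :: "'e::euclidean_space set" and S :: "'e contact_metric" and W :: "'f::euclidean_space set"
    and P N and m :: nat and c :: real +
  assumes simple: "\<And>x Y. x \<in> W \<Longrightarrow> ip x Y (N x) = 0 \<Longrightarrow> ip x Y (E x) = 0 \<Longrightarrow> B x Y = \<Lambda> x *\<^sub>R Y \<Longrightarrow> Y = 0"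
begin

text \<open>Codazzi paired with \<open>E\<close> shows that \<open>\<Lambda> - B\<close> kills the
  tangential part of \<open>nab E E\<close>, which is orthogonal to \<open>E\<close>; by simplicity
  it is 0. Thus the integral curves of \<open>E\<close> are geodesics of the hypersurface.\<close>

lemma nab_E_E:
  assumes x: "x \<in> W" shows "nab (E x) E x = - \<Lambda> x *\<^sub>R N x"
proof -
  interpret i: inner_form "ip x" by (rule inner_ip[OF x])
  note fr = frame_simps[OF x]
  note lB = sop_linear[OF B_sop x]
  define Q where "Q = \<Lambda> x *\<^sub>R nab (E x) E x - B x (nab (E x) E x)"
  have nN: "ip x (nab (E x) E x) (N x) = - \<Lambda> x" using nab_E_pairs(4)[OF x, of "E x"] fr by simp
  have nE: "ip x (nab (E x) E x) (E x) = 0" using nab_E_pairs(3)[OF x, of "E x"] fr by simp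
  have t: "ip x Q Y = 0" if Y: "ip x Y (N x) = 0" for Y
  proof -
    have 1: "ip x (dop (E x) B x Y) (E x) - ip x (dop Y B x (E x)) (E x) = ip x (CR x (E x) Y (N x)) (E x)"
      using codazzi[OF x E_simps(2)[OF x] Y] by (metis i.h_diff(1))
    have 2: "ip x (dop (E x) B x Y) (E x) = ip x Y (dr (E x) \<Lambda> x *\<^sub>R E x + Q)"
      using dop_self_adjoint[OF B_sop B_self_adjoint x, of "E x" Y "E x"] unfolding dop_B_E[OF x] Q_def
      by (simp add: algebra_simps)
    have 3: "ip x (dop Y B x (E x)) (E x) = dr Y \<Lambda> x"
      unfolding dop_B_E[OF x] using B_self_adjoint[OF x, of "nab Y E x" "E x"] fr by simp
    have 4: "ip x (CR x (E x) Y (N x)) (E x) = 0"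
      unfolding CRN[OF x E_simps(2)[OF x] Y] using fr phi_skew[OF x, of Y "E x"] by simp
    have "dr (E x) \<Lambda> x * ip x Y (E x) = dr Y \<Lambda> x"
      unfolding dr_Lam[OF x E_simps(2)[OF x]] dr_Lam[OF x Y] using fr i.sym[of Y "E x"] by simp
    then have "ip x Y Q = 0" using 1 unfolding 2 3 4 by simp
    then show ?thesis using i.sym by simp
  qed
  have "nab (E x) E x + \<Lambda> x *\<^sub>R N x = 0"
  proof (rule simple[OF x])
    show "ip x (nab (E x) E x + \<Lambda> x *\<^sub>R N x) (N x) = 0" "ip x (nab (E x) E x + \<Lambda> x *\<^sub>R N x) (E x) = 0"
      using nN nE fr by simp_all
    have QN: "ip x (Q + (\<Lambda> x * \<Lambda> x) *\<^sub>R N x) (N x) = 0"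
      using nN fr B_tangent[OF x] by (simp add: Q_def)
    then have "ip x Q (Q + (\<Lambda> x * \<Lambda> x) *\<^sub>R N x) = 0" by (rule t)
    then have "ip x (Q + (\<Lambda> x * \<Lambda> x) *\<^sub>R N x) (Q + (\<Lambda> x * \<Lambda> x) *\<^sub>R N x) = 0"
      using QN i.sym[of "N x" "Q + (\<Lambda> x * \<Lambda> x) *\<^sub>R N x"] by (metis add.right_neutral i.h_add(1) i.h_scale(1) mult_zero_right)
    then have "Q + (\<Lambda> x * \<Lambda> x) *\<^sub>R N x = 0" unfolding i.h_eq_0 .
    then show "B x (nab (E x) E x + \<Lambda> x *\<^sub>R N x) = \<Lambda> x *\<^sub>R (nab (E x) E x + \<Lambda> x *\<^sub>R N x)"
      by (simp add: Q_def linear_add[OF lB] linear_cmul[OF lB] B_N[OF x] algebra_simps)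
  qed
  then show ?thesis by (simp add: eq_neg_iff_add_eq_0)
qed

lemma codazzi_E:
  assumes x: "x \<in> W" and X: "ip x X (N x) = 0" "ip x X (E x) = 0"
  shows "\<Lambda> x *\<^sub>R nab X E x - B x (nab X E x) = dop (E x) B x X - CR x (E x) X (N x)"
proof -
  have "ip x (E x) X = 0" using X inner_form.sym[OF inner_ip[OF x]] by metis
  then have "dop X B x (E x) = \<Lambda> x *\<^sub>R nab X E x - B x (nab X E x)"
    using dop_B_E[OF x, of X] dr_Lam[OF x X(1)] by simp
  then show ?thesis using codazzi[OF x E_simps(2)[OF x] X(1)] by (simp add: algebra_simps)
qed

text \<open>By simplicity \<open>\<Lambda> - B\<close> is injective on tangent vectors orthogonal to
  \<open>E\<close>; a guess for \<open>nab X E\<close> is therefore verified by inserting it into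
  \<open>codazzi_E\<close>.\<close>

lemma nab_E_eqI:
  assumes x: "x \<in> W" and X: "ip x X (N x) = 0" "ip x X (E x) = 0"
    and Y: "ip x Y (N x) = - ip x (E x) (B x X)" "ip x Y (E x) = 0"
    and eq: "dop (E x) B x X - CR x (E x) X (N x) = \<Lambda> x *\<^sub>R Y - B x Y"
  shows "nab X E x = Y"
proof -
  interpret i: inner_form "ip x" by (rule inner_ip[OF x])
  have "nab X E x - Y = 0"
  proof (rule simple[OF x])
    show "ip x (nab X E x - Y) (N x) = 0" "ip x (nab X E x - Y) (E x) = 0"
      using nab_E_pairs(3,4)[OF x X(1)] Y by simp_all
    show "B x (nab X E x - Y) = \<Lambda> x *\<^sub>R (nab X E x - Y)"
      using codazzi_E[OF x X] eq by (simp add: linear_diff[OF sop_linear[OF B_sop x]] algebra_simps)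
  qed
  then show ?thesis by simp
qed

section \<open>Derivatives of the adapted frame and the value of \<open>c\<close>\<close>

lemma c_eq: "x \<in> W \<Longrightarrow> (c - 1) / 4 = - (bb x)\<^sup>2 - 1"
  using bb_facts(3)[of x] by simp

lemma beta_bb: "beta x = 2 * bb x" by (simp add: bb_def)

lemma bb_smooth: "smooth_on W bb"
  unfolding bb_def[abs_def] divide_real_def by (intro smooth_on_mult beta_smooth smooth_on_const oW)

lemma dr_E_bb: "x \<in> W \<Longrightarrow> dr (E x) bb x = 0"
  using dr_cmult[OF beta_smooth, of x "E x" "1/2"] dr_E_beta[of x] by (simp add: bb_def[abs_def])

lemma nab_E_frame:
  assumes x: "x \<in> W"
  shows "nab (E x) xi x = - pE x" "nab (E x) V x = - \<Lambda> x *\<^sub>R pE x" "nab (E x) pE x = \<Lambda> x *\<^sub>R V x + xi x"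
proof -
  note fr = frame_simps[OF x]
  show "nab (E x) xi x = - pE x" using nab_xi[OF x E_simps(2)[OF x]] fr by simp
  show "nab (E x) V x = - \<Lambda> x *\<^sub>R pE x"
    using nab_V[OF x E_simps(2)[OF x]] fr by (simp add: linear_cmul[OF phi_linear[OF x]])
  have "nab (E x) pE x = nab (E x) (\<lambda>y. phi y (E y)) x" by (simp add: pE_def[abs_def])
  then show "nab (E x) pE x = \<Lambda> x *\<^sub>R V x + xi x"
    unfolding nab_phi[OF E_smooth x E_simps(2)[OF x]] nab_E_E[OF x]
    using fr by (simp add: linear_cmul[OF phi_linear[OF x]] linear_neg[OF phi_linear[OF x]])
qed

lemma nab_frame_E:
  assumes x: "x \<in> W"
  shows "nab (xi x) E x = - pE x" "nab (V x) E x = - bb x *\<^sub>R pE x" "nab (pE x) E x = - xi x - bb x *\<^sub>R V x"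
proof -
  interpret i: inner_form "ip x" by (rule inner_ip[OF x])
  note fr = frame_simps[OF x] and b = bb_facts[OF x] and lB = sop_linear[OF B_sop x] and lp = phi_linear[OF x]
  note BV = B_V[OF x, unfolded beta_bb] and Bxi = B_xi[OF x]
  note lsimps = linear_neg[OF lB] linear_add[OF lB] linear_diff[OF lB] linear_cmul[OF lB] linear_cmul[OF lp]
  note E2 = E_simps(2)[OF x]
  note ne = nab_E_frame[OF x]
  show "nab (xi x) E x = - pE x"
  proof (rule nab_E_eqI[OF x])
    have "nab (E x) (\<lambda>y. B y (xi y)) x = nab (E x) V x" by (rule nab_cong[OF B_xi x])
    then have "dop (E x) B x (xi x) = - \<Lambda> x *\<^sub>R pE x + bb x *\<^sub>R pE x"
      using nab_op[OF B_sop xi_smooth x, of "E x"] ne b by (simp add: lsimps algebra_simps)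
    moreover have "CR x (E x) (xi x) (N x) = 0"
      unfolding CRN[OF x E2 xi_N(1)[OF x]] using fr by simp
    ultimately show "dop (E x) B x (xi x) - CR x (E x) (xi x) (N x) = \<Lambda> x *\<^sub>R (- pE x) - B x (- pE x)"
      using b by (simp add: lsimps)
  qed (use fr Bxi in simp_all)
  show "nab (V x) E x = - bb x *\<^sub>R pE x"
  proof (rule nab_E_eqI[OF x])
    have "dop (E x) B x (V x) = - (1 + bb x * \<Lambda> x) *\<^sub>R pE x"
      unfolding dop_B_V[OF x E2] beta_bb dr_E_beta[OF x, unfolded beta_bb] using fr b by (simp add: lsimps algebra_simps)
        (simp add: scaleR_left_distrib[symmetric])
    note d = this
    have r: "CR x (E x) (V x) (N x) = ((c - 1) / 4) *\<^sub>R pE x"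
      unfolding CRN[OF x E2 V_simps(4)[OF x]] using fr by simp
    show "dop (E x) B x (V x) - CR x (E x) (V x) (N x) = \<Lambda> x *\<^sub>R (- bb x *\<^sub>R pE x) - B x (- bb x *\<^sub>R pE x)"
      unfolding d r c_eq[OF x] using b(1) by (simp add: lsimps power2_eq_square algebra_simps)
  qed (use fr BV in simp_all)
  show "nab (pE x) E x = - xi x - bb x *\<^sub>R V x"
  proof (rule nab_E_eqI[OF x])
    have "nab (E x) (\<lambda>y. B y (pE y)) x = nab (E x) (\<lambda>y. bb y *\<^sub>R pE y) x" by (rule nab_cong[OF bb_facts(1) x])
    then have "dop (E x) B x (pE x) = bb x *\<^sub>R (\<Lambda> x *\<^sub>R V x + xi x) - B x (\<Lambda> x *\<^sub>R V x + xi x)"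
      using nab_op[OF B_sop pE_smooth x, of "E x"] nab_scale[OF bb_smooth pE_smooth x, of "E x"] ne dr_E_bb[OF x]
      by (simp add: algebra_simps)
    note d = this
    have r: "CR x (E x) (pE x) (N x) = (2 * ((c - 1) / 4)) *\<^sub>R V x"
      unfolding CRN[OF x E2 pE_simps(2)[OF x]] using fr by simp
    show "dop (E x) B x (pE x) - CR x (E x) (pE x) (N x)
      = \<Lambda> x *\<^sub>R (- xi x - bb x *\<^sub>R V x) - B x (- xi x - bb x *\<^sub>R V x)"
      unfolding d r c_eq[OF x] using b(1) BV Bxi by (simp add: lsimps power2_eq_square algebra_simps scaleR_2 scaleR_double)
  qed (use fr b in simp_all)
qed

lemma CR_E_pE: "x \<in> W \<Longrightarrow> CR x (E x) (pE x) (E x) = - c *\<^sub>R pE x"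
proof -
  assume x: "x \<in> W"
  interpret i: inner_form "ip x" by (rule inner_ip[OF x])
  have "CR x (E x) (pE x) (E x) = - ((c - 1) / 4) *\<^sub>R (2 *\<^sub>R pE x + pE x) - ((c + 3) / 4) *\<^sub>R pE x"
    using frame_simps[OF x] unfolding CR_def by simp
  also have "\<dots> = (- ((c - 1) / 4) * 3 - (c + 3) / 4) *\<^sub>R pE x"
    by (simp only: scaleR_add_right scaleR_scaleR scaleR_left_distrib[symmetric] scaleR_left_diff_distrib[symmetric]) (simp add: field_simps)
  also have "- ((c - 1) / 4) * 3 - (c + 3) / 4 = - c" by (simp add: field_simps)
  finally show ?thesis .
qed

text \<open>All derivatives of \<open>E\<close> in the frame directions are known, so the curvature
  on \<open>E\<close> and \<open>pE\<close> can be computed from them and compared with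
  \<open>c\<close>.\<close>

lemma bb_0:
  assumes x: "x \<in> W" shows "bb x = 0"
proof -
  interpret i: inner_form "ip x" by (rule inner_ip[OF x])
  note fr = frame_simps[OF x] and ne = nab_E_frame[OF x] and nf = nab_frame_E[OF x]
  note lB = sop_linear[OF B_sop x]
  have bV: "smooth_on W (\<lambda>y. bb y *\<^sub>R V y)" by (intro smooth_on_scaleR oW bb_smooth V_smooth)
  have mx: "smooth_on W (\<lambda>y. - xi y)" by (intro smooth_on_minus oW xi_smooth)
  have mL: "smooth_on W (\<lambda>y. - \<Lambda> y)" by (intro smooth_on_minus oW Lam_smooth)
  have 1: "nab (E x) (\<lambda>y. nab (pE y) E y) x = pE x + (bb x * \<Lambda> x) *\<^sub>R pE x"
  proof -
    have "nab (E x) (\<lambda>y. nab (pE y) E y) x = nab (E x) (\<lambda>y. - xi y - bb y *\<^sub>R V y) x"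
      by (rule nab_cong[OF nab_frame_E(3) x])
    then show ?thesis
      unfolding nab_diff[OF mx bV x] nab_minus[OF xi_smooth x] nab_scale[OF bb_smooth V_smooth x]
      using ne dr_E_bb[OF x] by simp
  qed
  have 2: "nab (pE x) (\<lambda>y. nab (E y) E y) x = - (\<Lambda> x * bb x) *\<^sub>R pE x"
  proof -
    have "nab (pE x) (\<lambda>y. nab (E y) E y) x = nab (pE x) (\<lambda>y. - \<Lambda> y *\<^sub>R N y) x"
      by (rule nab_cong[OF nab_E_E x])
    moreover have "dr (pE x) (\<lambda>y. - \<Lambda> y) x = 0"
      using dr_cmult[OF Lam_smooth x, of "pE x" "-1"] dr_Lam[OF x pE_simps(2)[OF x]] fr by simp
    ultimately show ?thesis
      using nab_scale[OF mL N_smooth x, of "pE x"] bb_facts(1)[OF x] by (simp add: B_def)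
  qed
  have l: "linear (\<lambda>X. nab X E x)" by (rule nab_linear[OF E_smooth x])
  have 3: "nab (nab (E x) pE x) E x = - (\<Lambda> x * bb x) *\<^sub>R pE x - pE x"
    unfolding ne linear_add[OF l] linear_cmul[OF l] nf by simp
  have 4: "nab (nab (pE x) E x) E x = (1 + bb x * bb x) *\<^sub>R pE x"
    unfolding nf(3) linear_diff[OF l] linear_cmul[OF l] linear_neg[OF l] nf(1,2) by (simp add: scaleR_left_distrib)
  have "nab (E x) (\<lambda>y. nab (pE y) E y) x - nab (pE x) (\<lambda>y. nab (E y) E y) x
    = CR x (E x) (pE x) (E x) + nab (nab (E x) pE x) E x - nab (nab (pE x) E x) E x"
    by (rule nab_curv[OF E_smooth E_smooth pE_smooth x E_simps(2) pE_simps(2)])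
  then have "ip x (pE x + (bb x * \<Lambda> x) *\<^sub>R pE x - (- (\<Lambda> x * bb x) *\<^sub>R pE x)) (pE x)
    = ip x (- c *\<^sub>R pE x + (- (\<Lambda> x * bb x) *\<^sub>R pE x - pE x) - (1 + bb x * bb x) *\<^sub>R pE x) (pE x)"
    unfolding 1 2 3 4 CR_E_pE[OF x] by simp
  then have "1 + bb x * \<Lambda> x + \<Lambda> x * bb x = - c - \<Lambda> x * bb x - 1 - (1 + bb x * bb x)"
    using fr by (simp add: algebra_simps)
  \<comment> \<open>With \<open>c = - 3 - 4 * bb^2\<close> the preceding equation becomes
    \<open>3 * bb * \<Lambda> = 3 * bb^2\<close>.\<close>
  then have "bb x * \<Lambda> x = bb x * bb x"
    using bb_facts(3)[OF x] by algebra
  then show ?thesis using bb_facts(2)[OF x] by simp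
qed

lemma c_m3: "c = - 3"
proof -
  obtain x where "x \<in> W" using W_ne by auto
  from bb_facts(3)[OF this] bb_0[OF this] show ?thesis by simp
qed

lemma B_frame:
  assumes x: "x \<in> W"
  shows "B x (N x) = 0" "B x (E x) = \<Lambda> x *\<^sub>R E x" "B x (pE x) = 0" "B x (xi x) = V x" "B x (V x) = xi x"
  using B_N[OF x] E_simps[OF x] bb_facts(1)[OF x] B_xi[OF x] B_V[OF x] bb_0[OF x] by (simp_all add: beta_bb)

lemma nab_frame_E0:
  assumes x: "x \<in> W"
  shows "nab (xi x) E x = - pE x" "nab (V x) E x = 0" "nab (pE x) E x = - xi x" "nab (N x) E x = 0"
  using nab_frame_E[OF x] bb_0[OF x] nab_N_arg[OF x E_smooth] by simp_all

section \<open>Evolution on the complement of the adapted frame\<close>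

definition Dp where "Dp x X \<longleftrightarrow> ip x X (N x) = 0 \<and> ip x X (E x) = 0 \<and> ip x X (pE x) = 0 \<and> ip x X (xi x) = 0 \<and> ip x X (V x) = 0"

definition Pi where "Pi x v = v - ip x v (N x) *\<^sub>R N x - ip x v (E x) *\<^sub>R E x - ip x v (pE x) *\<^sub>R pE x
  - ip x v (xi x) *\<^sub>R xi x - ip x v (V x) *\<^sub>R V x"

lemma Pi_id: "Dp x X \<Longrightarrow> Pi x X = X"
  by (simp add: Dp_def Pi_def)

lemma Dp_Pi:
  assumes x: "x \<in> W" shows "Dp x (Pi x v)"
proof -
  interpret i: inner_form "ip x" by (rule inner_ip[OF x])
  show ?thesis unfolding Dp_def Pi_def using frame_simps[OF x] by simp
qed

lemma Pi_self_adjoint: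
  assumes x: "x \<in> W" shows "ip x (Pi x u) v = ip x u (Pi x v)"
proof -
  interpret i: inner_form "ip x" by (rule inner_ip[OF x])
  show ?thesis unfolding Pi_def using i.sym[of _ v] by (simp add: i.sym[of _ v] mult.commute)
qed

lemma Pi_sop: "sop Pi"
  unfolding Pi_def[abs_def]
  by (intro sop_diff sop_id sop_rank1 N_smooth E_smooth pE_smooth xi_smooth V_smooth)

lemma dop_diff:
  assumes A: "sop A" "sop C" and x: "x \<in> W"
  shows "dop X (\<lambda>x v. A x v - C x v) x v = dop X A x v - dop X C x v"
  using nab_diff[of "\<lambda>y. A y v" "\<lambda>y. C y v" x X] A x by (simp add: dop_def sop_def)

lemma dop_id: "dop X (\<lambda>x v. v) x v = 0"
  by (simp add: dop_def)

lemma dop_rank1: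
  assumes Y: "smooth_on W Y" and Z: "smooth_on W Z" and x: "x \<in> W"
  shows "dop X (\<lambda>x v. ip x v (Y x) *\<^sub>R Z x) x v = ip x v (nab X Y x) *\<^sub>R Z x + ip x v (Y x) *\<^sub>R nab X Z x"
  unfolding dop_def nab_scale[OF ip_smooth[OF smooth_on_const Y] Z x] dr_ip[OF smooth_on_const Y x]
  by (simp add: algebra_simps)

text \<open>Along \<open>E\<close> the frame \<open>N\<close>, \<open>E\<close>, \<open>pE\<close>,
  \<open>xi\<close>, \<open>V\<close> moves by a skew matrix within its own span, so the projection
  to the complement is parallel.\<close>

lemma dop_Pi:
  assumes x: "x \<in> W" shows "dop (E x) Pi x v = 0"
proof -
  interpret i: inner_form "ip x" by (rule inner_ip[OF x])
  note sm = N_smooth E_smooth pE_smooth xi_smooth V_smooth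
  have "dop (E x) Pi x v = - (ip x v (nab (E x) N x) *\<^sub>R N x + ip x v (N x) *\<^sub>R nab (E x) N x)
     - (ip x v (nab (E x) E x) *\<^sub>R E x + ip x v (E x) *\<^sub>R nab (E x) E x)
     - (ip x v (nab (E x) pE x) *\<^sub>R pE x + ip x v (pE x) *\<^sub>R nab (E x) pE x)
     - (ip x v (nab (E x) xi x) *\<^sub>R xi x + ip x v (xi x) *\<^sub>R nab (E x) xi x)
     - (ip x v (nab (E x) V x) *\<^sub>R V x + ip x v (V x) *\<^sub>R nab (E x) V x)"
    unfolding Pi_def[abs_def]
    by (simp add: dop_diff sop_diff sop_id sop_rank1 sm x dop_id dop_rank1 del: diff_conv_add_uminus)
  moreover have "nab (E x) N x = \<Lambda> x *\<^sub>R E x" using E_simps(6)[OF x] by (simp add: B_def)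
  ultimately show ?thesis
    unfolding nab_E_E[OF x] nab_E_frame[OF x] by (simp add: algebra_simps)
qed

lemma trc_Pi:
  assumes x: "x \<in> W" and A: "linear A"
  shows "trc (\<lambda>v. A (Pi x v)) = trc A - ip x (A (N x)) (N x) - ip x (A (E x)) (E x) - ip x (A (pE x)) (pE x)
    - ip x (A (xi x)) (xi x) - ip x (A (V x)) (V x)"
proof -
  interpret i: inner_form "ip x" by (rule inner_ip[OF x])
  have r: "trc (\<lambda>v. ip x v Y *\<^sub>R Z) = ip x Z Y" for Y Z using trc_rank1[OF i.lin(2)] .
  show ?thesis unfolding Pi_def by (simp add: linear_diff[OF A] linear_cmul[OF A] trc_diff r)
qed

text \<open>With \<open>Pi\<close> built in, \<open>Ah\<close> and \<open>Wh\<close> are smooth on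
  the whole ambient space and vanish on the frame. The additional zero eigenvalues do not affect
  traces of words of positive length.\<close>

definition Ah where "Ah x v = B x (Pi x v)"
definition Wh where "Wh x v = nab (Pi x v) E x"

lemma Ah_sop: "sop Ah" unfolding Ah_def[abs_def] by (rule sop_compose[OF B_sop Pi_sop])

lemma Wop_sop: "sop (\<lambda>x X. nab X E x)" by (rule sop_nab[OF E_smooth])

lemma Wh_sop: "sop Wh" unfolding Wh_def[abs_def] by (rule sop_compose[OF Wop_sop Pi_sop])

lemma Dp_B:
  assumes x: "x \<in> W" and X: "Dp x X" shows "Dp x (B x X)"
  using X B_frame[OF x] B_self_adjoint[OF x, of X] B_tangent[OF x]
    inner_form.h_scale(2)[OF inner_ip[OF x]] inner_form.h_zero(2)[OF inner_ip[OF x]] by (simp add: Dp_def)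

lemma Dp_nab:
  assumes x: "x \<in> W" and X: "Dp x X" shows "Dp x (nab X E x)"
proof -
  interpret i: inner_form "ip x" by (rule inner_ip[OF x])
  have tX: "ip x X (N x) = 0" using X by (simp add: Dp_def)
  have BX: "Dp x (B x X)" by (rule Dp_B[OF x X])
  have sk: "ip x (E x) (phi x Y) = - ip x Y (pE x)" for Y
    using phi_skew[OF x, of "E x" Y] i.sym[of Y "pE x"] by (simp add: frame_simps[OF x])
  \<comment> \<open>Symmetry replaces the unknown derivative by \<open>nab pE E\<close>, which is
    \<open>- xi\<close>.\<close>
  have "ip x (nab X E x) (pE x) = ip x (nab (pE x) E x) X"
    by (rule W_sym[OF x]) (use X frame_simps[OF x] in \<open>simp_all add: Dp_def\<close>)
  also have "\<dots> = - ip x X (xi x)" unfolding nab_frame_E0[OF x] using i.sym[of X "xi x"] by simp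
  finally show ?thesis
    using nab_E_pairs[OF x tX] X BX i.sym[of "B x X" "E x"] by (simp add: Dp_def sk)
qed

lemma Pi_Ah: "x \<in> W \<Longrightarrow> Pi x (Ah x v) = Ah x v"
  unfolding Ah_def by (intro Pi_id Dp_B Dp_Pi)

lemma Pi_Wh: "x \<in> W \<Longrightarrow> Pi x (Wh x v) = Wh x v"
  unfolding Wh_def by (intro Pi_id Dp_nab Dp_Pi)

lemma Ah_self_adjoint: "x \<in> W \<Longrightarrow> ip x (Ah x u) v = ip x u (Ah x v)"
proof -
  assume x: "x \<in> W"
  have "ip x (Ah x u) v = ip x (Ah x u) (Pi x v)" using Pi_self_adjoint[OF x, of "Ah x u" v] Pi_Ah[OF x] by simp
  also have "\<dots> = ip x (Pi x u) (Ah x v)" unfolding Ah_def by (rule B_self_adjoint[OF x])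
  also have "\<dots> = ip x u (Ah x v)" using Pi_self_adjoint[OF x, of u "Ah x v"] Pi_Ah[OF x] by simp
  finally show ?thesis .
qed

lemma Wh_self_adjoint: "x \<in> W \<Longrightarrow> ip x (Wh x u) v = ip x u (Wh x v)"
proof -
  assume x: "x \<in> W"
  interpret i: inner_form "ip x" by (rule inner_ip[OF x])
  have "ip x (Wh x u) v = ip x (Wh x u) (Pi x v)" using Pi_self_adjoint[OF x, of "Wh x u" v] Pi_Wh[OF x] by simp
  also have "\<dots> = ip x (Wh x v) (Pi x u)"
    unfolding Wh_def by (rule W_sym[OF x]) (use Dp_Pi[OF x] in \<open>simp_all add: Dp_def\<close>)
  also have "\<dots> = ip x (Pi x u) (Wh x v)" by (rule i.sym)
  also have "\<dots> = ip x u (Wh x v)" using Pi_self_adjoint[OF x, of u "Wh x v"] Pi_Wh[OF x] by simp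
  finally show ?thesis .
qed

lemma dop_Ah:
  assumes x: "x \<in> W" shows "dop (E x) Ah x v = \<Lambda> x *\<^sub>R Wh x v - Ah x (Wh x v)"
proof -
  interpret i: inner_form "ip x" by (rule inner_ip[OF x])
  define X where "X = Pi x v"
  have X: "Dp x X" unfolding X_def by (rule Dp_Pi[OF x])
  then have t: "ip x X (N x) = 0" "ip x X (E x) = 0" "ip x (V x) X = 0" "ip x (pE x) X = 0"
    using i.sym by (simp_all add: Dp_def)
  have "dop (E x) Ah x v = dop (E x) B x X"
    unfolding Ah_def[abs_def] dop_compose[OF B_sop Pi_sop x] dop_Pi[OF x] X_def
    by (simp add: linear_0[OF sop_linear[OF B_sop x]])
  moreover have "CR x (E x) X (N x) = 0"
    unfolding CRN[OF x E_simps(2)[OF x] t(1)] using t frame_simps[OF x] by simp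
  ultimately have "dop (E x) Ah x v = \<Lambda> x *\<^sub>R nab X E x - B x (nab X E x)"
    using codazzi_E[OF x t(1,2)] by simp
  moreover have "Ah x (Wh x v) = B x (Wh x v)" unfolding Ah_def using Pi_Wh[OF x] by simp
  ultimately show ?thesis by (simp add: Wh_def X_def)
qed

text \<open>Riccati equation for the shape of the level sets. On the complement only the constant
  curvature part could contribute, and \<open>c + 3 = 0\<close> removes it.\<close>

lemma dop_Wop:
  assumes x: "x \<in> W" and X: "Dp x X"
  shows "dop (E x) (\<lambda>x X. nab X E x) x X = - \<Lambda> x *\<^sub>R B x X - nab (nab X E x) E x"
proof -
  interpret i: inner_form "ip x" by (rule inner_ip[OF x])
  have t: "ip x X (N x) = 0" using X by (simp add: Dp_def)
  have EX: "ip x (E x) X = 0" "ip x (pE x) X = 0" "ip x (xi x) X = 0" using X i.sym by (simp_all add: Dp_def)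
  obtain Z where Z: "smooth_on W Z" "\<And>y. y \<in> W \<Longrightarrow> ip y (Z y) (N y) = 0" "Z x = X"
    using tangential_field[OF x t] by blast
  have mL: "smooth_on W (\<lambda>y. - \<Lambda> y)" by (intro smooth_on_minus oW Lam_smooth)
  have "nab X (\<lambda>y. nab (E y) E y) x = nab X (\<lambda>y. - \<Lambda> y *\<^sub>R N y) x"
    by (rule nab_cong[OF nab_E_E x])
  moreover have "dr X (\<lambda>y. - \<Lambda> y) x = 0"
    using dr_cmult[OF Lam_smooth x, of X "-1"] dr_Lam[OF x t] EX by simp
  ultimately have 1: "nab X (\<lambda>y. nab (E y) E y) x = - \<Lambda> x *\<^sub>R B x X"
    using nab_scale[OF mL N_smooth x, of X] by (simp add: B_def)
  have "c + 3 = 0" using c_m3 by simp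
  then have "CR x (E x) X (E x) = 0"
    unfolding CR_def using EX phi_skew[OF x, of X "E x"] X frame_simps[OF x] by (simp add: Dp_def)
  then have "nab (E x) (\<lambda>y. nab (Z y) E y) x - nab X (\<lambda>y. nab (E y) E y) x
    = nab (nab (E x) Z x) E x - nab (nab X E x) E x"
    using nab_curv[OF E_smooth E_smooth Z(1) x E_simps(2) Z(2)] Z(3) by simp
  then show ?thesis
    using nab_op[OF Wop_sop Z(1) x, of "E x"] Z(3) 1 by (simp add: algebra_simps eq_neg_iff_add_eq_0)
qed

lemma dop_Wh:
  assumes x: "x \<in> W" shows "dop (E x) Wh x v = - \<Lambda> x *\<^sub>R Ah x v - Wh x (Wh x v)"
proof -
  have "dop (E x) Wh x v = dop (E x) (\<lambda>x X. nab X E x) x (Pi x v)"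
    unfolding Wh_def[abs_def] dop_compose[OF Wop_sop Pi_sop x] dop_Pi[OF x]
    by (simp add: linear_0[OF sop_linear[OF Wop_sop x]])
  moreover have "Wh x (Wh x v) = nab (Wh x v) E x"
    using Pi_Wh[OF x, of v] by (simp add: Wh_def)
  ultimately show ?thesis unfolding dop_Wop[OF x Dp_Pi[OF x]] Ah_def by (simp add: Wh_def)
qed

text \<open>The derivative of the self-adjoint field \<open>Ah\<close> along \<open>E\<close> is
  self-adjoint. By \<open>dop_Ah\<close> it is \<open>\<Lambda> Wh - Ah Wh\<close>, so the product
  \<open>Ah Wh\<close> of two self-adjoint operators is self-adjoint.\<close>

lemma Ah_Wh_commute:
  assumes x: "x \<in> W" shows "Ah x (Wh x v) = Wh x (Ah x v)"
proof (rule inner_form.h_ext[OF inner_ip[OF x]])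
  interpret i: inner_form "ip x" by (rule inner_ip[OF x])
  fix w
  have "ip x (dop (E x) Ah x v) w = ip x v (dop (E x) Ah x w)"
    by (rule dop_self_adjoint[OF Ah_sop Ah_self_adjoint x])
  then have "ip x (Ah x (Wh x v)) w = ip x v (Ah x (Wh x w))"
    unfolding dop_Ah[OF x] using Wh_self_adjoint[OF x, of v w] by simp
  then show "ip x (Ah x (Wh x v)) w = ip x (Wh x (Ah x v)) w"
    using Wh_self_adjoint[OF x, of "Ah x v" w] Ah_self_adjoint[OF x, of v "Wh x w"] by simp
qed

text \<open>Of the trace \<open>- 2 * \<Lambda>\<close> of \<open>B\<close> the direction
  \<open>E\<close> carries \<open>\<Lambda>\<close>. Since \<open>B\<close> exchanges
  \<open>xi\<close> and \<open>V\<close>, these add 0 to the trace and 2 to the trace of the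
  square.\<close>

lemma traces:
  assumes x: "x \<in> W"
  shows "trc (Ah x) = - 3 * \<Lambda> x" "trc (\<lambda>v. B x (B x v)) = (\<Lambda> x)\<^sup>2 + 2 + trc (\<lambda>v. Ah x (Ah x v))"
    "trc (\<lambda>X. nab X E x) = trc (Wh x)"
proof -
  interpret i: inner_form "ip x" by (rule inner_ip[OF x])
  note fr = frame_simps[OF x] and lB = sop_linear[OF B_sop x]
  have "trc (B x) = - 2 * \<Lambda> x" using m_pos by (simp add: \<Lambda>_def f_def)
  then show "trc (Ah x) = - 3 * \<Lambda> x"
    using trc_Pi[OF x lB] fr B_frame[OF x] by (simp add: Ah_def[abs_def])
  have l2: "linear (\<lambda>v. B x (B x v))" using linear_compose[OF lB lB] by (simp add: o_def)
  have "(\<lambda>v. Ah x (Ah x v)) = (\<lambda>v. B x (B x (Pi x v)))"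
    using Pi_Ah[OF x] by (simp add: Ah_def)
  then show "trc (\<lambda>v. B x (B x v)) = (\<Lambda> x)\<^sup>2 + 2 + trc (\<lambda>v. Ah x (Ah x v))"
    using trc_Pi[OF x l2] fr B_frame[OF x] by (simp add: linear_cmul[OF lB] linear_0[OF lB] power2_eq_square)
  show "trc (\<lambda>X. nab X E x) = trc (Wh x)"
    using trc_Pi[OF x sop_linear[OF Wop_sop x]] fr nab_frame_E0[OF x] nab_E_E[OF x] by (simp add: Wh_def[abs_def])
qed

text \<open>At \<open>c = - 3\<close> one has \<open>k2 = - 2\<close>, \<open>kk = - (m + 1)\<close>
  and \<open>Ctot = m\<close>, so the sum is \<open>(1 + kk) * (2 + kk) + m\<close>. The 2 is the
  contribution of \<open>xi\<close> and \<open>V\<close> to the square of \<open>B\<close>.\<close>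

lemma constant_value: "2 + 3 * kk + kk\<^sup>2 + Ctot = (real m)\<^sup>2"
proof -
  have k: "k2 = - 2" unfolding k2_def ricci_k2_def unfolding c_m3 by (simp add: algebra_simps)
  have kk: "kk = - real m - 1" using k2_pos(3) unfolding k by simp
  show ?thesis unfolding Ctot_def kk k unfolding c_m3 using m_pos by (simp add: power2_eq_square field_simps)
qed

text \<open>As \<open>Gf = rho * E\<close> and \<open>E \<Lambda> = m * rho\<close>, the left side
  is \<open>m\<close> times the divergence of \<open>Gf\<close>.\<close>

lemma normal_equation:
  assumes x: "x \<in> W"
  shows "dr (E x) (\<lambda>y. dr (E y) \<Lambda> y) x + trc (Wh x) * dr (E x) \<Lambda> x
    = \<Lambda> x * (\<Lambda> x * \<Lambda> x + trc (\<lambda>v. Ah x (Ah x v)) + (real m)\<^sup>2)"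
proof -
  interpret i: inner_form "ip x" by (rule inner_ip[OF x])
  have dL: "dr (E y) \<Lambda> y = real m * rho y" if "y \<in> W" for y
    using dr_Lam[OF that E_simps(2)[OF that]] E_simps(1)[OF that] by simp
  have "nab X Gf x = dr X rho x *\<^sub>R E x + rho x *\<^sub>R nab X E x" for X
    using nab_cong[OF Gf_E x, where X=X] nab_scale[OF rho_smooth E_smooth x, of X] by simp
  then have "trc (\<lambda>X. nab X Gf x) = dr (E x) rho x + rho x * trc (Wh x)"
    using trc_rank1[OF dr_linear[OF rho_smooth x]] traces(3)[OF x] by (simp add: trc_add trc_scale)
  then have 1: "dr (E x) rho x + rho x * trc (Wh x) = f x * ((\<Lambda> x)\<^sup>2 + trc (\<lambda>v. Ah x (Ah x v)) + (real m)\<^sup>2)"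
  proof -
    have "trc (\<lambda>v. B x (B x v)) + 3 * kk + kk\<^sup>2 + Ctot = (\<Lambda> x)\<^sup>2 + trc (\<lambda>v. Ah x (Ah x v)) + (real m)\<^sup>2"
      using traces(2)[OF x] constant_value by simp
    then show ?thesis using bih_eqs(2)[OF x] \<open>trc (\<lambda>X. nab X Gf x) = _\<close> by simp
  qed
  have "dr (E x) (\<lambda>y. dr (E y) \<Lambda> y) x = real m * dr (E x) rho x"
    using dr_cong[OF dL x, where X="E x"] dr_cmult[OF rho_smooth x] by simp
  then have "dr (E x) (\<lambda>y. dr (E y) \<Lambda> y) x + trc (Wh x) * dr (E x) \<Lambda> x = real m * (dr (E x) rho x + rho x * trc (Wh x))"
    unfolding dL[OF x] by (simp add: algebra_simps)
  then show ?thesis unfolding 1 by (simp add: \<Lambda>_def power2_eq_square)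
qed

text \<open>Mixed moments of the eigenvalue pairs. They are smooth across changes of multiplicity
  and closed under the derivation along \<open>E\<close>; diagonalisation is used pointwise
  only.\<close>

definition M where "M k l x = trc (\<lambda>v. (Wh x ^^ k) ((Ah x ^^ l) v))"

lemma sop_funpow: "sop A \<Longrightarrow> sop (\<lambda>x. A x ^^ k)"
proof (induction k)
  case 0 then show ?case using sop_id by (simp add: id_def)
next
  case (Suc k) show ?case using sop_compose[OF Suc.prems Suc.IH[OF Suc.prems]] by (simp add: o_def)
qed

lemma WA_sop: "sop (\<lambda>x v. (Wh x ^^ k) ((Ah x ^^ l) v))"
  by (rule sop_compose[OF sop_funpow[OF Wh_sop] sop_funpow[OF Ah_sop]])

lemma M_smooth: "smooth_on W (M k l)"
  unfolding M_def[abs_def] by (rule trc_smooth[OF WA_sop])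

lemma diagonal:
  assumes x: "x \<in> W"
  obtains T \<alpha> \<beta> where "inner_form.onb (ip x) T" "\<And>u. u \<in> T \<Longrightarrow> Ah x u = \<alpha> u *\<^sub>R u" "\<And>u. u \<in> T \<Longrightarrow> Wh x u = \<beta> u *\<^sub>R u"
proof -
  interpret i: inner_form "ip x" by (rule inner_ip[OF x])
  have "\<exists>T \<alpha> \<beta>. i.onb T \<and> (\<forall>u\<in>T. Ah x u = \<alpha> u *\<^sub>R u \<and> Wh x u = \<beta> u *\<^sub>R u)"
    by (rule i.simultaneous_diagonalization[OF sop_linear[OF Ah_sop x] Ah_self_adjoint[OF x]
      sop_linear[OF Wh_sop x] Wh_self_adjoint[OF x] Ah_Wh_commute[OF x]])
  then show ?thesis using that by (elim exE conjE) metis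
qed

context
  fixes x T \<alpha> \<beta>
  assumes x: "x \<in> W" and T: "inner_form.onb (ip x) T"
    and A: "\<And>u. u \<in> T \<Longrightarrow> Ah x u = \<alpha> u *\<^sub>R u" and Wd: "\<And>u. u \<in> T \<Longrightarrow> Wh x u = \<beta> u *\<^sub>R u"
begin

interpretation i: inner_form "ip x" by (rule inner_ip[OF x])

lemma pow_A: "u \<in> T \<Longrightarrow> (Ah x ^^ l) u = \<alpha> u ^ l *\<^sub>R u"
  by (induction l) (simp_all add: A linear_cmul[OF sop_linear[OF Ah_sop x]])

lemma pow_W: "u \<in> T \<Longrightarrow> (Wh x ^^ l) u = \<beta> u ^ l *\<^sub>R u"
  by (induction l) (simp_all add: Wd linear_cmul[OF sop_linear[OF Wh_sop x]])

lemma dop_pow_A: "u \<in> T \<Longrightarrow> dop (E x) (\<lambda>x. Ah x ^^ l) x u = (real l * \<alpha> u ^ (l - 1) * (\<Lambda> x - \<alpha> u) * \<beta> u) *\<^sub>R u"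
proof (induction l)
  case 0 then show ?case using dop_id[of "E x" x u] by (simp add: id_def)
next
  case (Suc l)
  have "dop (E x) (\<lambda>x. Ah x ^^ Suc l) x u = dop (E x) Ah x ((Ah x ^^ l) u) + Ah x (dop (E x) (\<lambda>x. Ah x ^^ l) x u)"
    using dop_compose[OF Ah_sop sop_funpow[OF Ah_sop] x] by (simp add: o_def)
  also have "\<dots> = (\<alpha> u ^ l * (\<Lambda> x - \<alpha> u) * \<beta> u + real l * \<alpha> u ^ (l - 1) * (\<Lambda> x - \<alpha> u) * \<beta> u * \<alpha> u) *\<^sub>R u"
    unfolding Suc.IH[OF Suc.prems] pow_A[OF Suc.prems] linear_cmul[OF dop_linear[OF Ah_sop x]] dop_Ah[OF x]
    by (simp add: Wd[OF Suc.prems] A[OF Suc.prems] linear_cmul[OF sop_linear[OF Ah_sop x]] linear_diff[OF sop_linear[OF Ah_sop x]] algebra_simps)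
  also have "\<alpha> u ^ l * (\<Lambda> x - \<alpha> u) * \<beta> u + real l * \<alpha> u ^ (l - 1) * (\<Lambda> x - \<alpha> u) * \<beta> u * \<alpha> u
    = real (Suc l) * \<alpha> u ^ (Suc l - 1) * (\<Lambda> x - \<alpha> u) * \<beta> u"
    by (cases l) (simp_all add: algebra_simps)
  finally show ?case .
qed

lemma dop_pow_W: "u \<in> T \<Longrightarrow> dop (E x) (\<lambda>x. Wh x ^^ k) x u = (- real k * \<beta> u ^ (k - 1) * (\<Lambda> x * \<alpha> u + \<beta> u * \<beta> u)) *\<^sub>R u"
proof (induction k)
  case 0 then show ?case using dop_id[of "E x" x u] by (simp add: id_def)
next
  case (Suc k)
  have "dop (E x) (\<lambda>x. Wh x ^^ Suc k) x u = dop (E x) Wh x ((Wh x ^^ k) u) + Wh x (dop (E x) (\<lambda>x. Wh x ^^ k) x u)"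
    using dop_compose[OF Wh_sop sop_funpow[OF Wh_sop] x] by (simp add: o_def)
  also have "\<dots> = (- (\<beta> u ^ k * (\<Lambda> x * \<alpha> u + \<beta> u * \<beta> u)) - real k * \<beta> u ^ (k - 1) * (\<Lambda> x * \<alpha> u + \<beta> u * \<beta> u) * \<beta> u) *\<^sub>R u"
    unfolding Suc.IH[OF Suc.prems] pow_W[OF Suc.prems] linear_cmul[OF dop_linear[OF Wh_sop x]] dop_Wh[OF x]
    by (simp add: Wd[OF Suc.prems] A[OF Suc.prems] linear_cmul[OF sop_linear[OF Wh_sop x]] linear_diff[OF sop_linear[OF Wh_sop x]]
      linear_neg[OF sop_linear[OF Wh_sop x]] algebra_simps)
  also have "- (\<beta> u ^ k * (\<Lambda> x * \<alpha> u + \<beta> u * \<beta> u)) - real k * \<beta> u ^ (k - 1) * (\<Lambda> x * \<alpha> u + \<beta> u * \<beta> u) * \<beta> u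
    = - real (Suc k) * \<beta> u ^ (Suc k - 1) * (\<Lambda> x * \<alpha> u + \<beta> u * \<beta> u)"
    by (cases k) (simp_all add: algebra_simps)
  finally show ?case .
qed

lemma M_diagonal: "M k l x = (\<Sum>u\<in>T. \<beta> u ^ k * \<alpha> u ^ l)"
proof -
  have "M k l x = (\<Sum>u\<in>T. ip x ((Wh x ^^ k) ((Ah x ^^ l) u)) u)"
    unfolding M_def by (rule i.trc_onb[OF sop_linear[OF WA_sop x] T])
  also have "\<dots> = (\<Sum>u\<in>T. \<beta> u ^ k * \<alpha> u ^ l)"
  proof (rule sum.cong[OF refl])
    fix u assume u: "u \<in> T"
    have "ip x u u = 1" using i.orthD[of T u u] T u by (simp add: i.onb_def)
    then show "ip x ((Wh x ^^ k) ((Ah x ^^ l) u)) u = \<beta> u ^ k * \<alpha> u ^ l"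
      by (simp add: pow_A[OF u] pow_W[OF u] linear_cmul[OF sop_linear[OF sop_funpow[OF Wh_sop] x]])
  qed
  finally show ?thesis .
qed

lemma dr_M_diagonal: "dr (E x) (M k l) x = (\<Sum>u\<in>T.
    (- real k * \<beta> u ^ (k - 1) * (\<Lambda> x * \<alpha> u + \<beta> u * \<beta> u)) * \<alpha> u ^ l
    + \<beta> u ^ k * (real l * \<alpha> u ^ (l - 1) * (\<Lambda> x - \<alpha> u) * \<beta> u))"
proof -
  have "dr (E x) (M k l) x = trc (dop (E x) (\<lambda>x v. (Wh x ^^ k) ((Ah x ^^ l) v)) x)"
    unfolding M_def[abs_def] by (rule dr_trc[OF WA_sop x])
  also have "\<dots> = (\<Sum>u\<in>T. ip x (dop (E x) (\<lambda>x v. (Wh x ^^ k) ((Ah x ^^ l) v)) x u) u)"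
    by (rule i.trc_onb[OF dop_linear[OF WA_sop x] T])
  also have "\<dots> = (\<Sum>u\<in>T. (- real k * \<beta> u ^ (k - 1) * (\<Lambda> x * \<alpha> u + \<beta> u * \<beta> u)) * \<alpha> u ^ l
    + \<beta> u ^ k * (real l * \<alpha> u ^ (l - 1) * (\<Lambda> x - \<alpha> u) * \<beta> u))"
  proof (rule sum.cong[OF refl])
    fix u assume u: "u \<in> T"
    have "ip x u u = 1" using i.orthD[of T u u] T u by (simp add: i.onb_def)
    then show "ip x (dop (E x) (\<lambda>x v. (Wh x ^^ k) ((Ah x ^^ l) v)) x u) u
      = (- real k * \<beta> u ^ (k - 1) * (\<Lambda> x * \<alpha> u + \<beta> u * \<beta> u)) * \<alpha> u ^ l
        + \<beta> u ^ k * (real l * \<alpha> u ^ (l - 1) * (\<Lambda> x - \<alpha> u) * \<beta> u)"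
      unfolding dop_compose[OF sop_funpow[OF Wh_sop] sop_funpow[OF Ah_sop] x] dop_pow_A[OF u] pow_A[OF u]
        linear_cmul[OF dop_linear[OF sop_funpow[OF Wh_sop] x]] dop_pow_W[OF u]
        linear_cmul[OF sop_linear[OF sop_funpow[OF Wh_sop] x]] pow_W[OF u]
      by (simp add: algebra_simps)
  qed
  finally show ?thesis .
qed

end

text \<open>Stated over commutative rings to serve both the numbers at a point and the power series.
  The truncated exponents at \<open>k = 0\<close> or \<open>l = 0\<close> are harmless because their
  coefficients vanish.\<close>

lemma moment_term:
  fixes a b L :: "'z::comm_ring_1"
  shows "(- of_nat k * b ^ (k - 1) * (L * a + b * b)) * a ^ l + b ^ k * (of_nat l * a ^ (l - 1) * (L - a) * b)
    = - (of_nat (k + l) * (b ^ Suc k * a ^ l)) + L * (of_nat l * (b ^ Suc k * a ^ (l - 1)) - of_nat k * (b ^ (k - 1) * a ^ Suc l))"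
  by (cases k; cases l) (simp_all add: algebra_simps)

lemma dr_M:
  assumes x: "x \<in> W"
  shows "dr (E x) (M k l) x = - (real (k + l) * M (Suc k) l x)
    + \<Lambda> x * (real l * M (Suc k) (l - 1) x - real k * M (k - 1) (Suc l) x)"
proof -
  obtain T \<alpha> \<beta> where d: "inner_form.onb (ip x) T" "\<And>u. u \<in> T \<Longrightarrow> Ah x u = \<alpha> u *\<^sub>R u" "\<And>u. u \<in> T \<Longrightarrow> Wh x u = \<beta> u *\<^sub>R u"
    using diagonal[OF x] by blast
  have 1: "M i j x = (\<Sum>u\<in>T. \<beta> u ^ i * \<alpha> u ^ j)" for i j
    by (rule M_diagonal[OF x d])
  have 2: "dr (E x) (M k l) x = (\<Sum>u\<in>T.
    (- real k * \<beta> u ^ (k - 1) * (\<Lambda> x * \<alpha> u + \<beta> u * \<beta> u)) * \<alpha> u ^ l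
    + \<beta> u ^ k * (real l * \<alpha> u ^ (l - 1) * (\<Lambda> x - \<alpha> u) * \<beta> u))"
    by (rule dr_M_diagonal[OF x d])
  show ?thesis
    unfolding 1 2 moment_term
    by (simp only: sum.distrib sum_negf sum_distrib_left[symmetric] sum_subtractf)
qed

lemma M_low: "x \<in> W \<Longrightarrow> \<Lambda> x = - M 0 1 x / 3" "M 1 0 x = trc (Wh x)" "M 0 2 x = trc (\<lambda>v. Ah x (Ah x v))"
  using traces(1)[of x] by (simp_all add: M_def numeral_2_eq_2)

end

text \<open>The hierarchy is infinite, but coefficient \<open>n + 1\<close> of any moment involves
  coefficients up to \<open>n\<close> only; induction on \<open>n\<close> treats all moments
  together. Moments with \<open>k + l > 0\<close> are closed under the recursion, and the zeroth one
  merely counts eigenvalues, so it is left out.\<close>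

lemma moment_unique:
  fixes T F :: "nat \<Rightarrow> nat \<Rightarrow> real fps"
  assumes T: "\<And>k l. k + l > 0 \<Longrightarrow> fps_deriv (T k l) = - (of_nat (k + l) * T (Suc k) l)
      + (fps_const (- 1 / 3) * T 0 1) * (of_nat l * T (Suc k) (l - 1) - of_nat k * T (k - 1) (Suc l))"
    and F: "\<And>k l. k + l > 0 \<Longrightarrow> fps_deriv (F k l) = - (of_nat (k + l) * F (Suc k) l)
      + (fps_const (- 1 / 3) * F 0 1) * (of_nat l * F (Suc k) (l - 1) - of_nat k * F (k - 1) (Suc l))"
    and 0: "\<And>k l. k + l > 0 \<Longrightarrow> fps_nth (T k l) 0 = fps_nth (F k l) 0"
    and kl: "k + l > 0"
  shows "T k l = F k l"
proof -
  have "\<forall>k l. k + l > 0 \<longrightarrow> fps_nth (T k l) n = fps_nth (F k l) n" for n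
  proof (induction n rule: less_induct)
    case (less n)
    show ?case
    proof (cases n)
      case 0 then show ?thesis using assms(3) by simp
    next
      case (Suc j)
      have IH: "fps_nth (T k l) i = fps_nth (F k l) i" if "i \<le> j" "k + l > 0" for i k l
        using less.IH[of i] that Suc by auto
      show ?thesis
      proof (intro allI impI)
        fix k l :: nat assume kl: "k + l > 0"
        have "fps_nth (of_nat l * T (Suc k) (l - 1) - of_nat k * T (k - 1) (Suc l)) i
          = fps_nth (of_nat l * F (Suc k) (l - 1) - of_nat k * F (k - 1) (Suc l)) i" if "i \<le> j" for i
          using IH[OF that, of "Suc k" "l - 1"] IH[OF that, of "k - 1" "Suc l"] by (simp flip: fps_of_nat)
        moreover have "fps_nth (fps_const (- 1 / 3) * T 0 1) i = fps_nth (fps_const (- 1 / 3) * F 0 1) i" if "i \<le> j" for i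
          using IH[OF that, of 0 1] by simp
        moreover have "fps_nth (of_nat (k + l) * T (Suc k) l) j = fps_nth (of_nat (k + l) * F (Suc k) l) j"
          using IH[of j "Suc k" l] by (simp flip: fps_of_nat)
        ultimately have "fps_nth (fps_deriv (T k l)) j = fps_nth (fps_deriv (F k l)) j"
          unfolding T[OF kl] F[OF kl] fps_add_nth fps_neg_nth fps_mult_nth[of "fps_const (- 1 / 3) * _"] by simp
        then show "fps_nth (T k l) n = fps_nth (F k l) n" by (simp add: Suc)
      qed
    qed
  qed
  then show ?thesis using kl by (auto intro: fps_ext)
qed

context crit3
begin

theorem contradiction: False
proof -
  obtain x0 where x0: "x0 \<in> W" using W_ne by auto
  define e where "e = (\<lambda>x. tau x (E x))"
  interpret t: taylor W e x0
    by unfold_locales (auto simp: e_def oW x0 intro: tau_smooth E_smooth)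
  have dir: "dirD e F x = dr (E x) F x" for F x by (simp add: dirD_def dr_def e_def)
  obtain T \<alpha> \<beta> where d: "inner_form.onb (ip x0) T" "\<And>u. u \<in> T \<Longrightarrow> Ah x0 u = \<alpha> u *\<^sub>R u" "\<And>u. u \<in> T \<Longrightarrow> Wh x0 u = \<beta> u *\<^sub>R u"
    using diagonal[OF x0] by blast
  interpret i: inner_form "ip x0" by (rule inner_ip[OF x0])
  have finT: "finite T" using d(1) i.orth_finite by (auto simp: i.onb_def)
  \<comment> \<open>Pairs \<open>(0, 0)\<close>, among them those of the frame directions, cannot be
    normalised to a unit vector. They contribute nothing to moments with \<open>k + l > 0\<close>
    and are dropped.\<close>
  define I where "I = {u \<in> T. \<alpha> u \<noteq> 0 \<or> \<beta> u \<noteq> 0}"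
  have finI: "finite I" using finT by (simp add: I_def)
  define a where "a j u = (if j = (0::nat) then \<alpha> u else \<beta> u)" for j u
  define Nn where "Nn = sol I a 0"
  define Om where "Om = sol I a 1"
  define L where "L = lam I Nn"
  have N: "fps_deriv (Nn u) = (L - Nn u) * Om u" and O: "fps_deriv (Om u) = - (Om u * Om u) - L * Nn u" for u
    unfolding L_def Nn_def Om_def by (rule sol_deriv)+
  define F where "F k l = (\<Sum>u\<in>I. Om u ^ k * Nn u ^ l)" for k l
  have LF: "L = fps_const (- 1 / 3) * F 0 1" by (simp add: L_def lam_def F_def)
  have dF: "fps_deriv (F k l) = - (of_nat (k + l) * F (Suc k) l)
      + (fps_const (- 1 / 3) * F 0 1) * (of_nat l * F (Suc k) (l - 1) - of_nat k * F (k - 1) (Suc l))" for k l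
  proof -
    have "fps_deriv (Om u ^ k * Nn u ^ l) = (- of_nat k * Om u ^ (k - 1) * (L * Nn u + Om u * Om u)) * Nn u ^ l
      + Om u ^ k * (of_nat l * Nn u ^ (l - 1) * (L - Nn u) * Om u)" for u
      by (simp add: fps_deriv_power N O fps_of_nat algebra_simps)
    then show ?thesis
      unfolding LF[symmetric] by (simp only: F_def fps_deriv_sum moment_term sum.distrib sum_negf sum_distrib_left[symmetric] sum_subtractf)
  qed
  define G where "G k l = tay e x0 (M k l)" for k l
  have sL: "smooth_on W (\<lambda>x. r * M k l x)" for r k l by (intro smooth_on_mult smooth_on_const M_smooth oW)
  have LG: "tay e x0 \<Lambda> = fps_const (- 1 / 3) * G 0 1"
  proof -
    have "tay e x0 \<Lambda> = tay e x0 (\<lambda>x. (- 1 / 3) * M 0 1 x)"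
      by (rule t.tay_cong) (use M_low(1) in simp)
    then show ?thesis unfolding G_def t.tay_cmult[OF M_smooth] .
  qed
  have dG: "fps_deriv (G k l) = - (of_nat (k + l) * G (Suc k) l)
      + (fps_const (- 1 / 3) * G 0 1) * (of_nat l * G (Suc k) (l - 1) - of_nat k * G (k - 1) (Suc l))" for k l
  proof -
    define H where "H x = real l * M (Suc k) (l - 1) x + - real k * M (k - 1) (Suc l) x" for x
    have sH: "smooth_on W H" unfolding H_def by (intro smooth_on_add sL oW)
    have "fps_deriv (G k l) = tay e x0 (dirD e (M k l))" unfolding G_def by (rule t.tay_deriv)
    also have "\<dots> = tay e x0 (\<lambda>x. - real (k + l) * M (Suc k) l x + \<Lambda> x * H x)"
      by (rule t.tay_cong) (simp add: dir dr_M H_def algebra_simps)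
    also have "\<dots> = tay e x0 (\<lambda>x. - real (k + l) * M (Suc k) l x) + tay e x0 \<Lambda> * tay e x0 H"
      unfolding t.tay_add[OF sL smooth_on_mult[OF oW Lam_smooth sH]] t.tay_mult[OF Lam_smooth sH] ..
    also have "tay e x0 H = fps_const (real l) * G (Suc k) (l - 1) + fps_const (- real k) * G (k - 1) (Suc l)"
      unfolding H_def t.tay_add[OF sL sL] t.tay_cmult[OF M_smooth] G_def ..
    also have "tay e x0 (\<lambda>x. - real (k + l) * M (Suc k) l x) = fps_const (- real (k + l)) * G (Suc k) l"
      unfolding t.tay_cmult[OF M_smooth] G_def ..
    finally show ?thesis unfolding LG
      by (simp only: fps_const_neg[symmetric] fps_of_nat mult_minus_left add_uminus_conv_diff)
  qed
  have G0: "fps_nth (G k l) 0 = fps_nth (F k l) 0" if "k + l > 0" for k l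
  proof -
    have "fps_nth (G k l) 0 = (\<Sum>u\<in>T. \<beta> u ^ k * \<alpha> u ^ l)"
      unfolding G_def t.tay_0 by (rule M_diagonal[OF x0 d])
    also have "\<dots> = (\<Sum>u\<in>I. \<beta> u ^ k * \<alpha> u ^ l)"
      by (rule sum.mono_neutral_right[OF finT]) (use that in \<open>auto simp: I_def zero_power\<close>)
    also have "\<dots> = fps_nth (F k l) 0"
      by (simp add: F_def fps_sum_nth Om_def Nn_def sol_0 a_def fps_nth_power_0)
    finally show ?thesis .
  qed
  have GF: "G k l = F k l" if "k + l > 0" for k l
    by (rule moment_unique[OF dG dF G0 that])
  have tL: "tay e x0 \<Lambda> = L" unfolding LG LF using GF[of 0 1] by simp
  have dL: "smooth_on W (dirD e \<Lambda>)" by (rule t.dirD_smooth[OF Lam_smooth])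
  have ddL: "smooth_on W (dirD e (dirD e \<Lambda>))" by (rule t.dirD_smooth[OF dL])
  show False
  proof (rule no_planar_series[OF finI _ N O L_def])
    show "(real m)\<^sup>2 \<ge> 0" by simp
    have dL': "fps_deriv L = tay e x0 (dirD e \<Lambda>)" unfolding tL[symmetric] by (rule t.tay_deriv)
    have LL: "smooth_on W (\<lambda>x. \<Lambda> x * \<Lambda> x)" by (intro smooth_on_mult Lam_smooth oW)
    have LM: "smooth_on W (\<lambda>x. \<Lambda> x * \<Lambda> x + M 0 2 x)" by (intro smooth_on_add LL M_smooth oW)
    have LK: "smooth_on W (\<lambda>x. \<Lambda> x * \<Lambda> x + M 0 2 x + (real m)\<^sup>2)" by (intro smooth_on_add LM smooth_on_const oW)
    have MD: "smooth_on W (\<lambda>x. M 1 0 x * dirD e \<Lambda> x)" by (intro smooth_on_mult M_smooth dL oW)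
    have "tay e x0 (\<lambda>x. dirD e (dirD e \<Lambda>) x + M 1 0 x * dirD e \<Lambda> x) = tay e x0 (\<lambda>x. \<Lambda> x * (\<Lambda> x * \<Lambda> x + M 0 2 x + (real m)\<^sup>2))"
    proof (rule t.tay_cong)
      fix x assume x: "x \<in> W"
      have "dirD e (dirD e \<Lambda>) x = dr (E x) (\<lambda>y. dr (E y) \<Lambda> y) x" unfolding dir by (simp add: dir[abs_def])
      then show "dirD e (dirD e \<Lambda>) x + M 1 0 x * dirD e \<Lambda> x = \<Lambda> x * (\<Lambda> x * \<Lambda> x + M 0 2 x + (real m)\<^sup>2)"
        using normal_equation[OF x] unfolding M_low(2,3) by (simp add: dir)
    qed
    then have "fps_deriv (fps_deriv L) + G 1 0 * fps_deriv L = L * (L * L + G 0 2 + fps_const ((real m)\<^sup>2))"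
      unfolding t.tay_add[OF ddL MD] t.tay_mult[OF M_smooth dL] t.tay_mult[OF Lam_smooth LK] t.tay_add[OF LM smooth_on_const]
        t.tay_add[OF LL M_smooth] t.tay_mult[OF Lam_smooth Lam_smooth] t.tay_const t.tay_deriv[symmetric] tL G_def .
    then show "fps_deriv (fps_deriv L) + (\<Sum>u\<in>I. Om u) * fps_deriv L = L * (L * L + (\<Sum>u\<in>I. Nn u * Nn u) + fps_const ((real m)\<^sup>2))"
      using GF[of 1 0] GF[of 0 2] by (simp add: F_def power2_eq_square)
    show "fps_nth (Nn u) 0 \<noteq> 0 \<or> fps_nth (Om u) 0 \<noteq> 0" if "u \<in> I" for u
      using that by (simp add: Nn_def Om_def sol_0 a_def I_def)
    show "fps_nth L 0 > 0" unfolding tL[symmetric] t.tay_0 by (rule Lam_pos[OF x0])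
    show "fps_nth (fps_deriv L) 0 > 0"
      unfolding dL' t.tay_0 dir using dr_Lam[OF x0 E_simps(2)[OF x0]] E_simps(1)[OF x0] rho_pos[OF x0] m_pos by simp
  qed
qed

end

section \<open>Nonexistence\<close>

lemma (in along_metric) subset: "open W' \<Longrightarrow> W' \<subseteq> W \<Longrightarrow> along_metric U g W' P"
  using along_metric_intro[OF oU g _ smooth_on_subset[OF P]] PU by blast

lemma (in imm) subset: "open W' \<Longrightarrow> W' \<subseteq> W \<Longrightarrow> imm U g W' P"
  by (intro imm.intro imm_axioms.intro along_metric.subset[OF along_metric_axioms]) (auto intro: injP)

text \<open>The normal part of a constant vector that is not tangent at \<open>x0\<close>,
  normalised where it does not vanish.\<close>

lemma (in imm) exists_local_normal:
  assumes dim: "DIM('f) < DIM('e)" and x0: "x0 \<in> W"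
  obtains W0 N where "open W0" "x0 \<in> W0" "W0 \<subseteq> W" "smooth_on W0 N"
    "\<And>x. x \<in> W0 \<Longrightarrow> ip x (N x) (N x) = 1" "\<And>x u. x \<in> W0 \<Longrightarrow> ip x (N x) (FD P x u) = 0"
proof -
  have "dim (range (FD P x0)) \<le> DIM('f)"
    using dim_image_le[OF dP_linear[OF x0], of UNIV] by simp
  then have "range (FD P x0) \<noteq> UNIV" using dim by auto
  then obtain v where v: "v \<notin> range (FD P x0)" by blast
  define Z where "Z x = v - FD P x (tau x v)" for x
  define q where "q x = ip x (Z x) (Z x)" for x
  have Z: "smooth_on W Z" unfolding Z_def[abs_def]
    by (intro smooth_on_diff smooth_on_const dP_smooth tau_smooth_const oW)
  have q: "smooth_on W q" unfolding q_def[abs_def] by (intro ip_smooth Z)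
  define W0 where "W0 = {x \<in> W. q x \<noteq> 0}"
  have W0: "open W0" "W0 \<subseteq> W"
    unfolding W0_def using open_nonzero[OF oW smooth_on_continuous[OF q]] by auto
  have qpos: "q x > 0" if "x \<in> W0" for x
    using that inner_form.h_nonneg[OF inner_ip, of x "Z x"] by (auto simp: W0_def q_def order.strict_iff_order)
  define N where "N x = inverse (sqrt (q x)) *\<^sub>R Z x" for x
  have "q x0 \<noteq> 0"
    using v inner_form.h_eq_0[OF inner_ip[OF x0], of "Z x0"] by (auto simp: q_def Z_def)
  then have "x0 \<in> W0" using x0 by (simp add: W0_def)
  moreover have "smooth_on W0 N"
    unfolding N_def[abs_def]
  proof (intro smooth_on_scaleR smooth_on_inverse smooth_on_sqrt W0(1) smooth_on_subset[OF q W0(2)] smooth_on_subset[OF Z W0(2)] qpos)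
    show "sqrt (q x) \<noteq> 0" if "x \<in> W0" for x using qpos[OF that] by simp
  qed
  moreover have "ip x (N x) (N x) = 1" if x: "x \<in> W0" for x
  proof -
    interpret i: inner_form "ip x" by (rule inner_ip) (use x W0 in auto)
    have "ip x (N x) (N x) = inverse (sqrt (q x)) * (inverse (sqrt (q x)) * q x)" by (simp add: N_def q_def)
    then show ?thesis using qpos[OF x] by (simp add: field_simps)
  qed
  moreover have "ip x (N x) (FD P x u) = 0" if x: "x \<in> W0" for x u
  proof -
    have xW: "x \<in> W" using x W0 by auto
    interpret i: inner_form "ip x" by (rule inner_ip[OF xW])
    show ?thesis using tau_pb[OF xW, of v u] by (simp add: N_def Z_def pb_ip)
  qed
  ultimately show ?thesis using that W0 by blast
qed

lemma (in hypk) subset: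
  assumes "open W'" "W' \<subseteq> W" shows "hypk U S W' P N m c"
proof -
  interpret i: imm U "cmet S" W' P
    by (rule imm.subset[OF imm_axioms assms])
  show ?thesis
    by unfold_locales (use S dime dimf N xi_range k2nz assms(2) smooth_on_subset in
      \<open>auto simp: unit_normal_on_def xi_tangent_def\<close>)
qed

lemma (in crit) subset:
  assumes "open W'" "W' \<subseteq> W" "W' \<noteq> {}" shows "crit U S W' P N m c"
proof -
  interpret h: hypk U S W' P N m c by (rule subset[OF assms(1,2)])
  show ?thesis by unfold_locales (use fpos Gf_nz bih hopf assms in auto)
qed

text \<open>The open set is shrunk to generic points and then to points where
  \<open>\<Lambda>\<close> is simple. The fields \<open>E\<close>, \<open>B\<close>,
  \<open>\<Lambda>\<close> do not refer to \<open>W\<close>, so they keep their meaning on smaller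
  sets.\<close>

theorem (in crit) contradiction: False
proof -
  define W1 where "W1 = {x \<in> W. (2 * \<Lambda> x - beta x) * qq x \<noteq> 0}"
  have "smooth_on W qq"
    unfolding qq_def[abs_def]
    by (intro smooth_on_diff smooth_on_mult smooth_on_const Lam_smooth beta_smooth oW)
  then have "smooth_on W (\<lambda>x. (2 * \<Lambda> x - beta x) * qq x)"
    by (intro smooth_on_diff smooth_on_mult smooth_on_const Lam_smooth beta_smooth oW)
  then have W1: "open W1" unfolding W1_def by (rule open_nonzero[OF oW smooth_on_continuous])
  have ne: "W1 \<noteq> {}" using exists_generic by (auto simp: W1_def)
  interpret c1: crit U S W1 P N m c by (rule subset[OF W1 _ ne]) (auto simp: W1_def)
  interpret c2: crit2 U S W1 P N m c by unfold_locales (auto simp: W1_def)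
  obtain W' where W': "open W'" "W' \<noteq> {}" "W' \<subseteq> W1"
    "\<And>x Y. x \<in> W' \<Longrightarrow> ip x Y (N x) = 0 \<Longrightarrow> ip x Y (E x) = 0 \<Longrightarrow> B x Y = \<Lambda> x *\<^sub>R Y \<Longrightarrow> Y = 0"
    using c2.exists_simple_open by metis
  interpret d1: crit U S W' P N m c by (rule c1.subset[OF W'(1,3,2)])
  interpret d2: crit2 U S W' P N m c by unfold_locales (use W'(3) c2.gen1 c2.gen2 in auto)
  interpret d3: crit3 U S W' P N m c by unfold_locales (use W'(4) in auto)
  show False by (rule d3.contradiction)
qed

section \<open>From the hypotheses in charts to positive mean curvature\<close>

context hypk
begin

lemma shape_op_eq:
  assumes x: "x \<in> W" shows "FD P x (shape_op S P N x u) = - B x (FD P x u)"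
proof -
  have 1: "- along (levi_civita (cmet S)) P (\<lambda>_. u) N x = - B x (FD P x u)"
    by (simp add: along_cd B_def nab_def tau_dP[OF x])
  have 2: "FD P x (tau x (- B x (FD P x u))) = - B x (FD P x u)"
    by (rule dP_tau_tangent[OF x]) (simp add: inner_form.h_minus[OF inner_ip[OF x]] B_tangent[OF x])
  have "\<exists>!w. FD P x w = - B x (FD P x u)"
    using 2 injD[OF injP[OF x]] by metis
  from theI'[OF this] show ?thesis unfolding shape_op_def 1 .
qed

lemma mean_curv_norm_eq: "x \<in> W \<Longrightarrow> mean_curv_norm S P x = \<bar>f x\<bar>"
  using NN[of x] inner_form.h_scale[OF inner_ip, of x] unfolding mean_curv_norm_def
  by (simp add: mean_curv_eq ip_def[symmetric])

text \<open>At a zero of \<open>f\<close> the norm of \<open>H\<close> has a minimum; being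
  differentiable there, it would have zero gradient.\<close>

lemma f_nonzero:
  assumes g: "grad_principal S W P" and x: "x \<in> W" shows "f x \<noteq> 0"
proof
  assume f0: "f x = 0"
  have d: "mean_curv_norm S P differentiable (at x)" and gn: "grad_mean_curv S P x \<noteq> 0"
    using g x by (auto simp: grad_principal_def)
  have "FD (mean_curv_norm S P) x = (\<lambda>v. 0)"
    by (rule differential_zero_maxmin[OF x oW FD_works[OF d]]) (use f0 mean_curv_norm_eq x in auto)
  then have "grad_mean_curv S P x = 0"
    unfolding grad_mean_curv_def
    using inner_form.sharp_eqI[OF inner_pb[OF x], of 0 "\<lambda>v. 0"] inner_form.h_zero[OF inner_pb[OF x]] by (simp add: pb_def)
  then show False using gn by simp
qed

lemma positive_contradiction:
  assumes pos: "\<And>x. x \<in> W \<Longrightarrow> f x > 0" and ne: "W \<noteq> {}"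
    and g: "grad_principal S W P" and b: "ricci_biharmonic S W P" and h: "pseudo_hopf S W P"
  shows False
proof -
  have "crit U S W P N m c"
  proof unfold_locales
    fix x assume x: "x \<in> W"
    show "f x > 0" by (rule pos[OF x])
    show "star_bitension S P x = 0" using b x by (simp add: ricci_biharmonic_def)
    have "FD (mean_curv_norm S P) x = FD f x"
      by (rule FD_cong_open[OF oW x]) (use mean_curv_norm_eq pos in force)
    moreover have "grad_mean_curv S P x \<noteq> 0" using g x by (auto simp: grad_principal_def)
    ultimately have "sharp (pb x) (FD f x) \<noteq> 0" by (simp add: grad_mean_curv_def pb_def)
    then show "Gf x \<noteq> 0"
      using injD[OF injP[OF x], of "sharp (pb x) (FD f x)" 0] linear_0[OF dP_linear[OF x]] by (auto simp: Gf_def)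
    have V: "FD P x (tau x (V x)) = V x" by (rule dP_tau_tangent[OF x V_simps(4)[OF x]])
    have "FD P x u \<in> span {xi x, V x} \<Longrightarrow> FD P x (shape_op S P N x u) \<in> span {xi x, V x}" for u
      using h oW N x unfolding pseudo_hopf_def Let_def xi_def V_def phi_def by blast
    from this[of "tau x (V x)"] have "- B x (V x) \<in> span {xi x, V x}"
      unfolding shape_op_eq[OF x] V by (simp add: span_base)
    then show "B x (V x) \<in> span {xi x, V x}" using span_neg by fastforce
  qed (rule ne)
  then show False by (rule crit.contradiction)
qed

end

lemma grad_principal_subset: "grad_principal S W P \<Longrightarrow> W' \<subseteq> W \<Longrightarrow> grad_principal S W' P"
  unfolding grad_principal_def by blast

lemma pseudo_hopf_subset: "pseudo_hopf S W P \<Longrightarrow> W' \<subseteq> W \<Longrightarrow> pseudo_hopf S W' P"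
  unfolding pseudo_hopf_def by blast

lemma ricci_biharmonic_subset: "ricci_biharmonic S W P \<Longrightarrow> W' \<subseteq> W \<Longrightarrow> ricci_biharmonic S W' P"
  unfolding ricci_biharmonic_def by blast

theorem no_local_hypersurface:
  fixes P :: "'f::euclidean_space \<Rightarrow> 'e::euclidean_space"
  assumes imm: "imm U (cmet S) W P" and S: "sasakian_space_form_on c U S"
    and dim: "DIM('e) = 2 * m + 1" "DIM('f) = 2 * m" and k: "ricci_k2 m c \<noteq> 0"
    and xi: "xi_tangent S W P" and b: "ricci_biharmonic S W P" and h: "pseudo_hopf S W P"
    and g: "grad_principal S W P" and x0: "x0 \<in> W"
  shows False
proof -
  interpret i: imm U "cmet S" W P by (rule imm)
  obtain W0 N where N: "open W0" "x0 \<in> W0" "W0 \<subseteq> W" "smooth_on W0 N"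
    "\<And>x. x \<in> W0 \<Longrightarrow> i.ip x (N x) (N x) = 1" "\<And>x u. x \<in> W0 \<Longrightarrow> i.ip x (N x) (FD P x u) = 0"
    using i.exists_local_normal[OF _ x0] dim by auto
  interpret j: imm U "cmet S" W0 P by (rule i.subset[OF N(1,3)])
  have xi0: "xi_tangent S W0 P" using xi N(3) by (auto simp: xi_tangent_def)
  interpret p: hypk U S W0 P N m c
    by unfold_locales (use S dim k xi0 N in \<open>auto simp: unit_normal_on_def i.ip_def\<close>)
  \<comment> \<open>The sign of \<open>f\<close> at \<open>x0\<close>. For the normal
    \<open>\<sigma> N\<close> the mean curvature is positive near \<open>x0\<close>, where it
    coincides with the norm of \<open>H\<close>.\<close>
  define \<sigma> where "\<sigma> = sgn (p.f x0)"
  have f0: "p.f x0 \<noteq> 0" by (rule p.f_nonzero[OF grad_principal_subset[OF g N(3)] N(2)])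
  have \<sigma>: "\<sigma> * \<sigma> = 1" "\<sigma> * p.f x0 > 0" using f0 by (auto simp: \<sigma>_def sgn_if mult_neg_neg)
  define N' where "N' x = \<sigma> *\<^sub>R N x" for x
  have UN: "unit_normal_on S P W0 N'"
    unfolding unit_normal_on_def
  proof (intro conjI ballI allI)
    show "smooth_on W0 N'" unfolding N'_def[abs_def] by (intro smooth_on_scaleR smooth_on_const N(1,4))
    fix x u assume x: "x \<in> W0"
    interpret ii: inner_form "i.ip x" by (rule j.inner_ip[OF x])
    have "i.ip x (N' x) (N' x) = \<sigma> * \<sigma> * i.ip x (N x) (N x)" by (simp add: N'_def)
    then show "cmet S (P x) (N' x) (N' x) = 1" using \<sigma>(1) N(5)[OF x] by (simp add: i.ip_def)
    have "i.ip x (N' x) (FD P x u) = 0" using N(6)[OF x] by (simp add: N'_def)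
    then show "cmet S (P x) (N' x) (FD P x u) = 0" by (simp add: i.ip_def)
  qed
  interpret q: hypk U S W0 P N' m c
    by unfold_locales (fact S dim UN xi0 k)+
  have fq: "q.f x = \<sigma> * p.f x" if x: "x \<in> W0" for x
  proof -
    have "q.f x *\<^sub>R N' x = p.f x *\<^sub>R N x"
      using q.mean_curv_eq[OF x] p.mean_curv_eq[OF x] by (rule trans[OF sym])
    then have "(q.f x * \<sigma>) *\<^sub>R N x = p.f x *\<^sub>R N x" unfolding N'_def scaleR_scaleR .
    moreover have "N x \<noteq> 0" using N(5)[OF x] inner_form.h_zero[OF j.inner_ip[OF x]] by auto
    ultimately have "q.f x * \<sigma> = p.f x" by (rule scaleR_right_imp_eq[rotated])
    then have "q.f x * (\<sigma> * \<sigma>) = \<sigma> * p.f x" by (simp add: mult_ac)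
    then show ?thesis using \<sigma>(1) by simp
  qed
  define W1 where "W1 = {x \<in> W0. q.f x > 0}"
  have "open (W0 \<inter> q.f -` {0<..})"
    by (rule continuous_open_preimage[OF smooth_on_continuous[OF q.f_smooth] N(1)]) simp
  moreover have "W0 \<inter> q.f -` {0<..} = W1" by (auto simp: W1_def)
  ultimately have W1: "open W1" "W1 \<subseteq> W0" by (auto simp: W1_def)
  interpret r: hypk U S W1 P N' m c by (rule q.subset[OF W1])
  have W1W: "W1 \<subseteq> W" using W1 N by auto
  show False
  proof (rule r.positive_contradiction)
    show "q.f x > 0" if "x \<in> W1" for x using that by (simp add: W1_def)
    show "W1 \<noteq> {}" using N(2) fq[OF N(2)] \<sigma>(2) by (auto simp: W1_def)
  qed (intro grad_principal_subset[OF g W1W] pseudo_hopf_subset[OF h W1W] ricci_biharmonic_subset[OF b W1W])+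
qed

lemma open_local_dom:
  assumes A: "smooth_atlas A" "c \<in> A" and B: "smooth_atlas Abar" "d \<in> Abar"
    and cont: "continuous_on (carrier_of A) \<psi>"
  shows "open (local_dom \<psi> c d)"
proof -
  have ch: "is_chart c" "is_chart d" using A B by (auto simp: smooth_atlas_def)
  have "continuous_on (chart_dom c) \<psi>"
    by (rule continuous_on_subset[OF cont]) (use A(2) in \<open>auto simp: carrier_of_def\<close>)
  then have "open (chart_dom c \<inter> \<psi> -` chart_dom d)"
    using ch by (intro continuous_open_preimage) (auto simp: is_chart_def)
  then have "openin (top_of_set (chart_dom c)) (chart_dom c \<inter> \<psi> -` chart_dom d)"
    by (auto intro: open_subset)
  then have "openin (top_of_set (chart_range c)) (local_dom \<psi> c d)"
    unfolding local_dom_def using ch(1) by (intro homeomorphism_imp_open_map) (auto simp: is_chart_def)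
  then show ?thesis using ch(1) openin_open_eq by (auto simp: is_chart_def)
qed

lemma local_rep_range:
  assumes "is_chart c" shows "local_rep \<psi> c d ` local_dom \<psi> c d \<subseteq> chart_range d"
proof -
  have "inj_on (chart_map c) (chart_dom c)"
    using assms unfolding is_chart_def homeomorphism_def by (intro inj_on_inverseI[of _ "chart_inv c"]) blast
  then show ?thesis by (auto simp: local_rep_def local_dom_def chart_inv_def)
qed

theorem theorem4p3:
  fixes m :: nat and c :: real
    and Abar :: "('a::{t2_space,second_countable_topology}, 'e::euclidean_space) chart set"
    and \<S> :: "('a, 'e) chart \<Rightarrow> 'e contact_metric"
  assumes "DIM('e) = 2 * m + 1" and "DIM('f::euclidean_space) = 2 * m"
    and "sasakian_space_form c Abar \<S>"
    and "ricci_k2 m c \<noteq> 0"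
  shows "\<not> (\<exists>(A :: ('b::{t2_space,second_countable_topology}, 'f) chart set) (\<psi> :: 'b \<Rightarrow> 'a).
      smooth_atlas A \<and> carrier_of A \<noteq> {} \<and> immersion A Abar \<psi>
    \<and> in_all_charts A Abar \<S> \<psi> xi_tangent
    \<and> in_all_charts A Abar \<S> \<psi> ricci_biharmonic
    \<and> in_all_charts A Abar \<S> \<psi> pseudo_hopf
    \<and> in_all_charts A Abar \<S> \<psi> grad_principal)"
proof (intro notI, elim exE conjE)
  fix A :: "('b, 'f) chart set" and \<psi> :: "'b \<Rightarrow> 'a"
  assume A: "smooth_atlas A" "carrier_of A \<noteq> {}" and im: "immersion A Abar \<psi>"
    and Q: "in_all_charts A Abar \<S> \<psi> xi_tangent" "in_all_charts A Abar \<S> \<psi> ricci_biharmonic"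
      "in_all_charts A Abar \<S> \<psi> pseudo_hopf" "in_all_charts A Abar \<S> \<psi> grad_principal"
  \<comment> \<open>One point and a pair of charts around it and its image suffice, since the
    contradiction is local.\<close>
  obtain b p where b: "b \<in> A" "p \<in> chart_dom b" using A(2) by (auto simp: carrier_of_def)
  then have "p \<in> carrier_of A" by (auto simp: carrier_of_def)
  then have "\<psi> p \<in> carrier_of Abar" using im by (auto simp: immersion_def)
  then obtain d where d: "d \<in> Abar" "\<psi> p \<in> chart_dom d" by (auto simp: carrier_of_def)
  have Abar: "smooth_atlas Abar" and Sd: "sasakian_space_form_on c (chart_range d) (\<S> d)"
    using assms(3) d(1) by (auto simp: sasakian_space_form_def)
  let ?W = "local_dom \<psi> b d" and ?P = "local_rep \<psi> b d"
  have oW: "open ?W" by (rule open_local_dom[OF A(1) b(1) Abar d(1)]) (use im in \<open>simp add: immersion_def\<close>)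
  have P: "smooth_on ?W ?P" "\<And>x. x \<in> ?W \<Longrightarrow> inj (FD ?P x)" using im b(1) d(1) by (auto simp: immersion_def)
  have PU: "?P ` ?W \<subseteq> chart_range d"
    by (rule local_rep_range) (use A(1) b(1) in \<open>simp add: smooth_atlas_def\<close>)
  have oU: "open (chart_range d)" using Abar d(1) by (simp add: smooth_atlas_def is_chart_def)
  have g: "riemannian_metric_on (chart_range d) (cmet (\<S> d))"
    using Sd by (simp add: sasakian_space_form_on_def sasakian_on_def Let_def)
  have "imm (chart_range d) (cmet (\<S> d)) ?W ?P"
    by (intro imm.intro imm_axioms.intro along_metric_intro oU g oW P PU)
  then show False
    by (rule no_local_hypersurface[OF _ Sd assms(1,2,4)])
      (use Q b d in \<open>auto simp: in_all_charts_def local_dom_def\<close>)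
qed

end
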